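(* Let $\lambda\in\mathbb R\setminus\{0\}$, $\alpha>0$, $a>0$, $t>0$, let $\mathcal F(\rho)=\frac\lambda2\int_{\mathbb R^d}|x|^2\,d\rho(x)$ for $\rho\in\mathcal P_2(\mathbb R^d)$, and let $\mu_0=\mathcal N(a)$. Then, as $n\to+\infty$ (with $n$ large enough that $\frac tn<\frac1{\lambda_-}$), $$W_2\big(J^0_{n,t/n}(\mu_0),J^\alpha_{n,t/n}(\mu_0)\big)=\sum_{k=0}^{n-1}\Big(1+\lambda\frac tn\Big)^{k-n}\sqrt{\frac tn}\,\sqrt{\frac{\mathcal R_k(\alpha,\frac tn)}{1+\lambda\frac tn}}+o(1),$$ where for $\tau>0$ and $k\in\mathbb N$, $$\mathcal R_k(\alpha,\tau)=2\mathcal F\big(J^0_\tau(J^\alpha_{k,\tau}(\mu_0))*\sigma_{\alpha\tau}\big)-2\mathcal F\big(J^0_\tau(J^\alpha_{k,\tau}(\mu_0))\big)+\alpha\big[H(J^\alpha_{k,\tau}(\mu_0))-H(J^\alpha_{k+1,\tau}(\mu_0))\big]-\frac{\alpha^2}4\int_{k\tau}^{(k+1)\tau}\!\!\int|\nabla\ln\bar\rho^\alpha_\tau(s)|^2\,d\bar\rho^\alpha_\tau(s)\,ds$$ and $\bar\rho^\alpha_\tau$ is the interpolating curve defined in the context.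
   Context: $\mathcal P_2(\mathbb R^d)$: Borel probability measures with finite second moment; $W_2$: quadratic Wasserstein distance; $\lambda_-=\max(-\lambda,0)$, $1/0=+\infty$. For $s>0$, $\mathcal N(s)=\sigma_s$ is the centered Gaussian measure with density $(2\pi s)^{-d/2}e^{-|x|^2/(2s)}$. Boltzmann entropy: for $\rho\in\mathcal P_2(\mathbb R^m)$, $H(\rho)=\int\rho\ln\rho\,dx$ if $\rho$ is absolutely continuous with respect to Lebesgue measure, $+\infty$ otherwise. Schrödinger cost: $\mathrm{Sch}^{\alpha\tau}(\mu,\nu)=\inf_{\gamma\in\Pi(\mu,\nu)}\{\int\frac{|x-y|^2}{2}d\gamma+\alpha\tau H(\gamma)+\frac{\alpha\tau d}{2}\ln(2\pi\alpha\tau)\}$, with $\Pi(\mu,\nu)$ the set of couplings and $H(\gamma)$ the Boltzmann entropy on $\mathbb R^{2d}$. Schemes: $J^0_\tau(\mu)$ is the minimizer over $\rho\in\mathcal P_2(\mathbb R^d)$ of $\frac{W_2^2(\mu,\rho)}{2\tau}+\mathcal F(\rho)$, $J^\alpha_\tau(\mu)$ the minimizer of $\frac{\mathrm{Sch}^{\alpha\tau}(\mu,\rho)}{\tau}+\mathcal F(\rho)$; $J^0_{n,\tau}$, $J^\alpha_{n,\tau}$ are the $n$-fold iterates. Interpolating curve: $\bar\rho^\alpha_\tau:[0,+\infty)\to\mathcal P_2(\mathbb R^d)$ is the curve such that $\bar\rho^\alpha_\tau(k\tau)=J^\alpha_{k,\tau}(\mu_0)$ for all $k\in\mathbb N$ and,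 on each $[k\tau,(k+1)\tau]$, up to a time translation to $[0,\tau]$, it is the curve $\rho$ of the minimizer $(\rho,c)$ of the dynamic Schrödinger problem $$\min\Big\{\frac12\int_0^\tau\!\!\int|c_t|^2+\Big|\frac\alpha2\nabla\ln\rho_t\Big|^2d\rho_t\,dt\ :\ \rho(0)=J^\alpha_{k,\tau}(\mu_0),\ \rho(\tau)=J^\alpha_{k+1,\tau}(\mu_0),\ \partial_t\rho+\operatorname{div}(\rho c)=0\Big\}$$ (the PDE holding in the sense of distributions). *)

theory Defs
  imports "HOL-Probability.Probability" "HOL-Library.Landau_Symbols"
begin

section \<open>Probability measures, Wasserstein distance, entropy\<close>

definition P2 :: "'a::euclidean_space measure set" where
  "P2 = {\<rho>. prob_space \<rho> \<and> sets \<rho> = sets borel \<and> (\<integral>\<^sup>+ x. ennreal ((norm x)\<^sup>2) \<partial>\<rho>) < \<infinity>}"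

definition couplings ::
  "'a::euclidean_space measure \<Rightarrow> 'a measure \<Rightarrow> ('a \<times> 'a) measure set" where
  "couplings \<mu> \<nu> = {\<gamma>. prob_space \<gamma> \<and> sets \<gamma> = sets borel \<and>
     distr \<gamma> borel fst = \<mu> \<and> distr \<gamma> borel snd = \<nu>}"

(* The infimum is finite on P2, so that enn2real loses nothing there. *)
definition W2 :: "'a::euclidean_space measure \<Rightarrow> 'a measure \<Rightarrow> real" where
  "W2 \<mu> \<nu> = sqrt (enn2real (INF \<gamma>\<in>couplings \<mu> \<nu>.
      \<integral>\<^sup>+ z. ennreal ((dist (fst z) (snd z))\<^sup>2) \<partial>\<gamma>))"

definition gaussian :: "real \<Rightarrow> 'a::euclidean_space measure" where
  "gaussian s = density lborel
     (\<lambda>x. ennreal ((2 * pi * s) powr (- real DIM('a) / 2) * exp (- (norm x)\<^sup>2 / (2 * s))))"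

(* The integral of f ln f is the difference of the integrals of its positive and negative
   parts (ennreal truncates negative reals to 0); on P2 the negative part is integrable, so the
   difference is never of the form infinity - infinity.  Note ln 0 = 0. *)
definition boltzmann :: "'a::euclidean_space measure \<Rightarrow> ereal" where
  "boltzmann \<rho> =
    (if absolutely_continuous lborel \<rho> then
       (let f = (\<lambda>x. enn2real (RN_deriv lborel \<rho> x)) in
         enn2ereal (\<integral>\<^sup>+ x. ennreal (f x * ln (f x)) \<partial>lborel)
         - enn2ereal (\<integral>\<^sup>+ x. ennreal (- (f x * ln (f x))) \<partial>lborel))
     else \<infinity>)"

(* The Schroedinger cost with regularisation parameter \<epsilon>. *)
definition Sch :: "real \<Rightarrow> 'a::euclidean_space measure \<Rightarrow> 'a measure \<Rightarrow> ereal" where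
  "Sch \<epsilon> \<mu> \<nu> = (INF \<gamma>\<in>couplings \<mu> \<nu>.
      enn2ereal (\<integral>\<^sup>+ z. ennreal ((dist (fst z) (snd z))\<^sup>2 / 2) \<partial>\<gamma>)
      + ereal \<epsilon> * boltzmann \<gamma>
      + ereal (\<epsilon> * real DIM('a) / 2 * ln (2 * pi * \<epsilon>)))"


section \<open>The two schemes\<close>

definition J0 ::
  "('a::euclidean_space measure \<Rightarrow> real) \<Rightarrow> real \<Rightarrow> 'a measure \<Rightarrow> 'a measure" where
  "J0 F \<tau> \<mu> = (THE \<rho>. is_arg_min (\<lambda>\<rho>. (W2 \<mu> \<rho>)\<^sup>2 / (2 * \<tau>) + F \<rho>) (\<lambda>\<rho>. \<rho> \<in> P2) \<rho>)"

definition Jalpha ::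
  "('a::euclidean_space measure \<Rightarrow> real) \<Rightarrow> real \<Rightarrow> real \<Rightarrow> 'a measure \<Rightarrow> 'a measure" where
  "Jalpha F \<alpha> \<tau> \<mu> =
     (THE \<rho>. is_arg_min (\<lambda>\<rho>. Sch (\<alpha> * \<tau>) \<mu> \<rho> / ereal \<tau> + ereal (F \<rho>)) (\<lambda>\<rho>. \<rho> \<in> P2) \<rho>)"

definition J0_iter ::
  "('a::euclidean_space measure \<Rightarrow> real) \<Rightarrow> nat \<Rightarrow> real \<Rightarrow> 'a measure \<Rightarrow> 'a measure" where
  "J0_iter F n \<tau> = (J0 F \<tau>) ^^ n"

definition Jalpha_iter ::
  "('a::euclidean_space measure \<Rightarrow> real) \<Rightarrow> real \<Rightarrow> nat \<Rightarrow> real \<Rightarrow> 'a measure \<Rightarrow> 'a measure" where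
  "Jalpha_iter F \<alpha> n \<tau> = (Jalpha F \<alpha> \<tau>) ^^ n"


section \<open>Distributional derivatives\<close>

(* C^k by recursion on first-order partial derivatives. *)
primrec Ck :: "nat \<Rightarrow> ('a::euclidean_space \<Rightarrow> real) \<Rightarrow> bool" where
  "Ck 0 f \<longleftrightarrow> continuous_on UNIV f"
| "Ck (Suc k) f \<longleftrightarrow> f differentiable_on UNIV \<and>
     (\<forall>i\<in>Basis. Ck k (\<lambda>x. frechet_derivative f (at x) i))"

(* C_c^\<infinity>(U). *)
definition test_functions :: "'a::euclidean_space set \<Rightarrow> ('a \<Rightarrow> real) set" where
  "test_functions U = {\<phi>. (\<forall>k. Ck k \<phi>) \<and>
     compact (closure {x. \<phi> x \<noteq> 0}) \<and> closure {x. \<phi> x \<noteq> 0} \<subseteq> U}"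

definition weak_gradient :: "('a::euclidean_space \<Rightarrow> real) \<Rightarrow> ('a \<Rightarrow> 'a) \<Rightarrow> bool" where
  "weak_gradient f g \<longleftrightarrow>
     (\<forall>K. compact K \<longrightarrow> set_integrable lborel K f \<and> set_integrable lborel K g) \<and>
     (\<forall>\<phi>\<in>test_functions UNIV. \<forall>i\<in>Basis.
        (\<integral>x. f x * frechet_derivative \<phi> (at x) i \<partial>lborel) = - (\<integral>x. \<phi> x * (g x \<bullet> i) \<partial>lborel))"

(* v represents \<nabla> ln \<rho>, i.e. \<nabla>f / f where f is the density of \<rho>.  It is determined
   \<rho>-almost everywhere; the set where f vanishes is \<rho>-null. *)
definition log_gradient :: "'a::euclidean_space measure \<Rightarrow> ('a \<Rightarrow> 'a) \<Rightarrow> bool" where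
  "log_gradient \<rho> v \<longleftrightarrow> (\<exists>f g. f \<in> borel_measurable borel \<and> g \<in> borel_measurable borel \<and>
     (\<forall>x. 0 \<le> f x) \<and> \<rho> = density lborel (\<lambda>x. ennreal (f x)) \<and>
     weak_gradient f g \<and> v = (\<lambda>x. g x /\<^sub>R f x))"

(* The integral of |\<nabla> ln \<rho>|^2 against \<rho>.  All representatives v give the same value; the
   infimum serves to assign \<infinity> to measures that have no density with a weak gradient. *)
definition fisher :: "'a::euclidean_space measure \<Rightarrow> ennreal" where
  "fisher \<rho> = (INF v\<in>{v. log_gradient \<rho> v}. \<integral>\<^sup>+ x. ennreal ((norm (v x))\<^sup>2) \<partial>\<rho>)"


section \<open>The dynamic Schroedinger problem\<close>

(* In the last conjunct, frechet_derivative \<phi> (at (t, x)) (1, c t x) is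
   \<partial>\<^sub>t \<phi> + \<nabla>\<phi> \<bullet> c at (t, x). *)
definition continuity_equation ::
  "real \<Rightarrow> (real \<Rightarrow> 'a::euclidean_space measure) \<Rightarrow> (real \<Rightarrow> 'a \<Rightarrow> 'a) \<Rightarrow> bool" where
  "continuity_equation \<tau> \<rho> c \<longleftrightarrow>
     (\<lambda>(t, x). c t x) \<in> borel_measurable borel \<and>
     (\<forall>K. compact K \<longrightarrow>
        (\<integral>\<^sup>+ t\<in>{0..\<tau>}. (\<integral>\<^sup>+ x\<in>K. ennreal (norm (c t x)) \<partial>\<rho> t) \<partial>lborel) < \<infinity>) \<and>
     (\<forall>\<phi>\<in>test_functions ({0<..<\<tau>} \<times> UNIV).
        (LBINT t:{0..\<tau>}. (\<integral>x. frechet_derivative \<phi> (at (t, x)) (1, c t x) \<partial>\<rho> t)) = 0)"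

(* Only the restrictions of \<rho> and c to [0, \<tau>] matter.  Curves are continuous for W2, which
   gives a meaning to the boundary conditions. *)
definition admissible :: "real \<Rightarrow> 'a::euclidean_space measure \<Rightarrow> 'a measure \<Rightarrow>
    (real \<Rightarrow> 'a measure) \<times> (real \<Rightarrow> 'a \<Rightarrow> 'a) \<Rightarrow> bool" where
  "admissible \<tau> \<mu> \<nu> = (\<lambda>(\<rho>, c).
     (\<forall>t\<in>{0..\<tau>}. \<rho> t \<in> P2) \<and>
     (\<forall>s\<in>{0..\<tau>}. ((\<lambda>t. W2 (\<rho> t) (\<rho> s)) \<longlongrightarrow> 0) (at s within {0..\<tau>})) \<and>
     \<rho> 0 = \<mu> \<and> \<rho> \<tau> = \<nu> \<and> continuity_equation \<tau> \<rho> c)"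

definition dynamic_action :: "real \<Rightarrow> real \<Rightarrow>
    (real \<Rightarrow> 'a::euclidean_space measure) \<times> (real \<Rightarrow> 'a \<Rightarrow> 'a) \<Rightarrow> ennreal" where
  "dynamic_action \<alpha> \<tau> = (\<lambda>(\<rho>, c). ennreal (1 / 2) *
     (\<integral>\<^sup>+ t\<in>{0..\<tau>}. ((\<integral>\<^sup>+ x. ennreal ((norm (c t x))\<^sup>2) \<partial>\<rho> t)
                       + ennreal ((\<alpha> / 2)\<^sup>2) * fisher (\<rho> t)) \<partial>lborel))"

definition interpolating_curve ::
  "('a::euclidean_space measure \<Rightarrow> real) \<Rightarrow> real \<Rightarrow> real \<Rightarrow> 'a measure \<Rightarrow> (real \<Rightarrow> 'a measure) \<Rightarrow> bool"
where
  "interpolating_curve F \<alpha> \<tau> \<mu>\<^sub>0 r \<longleftrightarrow>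
     r \<in> extensional {0..} \<and> (\<forall>s\<ge>0. r s \<in> P2) \<and>
     (\<forall>k. r (real k * \<tau>) = Jalpha_iter F \<alpha> k \<tau> \<mu>\<^sub>0) \<and>
     (\<forall>k. \<exists>c. is_arg_min (dynamic_action \<alpha> \<tau>)
        (admissible \<tau> (Jalpha_iter F \<alpha> k \<tau> \<mu>\<^sub>0) (Jalpha_iter F \<alpha> (Suc k) \<tau> \<mu>\<^sub>0))
        ((\<lambda>s. r (real k * \<tau> + s)), c))"

(* Restricting to extensional functions on [0, \<infinity>) is what makes the curve unique as a
   function on all of real. *)
definition rho_bar ::
  "('a::euclidean_space measure \<Rightarrow> real) \<Rightarrow> real \<Rightarrow> real \<Rightarrow> 'a measure \<Rightarrow> real \<Rightarrow> 'a measure" where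
  "rho_bar F \<alpha> \<tau> \<mu>\<^sub>0 = (THE r. interpolating_curve F \<alpha> \<tau> \<mu>\<^sub>0 r)"

(* \<star> is convolution of measures. *)
definition residual ::
  "('a::ordered_euclidean_space measure \<Rightarrow> real) \<Rightarrow> 'a measure \<Rightarrow> nat \<Rightarrow> real \<Rightarrow> real \<Rightarrow> real" where
  "residual F \<mu>\<^sub>0 k \<alpha> \<tau> =
     2 * F (J0 F \<tau> (Jalpha_iter F \<alpha> k \<tau> \<mu>\<^sub>0) \<star> gaussian (\<alpha> * \<tau>))
     - 2 * F (J0 F \<tau> (Jalpha_iter F \<alpha> k \<tau> \<mu>\<^sub>0))
     + \<alpha> * (real_of_ereal (boltzmann (Jalpha_iter F \<alpha> k \<tau> \<mu>\<^sub>0))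
            - real_of_ereal (boltzmann (Jalpha_iter F \<alpha> (Suc k) \<tau> \<mu>\<^sub>0)))
     - \<alpha>\<^sup>2 / 4 * enn2real (\<integral>\<^sup>+ s\<in>{real k * \<tau>..real (Suc k) * \<tau>}.
          fisher (rho_bar F \<alpha> \<tau> \<mu>\<^sub>0 s) \<partial>lborel)"

end

theory Submission
  imports Defs
begin

text \<open>
  Every measure that occurs is a centered Gaussian. With \<open>v = 1 + l \<tau>\<close>, the map \<open>J0\<close> sends the
  variance \<open>s\<close> to \<open>s / v\<^sup>2\<close>, and \<open>Jalpha\<close> sends it to \<open>s / v\<^sup>2 + \<alpha> \<tau> / v\<close>: a relative entropy
  bound (Gibbs' inequality) for a Gaussian coupling gives the lower bound and the uniqueness.
  The minimizer of the dynamic problem between consecutive iterates is the Gaussian curve whose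
  variance \<open>S\<close> satisfies \<open>2 S S'' - S'\<^sup>2 = - \<alpha>\<^sup>2\<close>. With \<open>p = S' / (2 S)\<close>, its optimality follows by
  testing the continuity equation with \<open>p(t) |x|\<^sup>2 / 2\<close> and bounding the Fisher information from
  below by a perturbation of the Gaussian field \<open>x / S\<close>; equality forces Stein's equation for
  every time slice, which characterizes the Gaussian.

  The residual is therefore \<open>d \<alpha> (l \<tau> - ln v + ln (1 + \<alpha> \<tau> v / s) / 4)\<close>, while the Wasserstein
  distance is \<open>sqrt d\<close> times the difference of standard deviations, which telescopes into a sum of
  terms \<open>sqrt (s + \<alpha> \<tau> v) - sqrt s\<close>. The squares of corresponding terms agree up to
  \<open>O(\<tau>\<^sup>3)\<close>, so the \<open>n = t / \<tau>\<close> errors add up to \<open>O(sqrt \<tau>)\<close>.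
\<close>

section \<open>Smooth functions and bump functions\<close>

text \<open>The schemes and the interpolating curve are definite descriptions, so every minimizer
  has to be shown unique as well as found, and most of the work goes there. For
  \<open>Jalpha\<close>, the exponent in Gibbs' inequality is tilted by a small multiple of the
  indicator of a Borel set, which gives a Pinsker-type gap set by set. For the dynamic problem the
  competitors have merely weak gradients, and \<open>g / f\<close> carries no information where
  \<open>f\<close> vanishes; one must know that \<open>g\<close> is 0 there almost everywhere. Both
  this and the passage from Stein's equation to the Gaussian rest on one tool: a distributional
  derivative along a line is integrated to an exact formula for translates, which extends from test
  functions to indicators of compact sets. The function p calibrates the dynamic problem: the
  equation for the variance amounts to the Riccati equation p' = - p^2 - \<alpha>^2 / (4 S^2), which
  is exactly what makes every second moment of a competitor cancel except those at the end
  points.\<close>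

definition smooth :: "('a::euclidean_space \<Rightarrow> real) \<Rightarrow> bool" where
  "smooth f \<longleftrightarrow> (\<forall>k. Ck k f)"

lemma Ck_SucD: "Ck (Suc k) f \<Longrightarrow> Ck k f"
proof (induction k arbitrary: f)
  case 0
  then show ?case by (simp add: differentiable_imp_continuous_on)
next
  case (Suc k)
  then show ?case by (metis Ck.simps(2))
qed

lemma Ck_differentiable: "Ck (Suc k) f \<Longrightarrow> f differentiable at x"
  by (simp add: differentiable_on_def)

text \<open>\<open>Ck\<close> speaks of \<open>frechet_derivative\<close>; the rule lets a proof
  exhibit a derivative in any convenient form instead.\<close>

lemma Ck_SucI:
  assumes "\<And>x. (f has_derivative f' x) (at x)" "\<And>i. i \<in> Basis \<Longrightarrow> Ck k (\<lambda>x. f' x i)"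
  shows "Ck (Suc k) f"
proof -
  have "frechet_derivative f (at x) = f' x" for x
    using frechet_derivative_at[OF assms(1)] by simp
  moreover have "f differentiable_on UNIV"
    using assms(1) by (auto simp: differentiable_on_def differentiable_def)
  ultimately show ?thesis using assms(2) by simp
qed

lemma Ck_SucE:
  assumes "Ck (Suc k) f"
  shows "(f has_derivative frechet_derivative f (at x)) (at x)"
    "i \<in> Basis \<Longrightarrow> Ck k (\<lambda>x. frechet_derivative f (at x) i)"
  using assms Ck_differentiable[OF assms] by (auto simp: frechet_derivative_works)

lemma Ck_const: "Ck k (\<lambda>x. c)"
proof (induction k arbitrary: c)
  case (Suc k)
  then show ?case by (intro Ck_SucI[where f'="\<lambda>_ _. 0"]) auto
qed auto

lemma Ck_add: "Ck k f \<Longrightarrow> Ck k g \<Longrightarrow> Ck k (\<lambda>x. f x + g x)"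
proof (induction k arbitrary: f g)
  case 0
  then show ?case by (auto intro: continuous_intros)
next
  case (Suc k)
  note d = Ck_SucE[OF Suc.prems(1)] Ck_SucE[OF Suc.prems(2)]
  show ?case
    by (rule Ck_SucI[OF has_derivative_add[OF d(1) d(3)]]) (auto intro!: Suc.IH d)
qed

lemma Ck_mult: "Ck k f \<Longrightarrow> Ck k g \<Longrightarrow> Ck k (\<lambda>x. f x * g x)"
proof (induction k arbitrary: f g)
  case 0
  then show ?case by (auto intro: continuous_intros)
next
  case (Suc k)
  note d = Ck_SucE[OF Suc.prems(1)] Ck_SucE[OF Suc.prems(2)]
  show ?case
    by (rule Ck_SucI[OF has_derivative_mult[OF d(1) d(3)]])
      (auto intro!: Ck_add Suc.IH d Ck_SucD[OF Suc.prems(1)] Ck_SucD[OF Suc.prems(2)])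
qed

lemma Ck_linear:
  assumes "bounded_linear f" shows "Ck k f"
proof (cases k)
  case 0
  then show ?thesis using assms by (simp add: linear_continuous_on)
next
  case (Suc k')
  then show ?thesis
    using Ck_SucI[OF bounded_linear_imp_has_derivative[OF assms], of k'] Ck_const by auto
qed

text \<open>The chain rule turns \<open>D n\<close> into \<open>D (Suc n)\<close>, so the induction
  on the order \<open>k\<close> has to run over all members of the sequence of derivatives at once;
  the derivatives of \<open>f\<close> enter only as factors.\<close>

lemma Ck_compose:
  fixes f :: "'a::euclidean_space \<Rightarrow> real"
  assumes D: "\<And>n x. (D n has_real_derivative D (Suc n) x) (at x)" and "smooth f"
  shows "Ck k (\<lambda>x. D n (f x))"
proof (induction k arbitrary: n)
  case 0
  have "continuous_on UNIV (D n)"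
    using D by (meson DERIV_isCont continuous_at_imp_continuous_on)
  moreover have "continuous_on UNIV f" using assms(2) Ck.simps(1) unfolding smooth_def by blast
  ultimately show ?case by (auto intro: continuous_on_compose2)
next
  case (Suc k)
  have f: "Ck k f" "Ck (Suc k) f" using assms(2) unfolding smooth_def by auto
  show ?case
    by (rule Ck_SucI[OF DERIV_compose_FDERIV[OF D Ck_SucE(1)[OF f(2)]]])
      (auto intro!: Ck_mult Suc.IH Ck_SucE(2)[OF f(2)])
qed

text \<open>One-dimensional smoothness as a whole sequence of derivatives: this is the form that
  \<open>Ck_compose\<close> consumes, and it is available in closed form for \<open>exp\<close> and
  \<open>bump\<close>.\<close>

definition smooth_real :: "(real \<Rightarrow> real) \<Rightarrow> bool" where
  "smooth_real h \<longleftrightarrow> (\<exists>D. D 0 = h \<and> (\<forall>n x. (D n has_real_derivative D (Suc n) x) (at x)))"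

lemma smooth_const: "smooth (\<lambda>x. c)"
  and smooth_add: "smooth f \<Longrightarrow> smooth g \<Longrightarrow> smooth (\<lambda>x. f x + g x)"
  and smooth_mult: "smooth f \<Longrightarrow> smooth g \<Longrightarrow> smooth (\<lambda>x. f x * g x)"
  and smooth_linear: "bounded_linear f \<Longrightarrow> smooth f"
  by (auto simp: smooth_def Ck_const Ck_add Ck_mult Ck_linear)

lemma smooth_compose: "smooth_real h \<Longrightarrow> smooth f \<Longrightarrow> smooth (\<lambda>x. h (f x))"
  unfolding smooth_real_def using Ck_compose unfolding smooth_def by (metis smooth_def)

lemma smooth_diff: "smooth f \<Longrightarrow> smooth g \<Longrightarrow> smooth (\<lambda>x. f x - g x)"
  using smooth_add[of f "\<lambda>x. (-1) * g x"] smooth_mult[OF smooth_const[of "-1"], of g] by simp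

lemma smooth_divide: "smooth f \<Longrightarrow> smooth (\<lambda>x. f x / c)"
  using smooth_mult[OF _ smooth_const[of "1/c"]] by simp

lemma smooth_sum: "(\<And>i. i \<in> A \<Longrightarrow> smooth (f i)) \<Longrightarrow> smooth (\<lambda>x. \<Sum>i\<in>A. f i x)"
  by (induction A rule: infinite_finite_induct) (auto intro: smooth_const smooth_add)

lemma smooth_inner: "smooth (\<lambda>x. x \<bullet> i)"
  by (intro smooth_linear bounded_linear_inner_left)

lemma smooth_norm_sq: "smooth (\<lambda>x. (norm x)\<^sup>2)"
proof -
  have "(\<lambda>x::'a. (norm x)\<^sup>2) = (\<lambda>x. \<Sum>i\<in>Basis. (x \<bullet> i) * (x \<bullet> i))"
    by (auto simp: power2_norm_eq_inner euclidean_inner[symmetric])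
  then show ?thesis by (simp add: smooth_sum smooth_mult smooth_inner)
qed

lemma smooth_fst_snd_norm_sq:
  "smooth (\<lambda>z::real \<times> 'a::euclidean_space. fst z)"
  "smooth (\<lambda>z::real \<times> 'a::euclidean_space. (norm (snd z))\<^sup>2)"
proof -
  show "smooth (\<lambda>z::real \<times> 'a::euclidean_space. fst z)"
    by (intro smooth_linear bounded_linear_fst)
  have "(\<lambda>z::real \<times> 'a. (norm (snd z))\<^sup>2) = (\<lambda>z. \<Sum>i\<in>Basis. (snd z \<bullet> i) * (snd z \<bullet> i))"
    by (auto simp: power2_norm_eq_inner euclidean_inner[symmetric])
  moreover have "smooth (\<lambda>z::real \<times> 'a. snd z \<bullet> i)" for i
    by (intro smooth_linear bounded_linear_compose[OF bounded_linear_inner_left bounded_linear_snd])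
  ultimately show "smooth (\<lambda>z::real \<times> 'a. (norm (snd z))\<^sup>2)"
    by (simp add: smooth_sum smooth_mult)
qed

section \<open>The exponential and the flat function exp (- 1 / y)\<close>

lemma smooth_real_exp: "smooth_real exp"
  unfolding smooth_real_def by (rule exI[of _ "\<lambda>_. exp"]) (auto intro: DERIV_exp)

definition bump :: "real \<Rightarrow> real" where
  "bump y = (if y > 0 then exp (- 1 / y) else 0)"

lemma poly_exp_tendsto_0: "((\<lambda>z. poly p z * exp (- z)) \<longlongrightarrow> (0::real)) at_top"
proof -
  have "((\<lambda>z::real. coeff p i * (z ^ i / exp z)) \<longlongrightarrow> coeff p i * 0) at_top" for i
    by (intro tendsto_mult tendsto_power_div_exp_0 tendsto_const)
  then have "((\<lambda>z::real. \<Sum>i\<le>degree p. coeff p i * (z ^ i / exp z)) \<longlongrightarrow> (\<Sum>i\<le>degree p. coeff p i * 0)) at_top"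
    by (rule tendsto_sum)
  then show ?thesis
    by (simp add: poly_altdef sum_distrib_right exp_minus divide_inverse mult.assoc)
qed

text \<open>With z = 1 / y, the operator d/dy acts on functions of z as - z^2 d/dz, so the
  derivative of p(z) e^(-z) is z^2 (p - p')(z) e^(-z).\<close>

primrec bump_poly :: "nat \<Rightarrow> real poly" where
  "bump_poly 0 = 1"
| "bump_poly (Suc n) = [:0, 0, 1:] * (bump_poly n - pderiv (bump_poly n))"

definition bump_deriv :: "nat \<Rightarrow> real \<Rightarrow> real" where
  "bump_deriv n y = (if y > 0 then poly (bump_poly n) (1 / y) * exp (- 1 / y) else 0)"

lemma bump_deriv_has_derivative: "(bump_deriv n has_real_derivative bump_deriv (Suc n) y) (at y)"
proof -
  consider "y > 0" | "y < 0" | "y = 0" by linarith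
  then show ?thesis
  proof cases
    case 1
    have "((\<lambda>y. poly (bump_poly n) (1 / y) * exp (- 1 / y)) has_real_derivative
        bump_deriv (Suc n) y) (at y)"
      using 1 by (auto intro!: derivative_eq_intros poly_DERIV DERIV_chain'[where g="poly (bump_poly n)"]
          simp: bump_deriv_def field_simps power2_eq_square)
    then show ?thesis
      by (rule has_field_derivative_transform_within_open[where S="{0<..}"])
        (use 1 in \<open>auto simp: bump_deriv_def\<close>)
  next
    case 2
    have "((\<lambda>y. 0) has_real_derivative 0) (at y)" by simp
    then have "(bump_deriv n has_real_derivative 0) (at y)"
      by (rule has_field_derivative_transform_within_open[where S="{..<0}"])
        (use 2 in \<open>auto simp: bump_deriv_def\<close>)
    then show ?thesis using 2 by (simp add: bump_deriv_def)
  next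
    case 3
    \<comment> \<open>The difference quotient at 0 from the right is z p(z) e^(-z) with z = 1 / h;
      the factor \<open>[:0, 1:]\<close> is the z that comes from dividing by h.\<close>
    have "((\<lambda>z. poly ([:0, 1:] * bump_poly n) z * exp (- z)) \<longlongrightarrow> 0) at_top"
      by (rule poly_exp_tendsto_0)
    then have "((\<lambda>h. poly ([:0, 1:] * bump_poly n) (inverse h) * exp (- inverse h)) \<longlongrightarrow> 0) (at_right 0)"
      by (rule filterlim_compose[OF _ filterlim_inverse_at_top_right])
    then have R: "((\<lambda>h. (bump_deriv n (0 + h) - bump_deriv n 0) / h) \<longlongrightarrow> 0) (at_right 0)"
      by (rule Lim_transform_eventually)
        (auto simp: bump_deriv_def eventually_at_right_field field_simps intro!: exI[of _ 1])
    have L: "((\<lambda>h. (bump_deriv n (0 + h) - bump_deriv n 0) / h) \<longlongrightarrow> 0) (at_left 0)"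
      by (rule Lim_transform_eventually[OF tendsto_const])
        (auto simp: bump_deriv_def eventually_at_left_field field_simps intro!: exI[of _ "-1"])
    show ?thesis
      using filterlim_split_at[OF L R] 3 by (simp add: bump_deriv_def DERIV_def)
  qed
qed

lemma smooth_real_bump: "smooth_real bump"
  unfolding smooth_real_def
proof (rule exI[of _ bump_deriv], safe)
  show "bump_deriv 0 = bump" by (auto simp: bump_deriv_def bump_def)
qed (rule bump_deriv_has_derivative)

section \<open>The quadratic Wasserstein distance and Gaussian measures\<close>

lemma Cauchy_Schwarz_integral:
  fixes f g :: "'a \<Rightarrow> real"
  assumes [measurable]: "f \<in> borel_measurable M" "g \<in> borel_measurable M"
    and f2: "integrable M (\<lambda>x. (f x)\<^sup>2)" and g2: "integrable M (\<lambda>x. (g x)\<^sup>2)"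
  shows "integrable M (\<lambda>x. f x * g x)"
    "(\<integral>x. f x * g x \<partial>M)\<^sup>2 \<le> (\<integral>x. (f x)\<^sup>2 \<partial>M) * (\<integral>x. (g x)\<^sup>2 \<partial>M)"
proof -
  have le: "\<bar>f x * g x\<bar> \<le> (f x)\<^sup>2 + (g x)\<^sup>2" for x
    using sum_squares_bound[of "\<bar>f x\<bar>" "\<bar>g x\<bar>"] sum_power2_ge_zero[of "f x" "g x"]
    unfolding abs_mult power2_abs by linarith
  show fg: "integrable M (\<lambda>x. f x * g x)"
    by (rule Bochner_Integration.integrable_bound[OF Bochner_Integration.integrable_add[OF f2 g2]])
      (use le in \<open>auto simp: abs_of_nonneg\<close>)
  define A B C where "A = (\<integral>x. (f x)\<^sup>2 \<partial>M)" and "B = (\<integral>x. (g x)\<^sup>2 \<partial>M)" and "C = (\<integral>x. f x * g x \<partial>M)"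
  have nn: "A \<ge> 0" "B \<ge> 0" by (auto simp: A_def B_def)
  have q: "0 \<le> A - 2 * r * C + r\<^sup>2 * B" for r
  proof -
    have "0 \<le> (\<integral>x. (f x - r * g x)\<^sup>2 \<partial>M)" by simp
    also have "\<dots> = (\<integral>x. (f x)\<^sup>2 - 2 * r * (f x * g x) + r\<^sup>2 * (g x)\<^sup>2 \<partial>M)"
      by (simp add: power2_diff power_mult_distrib algebra_simps)
    also have "\<dots> = A - 2 * r * C + r\<^sup>2 * B"
      using f2 g2 fg by (simp add: A_def B_def C_def)
    finally show ?thesis .
  qed
  have "C\<^sup>2 \<le> A * B"
  proof (cases "B = 0")
    case True
    have "C = 0"
    proof (rule ccontr)
      assume "C \<noteq> 0"
      \<comment> \<open>For this \<open>r\<close> the quadratic, which is affine as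
        \<open>B = 0\<close>, takes the value A - (A + 1) = -1.\<close>
      with q[of "(A + 1) / (2 * C)"] True show False by (simp add: field_simps)
    qed
    then show ?thesis using True by simp
  next
    case False
    then show ?thesis using q[of "C / B"] nn by (simp add: field_simps power2_eq_square)
  qed
  then show "(\<integral>x. f x * g x \<partial>M)\<^sup>2 \<le> (\<integral>x. (f x)\<^sup>2 \<partial>M) * (\<integral>x. (g x)\<^sup>2 \<partial>M)"
    by (simp add: A_def B_def C_def)
qed

lemma P2D:
  assumes "\<mu> \<in> P2"
  shows "prob_space \<mu>" "sets \<mu> = sets borel" "space \<mu> = UNIV"
    "integrable \<mu> (\<lambda>x. (norm x)\<^sup>2)" "finite_measure \<mu>"
proof -
  show s: "prob_space \<mu>" "sets \<mu> = sets borel" using assms by (auto simp: P2_def)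
  note [measurable_cong] = s(2)
  show "space \<mu> = UNIV" using sets_eq_imp_space_eq[OF s(2)] by simp
  show "integrable \<mu> (\<lambda>x. (norm x)\<^sup>2)"
    by (rule integrableI_nonneg) (use assms in \<open>auto simp: P2_def\<close>)
  show "finite_measure \<mu>" using s(1) by (rule prob_space.finite_measure)
qed

lemma couplingsD:
  assumes "\<gamma> \<in> couplings \<mu> \<nu>"
  shows "prob_space \<gamma>" "sets \<gamma> = sets borel" "sets \<gamma> = sets (borel \<Otimes>\<^sub>M borel)" "space \<gamma> = UNIV"
    "distr \<gamma> borel fst = \<mu>" "distr \<gamma> borel snd = \<nu>"
proof -
  show s: "prob_space \<gamma>" "sets \<gamma> = sets borel" "distr \<gamma> borel fst = \<mu>" "distr \<gamma> borel snd = \<nu>"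
    using assms by (auto simp: couplings_def)
  show "space \<gamma> = UNIV" using sets_eq_imp_space_eq[OF s(2)] by simp
  show "sets \<gamma> = sets (borel \<Otimes>\<^sub>M borel)" unfolding borel_prod using s(2) .
qed

lemma couplings_integral:
  fixes f :: "'a::euclidean_space \<Rightarrow> real"
  assumes "\<gamma> \<in> couplings \<mu> \<nu>" and [measurable]: "f \<in> borel_measurable borel"
  shows "(\<integral>z. f (fst z) \<partial>\<gamma>) = (\<integral>x. f x \<partial>\<mu>)" "(\<integral>z. f (snd z) \<partial>\<gamma>) = (\<integral>x. f x \<partial>\<nu>)"
    "integrable \<gamma> (\<lambda>z. f (fst z)) \<longleftrightarrow> integrable \<mu> f"
    "integrable \<gamma> (\<lambda>z. f (snd z)) \<longleftrightarrow> integrable \<nu> f"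
proof -
  note c = couplingsD[OF assms(1)]
  note [measurable_cong] = c(3)
  show "(\<integral>z. f (fst z) \<partial>\<gamma>) = (\<integral>x. f x \<partial>\<mu>)" "(\<integral>z. f (snd z) \<partial>\<gamma>) = (\<integral>x. f x \<partial>\<nu>)"
    "integrable \<gamma> (\<lambda>z. f (fst z)) \<longleftrightarrow> integrable \<mu> f"
    "integrable \<gamma> (\<lambda>z. f (snd z)) \<longleftrightarrow> integrable \<nu> f"
    unfolding c(5,6)[symmetric] by (simp_all add: integral_distr integrable_distr_eq)
qed

lemma couplings_integrable_dist:
  fixes \<mu> :: "'a::euclidean_space measure"
  assumes "\<mu> \<in> P2" "\<nu> \<in> P2" "\<gamma> \<in> couplings \<mu> \<nu>"
  shows "integrable \<gamma> (\<lambda>z. (dist (fst z) (snd z))\<^sup>2)"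
proof -
  note [measurable_cong] = couplingsD(3)[OF assms(3)]
  have "integrable \<gamma> (\<lambda>z. 2 * (norm (fst z))\<^sup>2 + 2 * (norm (snd z))\<^sup>2)"
    using couplings_integral(3,4)[OF assms(3), of "\<lambda>x. (norm x)\<^sup>2"] P2D(4)[OF assms(1)] P2D(4)[OF assms(2)]
    by auto
  then show ?thesis
  proof (rule Bochner_Integration.integrable_bound)
    have "(dist x y)\<^sup>2 \<le> 2 * (norm x)\<^sup>2 + 2 * (norm y)\<^sup>2" for x y :: 'a
    proof -
      have "(dist x y)\<^sup>2 \<le> (norm x + norm y)\<^sup>2"
        by (intro power_mono) (auto simp: dist_norm norm_triangle_ineq4)
      also have "\<dots> \<le> 2 * (norm x)\<^sup>2 + 2 * (norm y)\<^sup>2"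
        using sum_squares_bound[of "norm x" "norm y"] by (simp add: power2_sum)
      finally show ?thesis .
    qed
    then show "AE z in \<gamma>. norm ((dist (fst z) (snd z))\<^sup>2) \<le> norm (2 * (norm (fst z))\<^sup>2 + 2 * (norm (snd z))\<^sup>2)"
      by auto
  qed measurable
qed

lemma product_coupling:
  fixes \<mu> :: "'a::euclidean_space measure"
  assumes "\<mu> \<in> P2" "\<nu> \<in> P2"
  shows "\<mu> \<Otimes>\<^sub>M \<nu> \<in> couplings \<mu> \<nu>"
proof -
  interpret A: prob_space \<mu> using assms(1) by (rule P2D)
  interpret B: prob_space \<nu> using assms(2) by (rule P2D)
  interpret P: pair_prob_space \<mu> \<nu> by unfold_locales
  have s: "sets \<mu> = sets borel" "sets \<nu> = sets borel" using assms by (auto simp: P2_def)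
  note [measurable_cong] = s
  have "distr (\<mu> \<Otimes>\<^sub>M \<nu>) borel fst = \<mu>"
    using distr_cong[OF refl s(1)[symmetric], of "\<mu> \<Otimes>\<^sub>M \<nu>" fst fst] B.distr_pair_fst[of \<mu>] by simp
  moreover have "distr (\<mu> \<Otimes>\<^sub>M \<nu>) borel snd = \<nu>"
  proof (rule measure_eqI)
    fix X assume "X \<in> sets (distr (\<mu> \<Otimes>\<^sub>M \<nu>) borel snd)"
    then have [measurable]: "X \<in> sets borel" by simp
    have "emeasure (distr (\<mu> \<Otimes>\<^sub>M \<nu>) borel snd) X = emeasure (\<mu> \<Otimes>\<^sub>M \<nu>) (space \<mu> \<times> X)"
      by (subst emeasure_distr) (auto simp: space_pair_measure P2D(3)[OF assms(2)] intro!: arg_cong2[where f=emeasure])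
    also have "\<dots> = emeasure \<nu> X"
      by (subst B.emeasure_pair_measure_Times) (auto simp: A.emeasure_space_1)
    finally show "emeasure (distr (\<mu> \<Otimes>\<^sub>M \<nu>) borel snd) X = emeasure \<nu> X" .
  qed (simp add: s)
  moreover have "sets (\<mu> \<Otimes>\<^sub>M \<nu>) = sets borel"
    unfolding borel_prod[symmetric] by (rule sets_pair_measure_cong) (auto simp: s)
  ultimately show ?thesis by (auto simp: couplings_def P.prob_space_axioms)
qed

lemma W2_nonneg [simp]: "0 \<le> W2 \<mu> \<nu>"
  by (simp add: W2_def)

text \<open>The product coupling has finite cost, so the infimum in \<open>W2\<close> is finite and
  both the root and \<open>enn2real\<close> can be undone.\<close>

lemma W2_sq:
  fixes \<mu> :: "'a::euclidean_space measure"
  assumes "\<mu> \<in> P2" "\<nu> \<in> P2"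
  shows "ennreal ((W2 \<mu> \<nu>)\<^sup>2) = (INF \<gamma>\<in>couplings \<mu> \<nu>. ennreal (\<integral>z. (dist (fst z) (snd z))\<^sup>2 \<partial>\<gamma>))"
proof -
  let ?I = "INF \<gamma>\<in>couplings \<mu> \<nu>. \<integral>\<^sup>+ z. ennreal ((dist (fst z) (snd z))\<^sup>2) \<partial>\<gamma>"
  have eq: "?I = (INF \<gamma>\<in>couplings \<mu> \<nu>. ennreal (\<integral>z. (dist (fst z) (snd z))\<^sup>2 \<partial>\<gamma>))"
    by (intro INF_cong refl nn_integral_eq_integral couplings_integrable_dist[OF assms]) auto
  have "?I < \<infinity>"
    unfolding eq by (rule le_less_trans[OF INF_lower[OF product_coupling[OF assms]]]) simp
  then show ?thesis
    by (simp add: W2_def eq[symmetric] less_top)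
qed

lemma W2_sq_le:
  fixes \<mu> :: "'a::euclidean_space measure"
  assumes "\<mu> \<in> P2" "\<nu> \<in> P2" "\<gamma> \<in> couplings \<mu> \<nu>"
  shows "(W2 \<mu> \<nu>)\<^sup>2 \<le> (\<integral>z. (dist (fst z) (snd z))\<^sup>2 \<partial>\<gamma>)"
proof -
  have "ennreal ((W2 \<mu> \<nu>)\<^sup>2) \<le> ennreal (\<integral>z. (dist (fst z) (snd z))\<^sup>2 \<partial>\<gamma>)"
    unfolding W2_sq[OF assms(1,2)] by (rule INF_lower[OF assms(3)])
  then show ?thesis by simp
qed

lemma W2_sq_ge:
  fixes \<mu> :: "'a::euclidean_space measure"
  assumes "\<mu> \<in> P2" "\<nu> \<in> P2" "\<And>\<gamma>. \<gamma> \<in> couplings \<mu> \<nu> \<Longrightarrow> c \<le> (\<integral>z. (dist (fst z) (snd z))\<^sup>2 \<partial>\<gamma>)"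
  shows "c \<le> (W2 \<mu> \<nu>)\<^sup>2"
proof -
  have "ennreal c \<le> ennreal ((W2 \<mu> \<nu>)\<^sup>2)"
    unfolding W2_sq[OF assms(1,2)] by (rule INF_greatest) (use assms(3) in \<open>auto intro: ennreal_leI\<close>)
  then show ?thesis by simp
qed

lemma W2_approx:
  fixes \<mu> :: "'a::euclidean_space measure"
  assumes "\<mu> \<in> P2" "\<nu> \<in> P2" "e > 0"
  obtains \<gamma> where "\<gamma> \<in> couplings \<mu> \<nu>" "(\<integral>z. (dist (fst z) (snd z))\<^sup>2 \<partial>\<gamma>) < (W2 \<mu> \<nu>)\<^sup>2 + e"
proof -
  have "\<not> (\<forall>\<gamma>\<in>couplings \<mu> \<nu>. (W2 \<mu> \<nu>)\<^sup>2 + e \<le> (\<integral>z. (dist (fst z) (snd z))\<^sup>2 \<partial>\<gamma>))"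
    using W2_sq_ge[OF assms(1,2), of "(W2 \<mu> \<nu>)\<^sup>2 + e"] assms(3) by auto
  then show ?thesis using that by (auto simp: not_le)
qed

text \<open>The easy half of Kantorovich duality, combined with Cauchy-Schwarz under a coupling. It
  is what extracts information from a small W2 distance: separation of measures, and continuity in
  time of integrals along a curve.\<close>

lemma W2_Lipschitz:
  fixes \<mu> :: "'a::euclidean_space measure" and f :: "'a \<Rightarrow> real"
  assumes "\<mu> \<in> P2" "\<nu> \<in> P2" and [measurable]: "f \<in> borel_measurable borel"
    and "integrable \<mu> f" "integrable \<nu> f" and L: "\<And>x y. \<bar>f x - f y\<bar> \<le> L * dist x y" "L \<ge> 0"
  shows "\<bar>(\<integral>x. f x \<partial>\<mu>) - (\<integral>x. f x \<partial>\<nu>)\<bar> \<le> L * W2 \<mu> \<nu>"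
proof -
  let ?D = "(\<integral>x. f x \<partial>\<mu>) - (\<integral>x. f x \<partial>\<nu>)"
  have "?D\<^sup>2 \<le> L\<^sup>2 * ((W2 \<mu> \<nu>)\<^sup>2 + e)" if "e > 0" for e
  proof -
    obtain \<gamma> where g: "\<gamma> \<in> couplings \<mu> \<nu>" "(\<integral>z. (dist (fst z) (snd z))\<^sup>2 \<partial>\<gamma>) < (W2 \<mu> \<nu>)\<^sup>2 + e"
      using W2_approx[OF assms(1,2) \<open>e > 0\<close>] .
    interpret prob_space \<gamma> using couplingsD(1)[OF g(1)] .
    note [measurable_cong] = couplingsD(3)[OF g(1)]
    note d2 = couplings_integrable_dist[OF assms(1,2) g(1)]
    have i: "integrable \<gamma> (\<lambda>z. f (fst z))" "integrable \<gamma> (\<lambda>z. f (snd z))"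
      using couplings_integral(3,4)[OF g(1), of f] assms by auto
    have D: "?D = (\<integral>z. (f (fst z) - f (snd z)) * 1 \<partial>\<gamma>)"
      using couplings_integral(1,2)[OF g(1), of f] i by simp
    have sq: "(f x - f y)\<^sup>2 \<le> L\<^sup>2 * (dist x y)\<^sup>2" for x y
      using power_mono[OF L(1)[of x y], of 2] by (simp add: power_mult_distrib)
    have int: "integrable \<gamma> (\<lambda>z. (f (fst z) - f (snd z))\<^sup>2)"
      by (rule Bochner_Integration.integrable_bound[OF integrable_mult_right[OF d2, of "L\<^sup>2"]])
        (use sq in auto)
    have "?D\<^sup>2 \<le> (\<integral>z. (f (fst z) - f (snd z))\<^sup>2 \<partial>\<gamma>) * (\<integral>z. 1\<^sup>2 \<partial>\<gamma>)"
      unfolding D by (rule Cauchy_Schwarz_integral) (use int in auto)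
    also have "\<dots> = (\<integral>z. (f (fst z) - f (snd z))\<^sup>2 \<partial>\<gamma>)" by (simp add: prob_space)
    also have "\<dots> \<le> (\<integral>z. L\<^sup>2 * (dist (fst z) (snd z))\<^sup>2 \<partial>\<gamma>)"
      by (rule integral_mono[OF int]) (use d2 sq in auto)
    also have "\<dots> \<le> L\<^sup>2 * ((W2 \<mu> \<nu>)\<^sup>2 + e)"
      using g(2) by (auto intro!: mult_left_mono)
    finally show ?thesis .
  qed
  \<comment> \<open>No coupling is known to attain the infimum, so the bound is proved with
    couplings of cost below W2^2 + e, and e tends to 0.\<close>
  then have "\<forall>\<^sub>F e in at_right 0. ?D\<^sup>2 \<le> L\<^sup>2 * ((W2 \<mu> \<nu>)\<^sup>2 + e)"
    by (auto simp: eventually_at_right_field intro: exI[of _ 1])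
  moreover have "((\<lambda>e. L\<^sup>2 * ((W2 \<mu> \<nu>)\<^sup>2 + e)) \<longlongrightarrow> L\<^sup>2 * ((W2 \<mu> \<nu>)\<^sup>2 + 0)) (at_right 0)"
    by (intro tendsto_intros)
  ultimately have "?D\<^sup>2 \<le> L\<^sup>2 * ((W2 \<mu> \<nu>)\<^sup>2 + 0)"
    by (intro tendsto_lowerbound[OF _ _ trivial_limit_at_right_real])
  then have "\<bar>?D\<bar>\<^sup>2 \<le> (L * W2 \<mu> \<nu>)\<^sup>2" by (simp add: power_mult_distrib)
  then show ?thesis by (rule power2_le_imp_le) (use L in auto)
qed

text \<open>The reverse triangle inequality in L^2 of a coupling, applied to the norms of the two
  coordinates. It serves as the lower bound for the distance of two Gaussians and for the continuity
  of the second moment along a curve.\<close>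

lemma W2_ge_moment_diff:
  fixes \<mu> :: "'a::euclidean_space measure"
  assumes "\<mu> \<in> P2" "\<nu> \<in> P2"
  shows "\<bar>sqrt (\<integral>x. (norm x)\<^sup>2 \<partial>\<mu>) - sqrt (\<integral>x. (norm x)\<^sup>2 \<partial>\<nu>)\<bar> \<le> W2 \<mu> \<nu>"
proof -
  let ?X = "\<integral>x. (norm x)\<^sup>2 \<partial>\<mu>" and ?Y = "\<integral>x. (norm x)\<^sup>2 \<partial>\<nu>"
  have nn: "?X \<ge> 0" "?Y \<ge> 0" by auto
  have "(sqrt ?X - sqrt ?Y)\<^sup>2 \<le> (W2 \<mu> \<nu>)\<^sup>2"
  proof (rule W2_sq_ge[OF assms])
    fix \<gamma> assume g: "\<gamma> \<in> couplings \<mu> \<nu>"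
    interpret prob_space \<gamma> using couplingsD(1)[OF g] .
    note [measurable_cong] = couplingsD(3)[OF g]
    note d2 = couplings_integrable_dist[OF assms(1,2) g]
    have i: "integrable \<gamma> (\<lambda>z. (norm (fst z))\<^sup>2)" "integrable \<gamma> (\<lambda>z. (norm (snd z))\<^sup>2)"
      using couplings_integral(3,4)[OF g, of "\<lambda>x. (norm x)\<^sup>2"] P2D(4)[OF assms(1)] P2D(4)[OF assms(2)] by auto
    have X: "?X = (\<integral>z. (norm (fst z))\<^sup>2 \<partial>\<gamma>)" and Y: "?Y = (\<integral>z. (norm (snd z))\<^sup>2 \<partial>\<gamma>)"
      using couplings_integral(1,2)[OF g, of "\<lambda>x. (norm x)\<^sup>2"] by auto
    let ?C = "\<integral>z. norm (fst z) * norm (snd z) \<partial>\<gamma>"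
    have C: "integrable \<gamma> (\<lambda>z. norm (fst z) * norm (snd z))" "?C\<^sup>2 \<le> ?X * ?Y"
      unfolding X Y by (rule Cauchy_Schwarz_integral; use i in simp)+
    have "?C \<le> sqrt ?X * sqrt ?Y"
      by (rule power2_le_imp_le) (use C nn in \<open>auto simp: power_mult_distrib\<close>)
    then have "(sqrt ?X - sqrt ?Y)\<^sup>2 \<le> ?X - 2 * ?C + ?Y"
      using nn by (simp add: power2_diff)
    also have "\<dots> = (\<integral>z. (norm (fst z))\<^sup>2 - 2 * (norm (fst z) * norm (snd z)) + (norm (snd z))\<^sup>2 \<partial>\<gamma>)"
      using i C(1) by (simp add: X Y)
    also have "\<dots> \<le> (\<integral>z. (dist (fst z) (snd z))\<^sup>2 \<partial>\<gamma>)"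
    proof (rule integral_mono)
      show "integrable \<gamma> (\<lambda>z. (norm (fst z))\<^sup>2 - 2 * (norm (fst z) * norm (snd z)) + (norm (snd z))\<^sup>2)"
        using i C(1) by auto
      fix z :: "'a \<times> 'a"
      have "\<bar>norm (fst z) - norm (snd z)\<bar>\<^sup>2 \<le> (dist (fst z) (snd z))\<^sup>2"
        by (intro power_mono) (auto simp: dist_norm norm_triangle_ineq3)
      then show "(norm (fst z))\<^sup>2 - 2 * (norm (fst z) * norm (snd z)) + (norm (snd z))\<^sup>2 \<le> (dist (fst z) (snd z))\<^sup>2"
        by (simp add: power2_diff)
    qed (rule d2)
    finally show "(sqrt ?X - sqrt ?Y)\<^sup>2 \<le> (\<integral>z. (dist (fst z) (snd z))\<^sup>2 \<partial>\<gamma>)" .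
  qed
  then have "\<bar>sqrt ?X - sqrt ?Y\<bar>\<^sup>2 \<le> (W2 \<mu> \<nu>)\<^sup>2" by simp
  then show ?thesis by (rule power2_le_imp_le) simp
qed

text \<open>Lipschitz functions that increase to the indicator of an open set. The whole space is a
  separate case because \<open>infdist\<close> to the empty set is 0 by convention.\<close>

definition lip_indicator :: "nat \<Rightarrow> 'a::euclidean_space set \<Rightarrow> 'a \<Rightarrow> real" where
  "lip_indicator n U x = (if U = UNIV then 1 else min 1 (real n * infdist x (- U)))"

lemma lip_indicator:
  shows "0 \<le> lip_indicator n U x" "lip_indicator n U x \<le> 1"
    "\<bar>lip_indicator n U x - lip_indicator n U y\<bar> \<le> real n * dist x y"
    "lip_indicator n U \<in> borel_measurable borel"
    "open U \<Longrightarrow> (\<lambda>n. lip_indicator n U x) \<longlonglongrightarrow> indicator U x"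
proof -
  show "0 \<le> lip_indicator n U x" "lip_indicator n U x \<le> 1"
    by (auto simp: lip_indicator_def infdist_nonneg)
  have "\<bar>real n * infdist x (- U) - real n * infdist y (- U)\<bar> \<le> real n * dist x y"
    using mult_left_mono[OF infdist_triangle_abs[of x "- U" y], of "real n"]
    by (simp add: abs_mult right_diff_distrib[symmetric])
  then show "\<bar>lip_indicator n U x - lip_indicator n U y\<bar> \<le> real n * dist x y"
    by (auto simp: lip_indicator_def min_def)
  show "lip_indicator n U \<in> borel_measurable borel"
    unfolding lip_indicator_def by (cases "U = UNIV")
      (auto intro!: borel_measurable_continuous_onI continuous_intros)
  assume "open U"
  then have c: "closed (- U)" by (simp add: closed_def)
  show "(\<lambda>n. lip_indicator n U x) \<longlonglongrightarrow> indicator U x"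
  proof (cases "U = UNIV")
    case False
    then have ne: "- U \<noteq> {}" by auto
    show ?thesis
    proof (cases "x \<in> U")
      case True
      then have p: "infdist x (- U) > 0" using infdist_pos_not_in_closed[OF c ne] by auto
      obtain N where N: "1 / infdist x (- U) < real N" using reals_Archimedean2 by blast
      have "\<forall>\<^sub>F n in sequentially. lip_indicator n U x = 1"
        using eventually_ge_at_top[of N]
      proof eventually_elim
        case (elim n)
        then have "1 / infdist x (- U) < real n" using N by (meson less_le_trans of_nat_le_iff)
        then show ?case using p False by (auto simp: lip_indicator_def field_simps)
      qed
      then show ?thesis using True by (simp add: tendsto_eventually)
    next
      case x: False
      then show ?thesis using False by (simp add: lip_indicator_def)
    qed
  qed (simp add: lip_indicator_def)
qed

lemma finite_measure_lip_indicator: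
  assumes "finite_measure \<mu>" "sets \<mu> = sets borel" "open U"
  shows "integrable \<mu> (lip_indicator n U)"
    "(\<lambda>n. \<integral>x. lip_indicator n U x \<partial>\<mu>) \<longlonglongrightarrow> measure \<mu> U"
proof -
  interpret finite_measure \<mu> by fact
  note [measurable_cong] = assms(2)
  note [measurable] = lip_indicator(4)
  have sp: "space \<mu> = UNIV" using sets_eq_imp_space_eq[OF assms(2)] by simp
  show "integrable \<mu> (lip_indicator n U)"
    by (rule integrable_const_bound[of _ 1]) (auto simp: abs_of_nonneg lip_indicator)
  have "(\<lambda>n. \<integral>x. lip_indicator n U x \<partial>\<mu>) \<longlonglongrightarrow> (\<integral>x. indicator U x \<partial>\<mu>)"
    by (rule integral_dominated_convergence[where w="\<lambda>_. 1"])
      (auto simp: lip_indicator assms intro!: borel_measurable_indicator)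
  then show "(\<lambda>n. \<integral>x. lip_indicator n U x \<partial>\<mu>) \<longlonglongrightarrow> measure \<mu> U" by (simp add: sp)
qed

lemma finite_borel_measure_eqI_open:
  fixes \<mu> :: "'a::euclidean_space measure"
  assumes "finite_measure \<mu>" "finite_measure \<nu>" "sets \<mu> = sets borel" "sets \<nu> = sets borel"
    and "\<And>U. open U \<Longrightarrow> measure \<mu> U = measure \<nu> U"
  shows "\<mu> = \<nu>"
proof (rule measure_eqI_generator_eq[where E="{S. open S}" and \<Omega>=UNIV and A="\<lambda>_. UNIV"])
  interpret A: finite_measure \<mu> by fact
  interpret B: finite_measure \<nu> by fact
  show "emeasure \<mu> X = emeasure \<nu> X" if "X \<in> {S. open S}" for X
    using assms(5) that by (simp add: A.emeasure_eq_measure B.emeasure_eq_measure)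
  show "sets \<mu> = sigma_sets UNIV {S. open S}" "sets \<nu> = sigma_sets UNIV {S. open S}"
    using assms(3,4) by (auto simp: borel_def)
  show "emeasure \<mu> UNIV \<noteq> \<infinity>" for i :: nat by simp
qed (auto simp: Int_stable_def)

text \<open>Integrals of Lipschitz functions agree, hence in the limit so do the masses of open
  sets. This turns a vanishing distance into uniqueness of the minimizer in
  \<open>J0\<close>.\<close>

lemma W2_eq_0D:
  fixes \<mu> :: "'a::euclidean_space measure"
  assumes "\<mu> \<in> P2" "\<nu> \<in> P2" "W2 \<mu> \<nu> = 0"
  shows "\<mu> = \<nu>"
proof (rule finite_borel_measure_eqI_open)
  fix U :: "'a set" assume U: "open U"
  have "(\<integral>x. lip_indicator n U x \<partial>\<mu>) = (\<integral>x. lip_indicator n U x \<partial>\<nu>)" for n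
    using W2_Lipschitz[OF assms(1,2) lip_indicator(4) _ _ lip_indicator(3), of n U]
      finite_measure_lip_indicator(1)[OF P2D(5,2)[OF assms(1)] U]
      finite_measure_lip_indicator(1)[OF P2D(5,2)[OF assms(2)] U] assms(3) by simp
  then show "measure \<mu> U = measure \<nu> U"
    using finite_measure_lip_indicator(2)[OF P2D(5,2)[OF assms(1)] U]
      finite_measure_lip_indicator(2)[OF P2D(5,2)[OF assms(2)] U] by (auto intro: LIMSEQ_unique)
qed (use P2D[OF assms(1)] P2D[OF assms(2)] in auto)

section \<open>Gaussian measures: moments, dilations, distances, convolution\<close>

definition gdens :: "real \<Rightarrow> 'a::euclidean_space \<Rightarrow> real" where
  "gdens s x = (2 * pi * s) powr (- real DIM('a) / 2) * exp (- (norm x)\<^sup>2 / (2 * s))"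

lemma gaussian_density: "gaussian s = density lborel (\<lambda>x. ennreal (gdens s x))"
  by (simp add: gaussian_def gdens_def)

lemma gdens_nonneg [simp]: "0 \<le> gdens s x"
  by (simp add: gdens_def)

lemma gdens_pos: "s > 0 \<Longrightarrow> 0 < gdens s x"
  by (simp add: gdens_def)

lemma gdens_measurable [measurable]: "gdens s \<in> borel_measurable borel"
  unfolding gdens_def by measurable

lemma sets_gaussian [simp, measurable_cong]: "sets (gaussian s) = sets borel"
  and space_gaussian [simp]: "space (gaussian s) = UNIV"
  by (auto simp: gaussian_def)

lemma norm_sq_sum_Basis: "(norm (x::'a::euclidean_space))\<^sup>2 = (\<Sum>b\<in>Basis. (x \<bullet> b)\<^sup>2)"
  unfolding power2_norm_eq_inner by (subst euclidean_inner) (simp add: power2_eq_square)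

lemma gdens_prod:
  fixes x :: "'a::euclidean_space"
  assumes "s > 0"
  shows "gdens s x = (\<Prod>b\<in>Basis. normal_density 0 (sqrt s) (x \<bullet> b))"
proof -
  have "(\<Prod>b\<in>(Basis::'a set). normal_density 0 (sqrt s) (x \<bullet> b))
      = (1 / sqrt (2 * pi * s)) ^ DIM('a) * exp (\<Sum>b\<in>Basis. - (x \<bullet> b)\<^sup>2 / (2 * s))"
    using assms by (simp add: normal_density_def prod_dividef exp_sum power_one_over field_simps)
  also have "(\<Sum>b\<in>Basis. - (x \<bullet> b)\<^sup>2 / (2 * s)) = - (norm x)\<^sup>2 / (2 * s)"
    by (simp add: norm_sq_sum_Basis sum_negf sum_divide_distrib[symmetric])
  also have "(1 / sqrt (2 * pi * s)) ^ DIM('a) = (2 * pi * s) powr (- real DIM('a) / 2)"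
  proof -
    have "(1 / sqrt A) ^ n = A powr (- real n / 2)" if "A > 0" for A n
    proof -
      have "1 / sqrt A = A powr (- (1 / 2))"
        using that by (simp only: powr_minus powr_half_sqrt less_imp_le inverse_eq_divide)
      then show ?thesis using that by (simp only: powr_power) simp
    qed
    from this[of "2 * pi * s"] show ?thesis using assms by simp
  qed
  finally show ?thesis by (simp add: gdens_def)
qed

lemma nn_integral_normal_density:
  assumes "s > 0"
  shows "(\<integral>\<^sup>+x. ennreal (normal_density 0 (sqrt s) x) \<partial>lborel) = 1"
    "(\<integral>\<^sup>+x. ennreal (normal_density 0 (sqrt s) x * x\<^sup>2) \<partial>lborel) = ennreal s"
proof -
  show "(\<integral>\<^sup>+x. ennreal (normal_density 0 (sqrt s) x) \<partial>lborel) = 1"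
    using assms by (subst nn_integral_eq_integral) auto
  have "has_bochner_integral lborel (\<lambda>x. normal_density 0 (sqrt s) x * x\<^sup>2) s"
    using normal_moment_even[of "sqrt s" 0 1] assms by (simp add: fact_numeral)
  then show "(\<integral>\<^sup>+x. ennreal (normal_density 0 (sqrt s) x * x\<^sup>2) \<partial>lborel) = ennreal s"
    using assms by (subst nn_integral_eq_integral) (auto simp: has_bochner_integral_iff)
qed

lemma nn_integral_gdens:
  assumes "s > 0"
  shows "(\<integral>\<^sup>+x. ennreal (gdens s (x::'a::euclidean_space)) \<partial>lborel) = 1"
    "(\<integral>\<^sup>+x. ennreal (gdens s (x::'a) * (norm x)\<^sup>2) \<partial>lborel) = ennreal (real DIM('a) * s)"
proof -
  have "(\<integral>\<^sup>+x. ennreal (gdens s (x::'a)) \<partial>lborel)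
      = (\<integral>\<^sup>+x. (\<Prod>b\<in>Basis. ennreal (normal_density 0 (sqrt s) (x \<bullet> b))) \<partial>(lborel::'a measure))"
    using assms by (simp add: gdens_prod prod_ennreal)
  then show "(\<integral>\<^sup>+x. ennreal (gdens s (x::'a)) \<partial>lborel) = 1"
    by (subst (asm) nn_integral_lborel_prod) (auto simp: nn_integral_normal_density[OF assms])
  \<comment> \<open>The factor x^2 sits at the coordinate \<open>c\<close> only, so that each
    coordinate moment is again a product of one-dimensional integrals.\<close>
  let ?f = "\<lambda>c b x. ennreal (normal_density 0 (sqrt s) x * (if b = c then x\<^sup>2 else 1))"
  have "(\<integral>\<^sup>+x. ennreal (gdens s (x::'a) * (x \<bullet> c)\<^sup>2) \<partial>lborel) = ennreal s" if c: "c \<in> Basis" for c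
  proof -
    have "gdens s x * (x \<bullet> c)\<^sup>2 = (\<Prod>b\<in>Basis. normal_density 0 (sqrt s) (x \<bullet> b) * (if b = c then (x \<bullet> b)\<^sup>2 else 1))" for x :: 'a
      using c assms by (simp add: gdens_prod prod.distrib)
    then have "(\<integral>\<^sup>+x. ennreal (gdens s (x::'a) * (x \<bullet> c)\<^sup>2) \<partial>lborel)
      = (\<integral>\<^sup>+x. (\<Prod>b\<in>Basis. ?f c b (x \<bullet> b)) \<partial>(lborel::'a measure))"
      by (simp add: prod_ennreal)
    also have "\<dots> = (\<Prod>b\<in>(Basis::'a set). \<integral>\<^sup>+x. ?f c b x \<partial>lborel)"
      by (subst nn_integral_lborel_prod) auto
    also have "\<dots> = (\<Prod>b\<in>(Basis::'a set). if b = c then ennreal s else 1)"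
      by (intro prod.cong refl) (auto simp: nn_integral_normal_density[OF assms])
    also have "\<dots> = ennreal s" using c by simp
    finally show ?thesis .
  qed
  moreover have "(\<integral>\<^sup>+x. ennreal (gdens s (x::'a) * (norm x)\<^sup>2) \<partial>lborel)
      = (\<integral>\<^sup>+x. (\<Sum>b\<in>Basis. ennreal (gdens s (x::'a) * (x \<bullet> b)\<^sup>2)) \<partial>lborel)"
    by (simp add: norm_sq_sum_Basis sum_distrib_left)
  ultimately show "(\<integral>\<^sup>+x. ennreal (gdens s (x::'a) * (norm x)\<^sup>2) \<partial>lborel) = ennreal (real DIM('a) * s)"
    using assms by (simp add: nn_integral_sum ennreal_mult ennreal_of_nat_eq_real_of_nat)
qed

lemma prob_space_gaussian: "s > 0 \<Longrightarrow> prob_space (gaussian s)"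
  by (intro prob_spaceI) (simp add: gaussian_density emeasure_density nn_integral_gdens)

lemma nn_integral_gaussian_norm_sq:
  "s > 0 \<Longrightarrow> (\<integral>\<^sup>+x. ennreal ((norm (x::'a::euclidean_space))\<^sup>2) \<partial>gaussian s) = ennreal (real DIM('a) * s)"
  by (simp add: gaussian_density nn_integral_density ennreal_mult[symmetric] nn_integral_gdens)

lemma gaussian_P2: "s > 0 \<Longrightarrow> gaussian s \<in> P2"
  by (simp add: P2_def prob_space_gaussian nn_integral_gaussian_norm_sq)

lemma integral_gaussian_norm_sq:
  "s > 0 \<Longrightarrow> (\<integral>x. (norm (x::'a::euclidean_space))\<^sup>2 \<partial>gaussian s) = real DIM('a) * s"
  by (simp add: integral_eq_nn_integral nn_integral_gaussian_norm_sq)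

lemma gdens_scale:
  fixes x :: "'a::euclidean_space"
  assumes "s > 0" "c \<noteq> 0"
  shows "gdens (c\<^sup>2 * s) (c *\<^sub>R x) * \<bar>c\<bar> ^ DIM('a) = gdens s x"
proof -
  have e1: "(2 * pi * (c\<^sup>2 * s)) powr (- real DIM('a) / 2) = (2 * pi * s) powr (- real DIM('a) / 2) * (c\<^sup>2) powr (- real DIM('a) / 2)"
    using assms by (simp add: powr_mult[symmetric] mult_ac)
  have e2: "(c\<^sup>2) powr (- real DIM('a) / 2) * \<bar>c\<bar> ^ DIM('a) = 1"
  proof -
    have "(c\<^sup>2) powr (- real DIM('a) / 2) = (\<bar>c\<bar> powr 2) powr (- real DIM('a) / 2)"
      using assms by simp
    also have "\<dots> = \<bar>c\<bar> powr (- real DIM('a))"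
      by (subst powr_powr) simp
    finally show ?thesis using assms by (simp add: powr_minus powr_realpow)
  qed
  have e3: "- (norm (c *\<^sub>R x))\<^sup>2 / (2 * (c\<^sup>2 * s)) = - (norm x)\<^sup>2 / (2 * s)"
    using assms by (simp add: power_mult_distrib)
  have "gdens (c\<^sup>2 * s) (c *\<^sub>R x) * \<bar>c\<bar> ^ DIM('a) = (2 * pi * s) powr (- real DIM('a) / 2)
      * ((c\<^sup>2) powr (- real DIM('a) / 2) * \<bar>c\<bar> ^ DIM('a)) * exp (- (norm x)\<^sup>2 / (2 * s))"
    unfolding gdens_def e1 e3 by (simp only: mult_ac)
  then show ?thesis unfolding e2 by (simp add: gdens_def)
qed

text \<open>All centered Gaussians are dilates of one another. This supplies the optimal coupling of
  two of them, the map x / v behind \<open>J0\<close>, the symmetry under x to - x, and one common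
  noise for a whole Gaussian curve.\<close>

lemma gaussian_scale:
  assumes "s > 0" "c \<noteq> 0"
  shows "distr (gaussian s) borel (\<lambda>x. c *\<^sub>R x) = (gaussian (c\<^sup>2 * s) :: 'a::euclidean_space measure)"
proof (rule measure_eqI)
  fix A assume "A \<in> sets (distr (gaussian s) borel (\<lambda>x::'a. c *\<^sub>R x))"
  then have [measurable]: "A \<in> sets borel" by simp
  have "emeasure (gaussian (c\<^sup>2 * s)) A = (\<integral>\<^sup>+x. ennreal (gdens (c\<^sup>2 * s) x) * indicator A x \<partial>lborel)"
    by (simp add: gaussian_density emeasure_density)
  also have "\<dots> = (\<integral>\<^sup>+x. \<bar>c\<bar> ^ DIM('a) * (ennreal (gdens (c\<^sup>2 * s) (c *\<^sub>R x)) * indicator A (c *\<^sub>R x)) \<partial>lborel)"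
    by (subst lborel_affine[OF assms(2), of 0])
      (simp add: nn_integral_density nn_integral_distr)
  also have "\<dots> = (\<integral>\<^sup>+x. ennreal (gdens s x) * indicator A (c *\<^sub>R x) \<partial>lborel)"
  proof (intro nn_integral_cong)
    fix x :: 'a
    have "ennreal (\<bar>c\<bar> ^ DIM('a)) * ennreal (gdens (c\<^sup>2 * s) (c *\<^sub>R x)) = ennreal (gdens s x)"
      unfolding gdens_scale[OF assms, symmetric, of x] by (subst ennreal_mult[symmetric]) (simp_all add: mult.commute)
    then show "\<bar>c\<bar> ^ DIM('a) * (ennreal (gdens (c\<^sup>2 * s) (c *\<^sub>R x)) * indicator A (c *\<^sub>R x))
        = ennreal (gdens s x) * indicator A (c *\<^sub>R x)"
      by (simp add: mult.assoc[symmetric])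
  qed
  also have "\<dots> = (\<integral>\<^sup>+x. indicator A (c *\<^sub>R x) \<partial>gaussian s)"
    by (simp add: gaussian_density nn_integral_density)
  also have "\<dots> = (\<integral>\<^sup>+x. indicator A x \<partial>distr (gaussian s) borel (\<lambda>x. c *\<^sub>R x))"
    by (rule nn_integral_distr[symmetric]) auto
  also have "\<dots> = emeasure (distr (gaussian s) borel (\<lambda>x. c *\<^sub>R x)) A" by simp
  finally show "emeasure (distr (gaussian s) borel (\<lambda>x. c *\<^sub>R x)) A = emeasure (gaussian (c\<^sup>2 * s)) A" ..
qed simp

text \<open>Dilating one standard Gaussian vector by both standard deviations gives a coupling with
  exactly this cost; the lower bound is the difference of the roots of the second moments.\<close>

lemma W2_gaussian:
  assumes "s > 0" "s' > 0"
  shows "W2 (gaussian s :: 'a::euclidean_space measure) (gaussian s') = sqrt DIM('a) * \<bar>sqrt s - sqrt s'\<bar>"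
proof (rule antisym)
  let ?G = "gaussian 1 :: 'a measure"
  let ?f = "\<lambda>z::'a. (sqrt s *\<^sub>R z, sqrt s' *\<^sub>R z)"
  interpret prob_space ?G by (rule prob_space_gaussian) simp
  have eq: "gaussian r = distr ?G borel (\<lambda>z. sqrt r *\<^sub>R z)" if "r > 0" for r
    using gaussian_scale[of 1 "sqrt r", where 'a='a] that by simp
  have m: "?f \<in> ?G \<rightarrow>\<^sub>M borel" unfolding borel_prod[symmetric] by measurable
  have "distr ?G borel ?f \<in> couplings (gaussian s) (gaussian s')"
    unfolding couplings_def eq[OF assms(1)] eq[OF assms(2)]
  proof (intro CollectI conjI)
    show "distr (distr ?G borel ?f) borel fst = distr ?G borel (\<lambda>z. sqrt s *\<^sub>R z)"
      "distr (distr ?G borel ?f) borel snd = distr ?G borel (\<lambda>z. sqrt s' *\<^sub>R z)"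
      by (subst distr_distr; use m in \<open>auto simp: borel_prod[symmetric] o_def\<close>)+
  qed (auto intro: prob_space_distr[OF m])
  then have "(W2 (gaussian s :: 'a measure) (gaussian s'))\<^sup>2 \<le> (\<integral>z. (dist (fst z) (snd z))\<^sup>2 \<partial>distr ?G borel ?f)"
    using assms by (intro W2_sq_le gaussian_P2)
  also have "\<dots> = (\<integral>z. (sqrt s - sqrt s')\<^sup>2 * (norm z)\<^sup>2 \<partial>?G)"
    by (subst integral_distr[OF m]) (auto simp: borel_prod[symmetric] dist_norm scaleR_diff_left[symmetric] power_mult_distrib)
  also have "\<dots> = (sqrt DIM('a) * \<bar>sqrt s - sqrt s'\<bar>)\<^sup>2"
    by (simp add: integral_gaussian_norm_sq power_mult_distrib)
  finally show "W2 (gaussian s :: 'a measure) (gaussian s') \<le> sqrt DIM('a) * \<bar>sqrt s - sqrt s'\<bar>"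
    by (rule power2_le_imp_le) simp
  show "sqrt DIM('a) * \<bar>sqrt s - sqrt s'\<bar> \<le> W2 (gaussian s :: 'a measure) (gaussian s')"
    using W2_ge_moment_diff[OF gaussian_P2[OF assms(1)] gaussian_P2[OF assms(2)], where 'a='a] assms
    by (simp add: integral_gaussian_norm_sq real_sqrt_mult right_diff_distrib[symmetric] abs_mult)
qed

text \<open>The cross term is removed by symmetry: averaging over y and - y, the parallelogram law
  turns |x + y|^2 + |x - y|^2 into 2 |x|^2 + 2 |y|^2, so that all integrands stay
  nonnegative.\<close>

lemma convolution_gaussian_norm_sq:
  fixes \<mu> :: "'a::ordered_euclidean_space measure"
  assumes "\<mu> \<in> P2" "s > 0"
  shows "(\<integral>x. (norm x)\<^sup>2 \<partial>(\<mu> \<star> gaussian s)) = (\<integral>x. (norm x)\<^sup>2 \<partial>\<mu>) + real DIM('a) * s"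
proof -
  interpret A: prob_space \<mu> using assms(1) by (rule P2D)
  interpret B: prob_space "gaussian s :: 'a measure" using assms(2) by (rule prob_space_gaussian)
  note [measurable_cong] = P2D(2)[OF assms(1)]
  have inner: "(\<integral>\<^sup>+y. ennreal ((norm (x + y))\<^sup>2) \<partial>gaussian s) = ennreal ((norm x)\<^sup>2) + ennreal (real DIM('a) * s)" (is "?I = ?J") for x :: 'a
  proof -
    have "gaussian s = distr (gaussian s) borel (\<lambda>x::'a. (-1) *\<^sub>R x)"
      using gaussian_scale[OF assms(2), of "-1", where 'a='a] by simp
    then have "?I = (\<integral>\<^sup>+y. ennreal ((norm (x + y))\<^sup>2) \<partial>distr (gaussian s) borel (\<lambda>x. (-1) *\<^sub>R x))"
      by simp
    also have "\<dots> = (\<integral>\<^sup>+y. ennreal ((norm (x - y))\<^sup>2) \<partial>gaussian s)"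
      by (simp add: nn_integral_distr)
    finally have "?I + ?I = (\<integral>\<^sup>+y. ennreal ((norm (x + y))\<^sup>2) + ennreal ((norm (x - y))\<^sup>2) \<partial>gaussian s)"
      by (simp add: nn_integral_add)
    also have "\<dots> = (\<integral>\<^sup>+y. ennreal (2 * (norm x)\<^sup>2) + 2 * ennreal ((norm (y::'a))\<^sup>2) \<partial>gaussian s)"
    proof (rule nn_integral_cong)
      fix y :: 'a
      have "(norm (x + y))\<^sup>2 + (norm (x - y))\<^sup>2 = 2 * (norm x)\<^sup>2 + 2 * (norm y)\<^sup>2"
        by (simp add: power2_norm_eq_inner inner_add inner_diff inner_commute)
      then show "ennreal ((norm (x + y))\<^sup>2) + ennreal ((norm (x - y))\<^sup>2) = ennreal (2 * (norm x)\<^sup>2) + 2 * ennreal ((norm y)\<^sup>2)"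
        using ennreal_plus[of "2 * (norm x)\<^sup>2" "2 * (norm y)\<^sup>2"]
        by (simp add: ennreal_mult' ennreal_plus[of "(norm (x + y))\<^sup>2" "(norm (x - y))\<^sup>2", symmetric] del: ennreal_plus)
    qed
    also have "\<dots> = ?J + ?J"
      using assms(2) by (simp add: nn_integral_add nn_integral_cmult nn_integral_gaussian_norm_sq B.emeasure_space_1[simplified]
        ennreal_mult' mult_2[symmetric] distrib_left)
    finally have "2 * ?I = 2 * ?J" by (simp add: mult_2)
    then show ?thesis unfolding ennreal_mult_cancel_left by auto
  qed
  have "(\<integral>\<^sup>+x. ennreal ((norm x)\<^sup>2) \<partial>(\<mu> \<star> gaussian s)) = (\<integral>\<^sup>+x. ennreal ((norm x)\<^sup>2) \<partial>\<mu>) + ennreal (real DIM('a) * s)"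
    by (subst nn_integral_convolution)
      (auto simp: inner nn_integral_add A.emeasure_space_1[unfolded P2D(3)[OF assms(1)]] P2D(2,3)[OF assms(1)]
        A.finite_measure_axioms B.finite_measure_axioms)
  also have "\<dots> = ennreal ((\<integral>x. (norm x)\<^sup>2 \<partial>\<mu>) + real DIM('a) * s)"
    using P2D(4)[OF assms(1)] assms(2) by (simp add: nn_integral_eq_integral)
  finally have eq: "(\<integral>\<^sup>+x. ennreal ((norm x)\<^sup>2) \<partial>(\<mu> \<star> gaussian s)) = ennreal ((\<integral>x. (norm x)\<^sup>2 \<partial>\<mu>) + real DIM('a) * s)" .
  have m: "(\<lambda>x::'a. (norm x)\<^sup>2) \<in> borel_measurable (\<mu> \<star> gaussian s)" by (simp add: convolution_def)
  have "0 \<le> (\<integral>x. (norm x)\<^sup>2 \<partial>\<mu>) + real DIM('a) * s" using assms(2) by simp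
  then show ?thesis
    unfolding integral_eq_nn_integral[OF m AE_I2[OF zero_le_power2]] eq by (rule enn2real_ennreal)
qed

section \<open>One step of the two schemes\<close>

lemma couplings_distr_fst:
  assumes "\<gamma> \<in> couplings \<mu> \<nu>" and [measurable]: "T \<in> borel \<rightarrow>\<^sub>M borel"
  shows "distr \<gamma> borel (\<lambda>z. (T (fst z), snd z)) \<in> couplings (distr \<mu> borel T) \<nu>"
proof -
  note c = couplingsD[OF assms(1)]
  interpret prob_space \<gamma> by (rule c)
  note [measurable_cong] = c(3)
  have m: "(\<lambda>z. (T (fst z), snd z)) \<in> \<gamma> \<rightarrow>\<^sub>M borel"
    unfolding borel_prod[symmetric] by measurable
  have "distr (distr \<gamma> borel (\<lambda>z. (T (fst z), snd z))) borel fst = distr (distr \<gamma> borel fst) borel T"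
    by (subst (1 2) distr_distr; use m in \<open>auto simp: borel_prod[symmetric] o_def\<close>)
  moreover have "distr (distr \<gamma> borel (\<lambda>z. (T (fst z), snd z))) borel snd = distr \<gamma> borel snd"
    by (subst distr_distr; use m in \<open>auto simp: borel_prod[symmetric] o_def\<close>)
  ultimately show ?thesis
    using prob_space_distr[OF m] by (simp add: couplings_def c(5,6))
qed

text \<open>Completing the square in y: up to a multiple of |x|^2, the sum |x - y|^2 + l \<tau>
  |y|^2 is v times the squared distance from y to x / v. Both steps are read off from it:
  \<open>J0\<close> moves x to x / v, and the entropic step adds Gaussian noise to x / v.\<close>

lemma quadratic_split:
  fixes x y :: "'a::euclidean_space"
  assumes "v = 1 + l * \<tau>" "v > 0"
  shows "(dist x y)\<^sup>2 = (l * \<tau> / v) * (norm x)\<^sup>2 - l * \<tau> * (norm y)\<^sup>2 + v * (dist ((1 / v) *\<^sub>R x) y)\<^sup>2"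
proof -
  have "v * (dist ((1 / v) *\<^sub>R x) y)\<^sup>2 = (x \<bullet> x) / v - 2 * (x \<bullet> y) + v * (y \<bullet> y)"
    using assms(2)
    by (simp add: dist_norm power2_norm_eq_inner inner_diff inner_commute algebra_simps divide_simps)
  moreover have "(l * \<tau> / v) * (x \<bullet> x) + (x \<bullet> x) / v = x \<bullet> x"
    using assms by (simp add: add_divide_distrib[symmetric] distrib_right[symmetric] field_simps)
  ultimately show ?thesis
    using assms(1) by (simp add: dist_norm power2_norm_eq_inner inner_diff inner_commute algebra_simps)
qed

text \<open>By \<open>quadratic_split\<close> the functional is at least a constant plus v / (2
  \<tau>) times the squared distance to the image of the Gaussian under x to x / v. As v > 0, this
  excess is nonnegative also for negative l, and it vanishes only at the image.\<close>

theorem J0_gaussian: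
  fixes s :: real
  assumes "\<tau> > 0" "v = 1 + l * \<tau>" "v > 0" "s > 0"
  shows "J0 (\<lambda>\<rho>. l / 2 * (\<integral>x. (norm (x::'a::euclidean_space))\<^sup>2 \<partial>\<rho>)) \<tau> (gaussian s) = gaussian (s / v\<^sup>2)"
proof -
  define F where "F = (\<lambda>\<rho>::'a measure. l / 2 * (\<integral>x. (norm (x::'a))\<^sup>2 \<partial>\<rho>))"
  let ?\<mu> = "gaussian s :: 'a measure" and ?\<nu> = "gaussian (s / v\<^sup>2) :: 'a measure"
  \<comment> \<open>The minimal value of the functional: l / (2 v) times the second moment of
    \<open>?\<mu>\<close>.\<close>
  define K where "K = l / (2 * v) * (real DIM('a) * s)"
  have \<mu>: "?\<mu> \<in> P2" and \<nu>: "?\<nu> \<in> P2" using assms by (auto intro: gaussian_P2)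
  have \<nu>_eq: "?\<nu> = distr ?\<mu> borel (\<lambda>x. (1 / v) *\<^sub>R x)"
    using gaussian_scale[of s "1 / v", where 'a='a] assms by (simp add: power_divide)
  have lower: "K + v / (2 * \<tau>) * (W2 ?\<nu> \<rho>)\<^sup>2 \<le> (W2 ?\<mu> \<rho>)\<^sup>2 / (2 * \<tau>) + F \<rho>" if \<rho>: "\<rho> \<in> P2" for \<rho>
  proof -
    have "(l * \<tau> / v) * (real DIM('a) * s) - l * \<tau> * (\<integral>x. (norm x)\<^sup>2 \<partial>\<rho>) + v * (W2 ?\<nu> \<rho>)\<^sup>2 \<le> (W2 ?\<mu> \<rho>)\<^sup>2"
    proof (rule W2_sq_ge[OF \<mu> \<rho>])
      fix \<gamma> assume g: "\<gamma> \<in> couplings ?\<mu> \<rho>"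
      note [measurable_cong] = couplingsD(3)[OF g]
      have m: "(\<lambda>z. ((1 / v) *\<^sub>R fst z, snd z)) \<in> \<gamma> \<rightarrow>\<^sub>M borel"
        unfolding borel_prod[symmetric] by measurable
      have g': "distr \<gamma> borel (\<lambda>z. ((1 / v) *\<^sub>R fst z, snd z)) \<in> couplings ?\<nu> \<rho>"
        unfolding \<nu>_eq by (rule couplings_distr_fst[OF g]) simp
      have d2: "integrable \<gamma> (\<lambda>z. (dist ((1 / v) *\<^sub>R fst z) (snd z))\<^sup>2)"
        using couplings_integrable_dist[OF \<nu> \<rho> g'] by (subst (asm) integrable_distr_eq[OF m]) (auto simp: borel_prod[symmetric])
      have "(W2 ?\<nu> \<rho>)\<^sup>2 \<le> (\<integral>z. (dist ((1 / v) *\<^sub>R fst z) (snd z))\<^sup>2 \<partial>\<gamma>)"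
        using W2_sq_le[OF \<nu> \<rho> g'] by (subst (asm) integral_distr[OF m]) (auto simp: borel_prod[symmetric])
      moreover have "(\<integral>z. (dist (fst z) (snd z))\<^sup>2 \<partial>\<gamma>) = (\<integral>z. (l * \<tau> / v) * (norm (fst z))\<^sup>2 - l * \<tau> * (norm (snd z))\<^sup>2
          + v * (dist ((1 / v) *\<^sub>R fst z) (snd z))\<^sup>2 \<partial>\<gamma>)"
        by (subst quadratic_split[OF assms(2,3)]) rule
      moreover have "\<dots> = (l * \<tau> / v) * (real DIM('a) * s) - l * \<tau> * (\<integral>x. (norm x)\<^sup>2 \<partial>\<rho>)
          + v * (\<integral>z. (dist ((1 / v) *\<^sub>R fst z) (snd z))\<^sup>2 \<partial>\<gamma>)"
        using couplings_integral[OF g, of "\<lambda>x. (norm x)\<^sup>2"] P2D(4)[OF \<mu>] P2D(4)[OF \<rho>] d2 assms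
        by (simp add: integral_gaussian_norm_sq)
      ultimately show "(l * \<tau> / v) * (real DIM('a) * s) - l * \<tau> * (\<integral>x. (norm x)\<^sup>2 \<partial>\<rho>) + v * (W2 ?\<nu> \<rho>)\<^sup>2
          \<le> (\<integral>z. (dist (fst z) (snd z))\<^sup>2 \<partial>\<gamma>)"
        using assms(3) by (simp add: mult_left_mono)
    qed
    then have "((l * \<tau> / v) * (real DIM('a) * s) - l * \<tau> * (\<integral>x. (norm x)\<^sup>2 \<partial>\<rho>) + v * (W2 ?\<nu> \<rho>)\<^sup>2) / (2 * \<tau>)
        \<le> (W2 ?\<mu> \<rho>)\<^sup>2 / (2 * \<tau>)"
      using assms(1) by (intro divide_right_mono) auto
    then show ?thesis
      using assms(1,3) by (simp add: K_def F_def add_divide_distrib diff_divide_distrib mult.commute)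
  qed
  have eq: "(W2 ?\<mu> ?\<nu>)\<^sup>2 / (2 * \<tau>) + F ?\<nu> = K"
  proof -
    have "(W2 ?\<mu> ?\<nu>)\<^sup>2 = real DIM('a) * s * (1 - 1 / v)\<^sup>2"
    proof -
      have "sqrt s - sqrt (s / v\<^sup>2) = sqrt s * (1 - 1 / v)"
        using assms by (simp add: real_sqrt_divide algebra_simps)
      then show ?thesis using assms by (simp add: W2_gaussian power_mult_distrib)
    qed
    moreover have "(1 - 1 / v)\<^sup>2 = (l * \<tau>)\<^sup>2 / v\<^sup>2"
      using assms by (simp add: power_divide[symmetric] diff_divide_eq_iff)
    moreover have "F ?\<nu> = l / 2 * (real DIM('a) * (s / v\<^sup>2))"
      using assms by (simp add: F_def integral_gaussian_norm_sq)
    ultimately have "(W2 ?\<mu> ?\<nu>)\<^sup>2 / (2 * \<tau>) + F ?\<nu>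
        = real DIM('a) * s * ((l * \<tau>)\<^sup>2 / v\<^sup>2) / (2 * \<tau>) + l / 2 * (real DIM('a) * (s / v\<^sup>2))"
      by (simp only:)
    also have "\<dots> = real DIM('a) * s * l * (l * \<tau> + 1) / (2 * v\<^sup>2)"
      using assms(1,3) by (simp add: field_simps power2_eq_square)
    also have "l * \<tau> + 1 = v" using assms(2) by simp
    also have "real DIM('a) * s * l * v / (2 * v\<^sup>2) = K" using assms(3) by (simp add: K_def power2_eq_square)
    finally show ?thesis .
  qed
  have "J0 F \<tau> ?\<mu> = ?\<nu>"
    unfolding J0_def
  proof (rule the_equality)
    have "K \<le> (W2 ?\<mu> \<rho>)\<^sup>2 / (2 * \<tau>) + F \<rho>" if "\<rho> \<in> P2" for \<rho>
      using lower[OF that] assms by (smt (verit) divide_nonneg_pos mult_nonneg_nonneg zero_le_power2)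
    then show "is_arg_min (\<lambda>\<rho>. (W2 ?\<mu> \<rho>)\<^sup>2 / (2 * \<tau>) + F \<rho>) (\<lambda>\<rho>. \<rho> \<in> P2) ?\<nu>"
      unfolding is_arg_min_def using \<nu> eq by force
  next
    fix \<rho> assume "is_arg_min (\<lambda>\<rho>. (W2 ?\<mu> \<rho>)\<^sup>2 / (2 * \<tau>) + F \<rho>) (\<lambda>\<rho>. \<rho> \<in> P2) \<rho>"
    then have \<rho>: "\<rho> \<in> P2" "(W2 ?\<mu> \<rho>)\<^sup>2 / (2 * \<tau>) + F \<rho> \<le> K"
      unfolding is_arg_min_def using \<nu> eq by force+
    then have "v / (2 * \<tau>) * (W2 ?\<nu> \<rho>)\<^sup>2 \<le> 0" using lower[of \<rho>] by linarith
    then have "(W2 ?\<nu> \<rho>)\<^sup>2 \<le> 0" using assms(1,3) by (simp only: mult_le_0_iff) (auto simp: divide_le_0_iff)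
    then have "W2 ?\<nu> \<rho> = 0" by simp
    then show "\<rho> = ?\<nu>" using W2_eq_0D[OF \<nu> \<rho>(1)] by simp
  qed
  then show ?thesis by (simp add: F_def)
qed

section \<open>Gibbs' inequality and the entropic step\<close>

lemma entropy_ge_pointwise:
  fixes u q :: real
  assumes "u \<ge> 0"
  shows "u * q + u - exp q \<le> u * ln u"
proof (cases "u = 0")
  case False
  then have u: "u > 0" using assms by simp
  \<comment> \<open>The tangent of exp at 0, evaluated at q - ln u; the result is Young's inequality
    for the conjugate pair u ln u - u and exp q.\<close>
  have "1 + (q - ln u) \<le> exp (q - ln u)" by (rule exp_ge_add_one_self)
  also have "\<dots> = exp q / u" using u by (simp add: exp_diff)
  finally have "u * (1 + (q - ln u)) \<le> exp q" using u by (simp add: field_simps)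
  then show ?thesis by (simp add: algebra_simps)
qed simp

text \<open>Gibbs' inequality in variational form, for an exponent \<open>q\<close> that need not be
  normalized; the freedom to perturb \<open>q\<close> is what later yields uniqueness. The minorant
  f q + f - exp q is integrable, so the negative part of f ln f is integrable too and the entropy is
  never infinity minus infinity.\<close>

lemma boltzmann_ge:
  fixes \<gamma> :: "'b::euclidean_space measure"
  assumes "prob_space \<gamma>" "sets \<gamma> = sets borel" "integrable \<gamma> q" "q \<in> borel_measurable borel"
    and "integrable lborel (\<lambda>z. exp (q z))"
  shows "ereal ((\<integral>z. q z \<partial>\<gamma>) + 1 - (\<integral>z. exp (q z) \<partial>lborel)) \<le> boltzmann \<gamma>"
proof (cases "absolutely_continuous lborel \<gamma>")
  case True
  interpret prob_space \<gamma> by fact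
  define f where "f = (\<lambda>x. enn2real (RN_deriv lborel \<gamma> x))"
  have [measurable]: "f \<in> borel_measurable borel" "q \<in> borel_measurable borel"
    using assms(4) borel_measurable_RN_deriv[of lborel \<gamma>] by (auto simp: f_def)
  have "density lborel (RN_deriv lborel \<gamma>) = \<gamma>"
    using True assms(2) by (intro sigma_finite_measure.density_RN_deriv[OF sigma_finite_lborel]) auto
  moreover have "AE x in lborel. RN_deriv lborel \<gamma> x \<noteq> \<infinity>"
    using True assms(2) sigma_finite_measure_axioms by (intro sigma_finite_measure.RN_deriv_finite[OF sigma_finite_lborel]) auto
  then have "density lborel (RN_deriv lborel \<gamma>) = density lborel (\<lambda>x. ennreal (f x))"
    by (intro density_cong) (auto simp: f_def less_top)
  ultimately have \<gamma>: "\<gamma> = density lborel (\<lambda>x. ennreal (f x))" by simp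
  have f0: "f x \<ge> 0" for x by (simp add: f_def)
  have fq: "integrable lborel (\<lambda>x. f x * q x)" "(\<integral>z. q z \<partial>\<gamma>) = (\<integral>x. f x * q x \<partial>lborel)"
    using assms(3) f0 unfolding \<gamma> by (simp_all add: integrable_density integral_density)
  have f1: "integrable lborel f" "(\<integral>x. f x \<partial>lborel) = 1"
  proof -
    have "integrable \<gamma> (\<lambda>_. 1::real)" "(\<integral>x. (1::real) \<partial>\<gamma>) = 1" using prob_space by simp_all
    then have "integrable (density lborel (\<lambda>x. ennreal (f x))) (\<lambda>_. 1::real)"
      "(\<integral>x. (1::real) \<partial>density lborel (\<lambda>x. ennreal (f x))) = 1"
      by (simp_all only: \<gamma>[symmetric])
    moreover have "(\<integral>x. f x *\<^sub>R (1::real) \<partial>lborel) = (\<integral>x. 1 \<partial>density lborel (\<lambda>x. ennreal (f x)))"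
      by (rule integral_density[symmetric]) (use f0 in auto)
    ultimately show "integrable lborel f" "(\<integral>x. f x \<partial>lborel) = 1"
      using f0 by (simp_all add: integrable_density)
  qed
  define ell where "ell = (\<lambda>x. f x * q x + f x - exp (q x))"
  have ell: "integrable lborel ell" "ell x \<le> f x * ln (f x)" for x
    using fq(1) f1(1) assms(5) entropy_ge_pointwise[OF f0] by (auto simp: ell_def)
  have int_ell: "(\<integral>x. ell x \<partial>lborel) = (\<integral>z. q z \<partial>\<gamma>) + 1 - (\<integral>z. exp (q z) \<partial>lborel)"
    unfolding ell_def using fq f1 assms(5) by simp
  have "integrable lborel (\<lambda>x. max 0 (- ell x))" using ell(1) by auto
  then have fin: "(\<integral>\<^sup>+ x. ennreal (- (f x * ln (f x))) \<partial>lborel) < \<infinity>"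
  proof -
    have "(\<integral>\<^sup>+ x. ennreal (- (f x * ln (f x))) \<partial>lborel) \<le> (\<integral>\<^sup>+ x. ennreal (norm (ell x)) \<partial>lborel)"
      by (intro nn_integral_mono ennreal_leI) (use ell(2) in \<open>smt (verit) real_norm_def\<close>)
    also have "\<dots> < \<infinity>" using ell(1) by (simp add: integrable_iff_bounded)
    finally show ?thesis .
  qed
  have b: "boltzmann \<gamma> = enn2ereal (\<integral>\<^sup>+ x. ennreal (f x * ln (f x)) \<partial>lborel)
      - enn2ereal (\<integral>\<^sup>+ x. ennreal (- (f x * ln (f x))) \<partial>lborel)"
    using True by (simp add: boltzmann_def f_def)
  show ?thesis
  proof (cases "(\<integral>\<^sup>+ x. ennreal (f x * ln (f x)) \<partial>lborel) = \<infinity>")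
    case True
    then show ?thesis using fin unfolding b by (cases "\<integral>\<^sup>+ x. ennreal (- (f x * ln (f x))) \<partial>lborel") auto
  next
    case False
    have i: "integrable lborel (\<lambda>x. f x * ln (f x))"
      using False fin by (auto simp: real_integrable_def less_top)
    have "(\<integral>x. ell x \<partial>lborel) \<le> (\<integral>x. f x * ln (f x) \<partial>lborel)"
      by (rule integral_mono[OF ell(1) i ell(2)])
    also have "\<dots> = enn2real (\<integral>\<^sup>+ x. ennreal (f x * ln (f x)) \<partial>lborel) - enn2real (\<integral>\<^sup>+ x. ennreal (- (f x * ln (f x))) \<partial>lborel)"
      by (rule real_lebesgue_integral_def[OF i])
    finally show ?thesis
      using False fin unfolding b int_ell
      by (cases "\<integral>\<^sup>+ x. ennreal (f x * ln (f x)) \<partial>lborel"; cases "\<integral>\<^sup>+ x. ennreal (- (f x * ln (f x))) \<partial>lborel") auto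
  qed
qed (simp add: boltzmann_def)

text \<open>The density is written as an exponential so that its logarithm is \<open>q\<close>
  itself; the Radon-Nikodym derivative agrees with it only almost everywhere.\<close>

lemma boltzmann_density:
  fixes q :: "'b::euclidean_space \<Rightarrow> real"
  assumes [measurable]: "q \<in> borel_measurable borel"
    and "integrable lborel (\<lambda>x. exp (q x) * q x)"
  shows "boltzmann (density lborel (\<lambda>x. ennreal (exp (q x)))) = ereal (\<integral>x. exp (q x) * q x \<partial>lborel)"
proof -
  let ?\<gamma> = "density lborel (\<lambda>x. ennreal (exp (q x)))"
  have "AE x in lborel. ennreal (exp (q x)) = RN_deriv lborel ?\<gamma> x"
    by (rule sigma_finite_measure.RN_deriv_unique[OF sigma_finite_lborel]) auto
  then have ae: "AE x in lborel. enn2real (RN_deriv lborel ?\<gamma> x) = exp (q x)"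
    by eventually_elim (metis enn2real_ennreal exp_ge_zero)
  have "absolutely_continuous lborel ?\<gamma>"
    by (intro absolutely_continuousI_density) auto
  moreover have "(\<integral>\<^sup>+ x. ennreal (enn2real (RN_deriv lborel ?\<gamma> x) * ln (enn2real (RN_deriv lborel ?\<gamma> x))) \<partial>lborel)
      = (\<integral>\<^sup>+ x. ennreal (exp (q x) * q x) \<partial>lborel)"
    using ae by (intro nn_integral_cong_AE) auto
  moreover have "(\<integral>\<^sup>+ x. ennreal (- (enn2real (RN_deriv lborel ?\<gamma> x) * ln (enn2real (RN_deriv lborel ?\<gamma> x)))) \<partial>lborel)
      = (\<integral>\<^sup>+ x. ennreal (- (exp (q x) * q x)) \<partial>lborel)"
    using ae by (intro nn_integral_cong_AE) auto
  ultimately have b: "boltzmann ?\<gamma> = enn2ereal (\<integral>\<^sup>+ x. ennreal (exp (q x) * q x) \<partial>lborel)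
      - enn2ereal (\<integral>\<^sup>+ x. ennreal (- (exp (q x) * q x)) \<partial>lborel)"
    by (simp add: boltzmann_def)
  have "(\<integral>\<^sup>+ x. ennreal (exp (q x) * q x) \<partial>lborel) < \<infinity>" "(\<integral>\<^sup>+ x. ennreal (- (exp (q x) * q x)) \<partial>lborel) < \<infinity>"
    using assms(2) by (auto simp: real_integrable_def less_top)
  then show ?thesis
    unfolding b real_lebesgue_integral_def[OF assms(2)]
    by (cases "\<integral>\<^sup>+ x. ennreal (exp (q x) * q x) \<partial>lborel"; cases "\<integral>\<^sup>+ x. ennreal (- (exp (q x) * q x)) \<partial>lborel") auto
qed

definition lngauss :: "real \<Rightarrow> 'a::euclidean_space \<Rightarrow> real" where
  "lngauss s x = - (real DIM('a) / 2 * ln (2 * pi * s)) - (norm x)\<^sup>2 / (2 * s)"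

lemma lngauss_measurable [measurable]: "lngauss s \<in> borel_measurable borel"
  unfolding lngauss_def by measurable

lemma exp_lngauss: "s > 0 \<Longrightarrow> exp (lngauss s x) = gdens s x"
  unfolding lngauss_def gdens_def diff_conv_add_uminus[of "- (real DIM('a) / 2 * ln (2 * pi * s))"] exp_add
  by (simp add: powr_def)

lemma boltzmann_gaussian:
  assumes "s > 0"
  shows "boltzmann (gaussian s :: 'a::euclidean_space measure)
    = ereal (- (real DIM('a) / 2 * ln (2 * pi * s)) - real DIM('a) / 2)"
proof -
  let ?G = "gaussian s :: 'a measure"
  interpret prob_space ?G using assms by (rule prob_space_gaussian)
  have i: "integrable ?G (lngauss s)"
    unfolding lngauss_def using P2D(4)[OF gaussian_P2[OF assms]] by auto
  have v: "(\<integral>x. lngauss s x \<partial>?G) = - (real DIM('a) / 2 * ln (2 * pi * s)) - real DIM('a) / 2"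
    unfolding lngauss_def using P2D(4)[OF gaussian_P2[OF assms], where 'a='a] assms
    by (simp add: integral_gaussian_norm_sq prob_space[simplified])
  have g: "?G = density lborel (\<lambda>x. ennreal (exp (lngauss s x)))"
    using assms by (simp add: gaussian_density exp_lngauss)
  have "integrable lborel (\<lambda>x::'a. exp (lngauss s x) * lngauss s x)"
    using i assms unfolding g by (subst (asm) integrable_density) auto
  from boltzmann_density[OF lngauss_measurable this]
  show ?thesis unfolding g[symmetric] v[symmetric]
    by (subst (2) g) (simp add: integral_density)
qed

lemma nn_integral_lborel_translate:
  fixes f :: "'a::euclidean_space \<Rightarrow> ennreal"
  assumes [measurable]: "f \<in> borel_measurable borel"
  shows "(\<integral>\<^sup>+x. f (x - c) \<partial>lborel) = (\<integral>\<^sup>+x. f x \<partial>lborel)"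
proof -
  have "(\<integral>\<^sup>+x. f x \<partial>lborel) = (\<integral>\<^sup>+x. f x \<partial>distr lborel borel ((+) (- c)))"
    by (simp add: lborel_distr_plus)
  also have "\<dots> = (\<integral>\<^sup>+x. f (x - c) \<partial>lborel)"
    by (simp add: nn_integral_distr)
  finally show ?thesis ..
qed

text \<open>Bayes' formula for X of variance \<open>s\<close> and Y = X / v plus independent noise
  of variance \<open>r\<close>: Y has variance \<open>s'\<close>, and given Y = y the vector X is
  Gaussian with mean s y / (v s') and variance s r / s'.\<close>

lemma gdens_complete_square:
  fixes x y :: "'a::euclidean_space"
  assumes "s > 0" "r > 0" "v > 0" and s': "s' = s / v\<^sup>2 + r"
  shows "gdens s x * gdens r (y - (1 / v) *\<^sub>R x) = gdens s' y * gdens (s * r / s') (x - (s / (v * s')) *\<^sub>R y)"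
proof -
  have pos: "s' > 0" using assms by (auto intro: add_nonneg_pos)
  have e: "(norm x)\<^sup>2 / (2 * s) + (norm (y - (1 / v) *\<^sub>R x))\<^sup>2 / (2 * r)
      = (norm y)\<^sup>2 / (2 * s') + (norm (x - (s / (v * s')) *\<^sub>R y))\<^sup>2 / (2 * (s * r / s'))"
  proof -
    have "1 / (2 * s) + (1 / v)\<^sup>2 / (2 * r) = 1 / (2 * (s * r / s'))"
    proof -
      have "1 / (2 * (s * r / s')) = (s / v\<^sup>2 + r) / (2 * s * r)" using s' by simp
      also have "\<dots> = 1 / (2 * s) + (1 / v)\<^sup>2 / (2 * r)"
        using assms(1-3) by (simp add: add_divide_distrib power_divide)
      finally show ?thesis ..
    qed
    moreover have "(1 / v) / r = (s / (v * s')) / (s * r / s')"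
      using assms(1-3) pos by (simp add: field_simps)
    moreover have "1 / (2 * r) = 1 / (2 * s') + (s / (v * s'))\<^sup>2 / (2 * (s * r / s'))"
    proof -
      have "(s / (v * s'))\<^sup>2 / (2 * (s * r / s')) = (s / v\<^sup>2) / (2 * r * s')"
        using assms(1-3) pos by (simp add: field_simps power2_eq_square)
      also have "s / v\<^sup>2 = s' - r" using s' by simp
      finally show ?thesis using assms(2) pos by (simp add: field_simps)
    qed
    moreover have sq: "(norm (x - k *\<^sub>R y))\<^sup>2 / (2 * w) = (1 / (2 * w)) * (x \<bullet> x) - (k / w) * (x \<bullet> y) + (k\<^sup>2 / (2 * w)) * (y \<bullet> y)"
      for k w and x y :: 'a
    proof -
      have "(norm (x - k *\<^sub>R y))\<^sup>2 = x \<bullet> x - 2 * k * (x \<bullet> y) + k\<^sup>2 * (y \<bullet> y)"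
        unfolding power2_norm_eq_inner
        by (simp add: inner_diff inner_commute power2_eq_square algebra_simps)
      then show ?thesis by (simp add: diff_divide_distrib add_divide_distrib)
    qed
    have "(norm x)\<^sup>2 / (2 * s) + (norm (y - (1 / v) *\<^sub>R x))\<^sup>2 / (2 * r)
        = (1 / (2 * s) + (1 / v)\<^sup>2 / (2 * r)) * (x \<bullet> x) - ((1 / v) / r) * (x \<bullet> y) + (1 / (2 * r)) * (y \<bullet> y)"
      unfolding sq by (simp add: power2_norm_eq_inner inner_commute distrib_right)
    moreover have "(norm y)\<^sup>2 / (2 * s') + (norm (x - (s / (v * s')) *\<^sub>R y))\<^sup>2 / (2 * (s * r / s'))
        = (1 / (2 * (s * r / s'))) * (x \<bullet> x) - ((s / (v * s')) / (s * r / s')) * (x \<bullet> y)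
          + (1 / (2 * s') + (s / (v * s'))\<^sup>2 / (2 * (s * r / s'))) * (y \<bullet> y)"
      unfolding sq by (simp add: power2_norm_eq_inner distrib_right)
    ultimately show ?thesis by simp
  qed
  have p: "(2 * pi * s) powr k * (2 * pi * r) powr k = (2 * pi * s') powr k * (2 * pi * (s * r / s')) powr k" for k
    using assms(1,2) pos by (simp add: powr_mult[symmetric] mult_ac)
  have m: "(P * exp (- X)) * (Q * exp (- Y)) = (P * Q) * exp (- (X + Y))" for P Q X Y :: real
    unfolding minus_add_distrib exp_add by (simp only: mult_ac)
  have g: "gdens s x = (2 * pi * s) powr (- real DIM('a) / 2) * exp (- ((norm x)\<^sup>2 / (2 * s)))" for s and x :: 'a
    by (simp add: gdens_def)
  show ?thesis unfolding g m e p ..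
qed

text \<open>The joint law of X and X / v plus noise. Integrating out y from the transition form, or
  x from the conditional form in \<open>gdens_complete_square\<close>, gives the two
  marginals.\<close>

lemma gaussian_transition_coupling:
  assumes "s > 0" "r > 0" "v > 0" and s': "s' = s / v\<^sup>2 + r"
  shows "density lborel (\<lambda>z. ennreal (gdens s (fst z) * gdens r (snd z - (1 / v) *\<^sub>R fst z)))
    \<in> couplings (gaussian s) (gaussian s' :: 'a::euclidean_space measure)" (is "?\<gamma> \<in> _")
proof -
  let ?h = "\<lambda>z::'a \<times> 'a. ennreal (gdens s (fst z) * gdens r (snd z - (1 / v) *\<^sub>R fst z))"
  have s'0: "s' > 0" using assms by (auto intro: add_nonneg_pos)
  have w: "s * r / s' > 0" using assms(1,2) s'0 by simp
  have [measurable]: "(\<lambda>z::'a \<times> 'a. gdens s (fst z) * gdens r (snd z - (1 / v) *\<^sub>R fst z)) \<in> borel_measurable borel"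
    unfolding borel_prod[symmetric] by measurable
  then have [measurable]: "?h \<in> borel_measurable borel" "?h \<in> borel_measurable (borel \<Otimes>\<^sub>M borel)"
    unfolding borel_prod by (rule measurable_compose[OF _ measurable_ennreal])+
  have fst_eq: "emeasure (distr ?\<gamma> borel fst) A = emeasure (gaussian s) A" if [measurable]: "A \<in> sets borel" for A
  proof -
    have "emeasure (distr ?\<gamma> borel fst) A = (\<integral>\<^sup>+z. ?h z * indicator A (fst z) \<partial>lborel)"
    proof -
      have [measurable]: "fst \<in> borel_measurable (borel::('a \<times> 'a) measure)" unfolding borel_prod[symmetric] by measurable
      have "emeasure (distr ?\<gamma> borel fst) A = (\<integral>\<^sup>+z. indicator A (fst z) \<partial>?\<gamma>)"
        by (subst nn_integral_indicator[symmetric]) (auto simp: nn_integral_distr simp del: nn_integral_indicator)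
      also have "\<dots> = (\<integral>\<^sup>+z. ?h z * indicator A (fst z) \<partial>lborel)"
        by (subst nn_integral_density) auto
      finally show ?thesis .
    qed
    also have "\<dots> = (\<integral>\<^sup>+x. \<integral>\<^sup>+y. ?h (x, y) * indicator A x \<partial>lborel \<partial>lborel)"
      unfolding lborel_prod[symmetric] by (subst lborel.nn_integral_fst[symmetric]) auto
    also have "\<dots> = (\<integral>\<^sup>+x. ennreal (gdens s x) * indicator A x \<partial>lborel)"
    proof (intro nn_integral_cong)
      fix x :: 'a
      have "(\<integral>\<^sup>+y. ?h (x, y) * indicator A x \<partial>lborel) =
          (\<integral>\<^sup>+y. ennreal (gdens s x) * indicator A x * ennreal (gdens r (y - (1 / v) *\<^sub>R x)) \<partial>lborel)"
        by (simp add: ennreal_mult' mult_ac)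
      also have "\<dots> = ennreal (gdens s x) * indicator A x"
        using nn_integral_lborel_translate[of "\<lambda>y. ennreal (gdens r y)" "(1 / v) *\<^sub>R x"] assms(2)
        by (simp add: nn_integral_cmult nn_integral_gdens)
      finally show "(\<integral>\<^sup>+y. ?h (x, y) * indicator A x \<partial>lborel) = ennreal (gdens s x) * indicator A x" .
    qed
    also have "\<dots> = emeasure (gaussian s) A" by (simp add: gaussian_density emeasure_density)
    finally show ?thesis .
  qed
  have snd_eq: "emeasure (distr ?\<gamma> borel snd) A = emeasure (gaussian s') A" if [measurable]: "A \<in> sets borel" for A
  proof -
    have "emeasure (distr ?\<gamma> borel snd) A = (\<integral>\<^sup>+z. ?h z * indicator A (snd z) \<partial>lborel)"
    proof -
      have [measurable]: "snd \<in> borel_measurable (borel::('a \<times> 'a) measure)" unfolding borel_prod[symmetric] by measurable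
      have "emeasure (distr ?\<gamma> borel snd) A = (\<integral>\<^sup>+z. indicator A (snd z) \<partial>?\<gamma>)"
        by (subst nn_integral_indicator[symmetric]) (auto simp: nn_integral_distr simp del: nn_integral_indicator)
      also have "\<dots> = (\<integral>\<^sup>+z. ?h z * indicator A (snd z) \<partial>lborel)"
        by (subst nn_integral_density) auto
      finally show ?thesis .
    qed
    also have "\<dots> = (\<integral>\<^sup>+y. \<integral>\<^sup>+x. ?h (x, y) * indicator A y \<partial>lborel \<partial>lborel)"
      unfolding lborel_prod[symmetric]
      by (subst lborel_pair.nn_integral_snd[symmetric]) (auto simp: case_prod_beta)
    also have "\<dots> = (\<integral>\<^sup>+y. ennreal (gdens s' y) * indicator A y \<partial>lborel)"
    proof (intro nn_integral_cong)
      fix y :: 'a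
      have "(\<integral>\<^sup>+x. ?h (x, y) * indicator A y \<partial>lborel) =
          (\<integral>\<^sup>+x. ennreal (gdens s' y) * indicator A y * ennreal (gdens (s * r / s') (x - (s / (v * s')) *\<^sub>R y)) \<partial>lborel)"
        by (simp add: gdens_complete_square[OF assms] ennreal_mult' mult_ac)
      also have "\<dots> = ennreal (gdens s' y) * indicator A y"
        using nn_integral_lborel_translate[of "\<lambda>x. ennreal (gdens (s * r / s') x)" "(s / (v * s')) *\<^sub>R y"] w
        by (simp add: nn_integral_cmult nn_integral_gdens)
      finally show "(\<integral>\<^sup>+x. ?h (x, y) * indicator A y \<partial>lborel) = ennreal (gdens s' y) * indicator A y" .
    qed
    also have "\<dots> = emeasure (gaussian s') A" by (simp add: gaussian_density emeasure_density)
    finally show ?thesis .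
  qed
  have f: "distr ?\<gamma> borel fst = gaussian s" by (rule measure_eqI) (auto intro: fst_eq)
  have "emeasure ?\<gamma> (space ?\<gamma>) = 1"
  proof -
    have "emeasure ?\<gamma> (space ?\<gamma>) = emeasure (distr ?\<gamma> borel fst) UNIV"
      by (subst emeasure_distr) (auto simp: borel_prod[symmetric])
    then show ?thesis
      using prob_space.emeasure_space_1[OF prob_space_gaussian[OF assms(1), where 'a='a]] by (simp add: f)
  qed
  then have "prob_space ?\<gamma>" by (rule prob_spaceI)
  moreover have "distr ?\<gamma> borel snd = gaussian s'" by (rule measure_eqI) (auto intro: snd_eq)
  ultimately show ?thesis using f by (simp add: couplings_def)
qed

text \<open>The logarithm of the joint density in
  \<open>gaussian_transition_coupling\<close>.\<close>

definition lntrans :: "real \<Rightarrow> real \<Rightarrow> real \<Rightarrow> 'a::euclidean_space \<times> 'a \<Rightarrow> real" where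
  "lntrans s r v z = lngauss s (fst z) + lngauss r (snd z - (1 / v) *\<^sub>R fst z)"

lemma lntrans_measurable [measurable]:
  "lntrans s r v \<in> borel_measurable (borel :: ('a::euclidean_space \<times> 'a) measure)"
  unfolding lntrans_def[abs_def] borel_prod[symmetric] by measurable

lemma exp_lntrans:
  "s > 0 \<Longrightarrow> r > 0 \<Longrightarrow> exp (lntrans s r v z) = gdens s (fst z) * gdens r (snd z - (1 / v) *\<^sub>R fst z)"
  by (simp add: lntrans_def exp_add exp_lngauss)

text \<open>The noise variance \<open>r\<close> is forced: by \<open>quadratic_split\<close> the
  Gibbs weight exp (- (|x - y|^2 / 2 + l \<tau> |y|^2 / 2) / (\<alpha> \<tau>)) is, as a function of
  y, proportional to a Gaussian with mean x / v and variance \<alpha> \<tau> / v.\<close>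

locale schroedinger_step =
  fixes s \<alpha> \<tau> l v r s' :: real
  assumes pos: "s > 0" "\<alpha> > 0" "\<tau> > 0" "v > 0"
    and v: "v = 1 + l * \<tau>" and r: "r = \<alpha> * \<tau> / v" and s': "s' = s / v\<^sup>2 + r"
begin

lemma r_pos: "r > 0" and s'_pos: "s' > 0"
  using pos by (auto simp: r s' intro!: add_nonneg_pos)

definition cost_const :: "'a::euclidean_space itself \<Rightarrow> real" where
  "cost_const TYPE('a) = - (\<alpha> * \<tau>) * (real DIM('a) / 2 * ln (2 * pi * s) + real DIM('a) / 2 * ln (2 * pi * r) + real DIM('a) / 2)
     + l * \<tau> * real DIM('a) * s / (2 * v) + \<alpha> * \<tau> * real DIM('a) / 2 * ln (2 * pi * (\<alpha> * \<tau>))"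

text \<open>\<open>lntrans\<close> is - |x - y|^2 / (2 \<alpha> \<tau>) plus a function of x and a
  multiple of |y|^2. Hence the transport cost cancels, and what remains depends on the coupling only
  through its marginals.\<close>

lemma integral_lntrans:
  fixes \<rho> :: "'a::euclidean_space measure"
  assumes "\<rho> \<in> P2" "\<gamma> \<in> couplings (gaussian s) \<rho>"
  shows "integrable \<gamma> (lntrans s r v)"
    "(\<integral>z. (dist (fst z) (snd z))\<^sup>2 / 2 \<partial>\<gamma>) + \<alpha> * \<tau> * (\<integral>z. lntrans s r v z \<partial>\<gamma>)
        + \<alpha> * \<tau> * real DIM('a) / 2 * ln (2 * pi * (\<alpha> * \<tau>))
      = cost_const TYPE('a) - \<tau> * (l / 2 * (\<integral>x. (norm x)\<^sup>2 \<partial>\<rho>))"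
proof -
  interpret prob_space \<gamma> using assms(2) by (rule couplingsD)
  note \<mu> = gaussian_P2[OF pos(1), where 'a='a]
  define c where "c = real DIM('a) / 2 * ln (2 * pi * s) + real DIM('a) / 2 * ln (2 * pi * r)"
  have q: "lntrans s r v z = - c - (1 / (2 * s)) * (norm (fst z))\<^sup>2 - (1 / (2 * (\<alpha> * \<tau>))) *
      ((dist (fst z) (snd z))\<^sup>2 - (l * \<tau> / v) * (norm (fst z))\<^sup>2 + l * \<tau> * (norm (snd z))\<^sup>2)" for z :: "'a \<times> 'a"
  proof -
    have "(dist ((1 / v) *\<^sub>R fst z) (snd z))\<^sup>2 / (2 * r) = (1 / (2 * (\<alpha> * \<tau>))) *
      ((dist (fst z) (snd z))\<^sup>2 - (l * \<tau> / v) * (norm (fst z))\<^sup>2 + l * \<tau> * (norm (snd z))\<^sup>2)"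
      unfolding quadratic_split[OF v pos(4), of "fst z" "snd z"] using pos by (simp add: r)
    then show ?thesis
      by (simp add: lntrans_def lngauss_def c_def dist_norm norm_minus_commute)
  qed
  note i = couplings_integrable_dist[OF \<mu> assms]
    couplings_integral(3,4)[OF assms(2), of "\<lambda>x. (norm x)\<^sup>2", simplified]
  have i': "integrable \<gamma> (\<lambda>z. (norm (fst z))\<^sup>2)" "integrable \<gamma> (\<lambda>z. (norm (snd z))\<^sup>2)"
    using i P2D(4)[OF \<mu>] P2D(4)[OF assms(1)] by auto
  show "integrable \<gamma> (lntrans s r v)"
    unfolding q[abs_def] using i(1) i' by auto
  have E1: "(\<integral>z. lntrans s r v z \<partial>\<gamma>) = - c - (1 / (2 * s)) * (real DIM('a) * s) - (1 / (2 * (\<alpha> * \<tau>))) *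
     ((\<integral>z. (dist (fst z) (snd z))\<^sup>2 \<partial>\<gamma>) - (l * \<tau> / v) * (real DIM('a) * s) + l * \<tau> * (\<integral>x. (norm x)\<^sup>2 \<partial>\<rho>))"
    unfolding q using i(1) i' couplings_integral(1,2)[OF assms(2), of "\<lambda>x. (norm x)\<^sup>2"] pos(1)
    by (simp add: integral_gaussian_norm_sq prob_space)
  have E2: "\<alpha> * \<tau> * (- c - (1 / (2 * s)) * (real DIM('a) * s) - (1 / (2 * (\<alpha> * \<tau>))) * X) = - (\<alpha> * \<tau>) * (c + real DIM('a) / 2) - X / 2" for X
    using pos by (simp add: field_simps)
  show "(\<integral>z. (dist (fst z) (snd z))\<^sup>2 / 2 \<partial>\<gamma>) + \<alpha> * \<tau> * (\<integral>z. lntrans s r v z \<partial>\<gamma>)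
        + \<alpha> * \<tau> * real DIM('a) / 2 * ln (2 * pi * (\<alpha> * \<tau>))
      = cost_const TYPE('a) - \<tau> * (l / 2 * (\<integral>x. (norm x)\<^sup>2 \<partial>\<rho>))"
    unfolding E1 E2 cost_const_def c_def
    using pos by (simp add: add_divide_distrib diff_divide_distrib algebra_simps)
qed

definition opt_coupling :: "('a::euclidean_space \<times> 'a) measure" where
  "opt_coupling = density lborel (\<lambda>z. ennreal (exp (lntrans s r v z)))"

lemma opt_coupling: "opt_coupling \<in> couplings (gaussian s) (gaussian s')"
  using gaussian_transition_coupling[OF pos(1) r_pos pos(4) s'] pos(1) r_pos
  by (simp add: opt_coupling_def exp_lntrans)

text \<open>The quadratic gap is of Pinsker type and comes from tilting the optimal exponent by a
  multiple of the indicator of \<open>A\<close> in the second variable. It yields uniqueness by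
  comparing masses of sets, without disintegrating couplings.\<close>

lemma Sch_ge:
  fixes \<rho> :: "'a::euclidean_space measure"
  assumes "\<rho> \<in> P2" and A[measurable]: "A \<in> sets borel" and le: "measure (gaussian s') A \<le> measure \<rho> A"
  shows "ereal (cost_const TYPE('a) - \<tau> * (l / 2 * (\<integral>x. (norm x)\<^sup>2 \<partial>\<rho>)) + \<alpha> * \<tau> * ((measure \<rho> A - measure (gaussian s') A)\<^sup>2 / 4))
    \<le> Sch (\<alpha> * \<tau>) (gaussian s) \<rho>"
  unfolding Sch_def
proof (rule INF_greatest)
  fix \<gamma> :: "('a \<times> 'a) measure" assume g: "\<gamma> \<in> couplings (gaussian s) \<rho>"
  note \<mu> = gaussian_P2[OF pos(1), where 'a='a]
  let ?p = "measure \<rho> A" and ?q = "measure (gaussian s') A"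
  \<comment> \<open>As e^lam - 1 \<le> lam + lam^2 on [0, 1], the tilt gains at least lam (p - q) -
    lam^2 q, with p and q the two masses of \<open>A\<close>. This is at least lam^2, because p - q
    = 2 lam and q \<le> 1.\<close>
  define lam where "lam = (?p - ?q) / 2"
  interpret R: prob_space \<rho> using P2D(1)[OF assms(1)] .
  interpret G: prob_space \<gamma> using couplingsD(1)[OF g] .
  interpret O: prob_space "opt_coupling :: ('a \<times> 'a) measure" using couplingsD(1)[OF opt_coupling] .
  note [measurable_cong] = couplingsD(3)[OF g]
  note [measurable_cong] = couplingsD(3)[OF opt_coupling]
  have q1: "0 \<le> ?q" "?p \<le> 1" by auto
  have "?p - ?q \<le> 2" using q1 by linarith
  then have lam: "0 \<le> lam" "lam \<le> 1" unfolding lam_def using le by auto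
  have A2 [measurable]: "(\<lambda>z::'a \<times> 'a. indicator A (snd z) :: real) \<in> borel_measurable borel"
    unfolding borel_prod[symmetric] by measurable
  let ?Q = "\<lambda>z. lntrans s r v z + lam * indicator A (snd z)"
  have indA: "(\<integral>z. indicator A (snd z) \<partial>\<gamma>) = ?p" "(\<integral>z. indicator A (snd z) \<partial>opt_coupling) = ?q"
    using couplings_integral(2)[OF g, of "indicator A"] couplings_integral(2)[OF opt_coupling, of "indicator A"] P2D(3)[OF assms(1)] by auto
  have indI: "integrable \<gamma> (\<lambda>z. indicator A (snd z) :: real)" "integrable opt_coupling (\<lambda>z::'a \<times> 'a. indicator A (snd z) :: real)"
    by (rule G.integrable_const_bound[of _ 1] O.integrable_const_bound[of _ 1]; auto)+
  have eQ: "exp (?Q z) = exp (lntrans s r v z) *\<^sub>R (1 + (exp lam - 1) * indicator A (snd z))" for z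
    by (auto simp: exp_add indicator_def)
  have "integrable opt_coupling (\<lambda>z::'a \<times> 'a. 1 + (exp lam - 1) * indicator A (snd z))"
    using indI by auto
  then have iQ: "integrable lborel (\<lambda>z::'a \<times> 'a. exp (?Q z))"
    unfolding eQ opt_coupling_def by (subst (asm) integrable_density) auto
  have "(\<integral>z. exp (?Q z) \<partial>lborel) = (\<integral>z. 1 + (exp lam - 1) * indicator A (snd z) \<partial>(opt_coupling::('a \<times> 'a) measure))"
    unfolding eQ opt_coupling_def by (subst integral_density) auto
  also have "\<dots> = 1 + (exp lam - 1) * ?q"
    using indI(2) by (simp add: indA O.prob_space)
  finally have eQ1: "(\<integral>z. exp (?Q z) \<partial>lborel) = 1 + (exp lam - 1) * ?q" .
  have "ereal ((\<integral>z. ?Q z \<partial>\<gamma>) + 1 - (\<integral>z. exp (?Q z) \<partial>lborel)) \<le> boltzmann \<gamma>"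
    by (rule boltzmann_ge[OF couplingsD(1,2)[OF g] _ _ iQ])
      (use integral_lntrans(1)[OF assms(1) g] indI in auto)
  moreover have "(\<integral>z. ?Q z \<partial>\<gamma>) = (\<integral>z. lntrans s r v z \<partial>\<gamma>) + lam * ?p"
    using integral_lntrans(1)[OF assms(1) g] indI by (simp add: indA)
  moreover have "(?p - ?q)\<^sup>2 / 4 \<le> lam * ?p - (exp lam - 1) * ?q"
  proof -
    have "(exp lam - 1) * ?q \<le> (lam + lam\<^sup>2) * ?q"
      using exp_bound[OF lam] q1 by (intro mult_right_mono) auto
    moreover have "lam\<^sup>2 * ?q \<le> lam\<^sup>2 * 1" using order_trans[OF le q1(2)] by (intro mult_left_mono) auto
    moreover have "?p = ?q + 2 * lam" by (simp add: lam_def field_simps)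
    moreover have "(?p - ?q)\<^sup>2 / 4 = lam\<^sup>2" by (simp add: lam_def power_divide)
    ultimately show ?thesis by (simp add: algebra_simps power2_eq_square)
  qed
  ultimately have b: "ereal ((\<integral>z. lntrans s r v z \<partial>\<gamma>) + (?p - ?q)\<^sup>2 / 4) \<le> boltzmann \<gamma>"
    unfolding eQ1 by (elim order_trans[rotated]) simp
  have d: "enn2ereal (\<integral>\<^sup>+ z. ennreal ((dist (fst z) (snd z))\<^sup>2 / 2) \<partial>\<gamma>) = ereal (\<integral>z. (dist (fst z) (snd z))\<^sup>2 / 2 \<partial>\<gamma>)"
    using couplings_integrable_dist[OF \<mu> assms(1) g]
    by (subst nn_integral_eq_integral) (auto simp: enn2ereal_ennreal)
  have "ereal (cost_const TYPE('a) - \<tau> * (l / 2 * (\<integral>x. (norm x)\<^sup>2 \<partial>\<rho>)) + \<alpha> * \<tau> * ((?p - ?q)\<^sup>2 / 4))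
     = ereal (\<integral>z. (dist (fst z) (snd z))\<^sup>2 / 2 \<partial>\<gamma>) + ereal (\<alpha> * \<tau>) * ereal ((\<integral>z. lntrans s r v z \<partial>\<gamma>) + (?p - ?q)\<^sup>2 / 4)
       + ereal (\<alpha> * \<tau> * real DIM('a) / 2 * ln (2 * pi * (\<alpha> * \<tau>)))"
    unfolding integral_lntrans(2)[OF assms(1) g, symmetric] by (simp add: distrib_left)
  also have "\<dots> \<le> ereal (\<integral>z. (dist (fst z) (snd z))\<^sup>2 / 2 \<partial>\<gamma>) + ereal (\<alpha> * \<tau>) * boltzmann \<gamma>
       + ereal (\<alpha> * \<tau> * real DIM('a) / 2 * ln (2 * pi * (\<alpha> * \<tau>)))"
    using pos by (intro add_mono ereal_mult_left_mono b order_refl) auto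
  finally show "ereal (cost_const TYPE('a) - \<tau> * (l / 2 * (\<integral>x. (norm x)\<^sup>2 \<partial>\<rho>)) + \<alpha> * \<tau> * ((?p - ?q)\<^sup>2 / 4))
     \<le> enn2ereal (\<integral>\<^sup>+ z. ennreal ((dist (fst z) (snd z))\<^sup>2 / 2) \<partial>\<gamma>) + ereal (\<alpha> * \<tau>) * boltzmann \<gamma>
       + ereal (\<alpha> * \<tau> * real DIM('a) / 2 * ln (2 * pi * (\<alpha> * \<tau>)))"
    unfolding d .
qed

text \<open>The case of equality in Gibbs' inequality: the coupling with log density
  \<open>lntrans\<close> has the integral of \<open>lntrans\<close> as its entropy.\<close>

lemma Sch_le:
  "Sch (\<alpha> * \<tau>) (gaussian s) (gaussian s' :: 'a::euclidean_space measure)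
    \<le> ereal (cost_const TYPE('a) - \<tau> * (l / 2 * (\<integral>x. (norm (x::'a))\<^sup>2 \<partial>gaussian s')))"
proof -
  note \<mu> = gaussian_P2[OF pos(1), where 'a='a] and \<nu> = gaussian_P2[OF s'_pos, where 'a='a]
  let ?g = "opt_coupling :: ('a \<times> 'a) measure"
  note g = opt_coupling[where 'a='a]
  have "integrable lborel (\<lambda>z::'a \<times> 'a. exp (lntrans s r v z) * lntrans s r v z)"
    using integral_lntrans(1)[OF \<nu> g] unfolding opt_coupling_def by (subst (asm) integrable_density) auto
  from boltzmann_density[OF lntrans_measurable this]
  have b: "boltzmann ?g = ereal (\<integral>z. lntrans s r v z \<partial>?g)"
    unfolding opt_coupling_def by (subst integral_density) auto
  have d: "enn2ereal (\<integral>\<^sup>+ z. ennreal ((dist (fst z) (snd z))\<^sup>2 / 2) \<partial>?g) = ereal (\<integral>z. (dist (fst z) (snd z))\<^sup>2 / 2 \<partial>?g)"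
    using couplings_integrable_dist[OF \<mu> \<nu> g]
    by (subst nn_integral_eq_integral) (auto simp: enn2ereal_ennreal)
  show ?thesis
    unfolding Sch_def
    by (rule INF_lower2[OF g]) (unfold b d integral_lntrans(2)[OF \<nu> g, symmetric], simp)
qed

theorem Jalpha_gaussian:
  "Jalpha (\<lambda>\<rho>. l / 2 * (\<integral>x. (norm (x::'a::euclidean_space))\<^sup>2 \<partial>\<rho>)) \<alpha> \<tau> (gaussian s) = gaussian s'"
proof -
  define F where "F = (\<lambda>\<rho>::'a measure. l / 2 * (\<integral>x. (norm (x::'a))\<^sup>2 \<partial>\<rho>))"
  let ?\<mu> = "gaussian s :: 'a measure" and ?\<nu> = "gaussian s' :: 'a measure"
  let ?obj = "\<lambda>\<rho>. Sch (\<alpha> * \<tau>) ?\<mu> \<rho> / ereal \<tau> + ereal (F \<rho>)"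
  note \<nu> = gaussian_P2[OF s'_pos, where 'a='a]
  define K where "K = cost_const TYPE('a) / \<tau>"
  have ge: "ereal (K + \<alpha> * ((measure \<rho> A - measure ?\<nu> A)\<^sup>2 / 4)) \<le> ?obj \<rho>"
    if "\<rho> \<in> P2" "A \<in> sets borel" "measure ?\<nu> A \<le> measure \<rho> A" for \<rho> A
  proof -
    define X where "X = cost_const TYPE('a) - \<tau> * F \<rho> + \<alpha> * \<tau> * ((measure \<rho> A - measure ?\<nu> A)\<^sup>2 / 4)"
    have "ereal X \<le> Sch (\<alpha> * \<tau>) ?\<mu> \<rho>"
      using Sch_ge[OF that] by (simp add: F_def X_def)
    then have "ereal X / ereal \<tau> \<le> Sch (\<alpha> * \<tau>) ?\<mu> \<rho> / ereal \<tau>"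
      using pos by (intro ereal_divide_right_mono) auto
    then have "ereal X / ereal \<tau> + ereal (F \<rho>) \<le> ?obj \<rho>" by (intro add_mono) auto
    moreover have "X / \<tau> + F \<rho> = K + \<alpha> * ((measure \<rho> A - measure ?\<nu> A)\<^sup>2 / 4)"
      using pos by (simp add: X_def K_def field_simps)
    ultimately show ?thesis using pos by simp
  qed
  have le: "?obj ?\<nu> \<le> ereal K"
  proof -
    define X where "X = cost_const TYPE('a) - \<tau> * F ?\<nu>"
    have "Sch (\<alpha> * \<tau>) ?\<mu> ?\<nu> / ereal \<tau> \<le> ereal X / ereal \<tau>"
      using Sch_le[where 'a='a] pos by (intro ereal_divide_right_mono) (auto simp: F_def X_def)
    then have "?obj ?\<nu> \<le> ereal X / ereal \<tau> + ereal (F ?\<nu>)" by (intro add_mono) auto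
    moreover have "X / \<tau> + F ?\<nu> = K" using pos by (simp add: X_def K_def field_simps)
    ultimately show ?thesis using pos by simp
  qed
  have "Jalpha F \<alpha> \<tau> ?\<mu> = ?\<nu>"
    unfolding Jalpha_def
  proof (rule the_equality)
    \<comment> \<open>For the empty set the gap is 0 and the plain lower bound is left.\<close>
    have "ereal K \<le> ?obj \<rho>" if "\<rho> \<in> P2" for \<rho> using ge[OF that, of "{}"] by simp
    then show "is_arg_min ?obj (\<lambda>\<rho>. \<rho> \<in> P2) ?\<nu>"
      unfolding is_arg_min_def using \<nu> le by (meson leD order_trans)
  next
    fix \<rho> assume "is_arg_min ?obj (\<lambda>\<rho>. \<rho> \<in> P2) \<rho>"
    then have \<rho>: "\<rho> \<in> P2" "?obj \<rho> \<le> ereal K"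
      unfolding is_arg_min_def using \<nu> le by (auto simp: not_less intro: order_trans)
    interpret R: prob_space \<rho> using P2D(1)[OF \<rho>(1)] .
    interpret N: prob_space ?\<nu> using P2D(1)[OF \<nu>] .
    note [simp] = P2D(2,3)[OF \<rho>(1)]
    have eq: "measure \<rho> A = measure ?\<nu> A" if "A \<in> sets borel" "measure ?\<nu> A \<le> measure \<rho> A" for A
    proof -
      have "ereal (K + \<alpha> * ((measure \<rho> A - measure ?\<nu> A)\<^sup>2 / 4)) \<le> ereal K"
        using ge[OF \<rho>(1) that] \<rho>(2) by (rule order_trans)
      then have "\<alpha> * (measure \<rho> A - measure ?\<nu> A)\<^sup>2 \<le> 0" by simp
      then have "(measure \<rho> A - measure ?\<nu> A)\<^sup>2 \<le> 0" using pos by (simp add: mult_le_0_iff)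
      then show ?thesis by simp
    qed
    show "\<rho> = ?\<nu>"
    proof (rule measure_eqI)
      fix A assume "A \<in> sets \<rho>"
      then have A: "A \<in> sets borel" by simp
      have "measure \<rho> A = measure ?\<nu> A"
      proof (cases "measure ?\<nu> A \<le> measure \<rho> A")
        \<comment> \<open>The gap is available for sets on which \<rho> has the larger mass; if
          \<open>A\<close> is not one of them, its complement is.\<close>
        case False
        then have "measure ?\<nu> (- A) \<le> measure \<rho> (- A)"
          using R.prob_compl[of A] N.prob_compl[of A] A by (simp add: Compl_eq_Diff_UNIV)
        from eq[OF _ this] show ?thesis
          using R.prob_compl[of A] N.prob_compl[of A] A by (simp add: Compl_eq_Diff_UNIV)
      qed (rule eq[OF A])
      then show "emeasure \<rho> A = emeasure ?\<nu> A" by (simp add: R.emeasure_eq_measure N.emeasure_eq_measure)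
    qed simp
  qed
  then show ?thesis by (simp add: F_def)
qed

end

section \<open>Test functions and translations\<close>

lemma test_functions_smooth: "\<phi> \<in> test_functions U \<Longrightarrow> smooth \<phi>"
  by (simp add: test_functions_def smooth_def)

lemma smooth_has_derivative:
  "smooth \<phi> \<Longrightarrow> (\<phi> has_derivative frechet_derivative \<phi> (at x)) (at x)"
  unfolding smooth_def using Ck_SucE(1) by blast

lemma smooth_continuous: "smooth \<phi> \<Longrightarrow> continuous_on UNIV \<phi>"
  unfolding smooth_def using Ck.simps(1) by blast

lemma smooth_measurable [measurable_dest]: "smooth \<phi> \<Longrightarrow> \<phi> \<in> borel_measurable borel"
  by (intro borel_measurable_continuous_onI smooth_continuous)

lemma frechet_derivative_sum_Basis:
  fixes \<phi> :: "'a::euclidean_space \<Rightarrow> real"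
  assumes "smooth \<phi>"
  shows "frechet_derivative \<phi> (at x) w = (\<Sum>i\<in>Basis. (w \<bullet> i) * frechet_derivative \<phi> (at x) i)"
proof -
  interpret bounded_linear "frechet_derivative \<phi> (at x)"
    using smooth_has_derivative[OF assms] by (rule has_derivative_bounded_linear)
  have "frechet_derivative \<phi> (at x) (\<Sum>i\<in>Basis. (w \<bullet> i) *\<^sub>R i) = (\<Sum>i\<in>Basis. (w \<bullet> i) * frechet_derivative \<phi> (at x) i)"
    by (simp add: sum scaleR)
  then show ?thesis by (simp add: euclidean_representation)
qed

lemma smooth_continuous_derivative:
  assumes "smooth \<phi>"
  shows "continuous_on UNIV (\<lambda>x. frechet_derivative \<phi> (at x) w)"
proof -
  have "continuous_on UNIV (\<lambda>x. frechet_derivative \<phi> (at x) i)" if "i \<in> Basis" for i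
    using assms that Ck_SucE(2)[of 0 \<phi> i] unfolding smooth_def by auto
  then show ?thesis
    by (subst frechet_derivative_sum_Basis[OF assms]) (intro continuous_intros)
qed

lemma smooth_derivative_measurable:
  "smooth \<phi> \<Longrightarrow> (\<lambda>x. frechet_derivative \<phi> (at x) w) \<in> borel_measurable borel"
  by (intro borel_measurable_continuous_onI smooth_continuous_derivative)

lemma test_functions_support:
  fixes \<phi> :: "'a::euclidean_space \<Rightarrow> real"
  assumes "\<phi> \<in> test_functions U"
  obtains R where "R > 0" "\<And>x. norm x > R \<Longrightarrow> \<phi> x = 0" "\<And>x w. norm x > R \<Longrightarrow> frechet_derivative \<phi> (at x) w = 0"
proof -
  let ?K = "closure {x. \<phi> x \<noteq> 0}"
  have "compact ?K" using assms by (simp add: test_functions_def)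
  then obtain R where R: "R > 0" "\<And>x. x \<in> ?K \<Longrightarrow> norm x \<le> R"
    using bounded_pos compact_imp_bounded by metis
  have z: "\<phi> x = 0" if "x \<notin> ?K" for x
    using that closure_subset[of "{x. \<phi> x \<noteq> 0}"] by auto
  have "frechet_derivative \<phi> (at x) w = 0" if "norm x > R" for x w
  proof -
    have x: "x \<in> - ?K" using R(2)[of x] that by auto
    have "(\<phi> has_derivative (\<lambda>_. 0)) (at x)"
    proof (rule has_derivative_transform_within_open[OF has_derivative_const[of 0]])
      show "open (- ?K)" by auto
      show "x \<in> - ?K" by (rule x)
      show "0 = \<phi> y" if "y \<in> - ?K" for y using z[of y] that by simp
    qed
    from fun_cong[OF frechet_derivative_at[OF this], of w] show ?thesis by simp
  qed
  moreover have "\<phi> x = 0" if "norm x > R" for x using z[of x] R(2)[of x] that by linarith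
  ultimately show ?thesis using that R(1) by blast
qed

lemma bounded_continuous_support:
  fixes u :: "'a::euclidean_space \<Rightarrow> real"
  assumes "continuous_on UNIV u" "\<And>x. norm x > R \<Longrightarrow> u x = 0"
  obtains C where "C \<ge> 0" "\<And>x. \<bar>u x\<bar> \<le> C"
proof -
  have "compact (u ` cball 0 R)"
    using assms(1) by (intro compact_continuous_image) (auto intro: continuous_on_subset)
  then obtain C where C: "C > 0" "\<And>y. y \<in> u ` cball 0 R \<Longrightarrow> norm y \<le> C"
    using bounded_pos compact_imp_bounded by metis
  have "\<bar>u x\<bar> \<le> C" for x
    using C assms(2)[of x] by (cases "norm x > R") (auto simp: not_less)
  then show ?thesis using that C(1) by (meson less_imp_le)
qed

lemma test_functions_bound:
  fixes \<phi> :: "'a::euclidean_space \<Rightarrow> real"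
  assumes "\<phi> \<in> test_functions U"
  obtains C where "C \<ge> 0" "\<And>x. \<bar>\<phi> x\<bar> \<le> C" "\<And>x w. \<bar>frechet_derivative \<phi> (at x) w\<bar> \<le> C * norm w"
proof -
  note sm = test_functions_smooth[OF assms]
  obtain R where R: "\<And>x. norm x > R \<Longrightarrow> \<phi> x = 0" "\<And>x w. norm x > R \<Longrightarrow> frechet_derivative \<phi> (at x) w = 0"
    using test_functions_support[OF assms] by metis
  obtain C0 where C0: "C0 \<ge> 0" "\<And>x. \<bar>\<phi> x\<bar> \<le> C0"
    using bounded_continuous_support[OF smooth_continuous[OF sm] R(1)] by metis
  have "\<exists>C\<ge>0. \<forall>x. \<bar>frechet_derivative \<phi> (at x) w\<bar> \<le> C" for w
    using bounded_continuous_support[OF smooth_continuous_derivative[OF sm] R(2)] by metis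
  then obtain C1 where C1: "\<And>w. C1 w \<ge> 0" "\<And>w x. \<bar>frechet_derivative \<phi> (at x) w\<bar> \<le> C1 w"
    by metis
  define C where "C = C0 + (\<Sum>i\<in>Basis. C1 i)"
  have S: "(\<Sum>i\<in>Basis. C1 i) \<ge> 0" using C1(1) by (intro sum_nonneg) auto
  have "\<bar>frechet_derivative \<phi> (at x) w\<bar> \<le> C * norm w" for x w
  proof -
    have "\<bar>frechet_derivative \<phi> (at x) w\<bar> \<le> (\<Sum>i\<in>Basis. \<bar>(w \<bullet> i) * frechet_derivative \<phi> (at x) i\<bar>)"
      by (subst frechet_derivative_sum_Basis[OF sm]) (rule sum_abs)
    also have "\<dots> \<le> (\<Sum>i\<in>Basis. norm w * C1 i)"
      using C1 by (intro sum_mono) (auto simp: abs_mult intro!: mult_mono Basis_le_norm)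
    also have "\<dots> = (\<Sum>i\<in>Basis. C1 i) * norm w" by (simp add: sum_distrib_left mult.commute)
    also have "\<dots> \<le> C * norm w" using C0(1) by (intro mult_right_mono) (auto simp: C_def)
    finally show ?thesis .
  qed
  moreover have "\<bar>\<phi> x\<bar> \<le> C" for x using C0(2)[of x] S by (simp add: C_def)
  moreover have "C \<ge> 0" using C0(1) S by (simp add: C_def)
  ultimately show ?thesis using that by blast
qed

lemma test_functionsI:
  assumes "smooth \<phi>" "\<And>x. norm x > R \<Longrightarrow> \<phi> x = 0"
  shows "\<phi> \<in> test_functions UNIV"
proof -
  have "{x. \<phi> x \<noteq> 0} \<subseteq> cball 0 R"
  proof
    fix x assume "x \<in> {x. \<phi> x \<noteq> 0}"
    then have "\<not> norm x > R" using assms(2) by auto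
    then show "x \<in> cball 0 R" by simp
  qed
  then have "bounded {x. \<phi> x \<noteq> 0}" using bounded_cball bounded_subset by blast
  then show ?thesis using assms(1) by (simp add: test_functions_def smooth_def)
qed

lemma test_functions_mult:
  assumes "\<phi> \<in> test_functions U" "smooth f"
  shows "(\<lambda>x. \<phi> x * f x) \<in> test_functions UNIV"
proof -
  obtain R where "\<And>x. norm x > R \<Longrightarrow> \<phi> x = 0" using test_functions_support[OF assms(1)] by metis
  then show ?thesis
    using assms by (intro test_functionsI[of _ R] smooth_mult) (auto intro: test_functions_smooth)
qed

lemma has_derivative_translate: "((\<lambda>x. x - c) has_derivative (\<lambda>x. x)) (at x)"
  by (auto intro!: derivative_eq_intros)

lemma smooth_translate: "smooth f \<Longrightarrow> smooth (\<lambda>x. f (x - c))"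
proof -
  have "Ck k f \<Longrightarrow> Ck k (\<lambda>x. f (x - c))" for k
  proof (induction k arbitrary: f)
    case 0
    have "continuous_on UNIV (\<lambda>x. x - c)" by (intro continuous_intros)
    then show ?case using 0 continuous_on_compose2[of UNIV f UNIV "\<lambda>x. x - c"] by simp
  next
    case (Suc k)
    note d = Ck_SucE[OF Suc.prems]
    have "((\<lambda>x. f (x - c)) has_derivative frechet_derivative f (at (x - c))) (at x)" for x
      using has_derivative_compose[OF has_derivative_translate, of f _ x] d(1) by blast
    then show ?case by (rule Ck_SucI) (rule Suc.IH[OF d(2)])
  qed
  then show "smooth f \<Longrightarrow> smooth (\<lambda>x. f (x - c))" by (auto simp: smooth_def)
qed

lemma frechet_derivative_translate:
  assumes "smooth f"
  shows "frechet_derivative (\<lambda>x. f (x - c)) (at x) = frechet_derivative f (at (x - c))"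
proof -
  have "((\<lambda>x. f (x - c)) has_derivative frechet_derivative f (at (x - c))) (at x)"
    using has_derivative_compose[OF has_derivative_translate, of f _ x]
      smooth_has_derivative[OF assms] by blast
  then show ?thesis by (rule frechet_derivative_at[symmetric])
qed

lemma test_functions_translate:
  assumes "\<phi> \<in> test_functions UNIV"
  shows "(\<lambda>x. \<phi> (x - c)) \<in> test_functions UNIV"
proof -
  obtain R where R: "\<And>x. norm x > R \<Longrightarrow> \<phi> x = 0" using test_functions_support[OF assms] by metis
  have "norm (x - c) > R" if "norm x > R + norm c" for x
    using norm_triangle_ineq2[of x c] that by linarith
  then show ?thesis
    using assms R by (intro test_functionsI[of _ "R + norm c"] smooth_translate) (auto intro: test_functions_smooth)
qed

lemma integrable_bounded_support:
  fixes u :: "'a::euclidean_space \<Rightarrow> real"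
  assumes "sets \<nu> = sets borel" "emeasure \<nu> (cball 0 R) < \<infinity>" "u \<in> borel_measurable borel"
    and "\<And>x. \<bar>u x\<bar> \<le> C" "\<And>x. norm x > R \<Longrightarrow> u x = 0"
  shows "integrable \<nu> u"
proof (rule Bochner_Integration.integrable_bound)
  show "integrable \<nu> (\<lambda>x. C * indicator (cball 0 R) x :: real)"
    using assms(1,2) by (intro integrable_mult_right integrable_real_indicator) auto
  show "u \<in> borel_measurable \<nu>" using assms(1,3) measurable_cong_sets by blast
  have "norm (u x) \<le> norm (C * indicator (cball 0 R) x)" for x
    using assms(4)[of x] assms(5)[of x] by (auto simp: indicator_def not_le intro: order_trans[OF _ abs_ge_self])
  then show "AE x in \<nu>. norm (u x) \<le> norm (C * indicator (cball 0 R) x)" by simp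
qed

text \<open>The fundamental theorem of calculus along the segment from x to x - h w, followed by
  Fubini. All integrands live in the ball of radius \<open>R'\<close>, which has finite
  \<nu>-mass.\<close>

lemma shift_test_function_integral:
  fixes \<phi> :: "'a::euclidean_space \<Rightarrow> real"
  assumes "sigma_finite_measure \<nu>" and sets: "sets \<nu> = sets borel" and fin: "\<And>R. emeasure \<nu> (cball 0 R) < \<infinity>"
    and \<phi>: "\<phi> \<in> test_functions UNIV" and h: "0 \<le> h"
  shows "(\<integral>x. \<phi> (x - h *\<^sub>R w) \<partial>\<nu>) - (\<integral>x. \<phi> x \<partial>\<nu>)
    = - (\<integral>r. indicator {0..h} r * (\<integral>x. frechet_derivative \<phi> (at (x - r *\<^sub>R w)) w \<partial>\<nu>) \<partial>lborel)"
proof -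
  interpret sigma_finite_measure \<nu> by fact
  interpret P: pair_sigma_finite \<nu> "lborel :: real measure" by unfold_locales
  note [measurable_cong] = sets
  note sm = test_functions_smooth[OF \<phi>]
  let ?D = "\<lambda>x. frechet_derivative \<phi> (at x) w"
  have [measurable]: "?D \<in> borel_measurable borel" "\<phi> \<in> borel_measurable borel"
    using smooth_derivative_measurable[OF sm] smooth_measurable[OF sm] by auto
  obtain R where R: "R > 0" "\<And>x. norm x > R \<Longrightarrow> \<phi> x = 0" "\<And>x w. norm x > R \<Longrightarrow> frechet_derivative \<phi> (at x) w = 0"
    using test_functions_support[OF \<phi>] by metis
  obtain C where C: "C \<ge> 0" "\<And>x. \<bar>\<phi> x\<bar> \<le> C" "\<And>x w. \<bar>frechet_derivative \<phi> (at x) w\<bar> \<le> C * norm w"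
    using test_functions_bound[OF \<phi>] by metis
  define R' where "R' = R + h * norm w"
  have out: "norm (x - r *\<^sub>R w) > R" if "norm x > R'" "0 \<le> r" "r \<le> h" for x r
  proof -
    have "r * norm w \<le> h * norm w" using that by (intro mult_right_mono) auto
    then show ?thesis using norm_triangle_ineq2[of x "r *\<^sub>R w"] that by (simp add: R'_def)
  qed
  have int: "integrable (\<nu> \<Otimes>\<^sub>M lborel) (\<lambda>(x, r). indicator {0..h} r * ?D (x - r *\<^sub>R w))"
  proof (rule Bochner_Integration.integrable_bound)
    have "emeasure (\<nu> \<Otimes>\<^sub>M lborel) (cball 0 R' \<times> {0..h}) = emeasure \<nu> (cball 0 R') * emeasure lborel {0..h}"
      by (rule lborel.emeasure_pair_measure_Times) (auto simp: sets)
    also have "\<dots> < \<infinity>" using fin[of R'] h by (simp add: ennreal_mult_less_top)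
    finally show "integrable (\<nu> \<Otimes>\<^sub>M lborel) (\<lambda>z. (C * norm w) * indicator (cball 0 R' \<times> {0..h}) z :: real)"
      by (intro integrable_mult_right integrable_real_indicator) (auto simp: sets)
    have bnd: "norm (indicator {0..h} r * ?D (x - r *\<^sub>R w)) \<le> norm ((C * norm w) * indicator (cball 0 R' \<times> {0..h}) (x, r))" for x r
    proof (cases "r \<in> {0..h} \<and> norm x \<le> R'")
      case True
      then show ?thesis using C(1) C(3)[of "x - r *\<^sub>R w" w] by (simp add: abs_mult)
    next
      case False
      then consider "r \<notin> {0..h}" | "r \<in> {0..h}" "norm x > R'" using not_le by blast
      then show ?thesis
      proof cases
        case 2
        then have "?D (x - r *\<^sub>R w) = 0" by (intro R(3) out) auto
        then show ?thesis by simp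
      qed simp
    qed
    show "AE z in \<nu> \<Otimes>\<^sub>M lborel. norm (case z of (x, r) \<Rightarrow> indicator {0..h} r * ?D (x - r *\<^sub>R w))
        \<le> norm ((C * norm w) * indicator (cball 0 R' \<times> {0..h}) z)"
    proof (intro AE_I2)
      fix z :: "'a \<times> real"
      obtain x r where z: "z = (x, r)" by (cases z)
      show "norm (case z of (x, r) \<Rightarrow> indicator {0..h} r * ?D (x - r *\<^sub>R w))
        \<le> norm ((C * norm w) * indicator (cball 0 R' \<times> {0..h}) z)"
        unfolding z case_prod_conv by (rule bnd)
    qed
  qed measurable
  have inner: "(\<integral>r. indicator {0..h} r * ?D (x - r *\<^sub>R w) \<partial>lborel) = \<phi> x - \<phi> (x - h *\<^sub>R w)" for x
  proof -
    have "(\<integral>r. ?D (x - r *\<^sub>R w) * indicator {0..h} r \<partial>lborel) = (- \<phi> (x - h *\<^sub>R w)) - (- \<phi> (x - 0 *\<^sub>R w))"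
    proof (rule integral_FTC_Icc_real[OF h])
      fix r :: real
      interpret L: bounded_linear "frechet_derivative \<phi> (at (x - r *\<^sub>R w))"
        using smooth_has_derivative[OF sm] by (rule has_derivative_bounded_linear)
      have "((\<lambda>r. x - r *\<^sub>R w) has_derivative (\<lambda>d. - (d *\<^sub>R w))) (at r)"
        by (auto intro!: derivative_eq_intros)
      from has_derivative_compose[OF this smooth_has_derivative[OF sm]]
      have "((\<lambda>r. \<phi> (x - r *\<^sub>R w)) has_derivative (\<lambda>d. frechet_derivative \<phi> (at (x - r *\<^sub>R w)) (- (d *\<^sub>R w)))) (at r)" .
      moreover have "(\<lambda>d. frechet_derivative \<phi> (at (x - r *\<^sub>R w)) (- (d *\<^sub>R w))) = (*) (- ?D (x - r *\<^sub>R w))"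
        by (simp add: fun_eq_iff L.neg L.scaleR)
      ultimately have "((\<lambda>r. \<phi> (x - r *\<^sub>R w)) has_real_derivative (- ?D (x - r *\<^sub>R w))) (at r)"
        by (simp add: has_field_derivative_def)
      from DERIV_minus[OF this]
      show "((\<lambda>r. - \<phi> (x - r *\<^sub>R w)) has_real_derivative ?D (x - r *\<^sub>R w)) (at r)" by simp
      have "continuous_on UNIV (\<lambda>r. ?D (x - r *\<^sub>R w))"
        by (intro continuous_on_compose2[OF smooth_continuous_derivative[OF sm]] continuous_intros) auto
      then show "isCont (\<lambda>r. ?D (x - r *\<^sub>R w)) r" by (simp add: continuous_on_eq_continuous_at)
    qed
    then show ?thesis by (simp add: mult.commute)
  qed
  have i0: "integrable \<nu> \<phi>"
    by (rule integrable_bounded_support[OF sets fin _ C(2) R(2)]) auto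
  have ih: "integrable \<nu> (\<lambda>x. \<phi> (x - h *\<^sub>R w))"
    by (rule integrable_bounded_support[OF sets fin, of _ C R']) (use C R out[of _ h] h in auto)
  have "(\<integral>r. indicator {0..h} r * (\<integral>x. ?D (x - r *\<^sub>R w) \<partial>\<nu>) \<partial>lborel)
      = (\<integral>r. (\<integral>x. indicator {0..h} r * ?D (x - r *\<^sub>R w) \<partial>\<nu>) \<partial>lborel)" by simp
  also have "\<dots> = (\<integral>x. (\<integral>r. indicator {0..h} r * ?D (x - r *\<^sub>R w) \<partial>lborel) \<partial>\<nu>)"
    by (rule P.Fubini_integral[OF int])
  also have "\<dots> = (\<integral>x. \<phi> x \<partial>\<nu>) - (\<integral>x. \<phi> (x - h *\<^sub>R w) \<partial>\<nu>)"
    unfolding inner using i0 ih by simp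
  finally show ?thesis by simp
qed

text \<open>Lebesgue measure is translation invariant, so in the shift formula the left side is 0
  and the inner integral on the right does not depend on r; h = 1 gives the claim. This is
  integration by parts without iterated integrals.\<close>

lemma integral_derivative_test_function:
  fixes \<phi> :: "'a::euclidean_space \<Rightarrow> real"
  assumes \<phi>: "\<phi> \<in> test_functions UNIV"
  shows "(\<integral>x. frechet_derivative \<phi> (at x) w \<partial>lborel) = 0"
proof -
  have tr: "(\<integral>x. u (x - c) \<partial>lborel) = (\<integral>x. u x \<partial>lborel)" if "u \<in> borel_measurable borel" for u :: "'a \<Rightarrow> real" and c
  proof -
    have "(\<integral>x. u x \<partial>lborel) = (\<integral>x. u x \<partial>distr lborel borel ((+) (- c)))" by (simp add: lborel_distr_plus)
    also have "\<dots> = (\<integral>x. u (x - c) \<partial>lborel)" by (subst integral_distr) (use that in auto)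
    finally show ?thesis ..
  qed
  note sm = test_functions_smooth[OF \<phi>]
  have "(\<integral>x. \<phi> (x - 1 *\<^sub>R w) \<partial>lborel) - (\<integral>x. \<phi> x \<partial>lborel)
    = - (\<integral>r. indicator {0..1} r * (\<integral>x. frechet_derivative \<phi> (at (x - r *\<^sub>R w)) w \<partial>lborel) \<partial>lborel)"
    by (rule shift_test_function_integral[OF sigma_finite_lborel _ _ \<phi>]) (auto intro: emeasure_bounded_finite[OF bounded_cball, unfolded infinity_ennreal_def])
  then show ?thesis
    unfolding tr[OF smooth_measurable[OF sm]] tr[OF smooth_derivative_measurable[OF sm]] by simp
qed

text \<open>The distributional derivative of \<nu> along \<open>w\<close> is \<open>g\<close> times
  Lebesgue measure. There are two uses: \<nu> with density \<open>f\<close> and \<open>g\<close> a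
  component of its weak gradient, and a reweighted probability measure with
  \<open>g = 0\<close>.\<close>

locale weak_translation =
  fixes \<nu> :: "'a::euclidean_space measure" and g :: "'a \<Rightarrow> real" and w :: 'a
  assumes sigma: "sigma_finite_measure \<nu>" and sets: "sets \<nu> = sets borel"
    and fin: "\<And>R. emeasure \<nu> (cball 0 R) < \<infinity>"
    and g_meas: "g \<in> borel_measurable borel"
    and g_int: "\<And>R. integrable lborel (\<lambda>x. indicator (cball 0 R) x * g x)"
    and weak: "\<And>\<phi>. \<phi> \<in> test_functions UNIV \<Longrightarrow>
      (\<integral>x. frechet_derivative \<phi> (at x) w \<partial>\<nu>) = - (\<integral>x. \<phi> x * g x \<partial>lborel)"
begin

text \<open>The derivative equation integrated along \<open>w\<close>. Unlike the differential form
  it makes sense for discontinuous \<open>u\<close>, so it can be carried over to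
  indicators.\<close>

definition shift_identity :: "('a \<Rightarrow> real) \<Rightarrow> bool" where
  "shift_identity u \<longleftrightarrow> (\<forall>h\<ge>0. (\<integral>x. u (x - h *\<^sub>R w) \<partial>\<nu>) - (\<integral>x. u x \<partial>\<nu>)
     = (\<integral>r. indicator {0..h} r * (\<integral>x. u (x - r *\<^sub>R w) * g x \<partial>lborel) \<partial>lborel))"

lemma shift_identity_test_function:
  assumes "\<phi> \<in> test_functions UNIV" shows "shift_identity \<phi>"
  unfolding shift_identity_def
proof (intro allI impI)
  fix h :: real assume h: "0 \<le> h"
  have "(\<integral>x. frechet_derivative \<phi> (at (x - r *\<^sub>R w)) w \<partial>\<nu>) = - (\<integral>x. \<phi> (x - r *\<^sub>R w) * g x \<partial>lborel)" for r
    using weak[OF test_functions_translate[OF assms, of "r *\<^sub>R w"]]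
    by (simp add: frechet_derivative_translate[OF test_functions_smooth[OF assms]])
  then show "(\<integral>x. \<phi> (x - h *\<^sub>R w) \<partial>\<nu>) - (\<integral>x. \<phi> x \<partial>\<nu>)
     = (\<integral>r. indicator {0..h} r * (\<integral>x. \<phi> (x - r *\<^sub>R w) * g x \<partial>lborel) \<partial>lborel)"
    using shift_test_function_integral[OF sigma sets fin assms h, of w] by simp
qed

text \<open>Dominated convergence on both sides: the bound 1 and the common support dominate, and no
  smoothness of the limit enters.\<close>

lemma shift_identity_limit:
  assumes u: "\<And>n. shift_identity (u n)" "\<And>n. u n \<in> borel_measurable borel" "\<And>n x. \<bar>u n x\<bar> \<le> 1"
      "\<And>n x. norm x > R \<Longrightarrow> u n x = 0"
    and lim: "\<And>x. (\<lambda>n. u n x) \<longlonglongrightarrow> v x" and v[measurable]: "v \<in> borel_measurable borel"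
  shows "shift_identity v"
  unfolding shift_identity_def
proof (intro allI impI)
  fix h :: real assume h: "0 \<le> h"
  interpret sigma_finite_measure \<nu> by (rule sigma)
  note [measurable_cong] = sets
  note [measurable] = u(2) g_meas
  define R' where "R' = R + h * norm w"
  have out: "norm (x - r *\<^sub>R w) > R" if "norm x > R'" "0 \<le> r" "r \<le> h" for x r
  proof -
    have "r * norm w \<le> h * norm w" using that by (intro mult_right_mono) auto
    then show ?thesis using norm_triangle_ineq2[of x "r *\<^sub>R w"] that by (simp add: R'_def)
  qed
  have bd: "\<bar>u n (x - r *\<^sub>R w)\<bar> \<le> indicator (cball 0 R') x" if "0 \<le> r" "r \<le> h" for n x r
    using out[OF _ that, of x] u(3)[of n "x - r *\<^sub>R w"] u(4)[of "x - r *\<^sub>R w" n] by (auto simp: indicator_def not_le)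
  have ind: "integrable \<nu> (indicator (cball 0 R') :: 'a \<Rightarrow> real)"
    using fin sets by (intro integrable_real_indicator) auto
  have L1: "(\<lambda>n. \<integral>x. u n (x - r *\<^sub>R w) \<partial>\<nu>) \<longlonglongrightarrow> (\<integral>x. v (x - r *\<^sub>R w) \<partial>\<nu>)" if "0 \<le> r" "r \<le> h" for r
    by (rule integral_dominated_convergence[OF _ _ ind]) (use bd[OF that] lim in auto)
  let ?J = "\<integral>x. \<bar>indicator (cball 0 R') x * g x\<bar> \<partial>lborel"
  have bdg: "\<bar>u n (x - r *\<^sub>R w) * g x\<bar> \<le> \<bar>indicator (cball 0 R') x * g x\<bar>" if "0 \<le> r" "r \<le> h" for n x r
    using mult_right_mono[OF bd[OF that, of n x], of "\<bar>g x\<bar>"] by (simp add: abs_mult)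
  have gi: "integrable lborel (\<lambda>x. \<bar>indicator (cball 0 R') x * g x\<bar>)"
    using g_int[of R'] by (rule integrable_abs)
  have L2: "(\<lambda>n. \<integral>x. u n (x - r *\<^sub>R w) * g x \<partial>lborel) \<longlonglongrightarrow> (\<integral>x. v (x - r *\<^sub>R w) * g x \<partial>lborel)" if "0 \<le> r" "r \<le> h" for r
    by (rule integral_dominated_convergence[OF _ _ gi]) (use bdg[OF that] in \<open>auto intro!: tendsto_intros lim\<close>)
  have B: "\<bar>\<integral>x. u n (x - r *\<^sub>R w) * g x \<partial>lborel\<bar> \<le> ?J" if "0 \<le> r" "r \<le> h" for r n
  proof -
    have "\<bar>\<integral>x. u n (x - r *\<^sub>R w) * g x \<partial>lborel\<bar> \<le> (\<integral>x. \<bar>u n (x - r *\<^sub>R w) * g x\<bar> \<partial>lborel)"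
      by (rule integral_abs_bound)
    also have "\<dots> \<le> ?J"
      using gi by (rule integral_mono') (use bdg[OF that] in auto)
    finally show ?thesis .
  qed
  have "(\<lambda>n. \<integral>r. indicator {0..h} r * (\<integral>x. u n (x - r *\<^sub>R w) * g x \<partial>lborel) \<partial>lborel)
     \<longlonglongrightarrow> (\<integral>r. indicator {0..h} r * (\<integral>x. v (x - r *\<^sub>R w) * g x \<partial>lborel) \<partial>lborel)"
  proof (rule integral_dominated_convergence)
    show "integrable lborel (\<lambda>r. ?J * indicator {0..h} r :: real)"
      by (intro integrable_mult_right integrable_real_indicator) (auto simp: h)
    show "AE r in lborel. (\<lambda>n. indicator {0..h} r * (\<integral>x. u n (x - r *\<^sub>R w) * g x \<partial>lborel))
        \<longlonglongrightarrow> indicator {0..h} r * (\<integral>x. v (x - r *\<^sub>R w) * g x \<partial>lborel)"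
      using L2 by (auto simp: indicator_def)
    show "AE r in lborel. norm (indicator {0..h} r * (\<integral>x. u n (x - r *\<^sub>R w) * g x \<partial>lborel)) \<le> ?J * indicator {0..h} r" for n
      using B by (auto simp: indicator_def)
  qed measurable
  moreover have "(\<integral>r. indicator {0..h} r * (\<integral>x. u n (x - r *\<^sub>R w) * g x \<partial>lborel) \<partial>lborel)
     = (\<integral>x. u n (x - h *\<^sub>R w) \<partial>\<nu>) - (\<integral>x. u n x \<partial>\<nu>)" for n
    using u(1)[of n] h unfolding shift_identity_def by simp
  moreover have "(\<lambda>n. (\<integral>x. u n (x - h *\<^sub>R w) \<partial>\<nu>) - (\<integral>x. u n x \<partial>\<nu>)) \<longlonglongrightarrow> (\<integral>x. v (x - h *\<^sub>R w) \<partial>\<nu>) - (\<integral>x. v x \<partial>\<nu>)"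
    using tendsto_diff[OF L1[of h] L1[of 0]] h by simp
  ultimately show "(\<integral>x. v (x - h *\<^sub>R w) \<partial>\<nu>) - (\<integral>x. v x \<partial>\<nu>)
     = (\<integral>r. indicator {0..h} r * (\<integral>x. v (x - r *\<^sub>R w) * g x \<partial>lborel) \<partial>lborel)"
    by (simp add: LIMSEQ_unique)
qed

end

section \<open>Translation invariant measures\<close>

lemma bump_nonneg: "0 \<le> bump y" and bump_pos: "y > 0 \<Longrightarrow> 0 < bump y" and bump_eq_0: "y \<le> 0 \<Longrightarrow> bump y = 0"
  by (auto simp: bump_def)

lemma bump_le_1: "y \<le> 1 \<Longrightarrow> bump y \<le> bump 1"
  by (auto simp: bump_def)

context weak_translation
begin

text \<open>A finite union of balls is the positivity set of a smooth function \<psi>, and the test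
  functions 1 - exp (- n \<psi>) increase to its indicator.\<close>

lemma shift_identity_balls:
  assumes "finite S" "r > 0"
  shows "shift_identity (indicator (\<Union>c\<in>S. ball c r))"
proof -
  define \<psi> where "\<psi> = (\<lambda>x. \<Sum>c\<in>S. bump (r\<^sup>2 - (norm (x - c))\<^sup>2))"
  let ?U = "\<Union>c\<in>S. ball c r"
  have sm: "smooth \<psi>"
    unfolding \<psi>_def
    by (intro smooth_sum smooth_compose[OF smooth_real_bump] smooth_diff smooth_const smooth_translate[OF smooth_norm_sq])
  have nn: "\<psi> x \<ge> 0" for x unfolding \<psi>_def by (intro sum_nonneg bump_nonneg)
  have z: "\<psi> x = 0" if "x \<notin> ?U" for x
    unfolding \<psi>_def
  proof (intro sum.neutral ballI bump_eq_0)
    fix c assume "c \<in> S"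
    then have "r \<le> norm (x - c)" using that by (auto simp: dist_norm norm_minus_commute)
    then show "r\<^sup>2 - (norm (x - c))\<^sup>2 \<le> 0" using assms(2) by (simp add: power_mono)
  qed
  have p: "\<psi> x > 0" if xU: "x \<in> ?U" for x
  proof -
    obtain c where c: "c \<in> S" "x \<in> ball c r" using xU by blast
    then have "norm (x - c) < r" by (simp add: dist_norm norm_minus_commute)
    then have "r\<^sup>2 - (norm (x - c))\<^sup>2 > 0" by (simp add: power_strict_mono)
    then have "0 < bump (r\<^sup>2 - (norm (x - c))\<^sup>2)" by (rule bump_pos)
    also have "\<dots> \<le> \<psi> x"
      unfolding \<psi>_def using assms(1) c(1) by (intro member_le_sum) (auto simp: bump_nonneg)
    finally show ?thesis .
  qed
  have "bounded ?U" using assms(1) by auto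
  then obtain R where R: "\<And>x. x \<in> ?U \<Longrightarrow> norm x \<le> R" unfolding bounded_iff by blast
  have out: "\<psi> x = 0" if "norm x > R" for x using z[of x] R[of x] that by linarith
  define u where "u n x = 1 - exp ((- real n) * \<psi> x)" for n x
  have smu: "smooth (u n)" for n
    unfolding u_def by (intro smooth_diff smooth_const smooth_compose[OF smooth_real_exp] smooth_mult sm)
  show ?thesis
  proof (rule shift_identity_limit[of u R])
    show "shift_identity (u n)" for n
      by (rule shift_identity_test_function[OF test_functionsI[of _ R]]) (use smu out in \<open>auto simp: u_def\<close>)
    show "u n \<in> borel_measurable borel" for n using smu smooth_measurable by blast
    show "\<bar>u n x\<bar> \<le> 1" for n x
    proof -
      have "exp ((- real n) * \<psi> x) \<le> 1" using nn[of x] by simp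
      then show ?thesis unfolding u_def by (simp add: abs_le_iff)
    qed
    show "u n x = 0" if "norm x > R" for n x using out[OF that] by (simp add: u_def)
    show "(\<lambda>n. u n x) \<longlonglongrightarrow> indicator ?U x" for x
    proof (cases "x \<in> ?U")
      case True
      have "(\<lambda>n. exp (- \<psi> x) ^ n) \<longlonglongrightarrow> 0" by (rule LIMSEQ_power_zero) (use p[OF True] in simp)
      then have "(\<lambda>n. 1 - exp (- \<psi> x) ^ n) \<longlonglongrightarrow> 1 - 0" by (rule tendsto_diff[OF tendsto_const])
      then show ?thesis using True by (simp add: u_def exp_of_nat_mult[symmetric])
    next
      case False
      then show ?thesis using z[OF False] by (simp add: u_def)
    qed
  qed (auto intro!: borel_measurable_indicator borel_open)
qed

text \<open>Finitely many balls of radius 1 / (n + 1) with centres in K cover K; since K is closed,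
  the indicators of these unions converge to that of K at every point.\<close>

lemma shift_identity_compact:
  assumes "compact K"
  shows "shift_identity (indicator K)"
proof -
  have "\<exists>S. finite S \<and> S \<subseteq> K \<and> K \<subseteq> (\<Union>c\<in>S. ball c (1 / real (Suc n)))" for n
    using seq_compact_imp_totally_bounded[OF compact_imp_seq_compact[OF assms]] by (simp del: of_nat_Suc)
  then obtain S where S: "\<And>n. finite (S n)" "\<And>n. S n \<subseteq> K" "\<And>n. K \<subseteq> (\<Union>c\<in>S n. ball c (1 / real (Suc n)))"
    by metis
  define U where "U n = (\<Union>c\<in>S n. ball c (1 / real (Suc n)))" for n
  obtain R where R: "\<And>x. x \<in> K \<Longrightarrow> norm x \<le> R"
    using compact_imp_bounded[OF assms] unfolding bounded_iff by auto
  show ?thesis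
  proof (rule shift_identity_limit[of "\<lambda>n. indicator (U n)" "R + 1"])
    show "shift_identity (indicator (U n))" for n
      unfolding U_def by (rule shift_identity_balls[OF S(1)]) simp
    show "indicator (U n) \<in> borel_measurable borel" for n
      unfolding U_def by (auto intro!: borel_measurable_indicator borel_open)
    show "indicator (U n) x = 0" if "norm x > R + 1" for n x
    proof -
      have "x \<notin> U n"
      proof
        assume "x \<in> U n"
        then obtain c where c: "c \<in> S n" "dist c x < 1 / real (Suc n)" unfolding U_def by auto
        have "1 / real (Suc n) \<le> 1" by simp
        then have "norm x \<le> norm c + 1"
          using c(2) norm_triangle_ineq2[of x c] unfolding dist_norm norm_minus_commute[of c x] by linarith
        then show False using R[of c] S(2)[of n] c(1) that by auto
      qed
      then show ?thesis by simp
    qed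
    show "(\<lambda>n. indicator (U n) x) \<longlonglongrightarrow> (indicator K x :: real)" for x
    proof (cases "x \<in> K")
      case True
      then have "x \<in> U n" for n using S(3)[of n] unfolding U_def by blast
      then show ?thesis using True by simp
    next
      case False
      have "open (- K)" using assms by (simp add: compact_imp_closed open_Compl)
      then obtain e where e: "e > 0" "ball x e \<subseteq> - K" using False open_contains_ball by blast
      obtain N where N: "1 / e < real N" using reals_Archimedean2 by blast
      have "\<forall>\<^sub>F n in sequentially. indicator (U n) x = (0::real)"
        using eventually_ge_at_top[of N]
      proof eventually_elim
        case (elim n)
        have "1 / e < real (Suc n)" using N elim by linarith
        then have lt: "1 / real (Suc n) < e" using e(1) by (simp add: field_simps del: of_nat_Suc)
        have "x \<notin> U n"
        proof
          assume "x \<in> U n"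
          then obtain c where c: "c \<in> S n" "dist c x < 1 / real (Suc n)" unfolding U_def by auto
          then have "c \<in> ball x e" using lt by (simp add: dist_commute del: of_nat_Suc)
          then show False using e(2) S(2)[of n] c(1) by auto
        qed
        then show ?case by simp
      qed
      then show ?thesis using False by (simp add: tendsto_eventually)
    qed
  qed (use assms in \<open>auto intro!: borel_measurable_indicator simp: indicator_def borel_compact\<close>)
qed

end

lemma borel_eq_compact: "sets borel = sigma_sets (UNIV :: 'a::euclidean_space set) (Collect compact)"
proof
  have "Collect closed \<subseteq> sigma_sets (UNIV :: 'a set) (Collect compact)"
  proof
    fix C :: "'a set" assume "C \<in> Collect closed"
    then have "C = (\<Union>n::nat. C \<inter> cball 0 (real n))" "\<And>n. compact (C \<inter> cball 0 (real n))"
      by (auto simp: closed_Int_compact intro: real_arch_simple)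
    then show "C \<in> sigma_sets UNIV (Collect compact)"
      by (metis (no_types, lifting) mem_Collect_eq sigma_sets.Basic sigma_sets.Union)
  qed
  then show "sets borel \<subseteq> sigma_sets (UNIV :: 'a set) (Collect compact)"
    unfolding borel_eq_closed by (simp add: sigma_sets_mono)
  show "sigma_sets (UNIV :: 'a set) (Collect compact) \<subseteq> sets borel"
    using sets.sigma_sets_subset[of "Collect compact" "borel :: 'a measure"] by (auto intro: borel_compact)
qed

text \<open>Uniqueness of Haar measure. With B the unit ball, Fubini for 1_A(x) 1_B(y - x) and a
  translation in either variable give \<nu>(A) vol(B) = vol(A) \<nu>(B).\<close>

lemma translation_invariant_measure:
  fixes \<nu> :: "'a::euclidean_space measure"
  assumes sigma: "sigma_finite_measure \<nu>" and sets: "sets \<nu> = sets borel" and fin: "\<And>R. emeasure \<nu> (cball 0 R) < \<infinity>"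
    and inv: "\<And>K w. compact K \<Longrightarrow> (\<integral>x. indicator K (x - w) \<partial>\<nu>) = (\<integral>x. indicator K x \<partial>\<nu> :: real)"
  obtains c where "c \<ge> 0" "\<nu> = density lborel (\<lambda>_. ennreal c)"
proof -
  interpret sigma_finite_measure \<nu> by fact
  interpret P: pair_sigma_finite \<nu> "lborel :: 'a measure" by unfold_locales
  note [measurable_cong] = sets
  have sp: "space \<nu> = UNIV" using sets_eq_imp_space_eq[OF sets] by simp
  have Kfin: "emeasure \<nu> K < \<infinity>" if K: "compact K" for K
  proof -
    obtain R where "\<And>x. x \<in> K \<Longrightarrow> norm x \<le> R" using compact_imp_bounded[OF K] unfolding bounded_iff by auto
    then have "emeasure \<nu> K \<le> emeasure \<nu> (cball 0 R)" by (intro emeasure_mono) (auto simp: sets)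
    then show ?thesis using fin le_less_trans by blast
  qed
  \<comment> \<open>Invariance on compact sets extends to all Borel sets, because the compact sets
    are stable under intersection and generate the Borel sets.\<close>
  have shift: "distr \<nu> borel (\<lambda>x. x + w) = \<nu>" for w
  proof (rule measure_eqI_generator_eq[of "Collect compact" UNIV _ _ "\<lambda>n. cball 0 (real n)"])
    show "Int_stable (Collect compact :: 'a set set)" by (auto simp: Int_stable_def compact_Int)
    show "sets (distr \<nu> borel (\<lambda>x. x + w)) = sigma_sets UNIV (Collect compact)"
      "sets \<nu> = sigma_sets UNIV (Collect compact)"
      by (auto simp: sets borel_eq_compact[symmetric])
    fix K :: "'a set" assume "K \<in> Collect compact"
    then have K: "compact K" and [measurable]: "K \<in> sets borel" by (auto intro: borel_compact)
    let ?K' = "(\<lambda>x. x + (- w)) ` K"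
    have K': "compact ?K'" using K by (intro compact_continuous_image continuous_intros)
    have pre: "(\<lambda>x. x + w) -` K = ?K'"
    proof (intro set_eqI iffI)
      fix x assume "x \<in> (\<lambda>x. x + w) -` K"
      then show "x \<in> ?K'" by (intro image_eqI[of _ _ "x + w"]) auto
    qed auto
    have "emeasure (distr \<nu> borel (\<lambda>x. x + w)) K = emeasure \<nu> ?K'"
      by (simp add: emeasure_distr sp pre)
    also have "\<dots> = ennreal (\<integral>x. indicator ?K' x \<partial>\<nu>)"
      using Kfin[OF K'] by (simp add: sp emeasure_eq_ennreal_measure less_top)
    also have "(\<integral>x. indicator ?K' x \<partial>\<nu>) = (\<integral>x. indicator K (x - (- w)) \<partial>\<nu> :: real)"
    proof -
      have "indicator ?K' x = (indicator K (x - (- w)) :: real)" for x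
        unfolding pre[symmetric] by (simp add: indicator_def)
      then show ?thesis by (simp only:)
    qed
    also have "\<dots> = (\<integral>x. indicator K x \<partial>\<nu>)" by (rule inv[OF K])
    also have "ennreal \<dots> = emeasure \<nu> K"
      using Kfin[OF K] by (simp add: sp emeasure_eq_ennreal_measure less_top)
    finally show "emeasure (distr \<nu> borel (\<lambda>x. x + w)) K = emeasure \<nu> K" .
  next
    show "(\<Union>n. cball (0::'a) (real n)) = UNIV" by (auto intro: real_arch_simple)
    show "emeasure (distr \<nu> borel (\<lambda>x. x + w)) (cball 0 (real n)) \<noteq> \<infinity>" for n
    proof -
      have "emeasure (distr \<nu> borel (\<lambda>x. x + w)) (cball 0 (real n)) = emeasure \<nu> ((\<lambda>x. x + w) -` cball 0 (real n))"
        by (subst emeasure_distr) (auto simp: sp)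
      also have "\<dots> \<le> emeasure \<nu> (cball 0 (real n + norm w))"
      proof (rule emeasure_mono)
        show "(\<lambda>x. x + w) -` cball 0 (real n) \<subseteq> cball 0 (real n + norm w)"
        proof
          fix x assume "x \<in> (\<lambda>x. x + w) -` cball 0 (real n)"
          then show "x \<in> cball 0 (real n + norm w)" using norm_triangle_ineq4[of "x + w" w] by simp
        qed
      qed (simp add: sets)
      finally show ?thesis using fin[of "real n + norm w"] by auto
    qed
  qed auto
  have inv': "(\<integral>\<^sup>+x. f x \<partial>\<nu>) = (\<integral>\<^sup>+x. f (x + w) \<partial>\<nu>)" if "f \<in> borel_measurable borel" for f :: "'a \<Rightarrow> ennreal" and w
    using nn_integral_distr[of "\<lambda>x. x + w" \<nu> borel f] that unfolding shift by simp
  let ?B = "ball (0::'a) 1"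
  define b where "b = (indicator ?B :: 'a \<Rightarrow> ennreal)"
  have [measurable]: "b \<in> borel_measurable borel"
    unfolding b_def by (intro borel_measurable_indicator borel_open open_ball)
  have lb: "(\<integral>\<^sup>+y. b y \<partial>lborel) = emeasure lborel ?B" "(\<integral>\<^sup>+y. b y \<partial>\<nu>) = emeasure \<nu> ?B"
    unfolding b_def by (rule nn_integral_indicator, simp add: sets)+
  have key: "emeasure \<nu> A * emeasure lborel ?B = emeasure lborel A * emeasure \<nu> ?B" if [measurable]: "A \<in> sets borel" for A
  proof -
    have "emeasure \<nu> A * emeasure lborel ?B = (\<integral>\<^sup>+x. indicator A x * emeasure lborel ?B \<partial>\<nu>)"
      by (subst nn_integral_multc) (auto simp: sets)
    also have "\<dots> = (\<integral>\<^sup>+x. \<integral>\<^sup>+y. indicator A x * b (y - x) \<partial>lborel \<partial>\<nu>)"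
    proof (rule nn_integral_cong)
      fix x :: 'a
      have "(\<integral>\<^sup>+y. indicator A x * b (y - x) \<partial>lborel) = indicator A x * (\<integral>\<^sup>+y. b (y - x) \<partial>lborel)"
        by (rule nn_integral_cmult) measurable
      also have "(\<integral>\<^sup>+y. b (y - x) \<partial>lborel) = emeasure lborel ?B"
        by (subst nn_integral_lborel_translate) (simp_all add: lb)
      finally show "indicator A x * emeasure lborel ?B = (\<integral>\<^sup>+y. indicator A x * b (y - x) \<partial>lborel)" ..
    qed
    also have "\<dots> = (\<integral>\<^sup>+y. \<integral>\<^sup>+x. indicator A x * b (y - x) \<partial>\<nu> \<partial>lborel)"
      by (rule P.Fubini'[symmetric]) measurable
    \<comment> \<open>Shifting x by y under \<nu> leaves b (- x), which is free of y; the symmetry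
      of the ball will turn it into b x.\<close>
    also have "\<dots> = (\<integral>\<^sup>+y. \<integral>\<^sup>+x. indicator A (x + y) * b (- x) \<partial>\<nu> \<partial>lborel)"
    proof (rule nn_integral_cong)
      fix y :: 'a
      show "(\<integral>\<^sup>+x. indicator A x * b (y - x) \<partial>\<nu>) = (\<integral>\<^sup>+x. indicator A (x + y) * b (- x) \<partial>\<nu>)"
        by (subst inv'[of _ y]) auto
    qed
    also have "\<dots> = (\<integral>\<^sup>+x. \<integral>\<^sup>+y. indicator A (x + y) * b (- x) \<partial>lborel \<partial>\<nu>)"
      by (rule P.Fubini') measurable
    also have "\<dots> = (\<integral>\<^sup>+x. emeasure lborel A * b x \<partial>\<nu>)"
    proof (rule nn_integral_cong)
      fix x :: 'a
      have "(\<integral>\<^sup>+y. indicator A (x + y) * b (- x) \<partial>lborel) = (\<integral>\<^sup>+y. indicator A (y - (- x)) \<partial>lborel) * b (- x)"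
        by (simp add: nn_integral_multc add.commute)
      also have "\<dots> = emeasure lborel A * b x"
        by (subst nn_integral_lborel_translate) (auto simp: b_def indicator_def)
      finally show "(\<integral>\<^sup>+y. indicator A (x + y) * b (- x) \<partial>lborel) = emeasure lborel A * b x" .
    qed
    also have "\<dots> = emeasure lborel A * emeasure \<nu> ?B"
      by (simp add: nn_integral_cmult lb)
    finally show ?thesis .
  qed
  have lB: "emeasure lborel ?B \<noteq> 0" "emeasure lborel ?B \<noteq> \<infinity>"
    using emeasure_bounded_finite[of ?B] less_imp_neq[OF unit_ball_vol_pos[of "real DIM('a)"]]
    by (auto simp: emeasure_ball)
  have nB: "emeasure \<nu> ?B \<noteq> \<infinity>"
    using emeasure_mono[of ?B "cball 0 1" \<nu>] fin[of 1] sets by (auto simp: top_unique)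
  define c where "c = enn2real (emeasure \<nu> ?B / emeasure lborel ?B)"
  have c: "ennreal c = emeasure \<nu> ?B / emeasure lborel ?B"
  proof -
    have "emeasure \<nu> ?B / emeasure lborel ?B \<noteq> top"
      using lB nB by (simp add: ennreal_divide_eq_top_iff)
    then show ?thesis unfolding c_def by (intro ennreal_enn2real) (simp add: less_top)
  qed
  have "\<nu> = density lborel (\<lambda>_. ennreal c)"
  proof (rule measure_eqI)
    fix A assume "A \<in> sets \<nu>"
    then have A[measurable]: "A \<in> sets borel" by (simp add: sets)
    have "emeasure \<nu> A = emeasure \<nu> A * emeasure lborel ?B / emeasure lborel ?B"
      using lB by (simp add: ennreal_mult_divide_eq)
    also have "\<dots> = emeasure lborel A * ennreal c"
      unfolding key[OF A] c by (simp add: ennreal_times_divide)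
    also have "\<dots> = emeasure (density lborel (\<lambda>_. ennreal c)) A"
      by (simp add: emeasure_density nn_integral_cmult mult.commute)
    finally show "emeasure \<nu> A = emeasure (density lborel (\<lambda>_. ennreal c)) A" .
  qed (simp add: sets)
  moreover have "c \<ge> 0" by (simp add: c_def)
  ultimately show ?thesis using that by blast
qed

section \<open>Fisher information\<close>

text \<open>Move a compact set T on which f = 0 and g \<le> - 1 / M along \<open>w\<close>. Its
  \<nu>-mass starts at 0 and cannot become negative, but by the shift formula it initially changes
  at the rate given by the integral of g over T, which is negative if T has positive Lebesgue
  measure.\<close>

lemma (in weak_translation) nonneg_on_null_set:
  fixes f :: "'a \<Rightarrow> real"
  assumes \<nu>: "\<nu> = density lborel (\<lambda>x. ennreal (f x))" and f: "f \<in> borel_measurable borel" "\<And>x. 0 \<le> f x"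
  shows "AE x in lborel. f x = 0 \<longrightarrow> 0 \<le> g x"
proof -
  note [measurable] = f(1) g_meas
  \<comment> \<open>For M > 0 these sets exhaust the set where f = 0 and g < 0; the bounds make each
    of them bounded, with g bounded and uniformly negative on it.\<close>
  define S where "S M = {x. f x = 0 \<and> - real M \<le> g x \<and> g x \<le> - 1 / real M \<and> norm x \<le> real M}" for M :: nat
  have Sm: "S M \<in> sets borel" for M unfolding S_def by measurable
  have null: "emeasure lborel (S M) = 0" if M: "M > 0" for M
  proof (rule ccontr)
    assume ne: "emeasure lborel (S M) \<noteq> 0"
    have Sb: "bounded (S M)" unfolding S_def bounded_iff by auto
    have Sfin: "emeasure lborel (S M) < \<infinity>" by (rule emeasure_bounded_finite[OF Sb])
    have Sleb: "S M \<in> sets lebesgue" using Sm by auto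
    define e where "e = enn2real (emeasure lborel (S M))"
    have e1: "emeasure lborel (S M) = ennreal e"
      unfolding e_def using Sfin by simp
    have "e \<ge> 0" by (simp add: e_def)
    moreover have "e \<noteq> 0" using e1 ne by (metis ennreal_0)
    ultimately have e: "emeasure lborel (S M) = ennreal e" "e > 0" using e1 by auto
    obtain T where T: "closed T" "T \<subseteq> S M" "S M - T \<in> lmeasurable" "emeasure lebesgue (S M - T) < ennreal e"
      by (rule sets_lebesgue_inner_closed[OF Sleb e(2)])
    have Tc: "compact T" using T(1,2) Sb by (meson bounded_subset compact_eq_bounded_closed)
    have Tm[measurable]: "T \<in> sets borel" using T(1) by simp
    have Tpos: "emeasure lborel T > 0"
    proof (rule ccontr)
      assume "\<not> 0 < emeasure lborel T"
      then have "emeasure lborel T = 0" by simp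
      moreover have "emeasure lborel (S M) \<le> emeasure lborel T + emeasure lborel (S M - T)"
        using T(2) Sm Tm by (subst plus_emeasure) (auto simp: Un_absorb1)
      moreover have "emeasure lborel (S M - T) = emeasure lebesgue (S M - T)"
        using Sm Tm by (simp add: emeasure_completion)
      ultimately show False using T(4) e(1) by auto
    qed
    define lT where "lT = measure lborel T"
    have Tfin: "emeasure lborel T < \<infinity>" using Tc by (intro emeasure_bounded_finite compact_imp_bounded)
    have lT: "lT > 0"
    proof -
      have "emeasure lborel T = ennreal lT"
        unfolding lT_def using Tfin by (intro emeasure_eq_ennreal_measure) auto
      then show ?thesis using Tpos by (metis ennreal_less_zero_iff)
    qed
    \<comment> \<open>The rate of change in r of the \<nu>-mass of T + r w.\<close>
    define G where "G r = (\<integral>x. indicator T (x - r *\<^sub>R w) * g x \<partial>lborel)" for r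
    have gT: "integrable lborel (\<lambda>x. indicator T x * g x)"
    proof (rule Bochner_Integration.integrable_bound[OF g_int[of "real M"]])
      show "AE x in lborel. norm (indicator T x * g x) \<le> norm (indicator (cball 0 (real M)) x * g x)"
        using T(2) by (auto simp: indicator_def S_def)
    qed measurable
    have G0: "G 0 \<le> - lT / real M"
    proof -
      have "G 0 \<le> (\<integral>x. indicator T x * (- 1 / real M) \<partial>lborel)"
        unfolding G_def
      proof (rule integral_mono)
        show "integrable lborel (\<lambda>x. indicator T x * (- 1 / real M))"
          using Tfin by (intro integrable_mult_left integrable_real_indicator) auto
        show "indicator T (x - 0 *\<^sub>R w) * g x \<le> indicator T x * (- 1 / real M)" for x
          using T(2) by (auto simp: indicator_def S_def)
      qed (use gT in simp)
      also have "\<dots> = - lT / real M" by (simp add: lT_def)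
      finally show ?thesis .
    qed
    have avg: "0 \<le> (\<integral>r. indicator {0..h} r * G r \<partial>lborel)" if h: "0 \<le> h" for h
    proof -
      have "(\<integral>x. indicator T x \<partial>\<nu>) = (\<integral>x. f x * indicator T x \<partial>lborel)"
        unfolding \<nu> using f by (subst integral_density) auto
      also have "\<dots> = (\<integral>x. 0 \<partial>(lborel::'a measure))"
        using T(2) by (intro Bochner_Integration.integral_cong) (auto simp: indicator_def S_def)
      finally have "(\<integral>x. indicator T x \<partial>\<nu>) = (0::real)" by simp
      moreover have "0 \<le> (\<integral>x. indicator T (x - h *\<^sub>R w) \<partial>\<nu> :: real)" by simp
      moreover have "(\<integral>x. indicator T (x - h *\<^sub>R w) \<partial>\<nu>) - (\<integral>x. indicator T x \<partial>\<nu>) = (\<integral>r. indicator {0..h} r * G r \<partial>lborel)"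
        using shift_identity_compact[OF Tc, unfolded shift_identity_def, rule_format, OF h] unfolding G_def .
      ultimately show ?thesis by linarith
    qed
    \<comment> \<open>Right continuity of G at 0. The two parts of the symmetric difference of T and
      its translate need different arguments.\<close>
    have lim: "(G \<longlongrightarrow> G 0) (at_right 0)"
      unfolding tendsto_at_iff_sequentially
    proof (intro allI impI)
      fix r :: "nat \<Rightarrow> real" assume r: "\<forall>i. r i \<in> {0<..} - {0}" "r \<longlonglongrightarrow> 0"
      obtain B where B: "B > 0" "\<forall>n. norm (r n) \<le> B"
        by (rule BseqE[OF convergent_imp_Bseq[OF convergentI[OF r(2)]]])
      define R where "R = real M + B * norm w"
      have R: "x \<in> cball 0 R" if "x - (c * r n) *\<^sub>R w \<in> T" "\<bar>c\<bar> = 1" for x n c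
      proof -
        have "norm (x - (c * r n) *\<^sub>R w) \<le> real M" using that T(2) by (auto simp: S_def)
        moreover have "norm ((c * r n) *\<^sub>R w) \<le> B * norm w"
          using B(2)[rule_format, of n] that(2) by (auto simp: abs_mult intro!: mult_right_mono)
        ultimately show ?thesis
          using norm_triangle_ineq2[of x "(c * r n) *\<^sub>R w"] by (simp add: R_def)
      qed
      have outside: "(\<lambda>n. indicator T (x - (c * r n) *\<^sub>R w) * (1 - indicator T x) :: real) \<longlonglongrightarrow> 0" for x c
      proof (cases "x \<in> T")
        case False
        have "(\<lambda>n. x - (c * r n) *\<^sub>R w) \<longlonglongrightarrow> x - (c * 0) *\<^sub>R w" by (intro tendsto_intros r(2))
        then have "\<forall>\<^sub>F n in sequentially. x - (c * r n) *\<^sub>R w \<in> - T"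
          using False T(1) by (intro topological_tendstoD) auto
        then have "\<forall>\<^sub>F n in sequentially. indicator T (x - (c * r n) *\<^sub>R w) * (1 - indicator T x) = (0::real)"
          by eventually_elim auto
        then show ?thesis by (rule tendsto_eventually)
      qed simp
      have gi: "integrable lborel (\<lambda>x. \<bar>indicator (cball 0 R) x * g x\<bar>)" by (intro integrable_abs g_int)
      \<comment> \<open>The points outside T: as T is closed, each of them is avoided by all small
        translates of T, and dominated convergence applies.\<close>
      let ?a = "\<lambda>n x. indicator T (x - r n *\<^sub>R w) * (1 - indicator T x) * g x"
      have a_bd: "\<bar>?a n x\<bar> \<le> \<bar>indicator (cball 0 R) x * g x\<bar>" for n x
        using R[of x 1 n] by (auto simp: indicator_def)
      have A: "(\<lambda>n. \<integral>x. ?a n x \<partial>lborel) \<longlonglongrightarrow> (\<integral>x. 0 \<partial>(lborel::'a measure))"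
        by (rule integral_dominated_convergence[OF _ _ gi])
          (use a_bd in \<open>auto intro!: tendsto_mult_left_zero outside[of _ 1, simplified]\<close>)
      have ai: "integrable lborel (?a n)" for n
        by (rule Bochner_Integration.integrable_bound[OF gi]) (use a_bd in auto)
      \<comment> \<open>At points of T that the translate of T misses, pointwise convergence may
        fail. Their measure equals, by a translation, that of the points outside T which the
        opposite translate of T covers, and |g| \<le> M on T.\<close>
      let ?b = "\<lambda>n x. indicator T (x + r n *\<^sub>R w) * (1 - indicator T x) :: real"
      have ind: "integrable lborel (indicator (cball 0 R) :: 'a \<Rightarrow> real)"
        by (intro integrable_real_indicator) (auto intro: emeasure_bounded_finite[OF bounded_cball, unfolded infinity_ennreal_def])
      have b_bd: "\<bar>?b n x\<bar> \<le> indicator (cball 0 R) x" for n x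
        using R[of x "-1" n] by (auto simp: indicator_def)
      have B': "(\<lambda>n. \<integral>x. ?b n x \<partial>lborel) \<longlonglongrightarrow> (\<integral>x. 0 \<partial>(lborel::'a measure))"
        by (rule integral_dominated_convergence[OF _ _ ind]) (use b_bd outside[of _ "-1"] in auto)
      let ?c = "\<lambda>n x. indicator T x * (1 - indicator T (x - r n *\<^sub>R w)) :: real"
      have ci: "integrable lborel (?c n)" for n
        by (rule Bochner_Integration.integrable_bound[of _ "indicator T :: 'a \<Rightarrow> real"])
          (use Tfin in \<open>auto simp: indicator_def intro!: integrable_real_indicator\<close>)
      have bc: "(\<integral>x. ?b n x \<partial>lborel) = (\<integral>x. ?c n x \<partial>lborel)" for n
      proof -
        have "(\<integral>x. ?b n x \<partial>lborel) = (\<integral>x. ?b n x \<partial>distr lborel borel ((+) (- (r n *\<^sub>R w))))"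
          by (simp add: lborel_distr_plus)
        also have "\<dots> = (\<integral>x. ?c n x \<partial>lborel)"
          by (subst integral_distr) auto
        finally show ?thesis .
      qed
      let ?d = "\<lambda>n x. indicator T x * (1 - indicator T (x - r n *\<^sub>R w)) * g x"
      have d_bd: "\<bar>?d n x\<bar> \<le> real M * ?c n x" for n x
      proof (cases "x \<in> T")
        case True
        then have "- real M \<le> g x" "g x \<le> - 1 / real M" using T(2) by (auto simp: S_def)
        moreover have "- 1 / real M \<le> 0" by simp
        ultimately have "\<bar>g x\<bar> \<le> real M" by linarith
        then show ?thesis by (auto simp: indicator_def)
      qed simp
      have di: "integrable lborel (?d n)" for n
        by (rule Bochner_Integration.integrable_bound[OF integrable_mult_right[OF ci[of n], of "real M"]])
          (use d_bd in \<open>auto intro: order_trans[OF _ abs_ge_self]\<close>)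
      have D: "\<bar>\<integral>x. ?d n x \<partial>lborel\<bar> \<le> real M * (\<integral>x. ?b n x \<partial>lborel)" for n
      proof -
        have "\<bar>\<integral>x. ?d n x \<partial>lborel\<bar> \<le> (\<integral>x. \<bar>?d n x\<bar> \<partial>lborel)" by (rule integral_abs_bound)
        also have "\<dots> \<le> (\<integral>x. real M * ?c n x \<partial>lborel)"
          by (rule integral_mono) (use di ci d_bd in auto)
        finally show ?thesis by (simp add: bc)
      qed
      have "(\<lambda>n. real M * (\<integral>x. ?b n x \<partial>lborel)) \<longlonglongrightarrow> real M * 0"
        using B' by (intro tendsto_intros) simp
      then have bl: "(\<lambda>n. real M * (\<integral>x. ?b n x \<partial>lborel)) \<longlonglongrightarrow> 0" by simp
      have D': "(\<lambda>n. \<integral>x. ?d n x \<partial>lborel) \<longlonglongrightarrow> 0"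
        by (rule tendsto_rabs_zero_cancel, rule tendsto_sandwich[OF _ _ tendsto_const bl]) (use D in auto)
      have "G (r n) = G 0 + (\<integral>x. ?a n x \<partial>lborel) - (\<integral>x. ?d n x \<partial>lborel)" for n
      proof -
        have "G (r n) = (\<integral>x. indicator T x * g x + ?a n x - ?d n x \<partial>lborel)"
          unfolding G_def by (intro Bochner_Integration.integral_cong) (auto simp: indicator_def)
        then show ?thesis using gT ai[of n] di[of n] by (simp add: G_def)
      qed
      moreover have "(\<lambda>n. G 0 + (\<integral>x. ?a n x \<partial>lborel) - (\<integral>x. ?d n x \<partial>lborel)) \<longlonglongrightarrow> G 0 + 0 - 0"
        using A D' by (intro tendsto_intros) simp_all
      ultimately show "(G \<circ> r) \<longlonglongrightarrow> G 0" by (simp add: o_def)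
    qed
    \<comment> \<open>Half of the bound on \<open>G 0\<close>, which leaves room for continuity to
      keep G negative on a short interval.\<close>
    have G0': "G 0 < - lT / (2 * real M)" using G0 lT M by (simp add: field_simps)
    from order_tendstoD(2)[OF lim G0'] obtain d where d: "d > 0" "\<And>r. 0 < r \<Longrightarrow> r < d \<Longrightarrow> G r < - lT / (2 * real M)"
      by (auto simp: eventually_at_right_field)
    define h where "h = d / 2"
    have h: "h > 0" "h < d" using d(1) by (auto simp: h_def)
    have neg: "indicator {0..h} r * G r \<le> indicator {0..h} r * (- lT / (2 * real M))" for r
      using d(2)[of r] G0' h by (cases "r = 0") (auto simp: indicator_def)
    have "(\<integral>r. indicator {0..h} r * G r \<partial>lborel) \<le> (\<integral>r. indicator {0..h} r * (- lT / (2 * real M)) \<partial>lborel)"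
    proof (rule integral_mono)
      show i: "integrable lborel (\<lambda>r. indicator {0..h} r * (- lT / (2 * real M)))"
        using h by (intro integrable_mult_left integrable_real_indicator) auto
      define J where "J = (\<integral>x. \<bar>indicator (cball 0 (real M + h * norm w)) x * g x\<bar> \<partial>lborel)"
      show "integrable lborel (\<lambda>r. indicator {0..h} r * G r)"
      proof (rule Bochner_Integration.integrable_bound)
        show "integrable lborel (\<lambda>r. J * indicator {0..h} r :: real)"
          using h by (intro integrable_mult_right integrable_real_indicator) auto
        have "\<bar>G r\<bar> \<le> J" if "0 \<le> r" "r \<le> h" for r
        proof -
          have "\<bar>G r\<bar> \<le> (\<integral>x. \<bar>indicator T (x - r *\<^sub>R w) * g x\<bar> \<partial>lborel)"
            unfolding G_def by (rule integral_abs_bound)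
          also have "\<dots> \<le> J"
            unfolding J_def
          proof (rule integral_mono')
            show "integrable lborel (\<lambda>x. \<bar>indicator (cball 0 (real M + h * norm w)) x * g x\<bar>)"
              by (intro integrable_abs g_int)
            show "\<bar>indicator T (x - r *\<^sub>R w) * g x\<bar> \<le> \<bar>indicator (cball 0 (real M + h * norm w)) x * g x\<bar>" for x
            proof (cases "x - r *\<^sub>R w \<in> T")
              case True
              then have "norm (x - r *\<^sub>R w) \<le> real M" using T(2) by (auto simp: S_def)
              moreover have "norm (r *\<^sub>R w) \<le> h * norm w" using that by (simp add: mult_right_mono)
              ultimately have "norm x \<le> real M + h * norm w" using norm_triangle_ineq2[of x "r *\<^sub>R w"] by linarith
              then show ?thesis using True by simp
            qed simp
          qed simp
          finally show ?thesis .
        qed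
        then show "AE r in lborel. norm (indicator {0..h} r * G r) \<le> norm (J * indicator {0..h} r)"
          by (auto simp: indicator_def intro: order_trans[OF _ abs_ge_self])
      qed (unfold G_def, measurable)
    qed (rule neg)
    also have "\<dots> = h * (- lT / (2 * real M))" using h by simp
    also have "\<dots> < 0" using h lT M by (simp add: field_simps)
    finally show False using avg[of h] h by simp
  qed
  have "AE x in lborel. \<forall>M::nat. M > 0 \<longrightarrow> x \<notin> S M"
    unfolding AE_all_countable
  proof
    fix M :: nat
    show "AE x in lborel. 0 < M \<longrightarrow> x \<notin> S M"
    proof (cases "M > 0")
      case True
      then have "S M \<in> null_sets lborel" using null Sm by (intro null_setsI) auto
      from AE_not_in[OF this] show ?thesis by eventually_elim simp
    qed simp
  qed
  then show ?thesis
  proof eventually_elim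
    case (elim x)
    show ?case
    proof (intro impI, rule ccontr)
      assume x: "f x = 0" "\<not> 0 \<le> g x"
      obtain M :: nat where M: "max (max (- g x) (norm x)) (max 1 (- 1 / g x)) < real M" using reals_Archimedean2 by blast
      then have "M > 0" "- real M \<le> g x" "norm x \<le> real M" by auto
      moreover have "g x \<le> - 1 / real M"
      proof -
        have "- 1 / g x < real M" using M by simp
        then show ?thesis using x(2) \<open>M > 0\<close> by (simp add: field_simps)
      qed
      ultimately have "x \<in> S M" using x(1) by (simp add: S_def)
      then show False using elim \<open>M > 0\<close> by blast
    qed
  qed
qed

lemma weak_gradient_integrable:
  fixes f :: "'a::euclidean_space \<Rightarrow> real"
  assumes wg: "weak_gradient f g" and [measurable]: "f \<in> borel_measurable borel" "g \<in> borel_measurable borel"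
    and u: "u \<in> borel_measurable borel" "\<And>x. \<bar>u x\<bar> \<le> C" "\<And>x. norm x > R \<Longrightarrow> u x = (0::real)"
  shows "integrable lborel (\<lambda>x. f x * u x)" "integrable lborel (\<lambda>x. u x * (g x \<bullet> e))"
proof -
  have K: "integrable lborel (\<lambda>x. indicator (cball 0 R) x *\<^sub>R f x)" "integrable lborel (\<lambda>x. indicator (cball 0 R) x *\<^sub>R g x)"
    using wg compact_cball unfolding weak_gradient_def set_integrable_def by blast+
  note [measurable] = u(1)
  have C: "C \<ge> 0" using u(2)[of 0] by linarith
  have 1: "\<bar>f x * u x\<bar> \<le> \<bar>C * (indicator (cball 0 R) x *\<^sub>R f x)\<bar>" for x
  proof (cases "norm x > R")
    case False
    then show ?thesis using mult_right_mono[OF u(2)[of x], of "\<bar>f x\<bar>"] C by (simp add: abs_mult mult.commute)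
  qed (simp add: u(3))
  show "integrable lborel (\<lambda>x. f x * u x)"
    by (rule Bochner_Integration.integrable_bound[OF integrable_mult_right[OF K(1), of C]]) (use 1 in auto)
  have 2: "\<bar>u x * (g x \<bullet> e)\<bar> \<le> \<bar>(C * norm e) * norm (indicator (cball 0 R) x *\<^sub>R g x)\<bar>" for x
  proof (cases "norm x > R")
    case False
    have "\<bar>u x\<bar> * \<bar>g x \<bullet> e\<bar> \<le> C * (norm (g x) * norm e)"
      using u(2) C by (intro mult_mono Cauchy_Schwarz_ineq2) auto
    then show ?thesis using C False by (simp add: abs_mult mult_ac)
  qed (simp add: u(3))
  show "integrable lborel (\<lambda>x. u x * (g x \<bullet> e))"
    by (rule Bochner_Integration.integrable_bound[OF integrable_mult_right[OF integrable_norm[OF K(2)], of "C * norm e"]])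
      (use 2 in auto)
qed

lemma weak_gradient_direction:
  fixes f :: "'a::euclidean_space \<Rightarrow> real"
  assumes wg: "weak_gradient f g" and m: "f \<in> borel_measurable borel" "g \<in> borel_measurable borel"
    and \<phi>: "\<phi> \<in> test_functions UNIV"
  shows "(\<integral>x. f x * frechet_derivative \<phi> (at x) e \<partial>lborel) = - (\<integral>x. \<phi> x * (g x \<bullet> e) \<partial>lborel)"
proof -
  note sm = test_functions_smooth[OF \<phi>]
  obtain R where R: "\<And>x. norm x > R \<Longrightarrow> \<phi> x = 0" "\<And>x w. norm x > R \<Longrightarrow> frechet_derivative \<phi> (at x) w = 0"
    using test_functions_support[OF \<phi>] by metis
  obtain C where C: "\<And>x. \<bar>\<phi> x\<bar> \<le> C" "\<And>x w. \<bar>frechet_derivative \<phi> (at x) w\<bar> \<le> C * norm w"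
    using test_functions_bound[OF \<phi>] by metis
  note i1 = weak_gradient_integrable(1)[OF wg m smooth_derivative_measurable[OF sm] C(2) R(2)]
  note i2 = weak_gradient_integrable(2)[OF wg m smooth_measurable[OF sm] C(1) R(1)]
  have "(\<integral>x. f x * frechet_derivative \<phi> (at x) e \<partial>lborel)
      = (\<integral>x. (\<Sum>i\<in>Basis. (e \<bullet> i) * (f x * frechet_derivative \<phi> (at x) i)) \<partial>lborel)"
    by (subst frechet_derivative_sum_Basis[OF sm]) (simp add: sum_distrib_left mult_ac)
  also have "\<dots> = (\<Sum>i\<in>Basis. (e \<bullet> i) * (\<integral>x. f x * frechet_derivative \<phi> (at x) i \<partial>lborel))"
    using i1 by (subst Bochner_Integration.integral_sum) auto
  also have "\<dots> = (\<Sum>i\<in>Basis. (e \<bullet> i) * - (\<integral>x. \<phi> x * (g x \<bullet> i) \<partial>lborel))"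
    using wg \<phi> unfolding weak_gradient_def by (intro sum.cong refl) simp
  also have "\<dots> = - (\<Sum>i\<in>Basis. (e \<bullet> i) * (\<integral>x. \<phi> x * (g x \<bullet> i) \<partial>lborel))"
    by (simp add: sum_negf)
  also have "(\<Sum>i\<in>Basis. (e \<bullet> i) * (\<integral>x. \<phi> x * (g x \<bullet> i) \<partial>lborel)) = (\<integral>x. (\<Sum>i\<in>Basis. (e \<bullet> i) * (\<phi> x * (g x \<bullet> i))) \<partial>lborel)"
    using i2 by (subst Bochner_Integration.integral_sum) auto
  also have "\<dots> = (\<integral>x. \<phi> x * (g x \<bullet> e) \<partial>lborel)"
    by (subst (2) euclidean_inner) (simp add: sum_distrib_left mult_ac)
  finally show ?thesis .
qed

text \<open>Differentiating f along a line in both directions: where f attains its minimum 0, the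
  weak gradient has to vanish.\<close>

lemma weak_gradient_eq_0:
  fixes f :: "'a::euclidean_space \<Rightarrow> real"
  assumes wg: "weak_gradient f g" and m[measurable]: "f \<in> borel_measurable borel" "g \<in> borel_measurable borel"
    and f0: "\<And>x. 0 \<le> f x"
  shows "AE x in lborel. f x = 0 \<longrightarrow> g x = 0"
proof -
  have nn: "AE x in lborel. f x = 0 \<longrightarrow> 0 \<le> g x \<bullet> e" for e
  proof -
    let ?\<nu> = "density lborel (\<lambda>x. ennreal (f x))"
    have "weak_translation ?\<nu> (\<lambda>x. g x \<bullet> e) e"
    proof (rule weak_translation.intro)
      show "sigma_finite_measure ?\<nu>"
        by (subst sigma_finite_measure.sigma_finite_iff_density_finite[OF sigma_finite_lborel]) auto
      show "sets ?\<nu> = sets borel" by simp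
      show "emeasure ?\<nu> (cball 0 R) < \<infinity>" for R
      proof -
        have "integrable lborel (\<lambda>x. indicator (cball 0 R) x *\<^sub>R f x)"
          using wg compact_cball unfolding weak_gradient_def set_integrable_def by blast
        then have "(\<integral>\<^sup>+x. ennreal (norm (indicator (cball 0 R) x *\<^sub>R f x)) \<partial>lborel) < \<infinity>"
          by (simp add: integrable_iff_bounded)
        moreover have "ennreal (norm (indicator (cball 0 R) x *\<^sub>R f x)) = ennreal (f x) * indicator (cball 0 R) x" for x
          using f0[of x] by (auto simp: indicator_def)
        ultimately show ?thesis by (simp add: emeasure_density)
      qed
      show "(\<lambda>x. g x \<bullet> e) \<in> borel_measurable borel" by measurable
      show "integrable lborel (\<lambda>x. indicator (cball 0 R) x * (g x \<bullet> e))" for R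
        by (rule weak_gradient_integrable(2)[OF wg m, of _ 1 R]) (auto simp: indicator_def)
      fix \<phi> :: "'a \<Rightarrow> real" assume \<phi>: "\<phi> \<in> test_functions UNIV"
      show "(\<integral>x. frechet_derivative \<phi> (at x) e \<partial>?\<nu>) = - (\<integral>x. \<phi> x * (g x \<bullet> e) \<partial>lborel)"
        unfolding weak_gradient_direction[OF wg m \<phi>, symmetric]
        using smooth_derivative_measurable[OF test_functions_smooth[OF \<phi>]] f0
        by (subst integral_density) auto
    qed
    then show ?thesis by (rule weak_translation.nonneg_on_null_set) (use f0 in auto)
  qed
  have "AE x in lborel. \<forall>i\<in>Basis. f x = 0 \<longrightarrow> g x \<bullet> i = 0"
  proof (rule AE_finite_allI)
    fix i :: 'a
    show "AE x in lborel. f x = 0 \<longrightarrow> g x \<bullet> i = 0"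
      using nn[of i] nn[of "- i"] by eventually_elim auto
  qed simp
  then show ?thesis by eventually_elim (auto intro: euclidean_eqI)
qed

section \<open>Cutoffs and the lower bound for the Fisher information\<close>

definition cutoff :: "real \<Rightarrow> 'a::euclidean_space \<Rightarrow> real" where
  "cutoff R x = bump (1 - (norm x)\<^sup>2 / R\<^sup>2) / bump 1"

lemma bump_has_derivative: "(bump has_real_derivative bump_deriv 1 y) (at y)"
proof -
  have "bump_deriv 0 = bump" by (auto simp: bump_deriv_def bump_def)
  then show ?thesis using bump_deriv_has_derivative[of 0 y] by simp
qed

lemma smooth_cutoff: "smooth (cutoff R)"
  unfolding cutoff_def[abs_def]
  by (intro smooth_divide smooth_compose[OF smooth_real_bump] smooth_diff smooth_const smooth_norm_sq)

lemma cutoff_bounds: "0 \<le> cutoff R x" "cutoff R x \<le> 1"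
  using bump_nonneg bump_pos[of 1] bump_le_1[of "1 - (norm x)\<^sup>2 / R\<^sup>2"] by (auto simp: cutoff_def divide_simps)

lemma cutoff_eq_0: "R > 0 \<Longrightarrow> norm x > R \<Longrightarrow> cutoff R x = 0"
proof -
  assume "R > 0" "norm x > R"
  then have "1 - (norm x)\<^sup>2 / R\<^sup>2 \<le> 0" by (simp add: field_simps power_mono)
  then show "cutoff R x = 0" by (simp add: cutoff_def bump_eq_0)
qed

lemma cutoff_derivative:
  "(cutoff R has_derivative (\<lambda>w. - (2 * (x \<bullet> w) / R\<^sup>2) * bump_deriv 1 (1 - (norm x)\<^sup>2 / R\<^sup>2) / bump 1)) (at x)"
proof -
  have "((\<lambda>x::'a. 1 - (norm x)\<^sup>2 / R\<^sup>2) has_derivative (\<lambda>w. - (2 * (x \<bullet> w) / R\<^sup>2))) (at x)"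
  proof -
    have "((\<lambda>x::'a. x \<bullet> x) has_derivative (\<lambda>w. x \<bullet> w + w \<bullet> x)) (at x)"
      by (intro has_derivative_inner has_derivative_ident)
    from has_derivative_diff[OF has_derivative_const[of 1] bounded_linear.has_derivative[OF bounded_linear_divide this, of "R\<^sup>2"]]
    show ?thesis by (simp add: power2_norm_eq_inner inner_commute)
  qed
  from DERIV_compose_FDERIV[OF bump_has_derivative this]
  have "((\<lambda>x. bump (1 - (norm x)\<^sup>2 / R\<^sup>2)) has_derivative (\<lambda>w. - (2 * (x \<bullet> w) / R\<^sup>2) * bump_deriv 1 (1 - (norm x)\<^sup>2 / R\<^sup>2))) (at x)" .
  from bounded_linear.has_derivative[OF bounded_linear_divide this, of "bump 1"]
  show ?thesis unfolding cutoff_def[abs_def] .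
qed

lemma cutoff_tendsto: "(\<lambda>n. cutoff (real (Suc n)) x) \<longlonglongrightarrow> 1"
  and sq_ratio_tendsto: "(\<lambda>n. (norm x)\<^sup>2 / (real (Suc n))\<^sup>2) \<longlonglongrightarrow> 0"
proof -
  have "(\<lambda>n. (norm x)\<^sup>2 * (inverse (real (Suc n)))\<^sup>2) \<longlonglongrightarrow> (norm x)\<^sup>2 * 0\<^sup>2"
    by (intro tendsto_intros LIMSEQ_inverse_real_of_nat)
  then show l: "(\<lambda>n. (norm x)\<^sup>2 / (real (Suc n))\<^sup>2) \<longlonglongrightarrow> 0" by (simp add: divide_inverse power_inverse)
  have "isCont bump (1 - 0)" using bump_has_derivative DERIV_isCont by blast
  then have "(\<lambda>n. bump (1 - (norm x)\<^sup>2 / (real (Suc n))\<^sup>2) / bump 1) \<longlonglongrightarrow> bump (1 - 0) / bump 1"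
    by (intro tendsto_divide isCont_tendsto_compose[of "1 - 0" bump] tendsto_diff tendsto_const l) (use bump_pos[of 1] in auto)
  then show "(\<lambda>n. cutoff (real (Suc n)) x) \<longlonglongrightarrow> 1" using bump_pos[of 1] by (simp add: cutoff_def)
qed

text \<open>Applied with y = |x|^2 / R^2. The second bound controls the radial derivative of
  \<open>cutoff R\<close> independently of R, the first one makes it tend to 0 as R grows.\<close>

lemma bump_deriv_bound:
  obtains B where "B \<ge> 0" "\<And>y. y \<ge> 0 \<Longrightarrow> \<bar>bump_deriv 1 (1 - y)\<bar> \<le> B" "\<And>y. y \<ge> 0 \<Longrightarrow> \<bar>y * bump_deriv 1 (1 - y)\<bar> \<le> B"
proof -
  have "continuous_on {0..1} (bump_deriv 1)"
    using bump_deriv_has_derivative by (intro continuous_at_imp_continuous_on ballI) (metis DERIV_isCont)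
  then have "compact (bump_deriv 1 ` {0..1})" by (intro compact_continuous_image compact_Icc)
  then obtain B where B: "B > 0" "\<And>y. y \<in> bump_deriv 1 ` {0..1} \<Longrightarrow> norm y \<le> B"
    using bounded_pos compact_imp_bounded by metis
  have b: "\<bar>bump_deriv 1 (1 - y)\<bar> \<le> B" if "y \<ge> 0" for y
  proof (cases "y \<le> 1")
    case True
    then show ?thesis using B(2)[of "bump_deriv 1 (1 - y)"] that by auto
  next
    case False
    then show ?thesis using B(1) by (simp add: bump_deriv_def)
  qed
  have "\<bar>y * bump_deriv 1 (1 - y)\<bar> \<le> B" if "y \<ge> 0" for y
  proof (cases "y \<le> 1")
    case True
    have "\<bar>y\<bar> * \<bar>bump_deriv 1 (1 - y)\<bar> \<le> 1 * B" using True that b[OF that] by (intro mult_mono) auto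
    then show ?thesis by (simp add: abs_mult)
  next
    case False
    then show ?thesis using B(1) by (simp add: bump_deriv_def)
  qed
  then show ?thesis using that b B(1) by (meson less_imp_le)
qed

text \<open>The weak gradient tested against the compactly supported vector field - (cutoff / s) x +
  \<zeta> e; the bracket on the right is the divergence of that field. Each of its components is
  handled as a test function.\<close>

lemma weak_gradient_cutoff_field:
  fixes f :: "'a::euclidean_space \<Rightarrow> real"
  assumes wg: "weak_gradient f g" and m: "f \<in> borel_measurable borel" "g \<in> borel_measurable borel"
    and \<zeta>: "\<zeta> \<in> test_functions UNIV" and R: "R > 0"
  shows "(\<integral>x. g x \<bullet> (- (cutoff R x / s) *\<^sub>R x + \<zeta> x *\<^sub>R e) \<partial>lborel)
    = - (\<integral>x. f x * (- (1 / s) * (real DIM('a) * cutoff R x + frechet_derivative (cutoff R) (at x) x)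
        + frechet_derivative \<zeta> (at x) e) \<partial>lborel)"
proof -
  define \<phi> :: "'a \<Rightarrow> 'a \<Rightarrow> real" where "\<phi> i x = cutoff R x * (x \<bullet> i)" for i x
  have c_test: "cutoff R \<in> test_functions (UNIV :: 'a set)"
    by (rule test_functionsI[OF smooth_cutoff cutoff_eq_0[OF R]])
  have \<phi>_test: "\<phi> i \<in> test_functions UNIV" for i
    unfolding \<phi>_def[abs_def] by (rule test_functions_mult[OF c_test smooth_inner])
  have \<phi>_deriv: "frechet_derivative (\<phi> i) (at x) i = cutoff R x + (x \<bullet> i) * frechet_derivative (cutoff R) (at x) i"
    if "i \<in> Basis" for i x
  proof -
    have "(\<phi> i has_derivative (\<lambda>w. cutoff R x * (w \<bullet> i) + frechet_derivative (cutoff R) (at x) w * (x \<bullet> i))) (at x)"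
      unfolding \<phi>_def[abs_def]
      by (intro has_derivative_mult smooth_has_derivative smooth_cutoff bounded_linear_imp_has_derivative bounded_linear_inner_left)
    from frechet_derivative_at[OF this, symmetric] that show ?thesis by (simp add: mult.commute)
  qed
  have iphi: "integrable lborel (\<lambda>x. \<psi> x * (g x \<bullet> e'))" "integrable lborel (\<lambda>x. f x * frechet_derivative \<psi> (at x) e')"
    if \<psi>: "\<psi> \<in> test_functions UNIV" for \<psi> e'
  proof -
    obtain R where R: "\<And>x. norm x > R \<Longrightarrow> \<psi> x = 0" "\<And>x w. norm x > R \<Longrightarrow> frechet_derivative \<psi> (at x) w = 0"
      using test_functions_support[OF \<psi>] by metis
    obtain C where C: "\<And>x. \<bar>\<psi> x\<bar> \<le> C" "\<And>x w. \<bar>frechet_derivative \<psi> (at x) w\<bar> \<le> C * norm w"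
      using test_functions_bound[OF \<psi>] by metis
    note sm = test_functions_smooth[OF \<psi>]
    show "integrable lborel (\<lambda>x. \<psi> x * (g x \<bullet> e'))"
      by (rule weak_gradient_integrable(2)[OF wg m smooth_measurable[OF sm] C(1) R(1)])
    show "integrable lborel (\<lambda>x. f x * frechet_derivative \<psi> (at x) e')"
      by (rule weak_gradient_integrable(1)[OF wg m smooth_derivative_measurable[OF sm] C(2) R(2)])
  qed
  have "g x \<bullet> (- (cutoff R x / s) *\<^sub>R x + \<zeta> x *\<^sub>R e) = - (1 / s) * (\<Sum>i\<in>Basis. \<phi> i x * (g x \<bullet> i)) + \<zeta> x * (g x \<bullet> e)" for x
  proof -
    have "(\<Sum>i\<in>Basis. \<phi> i x * (g x \<bullet> i)) = cutoff R x * (g x \<bullet> x)"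
      unfolding \<phi>_def euclidean_inner[of "g x" x] by (simp add: sum_distrib_left mult_ac)
    then show ?thesis by (simp add: inner_add_right inner_diff_right)
  qed
  then have "(\<integral>x. g x \<bullet> (- (cutoff R x / s) *\<^sub>R x + \<zeta> x *\<^sub>R e) \<partial>lborel)
      = - (1 / s) * (\<Sum>i\<in>Basis. \<integral>x. \<phi> i x * (g x \<bullet> i) \<partial>lborel) + (\<integral>x. \<zeta> x * (g x \<bullet> e) \<partial>lborel)"
    using iphi(1)[OF \<phi>_test] iphi(1)[OF \<zeta>] by (simp add: Bochner_Integration.integral_sum)
  also have "\<dots> = - (- (1 / s) * (\<Sum>i\<in>Basis. \<integral>x. f x * frechet_derivative (\<phi> i) (at x) i \<partial>lborel)
      + (\<integral>x. f x * frechet_derivative \<zeta> (at x) e \<partial>lborel))"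
    unfolding weak_gradient_direction[OF wg m \<phi>_test] weak_gradient_direction[OF wg m \<zeta>] by (simp add: sum_negf)
  also have "- (1 / s) * (\<Sum>i\<in>Basis. \<integral>x. f x * frechet_derivative (\<phi> i) (at x) i \<partial>lborel)
      + (\<integral>x. f x * frechet_derivative \<zeta> (at x) e \<partial>lborel)
     = (\<integral>x. - (1 / s) * (\<Sum>i\<in>Basis. f x * frechet_derivative (\<phi> i) (at x) i) + f x * frechet_derivative \<zeta> (at x) e \<partial>lborel)"
    using iphi(2)[OF \<phi>_test] iphi(2)[OF \<zeta>] by (simp add: Bochner_Integration.integral_sum)
  also have "\<dots> = (\<integral>x. f x * (- (1 / s) * (real DIM('a) * cutoff R x + frechet_derivative (cutoff R) (at x) x)
        + frechet_derivative \<zeta> (at x) e) \<partial>lborel)"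
  proof (rule Bochner_Integration.integral_cong[OF refl])
    fix x :: 'a
    have "(\<Sum>i\<in>Basis. f x * frechet_derivative (\<phi> i) (at x) i)
        = f x * (real DIM('a) * cutoff R x + frechet_derivative (cutoff R) (at x) x)"
      unfolding frechet_derivative_sum_Basis[OF smooth_cutoff, of R x x]
      by (simp add: \<phi>_deriv sum_distrib_left distrib_left sum.distrib mult_ac)
    then show "- (1 / s) * (\<Sum>i\<in>Basis. f x * frechet_derivative (\<phi> i) (at x) i) + f x * frechet_derivative \<zeta> (at x) e
      = f x * (- (1 / s) * (real DIM('a) * cutoff R x + frechet_derivative (cutoff R) (at x) x) + frechet_derivative \<zeta> (at x) e)"
      by (simp add: algebra_simps)
  qed
  finally show ?thesis .
qed

text \<open>From |v|^2 \<ge> 2 v . W - |W|^2 with W = - x / s + \<zeta> e, where the integral of v .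
  W against \<rho> is minus that of the divergence of W. The field - x / s is the log gradient of
  the Gaussian of variance s, and \<zeta> e is the perturbation that later detects measures other
  than this Gaussian. Cutoffs give W compact support and are removed in the limit.\<close>

lemma fisher_ge:
  fixes \<rho> :: "'a::euclidean_space measure"
  assumes \<rho>: "\<rho> \<in> P2" and s: "s > 0" and \<zeta>: "\<zeta> \<in> test_functions UNIV"
  shows "ennreal (2 * real DIM('a) / s - (\<integral>x. (norm x)\<^sup>2 \<partial>\<rho>) / s\<^sup>2
    - 2 * (\<integral>x. frechet_derivative \<zeta> (at x) e - \<zeta> x * (x \<bullet> e) / s \<partial>\<rho>)
    - (\<integral>x. (\<zeta> x)\<^sup>2 * (norm e)\<^sup>2 \<partial>\<rho>)) \<le> fisher \<rho>" (is "ennreal ?L \<le> _")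
  unfolding fisher_def
proof (rule INF_greatest)
  fix v assume "v \<in> {v. log_gradient \<rho> v}"
  then obtain f g where m[measurable]: "f \<in> borel_measurable borel" "g \<in> borel_measurable borel"
    and f0: "\<And>x. 0 \<le> f x" and \<rho>f: "\<rho> = density lborel (\<lambda>x. ennreal (f x))"
    and wg: "weak_gradient f g" and v: "v = (\<lambda>x. g x /\<^sub>R f x)"
    unfolding log_gradient_def by blast
  have vm[measurable]: "v \<in> borel_measurable borel" unfolding v by measurable
  interpret prob_space \<rho> using P2D(1)[OF \<rho>] .
  note [measurable_cong] = P2D(2)[OF \<rho>]
  note sm = test_functions_smooth[OF \<zeta>]
  note [measurable] = smooth_measurable[OF sm] smooth_derivative_measurable[OF sm]
    smooth_measurable[OF smooth_cutoff]
  obtain C where C: "C \<ge> 0" "\<And>x. \<bar>\<zeta> x\<bar> \<le> C" "\<And>x w. \<bar>frechet_derivative \<zeta> (at x) w\<bar> \<le> C * norm w"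
    using test_functions_bound[OF \<zeta>] by metis
  obtain R where R: "\<And>x. norm x > R \<Longrightarrow> \<zeta> x = 0" using test_functions_support[OF \<zeta>] by metis
  obtain B where B: "B \<ge> 0" "\<And>y. y \<ge> 0 \<Longrightarrow> \<bar>bump_deriv 1 (1 - y)\<bar> \<le> B" "\<And>y. y \<ge> 0 \<Longrightarrow> \<bar>y * bump_deriv 1 (1 - y)\<bar> \<le> B"
    using bump_deriv_bound by metis
  have b1: "bump 1 > 0" by (rule bump_pos) simp
  show "ennreal ?L \<le> (\<integral>\<^sup>+x. ennreal ((norm (v x))\<^sup>2) \<partial>\<rho>)"
  proof (cases "(\<integral>\<^sup>+x. ennreal ((norm (v x))\<^sup>2) \<partial>\<rho>) = \<infinity>")
    case False
    have v2: "integrable \<rho> (\<lambda>x. (norm (v x))\<^sup>2)"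
      by (rule integrableI_nonneg) (use False in \<open>auto simp: less_top\<close>)
    define W where "W n x = - (cutoff (real (Suc n)) x / s) *\<^sub>R x + \<zeta> x *\<^sub>R e" for n x
    define D where "D n x = - (1 / s) * (real DIM('a) * cutoff (real (Suc n)) x + frechet_derivative (cutoff (real (Suc n))) (at x) x)
        + frechet_derivative \<zeta> (at x) e" for n x
    have [measurable]: "W n \<in> borel_measurable borel" for n unfolding W_def by measurable
    define q where "q n x = (norm x)\<^sup>2 / (real (Suc n))\<^sup>2" for n and x :: 'a
    have cd: "frechet_derivative (cutoff (real (Suc n))) (at x) x = - 2 / bump 1 * (q n x * bump_deriv 1 (1 - q n x))" for n x
      using fun_cong[OF frechet_derivative_at[OF cutoff_derivative[of "real (Suc n)" x]], of x, symmetric]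
      by (simp add: q_def power2_norm_eq_inner mult_ac del: of_nat_Suc)
    have q0: "q n x \<ge> 0" for n x by (simp add: q_def)
    have bdm: "bump_deriv 1 \<in> borel_measurable borel"
      using bump_deriv_has_derivative
      by (intro borel_measurable_continuous_onI continuous_at_imp_continuous_on ballI) (metis DERIV_isCont)
    have [measurable]: "D n \<in> borel_measurable borel" for n
    proof -
      have dm: "(\<lambda>x. frechet_derivative \<zeta> (at x) e) \<in> borel_measurable borel"
        by (rule smooth_derivative_measurable[OF sm])
      have cm: "(\<lambda>x::'a. frechet_derivative (cutoff (real (Suc n))) (at x) x) \<in> borel_measurable borel"
        unfolding cd q_def using bdm by measurable
      show ?thesis
        unfolding D_def
        by (intro borel_measurable_add borel_measurable_times borel_measurable_const cm dm smooth_measurable[OF smooth_cutoff])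
    qed
    have key: "(\<integral>x. v x \<bullet> W n x \<partial>\<rho>) = - (\<integral>x. D n x \<partial>\<rho>)" for n
    proof -
      have "(\<integral>x. v x \<bullet> W n x \<partial>\<rho>) = (\<integral>x. f x * (v x \<bullet> W n x) \<partial>lborel)"
        unfolding \<rho>f using f0 by (subst integral_density) auto
      \<comment> \<open>The quotient g / f is 0 by convention where f vanishes, so f v = g relies on
        g being 0 almost everywhere on that set.\<close>
      also have "\<dots> = (\<integral>x. g x \<bullet> W n x \<partial>lborel)"
      proof (rule integral_cong_AE)
        show "AE x in lborel. f x * (v x \<bullet> W n x) = g x \<bullet> W n x"
          using weak_gradient_eq_0[OF wg m f0] by eventually_elim (auto simp: v)
      qed measurable
      also have "\<dots> = - (\<integral>x. f x * D n x \<partial>lborel)"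
        unfolding W_def D_def by (rule weak_gradient_cutoff_field[OF wg m \<zeta>]) simp
      also have "(\<integral>x. f x * D n x \<partial>lborel) = (\<integral>x. D n x \<partial>\<rho>)"
        unfolding \<rho>f using f0 by (subst integral_density) auto
      finally show ?thesis .
    qed
    have W2: "(norm (W n x))\<^sup>2 \<le> 2 / s\<^sup>2 * (norm x)\<^sup>2 + 2 * C\<^sup>2 * (norm e)\<^sup>2" for n x
    proof -
      have "norm (W n x) \<le> norm x / s + C * norm e"
      proof -
        have "norm ((cutoff (real (Suc n)) x / s) *\<^sub>R x) \<le> norm x / s"
          using cutoff_bounds[of "real (Suc n)" x] s by (simp add: divide_right_mono mult_left_le_one_le)
        moreover have "norm (\<zeta> x *\<^sub>R e) \<le> C * norm e" using C by (simp add: mult_right_mono)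
        ultimately show ?thesis
          unfolding W_def using norm_triangle_ineq[of "- (cutoff (real (Suc n)) x / s) *\<^sub>R x" "\<zeta> x *\<^sub>R e"] by simp
      qed
      then have "(norm (W n x))\<^sup>2 \<le> (norm x / s + C * norm e)\<^sup>2" by (intro power_mono) auto
      also have "\<dots> \<le> 2 * (norm x / s)\<^sup>2 + 2 * (C * norm e)\<^sup>2"
        using sum_squares_bound[of "norm x / s" "C * norm e"] by (simp add: power2_sum)
      finally show ?thesis by (simp add: power_mult_distrib power_divide)
    qed
    have dom: "integrable \<rho> (\<lambda>x. 2 / s\<^sup>2 * (norm x)\<^sup>2 + 2 * C\<^sup>2 * (norm e)\<^sup>2)"
      using P2D(4)[OF \<rho>] by auto
    have W2i: "integrable \<rho> (\<lambda>x. (norm (W n x))\<^sup>2)" for n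
      by (rule Bochner_Integration.integrable_bound[OF dom]) (use W2 in \<open>auto intro: order_trans[OF _ abs_ge_self]\<close>)
    have vW: "integrable \<rho> (\<lambda>x. v x \<bullet> W n x)" for n
    proof (rule Bochner_Integration.integrable_bound[OF Bochner_Integration.integrable_add[OF v2 W2i[of n]]])
      have "\<bar>v x \<bullet> W n x\<bar> \<le> (norm (v x))\<^sup>2 + (norm (W n x))\<^sup>2" for x
        using Cauchy_Schwarz_ineq2[of "v x" "W n x"] sum_squares_bound[of "norm (v x)" "norm (W n x)"]
          zero_le_mult_iff[of "norm (v x)" "norm (W n x)"] by simp
      then show "AE x in \<rho>. norm (v x \<bullet> W n x) \<le> norm ((norm (v x))\<^sup>2 + (norm (W n x))\<^sup>2)" by simp
    qed measurable
    have ineq: "- 2 * (\<integral>x. D n x \<partial>\<rho>) - (\<integral>x. (norm (W n x))\<^sup>2 \<partial>\<rho>) \<le> (\<integral>x. (norm (v x))\<^sup>2 \<partial>\<rho>)" for n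
    proof -
      have "2 * (v x \<bullet> W n x) - (norm (W n x))\<^sup>2 \<le> (norm (v x))\<^sup>2" for x
        using inner_ge_zero[of "v x - W n x"] by (simp add: power2_norm_eq_inner inner_diff inner_commute)
      then have "(\<integral>x. 2 * (v x \<bullet> W n x) - (norm (W n x))\<^sup>2 \<partial>\<rho>) \<le> (\<integral>x. (norm (v x))\<^sup>2 \<partial>\<rho>)"
        using v2 vW W2i by (intro integral_mono) auto
      then show ?thesis using vW W2i by (simp add: key)
    qed
    define DB where "DB = 1 / s * (real DIM('a) + 2 / bump 1 * B) + C * norm e"
    have D_bd: "\<bar>D n x\<bar> \<le> DB" for n x
    proof -
      have "\<bar>frechet_derivative (cutoff (real (Suc n))) (at x) x\<bar> \<le> 2 / bump 1 * B"
        unfolding cd using mult_left_mono[OF B(3)[OF q0[of n x]], of "2 / bump 1"] b1 by (simp add: abs_mult)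
      moreover have "\<bar>real DIM('a) * cutoff (real (Suc n)) x\<bar> \<le> real DIM('a)"
        using cutoff_bounds[of "real (Suc n)" x] by (simp add: abs_mult mult_left_le)
      ultimately have "\<bar>real DIM('a) * cutoff (real (Suc n)) x + frechet_derivative (cutoff (real (Suc n))) (at x) x\<bar> \<le> real DIM('a) + 2 / bump 1 * B"
        by linarith
      then have "\<bar>- (1 / s) * (real DIM('a) * cutoff (real (Suc n)) x + frechet_derivative (cutoff (real (Suc n))) (at x) x)\<bar>
          \<le> 1 / s * (real DIM('a) + 2 / bump 1 * B)"
        using s by (simp add: abs_mult divide_right_mono)
      then show ?thesis using C(3)[of x e] unfolding D_def DB_def by linarith
    qed
    have D_lim: "(\<lambda>n. D n x) \<longlonglongrightarrow> - (1 / s) * (real DIM('a) * 1 + - 2 / bump 1 * 0) + frechet_derivative \<zeta> (at x) e" for x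
    proof -
      have "(\<lambda>n. q n x * bump_deriv 1 (1 - q n x)) \<longlonglongrightarrow> 0"
      proof (rule Lim_null_comparison)
        show "\<forall>\<^sub>F n in sequentially. norm (q n x * bump_deriv 1 (1 - q n x)) \<le> q n x * B"
          using mult_left_mono[OF B(2)[OF q0] q0] q0 by (simp add: abs_mult abs_of_nonneg)
        show "(\<lambda>n. q n x * B) \<longlonglongrightarrow> 0"
          unfolding q_def by (intro tendsto_mult_left_zero sq_ratio_tendsto)
      qed
      then show ?thesis unfolding D_def cd by (intro tendsto_intros cutoff_tendsto)
    qed
    have L1: "(\<lambda>n. \<integral>x. D n x \<partial>\<rho>) \<longlonglongrightarrow> (\<integral>x. - (1 / s) * (real DIM('a) * 1 + - 2 / bump 1 * 0) + frechet_derivative \<zeta> (at x) e \<partial>\<rho>)"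
      by (rule integral_dominated_convergence[where w="\<lambda>_. DB"]) (use D_bd D_lim in auto)
    have L2: "(\<lambda>n. \<integral>x. (norm (W n x))\<^sup>2 \<partial>\<rho>) \<longlonglongrightarrow> (\<integral>x. (norm (- (1 / s) *\<^sub>R x + \<zeta> x *\<^sub>R e))\<^sup>2 \<partial>\<rho>)"
    proof (rule integral_dominated_convergence[OF _ _ dom])
      show "AE x in \<rho>. (\<lambda>n. (norm (W n x))\<^sup>2) \<longlonglongrightarrow> (norm (- (1 / s) *\<^sub>R x + \<zeta> x *\<^sub>R e))\<^sup>2"
        unfolding W_def using s by (intro AE_I2 tendsto_intros cutoff_tendsto) auto
    qed (use W2 in auto)
    have \<zeta>i: "integrable \<rho> (\<lambda>x. (\<zeta> x)\<^sup>2 * (norm e)\<^sup>2)"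
    proof (rule integrable_const_bound[of _ "C\<^sup>2 * (norm e)\<^sup>2"])
      have "(\<zeta> x)\<^sup>2 * (norm e)\<^sup>2 \<le> C\<^sup>2 * (norm e)\<^sup>2" for x
        using power_mono[OF C(2)[of x], of 2] by (intro mult_right_mono) auto
      then show "AE x in \<rho>. norm ((\<zeta> x)\<^sup>2 * (norm e)\<^sup>2) \<le> C\<^sup>2 * (norm e)\<^sup>2" by simp
    qed measurable
    have \<zeta>xi: "integrable \<rho> (\<lambda>x. \<zeta> x * (x \<bullet> e) / s)"
    proof (rule integrable_const_bound[of _ "C * (\<bar>R\<bar> * norm e) / s"])
      have "\<bar>\<zeta> x * (x \<bullet> e)\<bar> \<le> C * (\<bar>R\<bar> * norm e)" for x
      proof (cases "norm x > R")
        case False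
        then have "norm x \<le> \<bar>R\<bar>" by linarith
        then have "\<bar>x \<bullet> e\<bar> \<le> \<bar>R\<bar> * norm e"
          using Cauchy_Schwarz_ineq2[of x e] by (meson mult_right_mono norm_ge_zero order_trans)
        then show ?thesis unfolding abs_mult using C by (intro mult_mono) auto
      qed (use C R in auto)
      then show "AE x in \<rho>. norm (\<zeta> x * (x \<bullet> e) / s) \<le> C * (\<bar>R\<bar> * norm e) / s"
        using s by (auto intro!: divide_right_mono)
    qed measurable
    have \<zeta>d: "integrable \<rho> (\<lambda>x. frechet_derivative \<zeta> (at x) e)"
      by (rule integrable_const_bound[of _ "C * norm e"]) (use C in auto)
    have E2: "(norm (- (1 / s) *\<^sub>R x + \<zeta> x *\<^sub>R e))\<^sup>2 = (1 / s\<^sup>2) * (norm x)\<^sup>2 - 2 * (\<zeta> x * (x \<bullet> e) / s) + (\<zeta> x)\<^sup>2 * (norm e)\<^sup>2" for x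
      unfolding power2_norm_eq_inner using s by (simp add: inner_add inner_diff inner_commute power2_eq_square field_simps)
    have lim: "(\<lambda>n. - 2 * (\<integral>x. D n x \<partial>\<rho>) - (\<integral>x. (norm (W n x))\<^sup>2 \<partial>\<rho>)) \<longlonglongrightarrow> ?L"
    proof -
      have "- 2 * (\<integral>x. - (1 / s) * (real DIM('a) * 1 + - 2 / bump 1 * 0) + frechet_derivative \<zeta> (at x) e \<partial>\<rho>)
        - (\<integral>x. (norm (- (1 / s) *\<^sub>R x + \<zeta> x *\<^sub>R e))\<^sup>2 \<partial>\<rho>) = ?L"
      proof -
        note i1 = integrable_mult_right[OF P2D(4)[OF \<rho>], of "1 / s\<^sup>2"] and i2 = integrable_mult_right[OF \<zeta>xi, of 2]
        have e1: "(\<integral>x. - (1 / s) * (real DIM('a) * 1 + - 2 / bump 1 * 0) + frechet_derivative \<zeta> (at x) e \<partial>\<rho>)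
            = - real DIM('a) / s + (\<integral>x. frechet_derivative \<zeta> (at x) e \<partial>\<rho>)"
          using \<zeta>d by (simp add: prob_space)
        have e2: "(\<integral>x. (1 / s\<^sup>2) * (norm x)\<^sup>2 - 2 * (\<zeta> x * (x \<bullet> e) / s) + (\<zeta> x)\<^sup>2 * (norm e)\<^sup>2 \<partial>\<rho>)
            = (1 / s\<^sup>2) * (\<integral>x. (norm x)\<^sup>2 \<partial>\<rho>) - 2 * (\<integral>x. \<zeta> x * (x \<bullet> e) / s \<partial>\<rho>) + (\<integral>x. (\<zeta> x)\<^sup>2 * (norm e)\<^sup>2 \<partial>\<rho>)"
          using Bochner_Integration.integral_add[OF Bochner_Integration.integrable_diff[OF i1 i2] \<zeta>i]
            Bochner_Integration.integral_diff[OF i1 i2] by (simp only: integral_mult_right_zero)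
        show ?thesis
          unfolding E2 e1 e2 Bochner_Integration.integral_diff[OF \<zeta>d \<zeta>xi] by simp
      qed
      then show ?thesis using tendsto_diff[OF tendsto_mult[OF tendsto_const[of "- 2"] L1] L2] by simp
    qed
    have "?L \<le> (\<integral>x. (norm (v x))\<^sup>2 \<partial>\<rho>)"
      by (rule LIMSEQ_le_const2[OF lim]) (use ineq in auto)
    then show ?thesis
      using v2 by (subst nn_integral_eq_integral) (auto intro: ennreal_leI)
  qed simp
qed

lemma smooth_gdens: "smooth (gdens s)"
proof -
  have eq: "gdens s = (\<lambda>x::'a. (2 * pi * s) powr (- real DIM('a) / 2) * exp ((- 1 / (2 * s)) * (norm x)\<^sup>2))"
    by (auto simp: gdens_def)
  show ?thesis
    unfolding eq by (intro smooth_mult smooth_const smooth_compose[OF smooth_real_exp] smooth_norm_sq)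
qed

lemma gdens_has_derivative:
  "(gdens s has_derivative (\<lambda>w. - (gdens s x * (x \<bullet> w) / s))) (at x)" for x :: "'a::euclidean_space"
proof -
  have "((\<lambda>x::'a. x \<bullet> x) has_derivative (\<lambda>w. x \<bullet> w + w \<bullet> x)) (at x)"
    by (intro has_derivative_inner has_derivative_ident)
  from bounded_linear.has_derivative[OF bounded_linear_mult_right this, of "- 1 / (2 * s)"]
  have "((\<lambda>x::'a. - (norm x)\<^sup>2 / (2 * s)) has_derivative (\<lambda>w. - (x \<bullet> w) / s)) (at x)"
    by (simp add: power2_norm_eq_inner inner_commute)
  from DERIV_compose_FDERIV[OF DERIV_exp this]
  have "((\<lambda>x::'a. exp (- (norm x)\<^sup>2 / (2 * s))) has_derivative (\<lambda>w. - (x \<bullet> w) / s * exp (- (norm x)\<^sup>2 / (2 * s)))) (at x)" .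
  from bounded_linear.has_derivative[OF bounded_linear_mult_right this, of "(2 * pi * s) powr (- real DIM('a) / 2)"]
  show ?thesis unfolding gdens_def[abs_def] by (simp add: mult_ac)
qed

text \<open>A test function times the Gaussian density is again a test function, so the integral of
  its derivative vanishes; the product rule turns this into the weak gradient identity.\<close>

lemma log_gradient_gaussian:
  assumes s: "s > 0"
  shows "log_gradient (gaussian s :: 'a::euclidean_space measure) (\<lambda>x. - (1 / s) *\<^sub>R x)"
  unfolding log_gradient_def
proof (intro exI conjI)
  let ?g = "\<lambda>x::'a. (- gdens s x / s) *\<^sub>R x"
  show "gdens s \<in> borel_measurable (borel :: 'a measure)" by measurable
  show "?g \<in> borel_measurable borel" by measurable
  show "\<forall>x::'a. 0 \<le> gdens s x" by simp
  show "gaussian s = density lborel (\<lambda>x::'a. ennreal (gdens s x))" by (rule gaussian_density)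
  show "(\<lambda>x::'a. - (1 / s) *\<^sub>R x) = (\<lambda>x. ?g x /\<^sub>R gdens s x)"
  proof
    fix x :: 'a
    have "gdens s x \<noteq> 0" using gdens_pos[OF s, of x] by simp
    then show "- (1 / s) *\<^sub>R x = ?g x /\<^sub>R gdens s x" by (simp add: field_simps)
  qed
  have cont: "continuous_on UNIV (gdens s :: 'a \<Rightarrow> real)" by (rule smooth_continuous[OF smooth_gdens])
  show "weak_gradient (gdens s) ?g"
    unfolding weak_gradient_def
  proof (intro conjI allI impI ballI)
    fix K :: "'a set" assume K: "compact K"
    show "set_integrable lborel K (gdens s)" "set_integrable lborel K ?g"
      unfolding set_integrable_def
      by (rule borel_integrable_compact[OF K]; intro continuous_intros continuous_on_subset[OF cont]; use s in auto)+
  next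
    fix \<phi> :: "'a \<Rightarrow> real" and i :: 'a assume \<phi>: "\<phi> \<in> test_functions UNIV" and i: "i \<in> Basis"
    note sm = test_functions_smooth[OF \<phi>]
    obtain R where R: "\<And>x. norm x > R \<Longrightarrow> \<phi> x = 0" "\<And>x w. norm x > R \<Longrightarrow> frechet_derivative \<phi> (at x) w = 0"
      using test_functions_support[OF \<phi>] by metis
    have int: "integrable lborel u" if u: "continuous_on UNIV u" "\<And>x. norm x > R \<Longrightarrow> u x = 0" for u :: "'a \<Rightarrow> real"
    proof -
      obtain C where "\<And>x. \<bar>u x\<bar> \<le> C" using bounded_continuous_support[OF u] by metis
      then show ?thesis
        using u by (intro integrable_bounded_support[of lborel R u C] borel_measurable_continuous_onI)
          (auto intro: emeasure_bounded_finite[OF bounded_cball, unfolded infinity_ennreal_def])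
    qed
    have i1: "integrable lborel (\<lambda>x. gdens s x * frechet_derivative \<phi> (at x) i)"
      using R(2) by (intro int continuous_intros cont smooth_continuous_derivative[OF sm]) auto
    have i2: "integrable lborel (\<lambda>x. \<phi> x * (?g x \<bullet> i))"
      using R(1) s by (intro int continuous_intros cont smooth_continuous[OF sm]) auto
    have "((\<lambda>x. \<phi> x * gdens s x) has_derivative (\<lambda>w. \<phi> x * - (gdens s x * (x \<bullet> w) / s) + frechet_derivative \<phi> (at x) w * gdens s x)) (at x)" for x
      by (intro has_derivative_mult smooth_has_derivative[OF sm] gdens_has_derivative)
    from frechet_derivative_at[OF this, symmetric]
    have D: "frechet_derivative (\<lambda>x. \<phi> x * gdens s x) (at x) i = gdens s x * frechet_derivative \<phi> (at x) i + \<phi> x * (?g x \<bullet> i)" for x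
      by (simp add: mult_ac)
    show "(\<integral>x. gdens s x * frechet_derivative \<phi> (at x) i \<partial>lborel) = - (\<integral>x. \<phi> x * (?g x \<bullet> i) \<partial>lborel)"
      using integral_derivative_test_function[OF test_functions_mult[OF \<phi> smooth_gdens], of s i] i1 i2
      unfolding D by (simp only: Bochner_Integration.integral_add)
  qed
qed

lemma fisher_gaussian:
  assumes "s > 0"
  shows "fisher (gaussian s :: 'a::euclidean_space measure) = ennreal (real DIM('a) / s)"
proof (rule antisym)
  let ?G = "gaussian s :: 'a measure"
  have "fisher ?G \<le> (\<integral>\<^sup>+x. ennreal ((norm (- (1 / s) *\<^sub>R x))\<^sup>2) \<partial>?G)"
    unfolding fisher_def by (rule INF_lower) (use log_gradient_gaussian[OF assms] in auto)
  also have "\<dots> = (\<integral>\<^sup>+x. ennreal (1 / s\<^sup>2) * ennreal ((norm x)\<^sup>2) \<partial>?G)"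
    by (intro nn_integral_cong) (simp add: ennreal_mult'[symmetric] power_mult_distrib power_divide)
  also have "\<dots> = ennreal (1 / s\<^sup>2) * ennreal (real DIM('a) * s)"
    using assms by (simp add: nn_integral_cmult nn_integral_gaussian_norm_sq)
  also have "\<dots> = ennreal (real DIM('a) / s)"
    using assms by (simp add: ennreal_mult'[symmetric] power2_eq_square)
  finally show "fisher ?G \<le> ennreal (real DIM('a) / s)" .
  \<comment> \<open>For \<zeta> = 0 the general bound is 2 d / s - d s / s^2 = d / s, with d the
    dimension.\<close>
  have z: "(\<lambda>x::'a. 0) \<in> test_functions UNIV" by (rule test_functionsI[of _ 0]) (auto intro: smooth_const)
  have "real DIM('a) / s = 2 * real DIM('a) / s - real DIM('a) * s / s\<^sup>2"
    using assms by (simp add: field_simps power2_eq_square)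
  then show "ennreal (real DIM('a) / s) \<le> fisher ?G"
    using fisher_ge[OF gaussian_P2[OF assms, where 'a='a] assms z, of 0] assms
    by (simp add: integral_gaussian_norm_sq frechet_derivative_const)
qed

section \<open>Curves of finite action\<close>

locale W2_curve =
  fixes \<rho> :: "real \<Rightarrow> 'a::euclidean_space measure" and \<tau> :: real
  assumes tau: "\<tau> > 0" and P2: "\<And>t. t \<in> {0..\<tau>} \<Longrightarrow> \<rho> t \<in> P2"
    and W2_cont: "\<And>s. s \<in> {0..\<tau>} \<Longrightarrow> ((\<lambda>t. W2 (\<rho> t) (\<rho> s)) \<longlongrightarrow> 0) (at s within {0..\<tau>})"
begin

lemma continuous_on_if_W2_bound:
  assumes "\<And>t s. t \<in> {0..\<tau>} \<Longrightarrow> s \<in> {0..\<tau>} \<Longrightarrow> \<bar>F t - F s\<bar> \<le> L * W2 (\<rho> t) (\<rho> s)"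
  shows "continuous_on {0..\<tau>} (F :: real \<Rightarrow> real)"
  unfolding continuous_on_def
proof
  fix s assume s: "s \<in> {0..\<tau>}"
  have "((\<lambda>t. F t - F s) \<longlongrightarrow> 0) (at s within {0..\<tau>})"
  proof (rule Lim_null_comparison)
    show "\<forall>\<^sub>F t in at s within {0..\<tau>}. norm (F t - F s) \<le> L * W2 (\<rho> t) (\<rho> s)"
      using assms s by (auto simp: eventually_at_filter)
    show "((\<lambda>t. L * W2 (\<rho> t) (\<rho> s)) \<longlongrightarrow> 0) (at s within {0..\<tau>})"
      by (intro tendsto_mult_right_zero W2_cont s)
  qed
  then show "(F \<longlongrightarrow> F s) (at s within {0..\<tau>})" by (rule LIM_zero_cancel)
qed

lemma continuous_integral_Lipschitz:
  assumes [measurable]: "u \<in> borel_measurable borel" and "\<And>x. \<bar>u x\<bar> \<le> C"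
    and "\<And>x y. \<bar>u x - u y\<bar> \<le> L * dist x y" "L \<ge> 0"
  shows "continuous_on {0..\<tau>} (\<lambda>t. \<integral>x. u x \<partial>\<rho> t)"
proof (rule continuous_on_if_W2_bound)
  have i: "integrable (\<rho> t) u" if "t \<in> {0..\<tau>}" for t
  proof -
    interpret prob_space "\<rho> t" using P2D(1)[OF P2[OF that]] .
    note [measurable_cong] = P2D(2)[OF P2[OF that]]
    show ?thesis by (rule integrable_const_bound[of _ C]) (use assms(2) in auto)
  qed
  show "\<bar>(\<integral>x. u x \<partial>\<rho> t) - (\<integral>x. u x \<partial>\<rho> s)\<bar> \<le> L * W2 (\<rho> t) (\<rho> s)"
    if "t \<in> {0..\<tau>}" "s \<in> {0..\<tau>}" for t s
    using that by (intro W2_Lipschitz P2 i assms) auto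
qed

lemma continuous_integral_test_function:
  assumes "\<phi> \<in> test_functions UNIV"
  shows "continuous_on {0..\<tau>} (\<lambda>t. \<integral>x. \<phi> x \<partial>\<rho> t)"
proof -
  note sm = test_functions_smooth[OF assms]
  obtain C where C: "C \<ge> 0" "\<And>x. \<bar>\<phi> x\<bar> \<le> C" "\<And>x w. \<bar>frechet_derivative \<phi> (at x) w\<bar> \<le> C * norm w"
    using test_functions_bound[OF assms] by metis
  have "norm (\<phi> x - \<phi> y) \<le> C * norm (x - y)" for x y
  proof (rule differentiable_bound[OF convex_UNIV])
    show "(\<phi> has_derivative frechet_derivative \<phi> (at x)) (at x within UNIV)" for x
      by (rule smooth_has_derivative[OF sm])
    show "onorm (frechet_derivative \<phi> (at x)) \<le> C" for x
      using C by (intro onorm_le) auto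
  qed auto
  then show ?thesis
    using C by (intro continuous_integral_Lipschitz[of \<phi> C C] smooth_measurable sm) (auto simp: dist_norm)
qed

lemma continuous_second_moment: "continuous_on {0..\<tau>} (\<lambda>t. \<integral>x. (norm x)\<^sup>2 \<partial>\<rho> t)"
proof -
  have "continuous_on {0..\<tau>} (\<lambda>t. sqrt (\<integral>x. (norm x)\<^sup>2 \<partial>\<rho> t))"
    by (rule continuous_on_if_W2_bound[of _ 1]) (use W2_ge_moment_diff P2 in auto)
  from continuous_on_power[OF this, of 2] show ?thesis by simp
qed

text \<open>Nothing is known about \<rho> outside [0, \<tau>]. Freezing the curve at its end points
  makes it a measurable kernel on the whole line.\<close>

definition clamped :: "real \<Rightarrow> 'a measure" where
  "clamped t = \<rho> (max 0 (min \<tau> t))"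

lemma clamp_in: "max 0 (min \<tau> t) \<in> {0..\<tau>}"
  using tau by auto

lemma clamped_eq: "t \<in> {0..\<tau>} \<Longrightarrow> clamped t = \<rho> t"
  by (auto simp: clamped_def)

lemma clamped_P2: "clamped t \<in> P2"
  unfolding clamped_def by (rule P2[OF clamp_in])

lemma continuous_clamped:
  assumes "continuous_on {0..\<tau>} (\<lambda>t. F (\<rho> t))"
  shows "continuous_on UNIV (\<lambda>t. F (clamped t) :: real)"
  unfolding clamped_def using assms clamp_in
  by (intro continuous_on_compose2[OF assms]) (auto intro!: continuous_intros)

text \<open>Only W2-continuity in time is available. The mass of an open set is a limit of integrals
  of Lipschitz functions, each continuous in t, and the open sets generate the Borel sets and are
  stable under intersection.\<close>

lemma clamped_kernel: "clamped \<in> borel \<rightarrow>\<^sub>M subprob_algebra borel"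
proof (rule measurable_subprob_algebra_generated[where G="{U. open U}" and \<Omega>=UNIV])
  show "sets borel = sigma_sets UNIV {U. open (U :: 'a set)}" by (simp add: borel_def)
  show "Int_stable {U. open (U :: 'a set)}" by (auto simp: Int_stable_def)
  show "subprob_space (clamped t)" for t
    using P2D(1)[OF clamped_P2] by (rule prob_space_imp_subprob_space)
  show "sets (clamped t) = sets borel" for t by (rule P2D(2)[OF clamped_P2])
  have m: "(\<lambda>t. emeasure (clamped t) U) \<in> borel_measurable borel" if U: "open U" for U
  proof -
    have "(\<lambda>t. measure (clamped t) U) \<in> borel_measurable borel"
    proof (rule borel_measurable_LIMSEQ_real)
      show "(\<lambda>n. \<integral>x. lip_indicator n U x \<partial>clamped t) \<longlonglongrightarrow> measure (clamped t) U" for t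
        by (rule finite_measure_lip_indicator(2)[OF P2D(5,2)[OF clamped_P2] U])
      show "(\<lambda>t. \<integral>x. lip_indicator n U x \<partial>clamped t) \<in> borel_measurable borel" for n
      proof (rule borel_measurable_continuous_onI, rule continuous_clamped, rule continuous_integral_Lipschitz)
        show "\<bar>lip_indicator n U x\<bar> \<le> 1" for x
          using lip_indicator(1,2)[of n U x] by simp
        show "\<bar>lip_indicator n U x - lip_indicator n U y\<bar> \<le> real n * dist x y" for x y
          by (rule lip_indicator)
      qed (auto intro: lip_indicator)
    qed
    then have "(\<lambda>t. ennreal (measure (clamped t) U)) \<in> borel_measurable borel" by measurable
    then show ?thesis
      using finite_measure.emeasure_eq_measure[OF P2D(5)[OF clamped_P2]] by simp
  qed
  then show "(\<lambda>t. emeasure (clamped t) U) \<in> borel_measurable borel" if "U \<in> {U. open U}" for U using that by simp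
  show "(\<lambda>t. emeasure (clamped t) UNIV) \<in> borel_measurable borel" by (rule m) simp
qed auto

lemma clamped_nn_integral_measurable:
  assumes "(\<lambda>(t, x). f t x) \<in> borel_measurable (borel \<Otimes>\<^sub>M borel)"
  shows "(\<lambda>t. \<integral>\<^sup>+x. f t x \<partial>clamped t) \<in> borel_measurable borel"
  by (rule nn_integral_measurable_subprob_algebra2[OF assms clamped_kernel])

text \<open>The integrand depends on t as well. Pushing the measure at time t to the slice over t
  makes the value an integral of one fixed function against a measurable kernel.\<close>

lemma clamped_integral_measurable:
  fixes f :: "real \<Rightarrow> 'a \<Rightarrow> real"
  assumes f[measurable]: "(\<lambda>(t, x). f t x) \<in> borel_measurable (borel \<Otimes>\<^sub>M borel)"
  shows "(\<lambda>t. \<integral>x. f t x \<partial>clamped t) \<in> borel_measurable borel"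
proof -
  have [measurable]: "clamped \<in> borel \<rightarrow>\<^sub>M subprob_algebra borel" by (rule clamped_kernel)
  note measurable_distr2[measurable]
  have "(\<lambda>t. integral\<^sup>L (distr (clamped t) (borel \<Otimes>\<^sub>M borel) (\<lambda>x. (t, x))) (\<lambda>(t, x). f t x)) \<in> borel_measurable borel"
    by measurable
  moreover have "integral\<^sup>L (distr (clamped t) (borel \<Otimes>\<^sub>M borel) (\<lambda>x. (t, x))) (\<lambda>(t, x). f t x) = (\<integral>x. f t x \<partial>clamped t)" for t
  proof -
    note [measurable_cong] = P2D(2)[OF clamped_P2[of t]]
    show ?thesis by (subst integral_distr) auto
  qed
  ultimately show ?thesis by simp
qed

end

text \<open>As \<open>\<kappa> \<rightarrow> \<infinity>\<close>, this tends to the indicator of (a, b) and its derivative to the difference of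
  the Dirac masses at a and b.\<close>

definition wbump :: "real \<Rightarrow> real \<Rightarrow> real \<Rightarrow> real \<Rightarrow> real" where
  "wbump \<kappa> a b t = bump (\<kappa> * ((t - a) * (b - t)))"

definition wbump' :: "real \<Rightarrow> real \<Rightarrow> real \<Rightarrow> real \<Rightarrow> real" where
  "wbump' \<kappa> a b t = \<kappa> * (a + b - 2 * t) * bump_deriv 1 (\<kappa> * ((t - a) * (b - t)))"

lemma wbump_DERIV: "(wbump \<kappa> a b has_real_derivative wbump' \<kappa> a b t) (at t)"
proof -
  have "((\<lambda>t. \<kappa> * ((t - a) * (b - t))) has_real_derivative \<kappa> * (a + b - 2 * t)) (at t)"
    by (auto intro!: derivative_eq_intros simp: algebra_simps)
  from DERIV_chain2[OF bump_has_derivative this]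
  show ?thesis unfolding wbump_def[abs_def] wbump'_def by (simp add: mult_ac)
qed

lemma isCont_bump_deriv: "isCont (bump_deriv n) y"
  using bump_deriv_has_derivative DERIV_isCont by blast

lemma isCont_wbump': "isCont (wbump' \<kappa> a b) t"
  unfolding wbump'_def[abs_def]
  by (intro continuous_intros isCont_o2[OF _ isCont_bump_deriv])

lemma continuous_on_wbump': "continuous_on A (wbump' \<kappa> a b)"
  by (intro continuous_at_imp_continuous_on ballI isCont_wbump')

lemma wbump_bounds: "0 \<le> wbump \<kappa> a b t" "wbump \<kappa> a b t \<le> 1"
  by (auto simp: wbump_def bump_def)

lemma wbump_eq_0: "\<kappa> \<ge> 0 \<Longrightarrow> a \<le> b \<Longrightarrow> t \<notin> {a<..<b} \<Longrightarrow> wbump \<kappa> a b t = 0"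
proof -
  assume h: "\<kappa> \<ge> 0" "a \<le> b" "t \<notin> {a<..<b}"
  have "(t - a) * (b - t) \<le> 0"
  proof (cases "t \<le> a")
    case True
    then show ?thesis using h(2) by (intro mult_nonpos_nonneg) auto
  next
    case False
    then show ?thesis using h(3) by (intro mult_nonneg_nonpos) auto
  qed
  then show "wbump \<kappa> a b t = 0"
    unfolding wbump_def by (intro bump_eq_0 mult_nonneg_nonpos[OF h(1)])
qed

lemma wbump_tendsto: "t \<in> {a<..<b} \<Longrightarrow> (\<lambda>n. wbump (real (Suc n)) a b t) \<longlonglongrightarrow> 1"
proof -
  assume t: "t \<in> {a<..<b}"
  define y where "y = (t - a) * (b - t)"
  have y: "y > 0" using t by (simp add: y_def)
  have "(\<lambda>n. exp (- (inverse (real (Suc n)) / y))) \<longlonglongrightarrow> exp (- (0 / y))"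
    by (intro tendsto_intros LIMSEQ_inverse_real_of_nat) (use y in auto)
  moreover have "exp (- (inverse (real (Suc n)) / y)) = wbump (real (Suc n)) a b t" for n
    using y unfolding wbump_def y_def[symmetric] by (simp add: bump_def field_simps del: of_nat_Suc)
  ultimately show ?thesis by simp
qed

lemma bump_deriv_1_nonneg: "0 \<le> bump_deriv 1 y"
  by (auto simp: bump_deriv_def)

lemma wbump'_reflect: "wbump' \<kappa> a b (a + b - t) = - wbump' \<kappa> a b t"
  by (simp add: wbump'_def algebra_simps)

text \<open>On the left half of [a, b] the function \<open>wbump'\<close> is nonnegative with total
  mass tending to 1, and its mass beyond a point r > a is at most 1 minus the value of
  \<open>wbump\<close> at r, which tends to 0. So the mass concentrates at a.\<close>

lemma wbump'_half_concentration:
  fixes m :: "real \<Rightarrow> real"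
  assumes ab: "a < b" and m: "continuous_on UNIV m"
  defines "c \<equiv> (a + b) / 2"
  shows "(\<lambda>n. \<integral>t. (wbump' (real (Suc n)) a b t * m t) * indicator {a..c} t \<partial>lborel) \<longlonglongrightarrow> m a"
proof -
  have c: "a < c" "c < b" using ab by (auto simp: c_def)
  have nn: "0 \<le> wbump' (real (Suc n)) a b t" if "t \<in> {a..c}" for n t
    using that unfolding wbump'_def c_def by (intro mult_nonneg_nonneg bump_deriv_1_nonneg) auto
  have [measurable]: "m \<in> borel_measurable borel" "wbump' \<kappa> a b \<in> borel_measurable borel" for \<kappa>
    using m isCont_wbump' by (auto intro!: borel_measurable_continuous_onI continuous_at_imp_continuous_on)
  have FTC: "has_bochner_integral lborel (\<lambda>t. wbump' \<kappa> a b t * indicator {r..s} t) (wbump \<kappa> a b s - wbump \<kappa> a b r)" if "r \<le> s" for r s \<kappa>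
    by (rule has_bochner_integral_FTC_Icc_real[OF that wbump_DERIV isCont_wbump'])
  have intm: "integrable lborel (\<lambda>t. (wbump' \<kappa> a b t * f t) * indicator {r..s} t)"
    if "continuous_on UNIV f" for f :: "real \<Rightarrow> real" and r s \<kappa>
  proof -
    have "continuous_on {r..s} (\<lambda>t. wbump' \<kappa> a b t * f t)"
      by (intro continuous_on_mult continuous_on_wbump' continuous_on_subset[OF that]) auto
    from borel_integrable_compact[OF compact_Icc this] show ?thesis by (simp add: mult.commute)
  qed
  have cm: "continuous_on UNIV (\<lambda>t. m t - m a)" by (intro continuous_intros m)
  obtain M where M: "M > 0" "\<And>t. t \<in> {a..c} \<Longrightarrow> \<bar>m t - m a\<bar> \<le> M"
  proof -
    have "compact ((\<lambda>t. m t - m a) ` {a..c})"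
      by (intro compact_continuous_image compact_Icc continuous_on_subset[OF cm]) auto
    then obtain M where "M > 0" "\<And>y. y \<in> (\<lambda>t. m t - m a) ` {a..c} \<Longrightarrow> norm y \<le> M"
      using bounded_pos compact_imp_bounded by metis
    then show ?thesis using that by auto
  qed
  define P where "P n = (\<integral>t. (wbump' (real (Suc n)) a b t * (m t - m a)) * indicator {a..c} t \<partial>lborel)" for n
  have bound: "\<bar>P n\<bar> \<le> e + M * (1 - wbump (real (Suc n)) a b r)"
    if e: "e \<ge> 0" and r: "r \<in> {a..c}" and close: "\<And>t. t \<in> {a..r} \<Longrightarrow> \<bar>m t - m a\<bar> \<le> e" for n e r
  proof -
    have pt: "\<bar>(wbump' (real (Suc n)) a b t * (m t - m a)) * indicator {a..c} t\<bar>
      \<le> e * (wbump' (real (Suc n)) a b t * indicator {a..r} t) + M * (wbump' (real (Suc n)) a b t * indicator {r..c} t)" (is "?l t \<le> ?r t") for t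
    proof (cases "t \<in> {a..c}")
      case True
      note w = nn[OF True, of n]
      show ?thesis
      proof (cases "t \<le> r")
        case True': True
        then have "\<bar>m t - m a\<bar> \<le> e" using close True by auto
        then have "\<bar>wbump' (real (Suc n)) a b t * (m t - m a)\<bar> \<le> wbump' (real (Suc n)) a b t * e"
          using w by (simp add: abs_mult mult_left_mono)
        moreover have "0 \<le> M * (wbump' (real (Suc n)) a b t * indicator {r..c} t)" using w M(1) by simp
        ultimately show ?thesis using True True' by (simp add: mult.commute)
      next
        case False
        have "\<bar>wbump' (real (Suc n)) a b t * (m t - m a)\<bar> \<le> wbump' (real (Suc n)) a b t * M"
          using w M(2)[OF True] by (simp add: abs_mult mult_left_mono)
        then show ?thesis using True False by (simp add: mult.commute)
      qed
    next
      case False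
      then show ?thesis using r by (auto simp: indicator_def)
    qed
    have "\<bar>P n\<bar> \<le> (\<integral>t. ?l t \<partial>lborel)" unfolding P_def by (rule integral_abs_bound)
    also have "\<dots> \<le> (\<integral>t. ?r t \<partial>lborel)"
      using r FTC[of a r] FTC[of r c]
      by (intro integral_mono pt integrable_abs intm[OF cm] Bochner_Integration.integrable_add integrable_mult_right)
        (auto simp: has_bochner_integral_iff)
    also have "\<dots> = e * (wbump (real (Suc n)) a b r - wbump (real (Suc n)) a b a) + M * (wbump (real (Suc n)) a b c - wbump (real (Suc n)) a b r)"
      using r FTC[of a r "real (Suc n)"] FTC[of r c "real (Suc n)"] by (simp add: has_bochner_integral_iff)
    also have "\<dots> \<le> e * 1 + M * (1 - wbump (real (Suc n)) a b r)"
      using e M(1) wbump_bounds[of "real (Suc n)" a b r] wbump_bounds[of "real (Suc n)" a b a] wbump_bounds[of "real (Suc n)" a b c]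
      by (intro add_mono mult_left_mono) linarith+
    finally show ?thesis by simp
  qed
  have P0: "P \<longlonglongrightarrow> 0"
  proof (rule LIMSEQ_I)
    fix e :: real assume e: "e > 0"
    have "isCont m a" using m by (simp add: continuous_on_eq_continuous_at)
    then obtain d where d: "d > 0" "\<And>t. \<bar>t - a\<bar> < d \<Longrightarrow> \<bar>m t - m a\<bar> < e / 2"
      unfolding isCont_def LIM_eq by (metis e half_gt_zero real_norm_def diff_self abs_zero)
    \<comment> \<open>Near enough to a for m to stay within e / 2 of m a, and still inside (a, b),
      where \<open>wbump\<close> tends to 1.\<close>
    define r where "r = min c (a + d / 2)"
    have r: "r \<in> {a..c}" "r \<in> {a<..<b}" using c d(1) by (auto simp: r_def)
    have close: "\<bar>m t - m a\<bar> \<le> e / 2" if "t \<in> {a..r}" for t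
      using d(2)[of t] that d(1) by (auto simp: r_def)
    have "(\<lambda>n. M * (1 - wbump (real (Suc n)) a b r)) \<longlonglongrightarrow> M * (1 - 1)"
      by (intro tendsto_intros wbump_tendsto r)
    then have "(\<lambda>n. M * (1 - wbump (real (Suc n)) a b r)) \<longlonglongrightarrow> 0" by simp
    then have "\<forall>\<^sub>F n in sequentially. M * (1 - wbump (real (Suc n)) a b r) < e / 2"
      by (rule order_tendstoD) (use e in simp)
    then have "\<forall>\<^sub>F n in sequentially. norm (P n - 0) < e"
    proof eventually_elim
      case (elim n)
      then show ?case using bound[OF _ r(1) close, of n] e by simp
    qed
    then show "\<exists>no. \<forall>n\<ge>no. norm (P n - 0) < e" by (simp add: eventually_sequentially)
  qed
  have "(\<integral>t. (wbump' (real (Suc n)) a b t * m t) * indicator {a..c} t \<partial>lborel) = P n + m a * wbump (real (Suc n)) a b c" for n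
  proof -
    have "(\<integral>t. (wbump' (real (Suc n)) a b t * m t) * indicator {a..c} t \<partial>lborel)
       = (\<integral>t. (wbump' (real (Suc n)) a b t * (m t - m a)) * indicator {a..c} t + m a * (wbump' (real (Suc n)) a b t * indicator {a..c} t) \<partial>lborel)"
      by (intro Bochner_Integration.integral_cong) (auto simp: algebra_simps)
    also have "\<dots> = P n + m a * (wbump (real (Suc n)) a b c - wbump (real (Suc n)) a b a)"
      using intm[OF cm] FTC[of a c "real (Suc n)"] c by (simp add: P_def has_bochner_integral_iff)
    also have "wbump (real (Suc n)) a b a = 0" using ab by (intro wbump_eq_0) auto
    finally show ?thesis by simp
  qed
  moreover have "(\<lambda>n. P n + m a * wbump (real (Suc n)) a b c) \<longlonglongrightarrow> 0 + m a * 1"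
    using c by (intro tendsto_intros P0 wbump_tendsto) auto
  ultimately show ?thesis by simp
qed

text \<open>The reflection t to a + b - t exchanges the two halves and reverses the sign of
  \<open>wbump'\<close>, so the right half contributes minus the value at b.\<close>

lemma wbump'_concentration:
  fixes m :: "real \<Rightarrow> real"
  assumes ab: "a < b" and m: "continuous_on UNIV m"
  shows "(\<lambda>n. \<integral>t. (wbump' (real (Suc n)) a b t * m t) * indicator {a..b} t \<partial>lborel) \<longlonglongrightarrow> m a - m b"
proof -
  define c where "c = (a + b) / 2"
  have c: "a < c" "c < b" using ab by (auto simp: c_def)
  let ?w = "\<lambda>n. wbump' (real (Suc n)) a b"
  have intm: "integrable lborel (\<lambda>t. (wbump' \<kappa> a b t * f t) * indicator {r..s} t)"
    if "continuous_on UNIV f" for f :: "real \<Rightarrow> real" and r s \<kappa>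
  proof -
    have "continuous_on {r..s} (\<lambda>t. wbump' \<kappa> a b t * f t)"
      by (intro continuous_on_mult continuous_on_wbump' continuous_on_subset[OF that]) auto
    from borel_integrable_compact[OF compact_Icc this] show ?thesis by (simp add: mult.commute)
  qed
  have reflect: "(\<integral>t. (?w n t * m t) * indicator {c..b} t \<partial>lborel) = - (\<integral>t. (?w n t * m (a + b - t)) * indicator {a..c} t \<partial>lborel)" for n
  proof -
    have "(\<integral>t. (?w n t * m t) * indicator {c..b} t \<partial>lborel)
        = (\<integral>t. (?w n (a + b + (- 1) * t) * m (a + b + (- 1) * t)) * indicator {c..b} (a + b + (- 1) * t) \<partial>lborel)"
      using lborel_integral_real_affine[of "- 1" "\<lambda>t. (?w n t * m t) * indicator {c..b} t" "a + b"] by simp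
    also have "\<dots> = (\<integral>t. - ((?w n t * m (a + b - t)) * indicator {a..c} t) \<partial>lborel)"
      by (intro Bochner_Integration.integral_cong refl) (auto simp: wbump'_reflect[simplified] indicator_def c_def)
    finally show ?thesis by simp
  qed
  have split: "(\<integral>t. (?w n t * m t) * indicator {a..b} t \<partial>lborel)
     = (\<integral>t. (?w n t * m t) * indicator {a..c} t \<partial>lborel) + (\<integral>t. (?w n t * m t) * indicator {c..b} t \<partial>lborel)" for n
  proof -
    have "(\<integral>t. (?w n t * m t) * indicator {a..b} t \<partial>lborel)
      = (\<integral>t. (?w n t * m t) * indicator {a..c} t + (?w n t * m t) * indicator {c..b} t \<partial>lborel)"
    proof (rule Bochner_Integration.integral_cong[OF refl])
      fix t
      \<comment> \<open>The midpoint belongs to both closed halves, but the derivative is 0 there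
        and it is not counted twice.\<close>
      have "?w n c = 0" by (simp add: wbump'_def c_def)
      then show "(?w n t * m t) * indicator {a..b} t = (?w n t * m t) * indicator {a..c} t + (?w n t * m t) * indicator {c..b} t"
        using c by (cases "t = c") (auto simp: indicator_def)
    qed
    then show ?thesis using intm[OF m] by simp
  qed
  have m': "continuous_on UNIV (\<lambda>t. m (a + b - t))"
    by (intro continuous_on_compose2[OF m] continuous_intros) auto
  show ?thesis
    unfolding split reflect
    using tendsto_add[OF wbump'_half_concentration[OF ab m] tendsto_minus[OF wbump'_half_concentration[OF ab m']]]
    by (simp add: c_def)
qed

section \<open>The second moment along a curve\<close>

definition cut_sq :: "nat \<Rightarrow> 'a::euclidean_space \<Rightarrow> real" where
  "cut_sq n x = cutoff (real (Suc n)) x * (norm x)\<^sup>2"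

definition cut_sq' :: "nat \<Rightarrow> 'a::euclidean_space \<Rightarrow> 'a \<Rightarrow> real" where
  "cut_sq' n x w = (2 * (x \<bullet> w)) * (cutoff (real (Suc n)) x
     - ((norm x)\<^sup>2 / (real (Suc n))\<^sup>2) * bump_deriv 1 (1 - (norm x)\<^sup>2 / (real (Suc n))\<^sup>2) / bump 1)"

lemma cut_sq_has_derivative: "(cut_sq n has_derivative cut_sq' n x) (at x)"
proof -
  have "((\<lambda>x::'a. x \<bullet> x) has_derivative (\<lambda>w. x \<bullet> w + w \<bullet> x)) (at x)"
    by (intro has_derivative_inner has_derivative_ident)
  from has_derivative_mult[OF cutoff_derivative[of "real (Suc n)" x] this]
  show ?thesis
    unfolding cut_sq_def[abs_def] cut_sq'_def[abs_def] power2_norm_eq_inner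
    by (rule has_derivative_eq_rhs) (auto simp: fun_eq_iff inner_commute algebra_simps add_divide_distrib diff_divide_distrib)
qed

lemma cut_sq_tendsto:
  "(\<lambda>n. cut_sq n x) \<longlonglongrightarrow> (norm x)\<^sup>2" "(\<lambda>n. cut_sq' n x w) \<longlonglongrightarrow> 2 * (x \<bullet> w)"
proof -
  show "(\<lambda>n. cut_sq n x) \<longlonglongrightarrow> (norm x)\<^sup>2"
    unfolding cut_sq_def using tendsto_mult[OF cutoff_tendsto tendsto_const, of x "(norm x)\<^sup>2"] by simp
  have "(\<lambda>n. cut_sq' n x w) \<longlonglongrightarrow> (2 * (x \<bullet> w)) * (1 - 0 * bump_deriv 1 (1 - 0) / bump 1)"
    unfolding cut_sq'_def
    by (intro tendsto_intros cutoff_tendsto sq_ratio_tendsto isCont_tendsto_compose[OF isCont_bump_deriv])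
      (use bump_pos[of 1] in auto)
  then show "(\<lambda>n. cut_sq' n x w) \<longlonglongrightarrow> 2 * (x \<bullet> w)" by simp
qed

lemma cut_sq_bound: "\<bar>cut_sq n x\<bar> \<le> (norm x)\<^sup>2"
  unfolding cut_sq_def using cutoff_bounds[of "real (Suc n)" x] by (simp add: abs_mult mult_left_le_one_le)

text \<open>Uniform in n and quadratic in x and w together: with w the velocity, the right side is
  integrable in space and time by finite second moments and finite kinetic energy.\<close>

lemma cut_sq'_bound:
  obtains C where "C \<ge> 0" "\<And>n x w. \<bar>cut_sq' n x (w::'a::euclidean_space)\<bar> \<le> C * ((norm x)\<^sup>2 + (norm w)\<^sup>2)"
proof -
  obtain B where B: "B \<ge> 0" "\<And>y. y \<ge> 0 \<Longrightarrow> \<bar>y * bump_deriv 1 (1 - y)\<bar> \<le> B"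
    using bump_deriv_bound by metis
  have b1: "bump 1 > 0" by (rule bump_pos) simp
  have "\<bar>cut_sq' n x w\<bar> \<le> (1 + B / bump 1) * ((norm x)\<^sup>2 + (norm w)\<^sup>2)" for n and x w :: 'a
  proof -
    have "\<bar>((norm x)\<^sup>2 / (real (Suc n))\<^sup>2) * bump_deriv 1 (1 - (norm x)\<^sup>2 / (real (Suc n))\<^sup>2) / bump 1\<bar> \<le> B / bump 1"
      unfolding abs_divide[of _ "bump 1"] abs_of_pos[OF b1]
      by (intro divide_right_mono B(2)) (use b1 in auto)
    then have 1: "\<bar>cutoff (real (Suc n)) x - ((norm x)\<^sup>2 / (real (Suc n))\<^sup>2) * bump_deriv 1 (1 - (norm x)\<^sup>2 / (real (Suc n))\<^sup>2) / bump 1\<bar> \<le> 1 + B / bump 1"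
      using cutoff_bounds[of "real (Suc n)" x] by linarith
    have 2: "\<bar>2 * (x \<bullet> w)\<bar> \<le> (norm x)\<^sup>2 + (norm w)\<^sup>2"
      using Cauchy_Schwarz_ineq2[of x w] sum_squares_bound[of "norm x" "norm w"] by (simp add: abs_mult)
    show ?thesis unfolding cut_sq'_def abs_mult[of "2 * (x \<bullet> w)"]
      using mult_mono[OF 2 1] by (simp add: mult.commute)
  qed
  then show ?thesis using that[of "1 + B / bump 1"] B(1) b1 by (simp add: field_simps)
qed

lemma test_function_space_time:
  assumes \<kappa>: "\<kappa> > 0" and ab: "0 < a" "a < b" "b < \<tau>"
  shows "(\<lambda>z. wbump \<kappa> a b (fst z) * cut_sq n (snd z)) \<in> test_functions ({0<..<\<tau>} \<times> (UNIV :: 'a::euclidean_space set))"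
proof -
  let ?\<phi> = "\<lambda>z::real \<times> 'a. wbump \<kappa> a b (fst z) * cut_sq n (snd z)"
  have "smooth ?\<phi>"
    unfolding wbump_def cut_sq_def cutoff_def
    by (intro smooth_mult smooth_compose[OF smooth_real_bump] smooth_diff smooth_const smooth_divide smooth_fst_snd_norm_sq)
  moreover have sub: "closure {z. ?\<phi> z \<noteq> 0} \<subseteq> {a..b} \<times> cball 0 (real (Suc n))"
  proof (rule closure_minimal)
    show "{z. ?\<phi> z \<noteq> 0} \<subseteq> {a..b} \<times> cball 0 (real (Suc n))"
    proof
      fix z assume "z \<in> {z. ?\<phi> z \<noteq> 0}"
      then have "wbump \<kappa> a b (fst z) \<noteq> 0" "cutoff (real (Suc n)) (snd z) \<noteq> 0" by (auto simp: cut_sq_def)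
      then have "fst z \<in> {a<..<b}" "\<not> norm (snd z) > real (Suc n)"
        using wbump_eq_0[of \<kappa> a b "fst z"] cutoff_eq_0[of "real (Suc n)" "snd z"] \<kappa> ab by auto
      then show "z \<in> {a..b} \<times> cball 0 (real (Suc n))" by (cases z) (auto simp: not_less)
    qed
    show "closed ({a..b} \<times> cball (0::'a) (real (Suc n)))" by (intro closed_Times) auto
  qed
  moreover have "compact (closure {z. ?\<phi> z \<noteq> 0})"
  proof -
    have "compact ({a..b} \<times> cball (0::'a) (real (Suc n)))" by (intro compact_Times) auto
    then show ?thesis using sub by (meson bounded_subset closed_closure compact_eq_bounded_closed compact_imp_bounded)
  qed
  moreover have "{a..b} \<times> cball 0 (real (Suc n)) \<subseteq> {0<..<\<tau>} \<times> (UNIV :: 'a set)" using ab by auto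
  ultimately show ?thesis by (auto simp: test_functions_def smooth_def)
qed

lemma test_function_space_time_derivative:
  "frechet_derivative (\<lambda>z. wbump \<kappa> a b (fst z) * cut_sq n (snd z)) (at (t, x)) (1, w)
    = wbump' \<kappa> a b t * cut_sq n x + wbump \<kappa> a b t * cut_sq' n x w"
proof -
  have "((\<lambda>z. wbump \<kappa> a b (fst z)) has_derivative (\<lambda>d. fst d * wbump' \<kappa> a b t)) (at (t, x))"
    using DERIV_compose_FDERIV[OF wbump_DERIV has_derivative_fst[OF has_derivative_ident], of \<kappa> a b "(t, x)"] by simp
  moreover have "((\<lambda>z. cut_sq n (snd z)) has_derivative (\<lambda>d. cut_sq' n x (snd d))) (at (t, x))"
    using has_derivative_compose[OF has_derivative_snd[OF has_derivative_ident] cut_sq_has_derivative, of n "(t, x)"] by simp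
  ultimately have "((\<lambda>z. wbump \<kappa> a b (fst z) * cut_sq n (snd z)) has_derivative
      (\<lambda>d. wbump \<kappa> a b t * cut_sq' n x (snd d) + fst d * wbump' \<kappa> a b t * cut_sq n x)) (at (t, x))"
    using has_derivative_mult by fastforce
  from fun_cong[OF frechet_derivative_at[OF this], of "(1, w)", symmetric] show ?thesis by simp
qed

locale finite_action_curve = W2_curve +
  fixes c :: "real \<Rightarrow> 'a \<Rightarrow> 'a"
  assumes ce: "continuity_equation \<tau> \<rho> c"
    and fin: "(\<integral>\<^sup>+ t\<in>{0..\<tau>}. (\<integral>\<^sup>+ x. ennreal ((norm (c t x))\<^sup>2) \<partial>\<rho> t) \<partial>lborel) < \<infinity>"
begin

text \<open>The energy \<open>u\<close> may be infinite on a null set of times; \<open>ur\<close> is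
  its real version and agrees with it at almost all times of the interval. \<open>k\<close> is half
  the time derivative of \<open>m\<close>, in the integrated sense of
  \<open>moment_identity\<close>.\<close>

definition u where "u t = (\<integral>\<^sup>+ x. ennreal ((norm (c t x))\<^sup>2) \<partial>clamped t)"
definition ur where "ur t = enn2real (u t)"
definition m where "m t = (\<integral>x. (norm x)\<^sup>2 \<partial>clamped t)"
definition k where "k t = (\<integral>x. x \<bullet> c t x \<partial>clamped t)"

lemma c_measurable [measurable]: "(\<lambda>z. c (fst z) (snd z)) \<in> borel_measurable (borel \<Otimes>\<^sub>M borel)"
  using ce unfolding continuity_equation_def borel_prod by (simp add: case_prod_beta')

lemma c_measurable' [measurable]: "c t \<in> borel_measurable borel"
  using measurable_Pair2[OF c_measurable, of t] by simp

lemma u_measurable [measurable]: "u \<in> borel_measurable borel"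
  unfolding u_def[abs_def] by (rule clamped_nn_integral_measurable) measurable

lemma ur_measurable [measurable]: "ur \<in> borel_measurable borel"
  unfolding ur_def[abs_def] by measurable

lemma k_measurable [measurable]: "k \<in> borel_measurable borel"
  unfolding k_def[abs_def] by (rule clamped_integral_measurable) measurable

lemma m_continuous: "continuous_on UNIV m"
  unfolding m_def[abs_def] by (rule continuous_clamped[OF continuous_second_moment])

lemma m_measurable [measurable]: "m \<in> borel_measurable borel"
  by (intro borel_measurable_continuous_onI m_continuous)

lemma u_fin: "(\<integral>\<^sup>+ t. u t * indicator {0..\<tau>} t \<partial>lborel) < \<infinity>"
proof -
  have "(\<integral>\<^sup>+ t. u t * indicator {0..\<tau>} t \<partial>lborel)
      = (\<integral>\<^sup>+ t\<in>{0..\<tau>}. (\<integral>\<^sup>+ x. ennreal ((norm (c t x))\<^sup>2) \<partial>\<rho> t) \<partial>lborel)"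
    by (intro nn_integral_cong) (auto simp: u_def clamped_eq indicator_def)
  then show ?thesis using fin by simp
qed

lemma AE_u: "AE t in lborel. t \<in> {0..\<tau>} \<longrightarrow> u t = ennreal (ur t)"
proof -
  have "AE t in lborel. u t * indicator {0..\<tau>} t \<noteq> \<infinity>"
    by (rule nn_integral_PInf_AE) (use u_fin in auto)
  then show ?thesis
    by eventually_elim (auto simp: ur_def indicator_def less_top split: if_splits)
qed

lemma ur_integrable: "integrable lborel (\<lambda>t. indicator {0..\<tau>} t * ur t)"
proof (rule integrableI_bounded)
  have "(\<integral>\<^sup>+ t. ennreal (norm (indicator {0..\<tau>} t * ur t)) \<partial>lborel) = (\<integral>\<^sup>+ t. u t * indicator {0..\<tau>} t \<partial>lborel)"
    by (rule nn_integral_cong_AE) (use AE_u in eventually_elim, auto simp: indicator_def ur_def)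
  then show "(\<integral>\<^sup>+ t. ennreal (norm (indicator {0..\<tau>} t * ur t)) \<partial>lborel) < \<infinity>" using u_fin by simp
qed measurable

lemma slice:
  assumes "u t = ennreal (ur t)"
  shows "integrable (clamped t) (\<lambda>x. (norm (c t x))\<^sup>2)" "(\<integral>x. (norm (c t x))\<^sup>2 \<partial>clamped t) = ur t"
    "integrable (clamped t) (\<lambda>x. (norm x)\<^sup>2 + (norm (c t x))\<^sup>2)"
    "integrable (clamped t) (\<lambda>x. x \<bullet> c t x)"
proof -
  note [measurable_cong] = P2D(2)[OF clamped_P2[of t]]
  have ur0: "ur t \<ge> 0" by (simp add: ur_def)
  have hb: "has_bochner_integral (clamped t) (\<lambda>x. (norm (c t x))\<^sup>2) (ur t)"
    by (rule has_bochner_integral_nn_integral) (use assms ur0 in \<open>auto simp: u_def\<close>)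
  then show i: "integrable (clamped t) (\<lambda>x. (norm (c t x))\<^sup>2)" "(\<integral>x. (norm (c t x))\<^sup>2 \<partial>clamped t) = ur t"
    by (auto simp: has_bochner_integral_iff)
  show i2: "integrable (clamped t) (\<lambda>x. (norm x)\<^sup>2 + (norm (c t x))\<^sup>2)"
    using i(1) P2D(4)[OF clamped_P2[of t]] by simp
  have "\<bar>x \<bullet> c t x\<bar> \<le> (norm x)\<^sup>2 + (norm (c t x))\<^sup>2" for x
    using Cauchy_Schwarz_ineq2[of x "c t x"] sum_squares_bound[of "norm x" "norm (c t x)"]
      mult_nonneg_nonneg[OF norm_ge_zero[of x] norm_ge_zero[of "c t x"]] by linarith
  then show "integrable (clamped t) (\<lambda>x. x \<bullet> c t x)"
    by (intro Bochner_Integration.integrable_bound[OF i2]) auto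
qed

text \<open>Integrate |c - r x|^2 \<ge> 0. The kinetic energy is thereby bounded below by an
  expression linear in \<open>m\<close> and \<open>k\<close>; r will be the value of p at that
  time.\<close>

lemma k_bound: "u t = ennreal (ur t) \<Longrightarrow> 2 * r * k t - r\<^sup>2 * m t \<le> ur t"
proof -
  assume h: "u t = ennreal (ur t)"
  note s = slice[OF h]
  note [measurable_cong] = P2D(2)[OF clamped_P2[of t]]
  have "2 * r * k t - r\<^sup>2 * m t = (\<integral>x. 2 * r * (x \<bullet> c t x) - r\<^sup>2 * (norm x)\<^sup>2 \<partial>clamped t)"
    using s(4) P2D(4)[OF clamped_P2[of t]] by (simp add: k_def m_def)
  also have "\<dots> \<le> (\<integral>x. (norm (c t x))\<^sup>2 \<partial>clamped t)"
  proof (rule integral_mono[OF _ s(1)])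
    show "integrable (clamped t) (\<lambda>x. 2 * r * (x \<bullet> c t x) - r\<^sup>2 * (norm x)\<^sup>2)"
      using s(4) P2D(4)[OF clamped_P2[of t]] by simp
    show "2 * r * (x \<bullet> c t x) - r\<^sup>2 * (norm x)\<^sup>2 \<le> (norm (c t x))\<^sup>2" for x
      using inner_ge_zero[of "c t x - r *\<^sub>R x"]
      by (simp add: power2_norm_eq_inner inner_diff inner_commute power2_eq_square[of r] algebra_simps)
  qed
  finally show ?thesis by (simp add: s(2))
qed

lemma k_abs_bound: "u t = ennreal (ur t) \<Longrightarrow> \<bar>k t\<bar> \<le> m t + ur t"
proof -
  assume h: "u t = ennreal (ur t)"
  have "m t \<ge> 0" "ur t \<ge> 0" by (auto simp: m_def ur_def)
  then show ?thesis using k_bound[OF h, of 1] k_bound[OF h, of "- 1"] by simp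
qed

lemma m_integrable: "continuous_on {0..\<tau>} f \<Longrightarrow> integrable lborel (\<lambda>t. indicator {0..\<tau>} t * (f t :: real))"
  using borel_integrable_compact[OF compact_Icc, of 0 \<tau> f] by simp

lemma k_integrable: "integrable lborel (\<lambda>t. indicator {0..\<tau>} t * k t)"
proof (rule Bochner_Integration.integrable_bound)
  show "integrable lborel (\<lambda>t. indicator {0..\<tau>} t * m t + indicator {0..\<tau>} t * ur t)"
    by (intro Bochner_Integration.integrable_add ur_integrable m_integrable continuous_on_subset[OF m_continuous]) auto
  show "AE t in lborel. norm (indicator {0..\<tau>} t * k t) \<le> norm (indicator {0..\<tau>} t * m t + indicator {0..\<tau>} t * ur t)"
    using AE_u by eventually_elim (use k_abs_bound in \<open>force simp: indicator_def\<close>)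
qed measurable

text \<open>The continuity equation is tested with a bump in time multiplied by a compactly
  supported version of |x|^2, and then the spatial cutoff is removed. Dominated convergence acts in
  space at almost every time, and afterwards in time.\<close>

lemma weak_moment_equation:
  assumes \<kappa>: "\<kappa> > 0" and ab: "0 < a" "a < b" "b < \<tau>"
  shows "(\<integral>t. indicator {0..\<tau>} t * (wbump' \<kappa> a b t * m t + 2 * wbump \<kappa> a b t * k t) \<partial>lborel) = 0"
proof -
  define E where "E n t = (\<integral>x. wbump' \<kappa> a b t * cut_sq n x + wbump \<kappa> a b t * cut_sq' n x (c t x) \<partial>clamped t)" for n t
  have [measurable]: "wbump \<kappa> a b \<in> borel_measurable borel" "wbump' \<kappa> a b \<in> borel_measurable borel"
    using DERIV_isCont[OF wbump_DERIV]
    by (auto intro!: borel_measurable_continuous_onI continuous_on_wbump' intro: continuous_at_imp_continuous_on)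
  have [measurable]: "(cut_sq n :: 'a \<Rightarrow> real) \<in> borel_measurable borel" for n
    unfolding cut_sq_def[abs_def] using smooth_measurable[OF smooth_cutoff] by measurable
  have [measurable]: "bump_deriv 1 \<in> borel_measurable borel"
    using isCont_bump_deriv by (intro borel_measurable_continuous_onI continuous_at_imp_continuous_on) auto
  have [measurable]: "(cutoff R :: 'a \<Rightarrow> real) \<in> borel_measurable borel" for R
    by (rule smooth_measurable[OF smooth_cutoff])
  have [measurable]: "(\<lambda>z. cut_sq' n (snd z) (c (fst z) (snd z))) \<in> borel_measurable (borel \<Otimes>\<^sub>M borel)" for n
    unfolding cut_sq'_def by measurable
  have [measurable]: "(\<lambda>x. cut_sq' n x (c t x)) \<in> borel_measurable borel" for n t
    unfolding cut_sq'_def by measurable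
  have Em[measurable]: "E n \<in> borel_measurable borel" for n
    unfolding E_def[abs_def] by (rule clamped_integral_measurable) measurable
  have zero: "(\<integral>t. indicator {0..\<tau>} t * E n t \<partial>lborel) = 0" for n
  proof -
    have "(LBINT t:{0..\<tau>}. (\<integral>x. frechet_derivative (\<lambda>z. wbump \<kappa> a b (fst z) * cut_sq n (snd z)) (at (t, x)) (1, c t x) \<partial>\<rho> t)) = 0"
      using ce test_function_space_time[OF \<kappa> ab] unfolding continuity_equation_def by blast
    then have "(\<integral>t. indicator {0..\<tau>} t * (\<integral>x. wbump' \<kappa> a b t * cut_sq n x + wbump \<kappa> a b t * cut_sq' n x (c t x) \<partial>\<rho> t) \<partial>lborel) = 0"
      unfolding test_function_space_time_derivative set_lebesgue_integral_def by simp
    moreover have "indicator {0..\<tau>} t * (\<integral>x. wbump' \<kappa> a b t * cut_sq n x + wbump \<kappa> a b t * cut_sq' n x (c t x) \<partial>\<rho> t) = indicator {0..\<tau>} t * E n t" for t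
      by (auto simp: E_def clamped_eq indicator_def)
    ultimately show ?thesis by simp
  qed
  obtain C where C: "C \<ge> 0" "\<And>n x w. \<bar>cut_sq' n x (w::'a)\<bar> \<le> C * ((norm x)\<^sup>2 + (norm w)\<^sup>2)"
    using cut_sq'_bound[where 'a='a] by metis
  have "compact (wbump' \<kappa> a b ` {0..\<tau>})"
    by (intro compact_continuous_image compact_Icc continuous_on_wbump')
  then obtain D where D: "D > 0" "\<And>y. y \<in> wbump' \<kappa> a b ` {0..\<tau>} \<Longrightarrow> norm y \<le> D"
    using bounded_pos compact_imp_bounded by metis
  have pt: "\<bar>wbump' \<kappa> a b t * cut_sq n x + wbump \<kappa> a b t * cut_sq' n x (c t x)\<bar>
      \<le> (D + C) * ((norm x)\<^sup>2 + (norm (c t x))\<^sup>2)" if t: "t \<in> {0..\<tau>}" for n t x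
  proof -
    have "\<bar>wbump' \<kappa> a b t * cut_sq n x\<bar> \<le> D * ((norm x)\<^sup>2 + (norm (c t x))\<^sup>2)"
      unfolding abs_mult using D t cut_sq_bound[of n x] by (intro mult_mono) (auto intro: order_trans)
    moreover have "\<bar>wbump \<kappa> a b t * cut_sq' n x (c t x)\<bar> \<le> 1 * (C * ((norm x)\<^sup>2 + (norm (c t x))\<^sup>2))"
      unfolding abs_mult using wbump_bounds[of \<kappa> a b t] C by (intro mult_mono) auto
    ultimately show ?thesis by (simp add: distrib_right)
  qed
  have "(\<lambda>n. \<integral>t. indicator {0..\<tau>} t * E n t \<partial>lborel)
      \<longlonglongrightarrow> (\<integral>t. indicator {0..\<tau>} t * (wbump' \<kappa> a b t * m t + 2 * wbump \<kappa> a b t * k t) \<partial>lborel)"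
  proof (rule integral_dominated_convergence)
    show "integrable lborel (\<lambda>t. (D + C) * (indicator {0..\<tau>} t * m t + indicator {0..\<tau>} t * ur t))"
      by (intro integrable_mult_right Bochner_Integration.integrable_add ur_integrable m_integrable continuous_on_subset[OF m_continuous]) auto
    show "AE t in lborel. norm (indicator {0..\<tau>} t * E n t) \<le> (D + C) * (indicator {0..\<tau>} t * m t + indicator {0..\<tau>} t * ur t)" for n
      using AE_u
    proof eventually_elim
      case (elim t)
      show ?case
      proof (cases "t \<in> {0..\<tau>}")
        case True
        note s = slice[OF elim[rule_format, OF True]]
        note [measurable_cong] = P2D(2)[OF clamped_P2[of t]]
        have "\<bar>E n t\<bar> \<le> (\<integral>x. \<bar>wbump' \<kappa> a b t * cut_sq n x + wbump \<kappa> a b t * cut_sq' n x (c t x)\<bar> \<partial>clamped t)"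
          unfolding E_def by (rule integral_abs_bound)
        also have "\<dots> \<le> (\<integral>x. (D + C) * ((norm x)\<^sup>2 + (norm (c t x))\<^sup>2) \<partial>clamped t)"
          using s(3) D C by (intro integral_mono') (auto intro: pt[OF True])
        also have "\<dots> = (D + C) * (m t + ur t)"
          using s(1,2) P2D(4)[OF clamped_P2[of t]] by (simp add: m_def)
        finally show ?thesis using True by simp
      qed simp
    qed
    show "AE t in lborel. (\<lambda>n. indicator {0..\<tau>} t * E n t) \<longlonglongrightarrow> indicator {0..\<tau>} t * (wbump' \<kappa> a b t * m t + 2 * wbump \<kappa> a b t * k t)"
      using AE_u
    proof eventually_elim
      case (elim t)
      show ?case
      proof (cases "t \<in> {0..\<tau>}")
        case True
        note s = slice[OF elim[rule_format, OF True]]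
        note [measurable_cong] = P2D(2)[OF clamped_P2[of t]]
        have "(\<lambda>n. E n t) \<longlonglongrightarrow> (\<integral>x. wbump' \<kappa> a b t * (norm x)\<^sup>2 + wbump \<kappa> a b t * (2 * (x \<bullet> c t x)) \<partial>clamped t)"
          unfolding E_def
        proof (rule integral_dominated_convergence)
          show "integrable (clamped t) (\<lambda>x. (D + C) * ((norm x)\<^sup>2 + (norm (c t x))\<^sup>2))"
            by (intro integrable_mult_right s(3))
          show "AE x in clamped t. (\<lambda>n. wbump' \<kappa> a b t * cut_sq n x + wbump \<kappa> a b t * cut_sq' n x (c t x))
              \<longlonglongrightarrow> wbump' \<kappa> a b t * (norm x)\<^sup>2 + wbump \<kappa> a b t * (2 * (x \<bullet> c t x))"
            by (intro AE_I2 tendsto_intros cut_sq_tendsto)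
        qed (use pt[OF True] in auto)
        also have "(\<integral>x. wbump' \<kappa> a b t * (norm x)\<^sup>2 + wbump \<kappa> a b t * (2 * (x \<bullet> c t x)) \<partial>clamped t)
            = wbump' \<kappa> a b t * m t + 2 * wbump \<kappa> a b t * k t"
          using s(4) P2D(4)[OF clamped_P2[of t]] by (simp add: m_def k_def)
        finally show ?thesis by (intro tendsto_mult_left)
      qed simp
    qed
  qed measurable
  then show ?thesis unfolding zero by (simp add: LIMSEQ_const_iff)
qed

end

section \<open>Lower bound for the action and uniqueness\<close>

lemma smooth_derivative_Basis:
  assumes "smooth \<phi>" "e \<in> Basis"
  shows "smooth (\<lambda>x. frechet_derivative \<phi> (at x) e)"
  unfolding smooth_def
proof
  fix k
  have "Ck (Suc k) \<phi>" using assms(1) by (simp only: smooth_def)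
  then show "Ck k (\<lambda>x. frechet_derivative \<phi> (at x) e)" using assms(2) by (rule Ck_SucE(2))
qed

lemma test_functions_derivative_Basis:
  assumes "\<phi> \<in> test_functions UNIV" "e \<in> Basis"
  shows "(\<lambda>x. frechet_derivative \<phi> (at x) e) \<in> test_functions UNIV"
proof -
  obtain R where "\<And>x w. norm x > R \<Longrightarrow> frechet_derivative \<phi> (at x) w = 0"
    using test_functions_support[OF assms(1)] by metis
  then show ?thesis
    using smooth_derivative_Basis[OF test_functions_smooth[OF assms(1)] assms(2)] by (intro test_functionsI[of _ R]) auto
qed

lemma ennreal_integral_le_nn_integral:
  assumes "integrable M f" shows "ennreal (\<integral>x. f x \<partial>M) \<le> (\<integral>\<^sup>+x. ennreal (f x) \<partial>M)"
proof -
  have "ennreal (\<integral>x. f x \<partial>M) \<le> ennreal (\<integral>x. max 0 (f x) \<partial>M)"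
    using assms by (intro ennreal_leI integral_mono) auto
  also have "\<dots> = (\<integral>\<^sup>+x. ennreal (max 0 (f x)) \<partial>M)"
    using assms by (subst nn_integral_eq_integral) auto
  finally show ?thesis by simp
qed

context finite_action_curve
begin

text \<open>The time bump in \<open>weak_moment_equation\<close> is sharpened; the continuity of
  \<open>m\<close> is what permits point evaluation in the limit.\<close>

lemma moment_identity_interior:
  assumes ab: "0 < a" "a < b" "b < \<tau>"
  shows "m b - m a = 2 * (\<integral>t. indicator {a<..<b} t * k t \<partial>lborel)"
proof -
  let ?w = "\<lambda>n. wbump (real (Suc n)) a b" and ?w' = "\<lambda>n. wbump' (real (Suc n)) a b"
  have [measurable]: "wbump \<kappa> a b \<in> borel_measurable borel" for \<kappa>
    using DERIV_isCont[OF wbump_DERIV] by (auto intro!: borel_measurable_continuous_onI intro: continuous_at_imp_continuous_on)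
  have i1: "integrable lborel (\<lambda>t. indicator {0..\<tau>} t * (?w' n t * m t))" for n
    by (intro m_integrable continuous_on_mult continuous_on_wbump' continuous_on_subset[OF m_continuous]) auto
  have bd: "\<bar>indicator {0..\<tau>} t * (?w n t * k t)\<bar> \<le> \<bar>indicator {0..\<tau>} t * k t\<bar>" for n t
    using wbump_bounds[of "real (Suc n)" a b t] by (auto simp: indicator_def abs_mult mult_left_le_one_le)
  have i2: "integrable lborel (\<lambda>t. indicator {0..\<tau>} t * (?w n t * k t))" for n
    by (rule Bochner_Integration.integrable_bound[OF k_integrable]) (use bd in auto)
  have eq: "(\<integral>t. (?w' n t * m t) * indicator {a..b} t \<partial>lborel) + 2 * (\<integral>t. indicator {0..\<tau>} t * (?w n t * k t) \<partial>lborel) = 0" for n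
  proof -
    have "0 = (\<integral>t. indicator {0..\<tau>} t * (?w' n t * m t) + 2 * (indicator {0..\<tau>} t * (?w n t * k t)) \<partial>lborel)"
      using weak_moment_equation[OF _ ab, of "real (Suc n)"] by (simp add: distrib_left mult_ac)
    also have "\<dots> = (\<integral>t. indicator {0..\<tau>} t * (?w' n t * m t) \<partial>lborel) + 2 * (\<integral>t. indicator {0..\<tau>} t * (?w n t * k t) \<partial>lborel)"
      using i1 i2 by simp
    also have "(\<integral>t. indicator {0..\<tau>} t * (?w' n t * m t) \<partial>lborel) = (\<integral>t. (?w' n t * m t) * indicator {a..b} t \<partial>lborel)"
    proof (rule Bochner_Integration.integral_cong[OF refl])
      fix t
      show "indicator {0..\<tau>} t * (?w' n t * m t) = (?w' n t * m t) * indicator {a..b} t"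
      proof (cases "t \<in> {a..b}")
        case False
        have "(t - a) * (b - t) \<le> 0"
        proof (cases "t \<le> a")
          case True
          then show ?thesis using ab by (intro mult_nonpos_nonneg) auto
        next
          case False
          then show ?thesis using \<open>t \<notin> {a..b}\<close> by (intro mult_nonneg_nonpos) auto
        qed
        then have "real (Suc n) * ((t - a) * (b - t)) \<le> 0" by (intro mult_nonneg_nonpos[OF of_nat_0_le_iff])
        then have "?w' n t = 0" unfolding wbump'_def bump_deriv_def by (simp del: of_nat_Suc)
        then show ?thesis by simp
      qed (use ab in auto)
    qed
    finally show ?thesis by simp
  qed
  have L: "(\<lambda>n. \<integral>t. indicator {0..\<tau>} t * (?w n t * k t) \<partial>lborel) \<longlonglongrightarrow> (\<integral>t. indicator {a<..<b} t * k t \<partial>lborel)"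
  proof (rule integral_dominated_convergence[OF _ _ integrable_abs[OF k_integrable]])
    show "AE t in lborel. (\<lambda>n. indicator {0..\<tau>} t * (?w n t * k t)) \<longlonglongrightarrow> indicator {a<..<b} t * k t"
    proof (rule AE_I2)
      fix t
      show "(\<lambda>n. indicator {0..\<tau>} t * (?w n t * k t)) \<longlonglongrightarrow> indicator {a<..<b} t * k t"
      proof (cases "t \<in> {a<..<b}")
        case True
        have "(\<lambda>n. indicator {0..\<tau>} t * (?w n t * k t)) \<longlonglongrightarrow> indicator {0..\<tau>} t * (1 * k t)"
          by (intro tendsto_intros wbump_tendsto True)
        then show ?thesis using True ab by simp
      next
        case False
        then show ?thesis using wbump_eq_0[of "real (Suc n)" a b t for n] ab by (simp del: of_nat_Suc)
      qed
    qed
  qed (use bd in auto)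
  have "(\<lambda>n. (\<integral>t. (?w' n t * m t) * indicator {a..b} t \<partial>lborel) + 2 * (\<integral>t. indicator {0..\<tau>} t * (?w n t * k t) \<partial>lborel))
     \<longlonglongrightarrow> (m a - m b) + 2 * (\<integral>t. indicator {a<..<b} t * k t \<partial>lborel)"
    by (intro tendsto_intros wbump'_concentration m_continuous L ab)
  then show ?thesis unfolding eq by (simp add: LIMSEQ_const_iff)
qed

text \<open>Test functions have their support in the open interval (0, \<tau>), so the end points
  are reached by shrinking a margin and using the continuity of \<open>m\<close>.\<close>

lemma moment_identity:
  assumes b: "b \<in> {0..\<tau>}"
  shows "m b - m 0 = 2 * (\<integral>t. indicator {0..b} t * k t \<partial>lborel)"
proof (cases "b = 0")
  case True
  have "(\<integral>t. indicator {0..b} t * k t \<partial>lborel) = (\<integral>t. 0 \<partial>(lborel :: real measure))"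
  proof (rule integral_cong_AE)
    show "AE t in lborel. indicator {0..b} t * k t = 0"
      using AE_lborel_singleton[of 0] by eventually_elim (auto simp: True indicator_def)
  qed auto
  then show ?thesis using True by simp
next
  case False
  then have b: "0 < b" "b \<le> \<tau>" using b by auto
  \<comment> \<open>The factor 1 / 3 keeps \<open>r n\<close> below \<open>b - r n\<close> for every
    n.\<close>
  define r where "r n = b * inverse (real (Suc n)) / 3" for n
  have r0: "(\<lambda>n. r n) \<longlonglongrightarrow> b * 0 / 3" unfolding r_def by (intro tendsto_intros LIMSEQ_inverse_real_of_nat) auto
  have r: "0 < r n" "r n \<le> b / 3" for n
  proof -
    have "inverse (real (Suc n)) \<le> 1" by (simp add: inverse_eq_divide)
    then have "b * inverse (real (Suc n)) \<le> b * 1" using b by (intro mult_left_mono) auto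
    then show "0 < r n" "r n \<le> b / 3" using b by (auto simp: r_def)
  qed
  have lt: "r n < b - r n" "b - r n < \<tau>" for n using r[of n] b by linarith+
  have eq: "m (b - r n) - m (0 + r n) = 2 * (\<integral>t. indicator {r n<..<b - r n} t * k t \<partial>lborel)" for n
    using moment_identity_interior[OF r(1) lt] by simp
  have ctm: "(\<lambda>n. m (f n)) \<longlonglongrightarrow> m l" if "f \<longlonglongrightarrow> l" for f l
    using m_continuous that by (intro isCont_tendsto_compose[of l m]) (auto simp: continuous_on_eq_continuous_at)
  have L: "(\<lambda>n. \<integral>t. indicator {r n<..<b - r n} t * k t \<partial>lborel) \<longlonglongrightarrow> (\<integral>t. indicator {0<..<b} t * k t \<partial>lborel)"
  proof (rule integral_dominated_convergence[OF _ _ integrable_abs[OF k_integrable]])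
    show "AE t in lborel. (\<lambda>n. indicator {r n<..<b - r n} t * k t) \<longlonglongrightarrow> indicator {0<..<b} t * k t"
    proof (rule AE_I2)
      fix t
      show "(\<lambda>n. indicator {r n<..<b - r n} t * k t) \<longlonglongrightarrow> indicator {0<..<b} t * k t"
      proof (cases "t \<in> {0<..<b}")
        case True
        have "\<forall>\<^sub>F n in sequentially. r n < t" using order_tendstoD(2)[OF r0, of t] True by simp
        moreover have "\<forall>\<^sub>F n in sequentially. r n < b - t" using order_tendstoD(2)[OF r0, of "b - t"] True by simp
        ultimately have "\<forall>\<^sub>F n in sequentially. indicator {r n<..<b - r n} t * k t = indicator {0<..<b} t * k t"
          by eventually_elim (use True in auto)
        then show ?thesis by (rule tendsto_eventually)
      next
        case False
        then have "t \<notin> {r n<..<b - r n}" for n using r(1)[of n] by auto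
        then show ?thesis using False by simp
      qed
    qed
    show "AE t in lborel. norm (indicator {r n<..<b - r n} t * k t) \<le> \<bar>indicator {0..\<tau>} t * k t\<bar>" for n
      using r[of n] b by (auto simp: indicator_def)
  qed measurable
  have "(\<lambda>n. m (b - r n) - m (0 + r n)) \<longlonglongrightarrow> m (b - b * 0 / 3) - m (0 + b * 0 / 3)"
    by (intro tendsto_diff ctm tendsto_const r0 tendsto_add)
  moreover have "(\<lambda>n. m (b - r n) - m (0 + r n)) \<longlonglongrightarrow> 2 * (\<integral>t. indicator {0<..<b} t * k t \<partial>lborel)"
    unfolding eq by (intro tendsto_intros L)
  ultimately have "m b - m 0 = 2 * (\<integral>t. indicator {0<..<b} t * k t \<partial>lborel)"
    by (simp add: LIMSEQ_unique)
  also have "(\<integral>t. indicator {0<..<b} t * k t \<partial>lborel) = (\<integral>t. indicator {0..b} t * k t \<partial>lborel)"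
  proof (rule integral_cong_AE)
    show "AE t in lborel. indicator {0<..<b} t * k t = indicator {0..b} t * k t"
      using AE_lborel_singleton[of 0] AE_lborel_singleton[of b] by eventually_elim (auto simp: indicator_def)
  qed measurable
  finally show ?thesis .
qed

text \<open>Integration by parts when \<open>m\<close> is known only through the integral of
  \<open>k\<close>: Fubini for k(t) p'(r) on the triangle t \<le> r takes the place of
  differentiating \<open>m\<close>.\<close>

lemma moment_by_parts:
  fixes p p' :: "real \<Rightarrow> real"
  assumes p: "\<And>t. t \<in> {0..\<tau>} \<Longrightarrow> (p has_real_derivative p' t) (at t)"
    and p': "\<And>t. t \<in> {0..\<tau>} \<Longrightarrow> isCont p' t"
  shows "integrable lborel (\<lambda>t. indicator {0..\<tau>} t * (p t * k t))"
    "2 * (\<integral>t. indicator {0..\<tau>} t * (p t * k t) \<partial>lborel)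
      = p \<tau> * m \<tau> - p 0 * m 0 - (\<integral>t. indicator {0..\<tau>} t * (p' t * m t) \<partial>lborel)"
proof -
  define kk where "kk t = indicator {0..\<tau>} t * k t" for t
  define q where "q r = indicator {0..\<tau>} r * p' r" for r
  have p'c: "continuous_on {0..\<tau>} p'" using p' by (intro continuous_at_imp_continuous_on) auto
  have pc: "continuous_on {0..\<tau>} p" using p by (intro DERIV_continuous_on) (auto intro: DERIV_subset)
  have kki: "integrable lborel kk" unfolding kk_def[abs_def] by (rule k_integrable)
  have qi: "integrable lborel q" unfolding q_def[abs_def] by (rule m_integrable[OF p'c])
  note [measurable] = borel_measurable_integrable[OF kki, simplified] borel_measurable_integrable[OF qi, simplified]
  define f where "f t r = kk t * (if t \<le> r then q r else 0)" for t r
  have fm[measurable]: "(\<lambda>(t, r). f t r) \<in> borel_measurable (lborel \<Otimes>\<^sub>M lborel)"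
    unfolding f_def by measurable
  have qq: "integrable lborel (\<lambda>r. if t \<le> r then q r else 0)" for t
    by (rule Bochner_Integration.integrable_bound[OF qi]) auto
  have fi: "integrable lborel (\<lambda>r. f t r)" for t
    unfolding f_def by (intro integrable_mult_right qq)
  have int: "integrable (lborel \<Otimes>\<^sub>M lborel) (\<lambda>(t, r). f t r)"
  proof (rule lborel_pair.Fubini_integrable)
    show "integrable lborel (\<lambda>t. \<integral>r. norm (case (t, r) of (t, r) \<Rightarrow> f t r) \<partial>lborel)"
    proof (rule Bochner_Integration.integrable_bound)
      show "integrable lborel (\<lambda>t. \<bar>kk t\<bar> * (\<integral>r. \<bar>q r\<bar> \<partial>lborel))" using kki by auto
      have "(\<integral>r. \<bar>f t r\<bar> \<partial>lborel) \<le> \<bar>kk t\<bar> * (\<integral>r. \<bar>q r\<bar> \<partial>lborel)" for t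
      proof -
        have "(\<integral>r. \<bar>f t r\<bar> \<partial>lborel) \<le> (\<integral>r. \<bar>kk t\<bar> * \<bar>q r\<bar> \<partial>lborel)"
          by (intro integral_mono integrable_abs fi integrable_mult_right qi) (auto simp: f_def abs_mult)
        then show ?thesis by simp
      qed
      then show "AE t in lborel. norm (\<integral>r. norm (case (t, r) of (t, r) \<Rightarrow> f t r) \<partial>lborel) \<le> norm (\<bar>kk t\<bar> * (\<integral>r. \<bar>q r\<bar> \<partial>lborel))"
        by (auto simp: abs_of_nonneg intro: order_trans[OF _ abs_ge_self])
    qed measurable
  qed (use fm fi in auto)
  have inner1: "(\<integral>r. f t r \<partial>lborel) = kk t * (p \<tau> - p t)" for t
  proof (cases "t \<in> {0..\<tau>}")
    case True
    have "(\<integral>r. p' r * indicator {t..\<tau>} r \<partial>lborel) = p \<tau> - p t"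
      using True by (intro integral_FTC_Icc_real p p') auto
    moreover have "f t r = kk t * (p' r * indicator {t..\<tau>} r)" for r
      using True by (auto simp: f_def q_def indicator_def)
    ultimately show ?thesis by simp
  qed (simp add: f_def kk_def)
  have inner2: "(\<integral>t. f t r \<partial>lborel) = q r * ((m r - m 0) / 2)" for r
  proof (cases "r \<in> {0..\<tau>}")
    case True
    have "f t r = q r * (indicator {0..r} t * k t)" for t
      using True by (auto simp: f_def kk_def indicator_def)
    then show ?thesis using moment_identity[OF True] by simp
  next
    case False
    then have "q r = 0" by (simp add: q_def)
    then have "f t r = 0" for t by (cases "t \<le> r") (simp_all add: f_def)
    then show ?thesis using \<open>q r = 0\<close> by simp
  qed
  have pki: "integrable lborel (\<lambda>t. p t * kk t)"
  proof -
    have "compact (p ` {0..\<tau>})" by (intro compact_continuous_image compact_Icc pc)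
    then obtain P where P: "P > 0" "\<And>y. y \<in> p ` {0..\<tau>} \<Longrightarrow> norm y \<le> P"
      using bounded_pos compact_imp_bounded by metis
    have "integrable lborel (\<lambda>t. indicator {0..\<tau>} t * p t)" by (rule m_integrable[OF pc])
    note [measurable] = borel_measurable_integrable[OF this, simplified]
    have eq: "p t * kk t = (indicator {0..\<tau>} t * p t) * kk t" for t by (simp add: kk_def indicator_def)
    show ?thesis
      unfolding eq
    proof (rule Bochner_Integration.integrable_bound[OF integrable_mult_right[OF kki, of P]])
      have "\<bar>indicator {0..\<tau>} t * p t * kk t\<bar> \<le> \<bar>P * kk t\<bar>" for t
        using P(1) P(2)[of "p t"] by (cases "t \<in> {0..\<tau>}") (auto simp: abs_mult intro!: mult_right_mono)
      then show "AE t in lborel. norm (indicator {0..\<tau>} t * p t * kk t) \<le> norm (P * kk t)" by simp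
    qed measurable
  qed
  have pk_eq: "indicator {0..\<tau>} t * (p t * k t) = p t * kk t" for t by (simp add: kk_def indicator_def)
  show "integrable lborel (\<lambda>t. indicator {0..\<tau>} t * (p t * k t))" unfolding pk_eq by (rule pki)
  have qmi: "integrable lborel (\<lambda>r. q r * m r)"
  proof -
    have "integrable lborel (\<lambda>r. indicator {0..\<tau>} r * (p' r * m r))"
      by (intro m_integrable continuous_on_mult p'c continuous_on_subset[OF m_continuous]) auto
    then show ?thesis by (simp add: q_def mult.assoc)
  qed
  have "(\<integral>t. kk t * (p \<tau> - p t) \<partial>lborel) = (\<integral>r. q r * ((m r - m 0) / 2) \<partial>lborel)"
    using lborel_pair.Fubini_integral[OF int] unfolding inner1 inner2 by simp
  moreover have "(\<integral>t. kk t * (p \<tau> - p t) \<partial>lborel) = p \<tau> * (\<integral>t. kk t \<partial>lborel) - (\<integral>t. p t * kk t \<partial>lborel)"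
    using kki pki by (simp add: right_diff_distrib mult.commute)
  moreover have "(\<integral>t. kk t \<partial>lborel) = (m \<tau> - m 0) / 2"
    using moment_identity[of \<tau>] tau by (simp add: kk_def)
  moreover have "(\<integral>r. q r * ((m r - m 0) / 2) \<partial>lborel) = ((\<integral>r. q r * m r \<partial>lborel) - m 0 * (p \<tau> - p 0)) / 2"
  proof -
    have "(\<integral>r. q r \<partial>lborel) = p \<tau> - p 0"
      using integral_FTC_Icc_real[of 0 \<tau> p p'] p p' tau by (simp add: q_def mult.commute)
    moreover have "(\<integral>r. q r * ((m r - m 0) / 2) \<partial>lborel) = (\<integral>r. (q r * m r - m 0 * q r) / 2 \<partial>lborel)"
      by (intro Bochner_Integration.integral_cong) (auto simp: algebra_simps)
    moreover have "(\<integral>r. (q r * m r - m 0 * q r) / 2 \<partial>lborel) = ((\<integral>r. q r * m r \<partial>lborel) - m 0 * (\<integral>r. q r \<partial>lborel)) / 2"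
      using qmi qi by simp
    ultimately show ?thesis by simp
  qed
  ultimately show "2 * (\<integral>t. indicator {0..\<tau>} t * (p t * k t) \<partial>lborel)
      = p \<tau> * m \<tau> - p 0 * m 0 - (\<integral>t. indicator {0..\<tau>} t * (p' t * m t) \<partial>lborel)"
    unfolding pk_eq by (simp add: q_def[abs_def] mult.assoc algebra_simps)
qed

text \<open>The defect in the Gaussian integration by parts formula for variance \<open>S t\<close>;
  it is 0 for all \<zeta> and e exactly when the measure at time t is that Gaussian.\<close>

definition stein :: "(real \<Rightarrow> real) \<Rightarrow> ('a \<Rightarrow> real) \<Rightarrow> 'a \<Rightarrow> real \<Rightarrow> real" where
  "stein S \<zeta> e t = (\<integral>x. frechet_derivative \<zeta> (at x) e - \<zeta> x * (x \<bullet> e) / S t \<partial>clamped t)"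

lemma test_function_integrable:
  assumes "\<phi> \<in> test_functions UNIV" shows "integrable (clamped t) \<phi>"
proof -
  obtain C where "\<And>x. \<bar>\<phi> x\<bar> \<le> C" using test_functions_bound[OF assms] by metis
  moreover interpret prob_space "clamped t" using P2D(1)[OF clamped_P2] .
  note [measurable_cong] = P2D(2)[OF clamped_P2[of t]]
  ultimately show ?thesis
    using smooth_measurable[OF test_functions_smooth[OF assms]] by (intro integrable_const_bound[of _ C]) auto
qed

lemma stein_continuous:
  assumes S: "\<And>t. t \<in> {0..\<tau>} \<Longrightarrow> S t > 0" "continuous_on {0..\<tau>} S"
    and \<zeta>: "\<zeta> \<in> test_functions UNIV" and e: "e \<in> Basis"
  shows "continuous_on {0..\<tau>} (stein S \<zeta> e)"
proof -
  note t1 = test_functions_derivative_Basis[OF \<zeta> e] and t2 = test_functions_mult[OF \<zeta> smooth_inner[of e]]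
  have eq: "stein S \<zeta> e t = (\<integral>x. frechet_derivative \<zeta> (at x) e \<partial>\<rho> t) - (\<integral>x. \<zeta> x * (x \<bullet> e) \<partial>\<rho> t) / S t" if "t \<in> {0..\<tau>}" for t
    using test_function_integrable[OF t1, of t] test_function_integrable[OF t2, of t] clamped_eq[OF that]
    by (simp add: stein_def)
  have "continuous_on {0..\<tau>} (\<lambda>t. (\<integral>x. frechet_derivative \<zeta> (at x) e \<partial>\<rho> t) - (\<integral>x. \<zeta> x * (x \<bullet> e) \<partial>\<rho> t) / S t)"
    using S(1) by (intro continuous_intros continuous_integral_test_function t1 t2 S(2)) force
  then show ?thesis by (rule continuous_on_eq) (simp add: eq)
qed

text \<open>A calibration argument. At almost every time the kinetic energy is at least 2 p k - p^2
  m, and the Fisher information is at least 2 d / S - m / S^2 plus the gain from the perturbation.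
  Once 2 p k is integrated by parts, the Riccati equation for p cancels all terms with
  \<open>m\<close> inside the interval, and only the end-point moments remain.\<close>

lemma action_lower_bound:
  fixes S p :: "real \<Rightarrow> real"
  assumes S: "\<And>t. t \<in> {0..\<tau>} \<Longrightarrow> S t > 0" "\<And>t. t \<in> {0..\<tau>} \<Longrightarrow> isCont S t"
    and p: "\<And>t. t \<in> {0..\<tau>} \<Longrightarrow> (p has_real_derivative (- (p t)\<^sup>2 - \<alpha>\<^sup>2 / 4 / (S t)\<^sup>2)) (at t)"
    and \<zeta>: "\<zeta> \<in> test_functions UNIV" and e: "e \<in> Basis"
  defines "B \<equiv> stein S \<zeta> e" and "C \<equiv> \<lambda>t. \<integral>x. (\<zeta> x)\<^sup>2 * (norm e)\<^sup>2 \<partial>clamped t"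
  shows "ennreal (1 / 2 * (p \<tau> * m \<tau> - p 0 * m 0 + \<alpha>\<^sup>2 / 4 * (\<integral>t. indicator {0..\<tau>} t * (2 * real DIM('a) / S t) \<partial>lborel)
      + \<alpha>\<^sup>2 / 4 * (\<integral>t. indicator {0..\<tau>} t * (2 * \<delta> * (B t)\<^sup>2 - \<delta>\<^sup>2 * (B t)\<^sup>2 * C t) \<partial>lborel)))
    \<le> dynamic_action \<alpha> \<tau> (\<rho>, c)"
proof -
  have Sc: "continuous_on {0..\<tau>} S" using S(2) by (intro continuous_at_imp_continuous_on) auto
  have pc: "continuous_on {0..\<tau>} p" using p by (intro DERIV_continuous_on) (auto intro: DERIV_subset)
  have Bc: "continuous_on {0..\<tau>} B" unfolding B_def by (rule stein_continuous[OF S(1) Sc \<zeta> e])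
  have mc: "continuous_on {0..\<tau>} m" by (rule continuous_on_subset[OF m_continuous]) auto
  have Cc: "continuous_on {0..\<tau>} C"
  proof -
    have "(\<lambda>x. \<zeta> x * (\<zeta> x * (norm e)\<^sup>2)) \<in> test_functions UNIV"
      by (intro test_functions_mult[OF \<zeta>] smooth_mult smooth_const test_functions_smooth[OF \<zeta>])
    from continuous_integral_test_function[OF this] show ?thesis
      by (rule continuous_on_eq) (simp add: C_def clamped_eq power2_eq_square mult.assoc)
  qed
  have S0: "S t \<noteq> 0" if "t \<in> {0..\<tau>}" for t using S(1)[OF that] by simp
  define p' where "p' t = - (p t)\<^sup>2 - \<alpha>\<^sup>2 / 4 / (S t)\<^sup>2" for t
  have p'cont: "isCont p' t" if "t \<in> {0..\<tau>}" for t
    unfolding p'_def[abs_def] using S0[OF that] S(2)[OF that] DERIV_isCont[OF p[OF that]]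
    by (intro continuous_intros) auto
  note parts = moment_by_parts[of p p', OF p[folded p'_def] p'cont]
  define X where "X t = 2 * \<delta> * (B t)\<^sup>2 - \<delta>\<^sup>2 * (B t)\<^sup>2 * C t" for t
  define L where "L t = 2 * real DIM('a) / S t - m t / (S t)\<^sup>2 + X t" for t
  define ell where "ell t = 2 * p t * k t - (p t)\<^sup>2 * m t + \<alpha>\<^sup>2 / 4 * L t" for t
  have fish: "ennreal (L t) \<le> fisher (clamped t)" if t: "t \<in> {0..\<tau>}" for t
  proof -
    \<comment> \<open>Scaling \<zeta> by - \<delta> B at each time gives the linear term of the
      perturbation the sign of a square: it becomes 2 \<delta> B^2.\<close>
    have sz: "(\<lambda>x. \<zeta> x * (- \<delta> * B t)) \<in> test_functions UNIV" by (intro test_functions_mult[OF \<zeta>] smooth_const)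
    have "((\<lambda>x. \<zeta> x * (- \<delta> * B t)) has_derivative (\<lambda>w. frechet_derivative \<zeta> (at x) w * (- \<delta> * B t))) (at x)" for x
      by (intro has_derivative_mult_left smooth_has_derivative test_functions_smooth[OF \<zeta>])
    from frechet_derivative_at[OF this, symmetric]
    have d: "frechet_derivative (\<lambda>x. \<zeta> x * (- \<delta> * B t)) (at x) e = (- \<delta> * B t) * frechet_derivative \<zeta> (at x) e" for x by simp
    have "(\<integral>x. frechet_derivative (\<lambda>x. \<zeta> x * (- \<delta> * B t)) (at x) e - \<zeta> x * (- \<delta> * B t) * (x \<bullet> e) / S t \<partial>clamped t)
        = (\<integral>x. (- \<delta> * B t) * (frechet_derivative \<zeta> (at x) e - \<zeta> x * (x \<bullet> e) / S t) \<partial>clamped t)"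
      unfolding d by (intro Bochner_Integration.integral_cong) (auto simp: algebra_simps)
    also have "\<dots> = - \<delta> * B t * B t" by (simp add: B_def stein_def)
    finally have 1: "(\<integral>x. frechet_derivative (\<lambda>x. \<zeta> x * (- \<delta> * B t)) (at x) e - \<zeta> x * (- \<delta> * B t) * (x \<bullet> e) / S t \<partial>clamped t)
        = - \<delta> * B t * B t" .
    have "(\<integral>x. (\<zeta> x * (- \<delta> * B t))\<^sup>2 * (norm e)\<^sup>2 \<partial>clamped t) = (\<integral>x. (\<delta>\<^sup>2 * (B t)\<^sup>2) * ((\<zeta> x)\<^sup>2 * (norm e)\<^sup>2) \<partial>clamped t)"
      by (intro Bochner_Integration.integral_cong) (auto simp: power_mult_distrib)
    then have 2: "(\<integral>x. (\<zeta> x * (- \<delta> * B t))\<^sup>2 * (norm e)\<^sup>2 \<partial>clamped t) = \<delta>\<^sup>2 * (B t)\<^sup>2 * C t"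
      by (simp add: C_def)
    show ?thesis
      using fisher_ge[OF clamped_P2[of t] S(1)[OF t] sz, of e] unfolding 1 2 m_def[symmetric]
      by (simp add: L_def X_def power2_eq_square algebra_simps)
  qed
  have i1: "integrable lborel (\<lambda>t. indicator {0..\<tau>} t * (p t * k t))" by (rule parts)
  have i2: "integrable lborel (\<lambda>t. indicator {0..\<tau>} t * ((p t)\<^sup>2 * m t))"
    by (intro m_integrable continuous_intros pc mc)
  have i3: "integrable lborel (\<lambda>t. indicator {0..\<tau>} t * (2 * real DIM('a) / S t))"
    using S0 by (intro m_integrable continuous_intros Sc) auto
  have i4: "integrable lborel (\<lambda>t. indicator {0..\<tau>} t * (m t / (S t)\<^sup>2))"
    using S0 by (intro m_integrable continuous_intros Sc mc) auto
  have i5: "integrable lborel (\<lambda>t. indicator {0..\<tau>} t * X t)"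
    unfolding X_def by (intro m_integrable continuous_intros Bc Cc)
  have ell_split: "indicator {0..\<tau>} t * ell t = 2 * (indicator {0..\<tau>} t * (p t * k t)) - indicator {0..\<tau>} t * ((p t)\<^sup>2 * m t)
      + \<alpha>\<^sup>2 / 4 * (indicator {0..\<tau>} t * (2 * real DIM('a) / S t)) - \<alpha>\<^sup>2 / 4 * (indicator {0..\<tau>} t * (m t / (S t)\<^sup>2))
      + \<alpha>\<^sup>2 / 4 * (indicator {0..\<tau>} t * X t)" for t
    by (simp add: ell_def L_def algebra_simps)
  have ell_int: "integrable lborel (\<lambda>t. indicator {0..\<tau>} t * ell t)"
    unfolding ell_split using i1 i2 i3 i4 i5
    by (intro Bochner_Integration.integrable_add Bochner_Integration.integrable_diff integrable_mult_right) auto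
  have p'm: "(\<integral>t. indicator {0..\<tau>} t * (p' t * m t) \<partial>lborel)
      = - (\<integral>t. indicator {0..\<tau>} t * ((p t)\<^sup>2 * m t) \<partial>lborel) - \<alpha>\<^sup>2 / 4 * (\<integral>t. indicator {0..\<tau>} t * (m t / (S t)\<^sup>2) \<partial>lborel)"
  proof -
    have "(\<integral>t. indicator {0..\<tau>} t * (p' t * m t) \<partial>lborel)
      = (\<integral>t. - (indicator {0..\<tau>} t * ((p t)\<^sup>2 * m t)) - \<alpha>\<^sup>2 / 4 * (indicator {0..\<tau>} t * (m t / (S t)\<^sup>2)) \<partial>lborel)"
      by (intro Bochner_Integration.integral_cong) (auto simp: p'_def algebra_simps)
    then show ?thesis
      by (simp only: Bochner_Integration.integral_diff[OF Bochner_Integration.integrable_minus[OF i2] integrable_mult_right[OF i4, of "\<alpha>\<^sup>2 / 4"]]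
          Bochner_Integration.integral_minus integral_mult_right_zero)
  qed
  have ell_val: "(\<integral>t. indicator {0..\<tau>} t * ell t \<partial>lborel)
      = p \<tau> * m \<tau> - p 0 * m 0 + \<alpha>\<^sup>2 / 4 * (\<integral>t. indicator {0..\<tau>} t * (2 * real DIM('a) / S t) \<partial>lborel)
      + \<alpha>\<^sup>2 / 4 * (\<integral>t. indicator {0..\<tau>} t * X t \<partial>lborel)"
  proof -
    have "(\<integral>t. indicator {0..\<tau>} t * ell t \<partial>lborel) = 2 * (\<integral>t. indicator {0..\<tau>} t * (p t * k t) \<partial>lborel)
      - (\<integral>t. indicator {0..\<tau>} t * ((p t)\<^sup>2 * m t) \<partial>lborel)
      + \<alpha>\<^sup>2 / 4 * (\<integral>t. indicator {0..\<tau>} t * (2 * real DIM('a) / S t) \<partial>lborel) - \<alpha>\<^sup>2 / 4 * (\<integral>t. indicator {0..\<tau>} t * (m t / (S t)\<^sup>2) \<partial>lborel)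
      + \<alpha>\<^sup>2 / 4 * (\<integral>t. indicator {0..\<tau>} t * X t \<partial>lborel)"
      unfolding ell_split
      using integrable_mult_right[OF i1, of 2] i2 integrable_mult_right[OF i3, of "\<alpha>\<^sup>2 / 4"] integrable_mult_right[OF i4, of "\<alpha>\<^sup>2 / 4"] integrable_mult_right[OF i5, of "\<alpha>\<^sup>2 / 4"]
      by (simp only: Bochner_Integration.integral_add Bochner_Integration.integral_diff Bochner_Integration.integrable_add
          Bochner_Integration.integrable_diff integral_mult_right_zero)
    moreover have "2 * (\<integral>t. indicator {0..\<tau>} t * (p t * k t) \<partial>lborel) - (\<integral>t. indicator {0..\<tau>} t * ((p t)\<^sup>2 * m t) \<partial>lborel)
        - \<alpha>\<^sup>2 / 4 * (\<integral>t. indicator {0..\<tau>} t * (m t / (S t)\<^sup>2) \<partial>lborel) = p \<tau> * m \<tau> - p 0 * m 0"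
      using parts(2) p'm by linarith
    ultimately show ?thesis by linarith
  qed
  have half: "ennreal (1 / 2 * (\<integral>t. indicator {0..\<tau>} t * ell t \<partial>lborel)) = ennreal (1 / 2) * ennreal (\<integral>t. indicator {0..\<tau>} t * ell t \<partial>lborel)"
    by (rule ennreal_mult') simp
  have "ennreal (\<integral>t. indicator {0..\<tau>} t * ell t \<partial>lborel) \<le> (\<integral>\<^sup>+t. ennreal (indicator {0..\<tau>} t * ell t) \<partial>lborel)"
    by (rule ennreal_integral_le_nn_integral[OF ell_int])
  also have "(\<integral>\<^sup>+t. ennreal (indicator {0..\<tau>} t * ell t) \<partial>lborel)
     \<le> (\<integral>\<^sup>+ t\<in>{0..\<tau>}. ((\<integral>\<^sup>+ x. ennreal ((norm (c t x))\<^sup>2) \<partial>\<rho> t) + ennreal ((\<alpha> / 2)\<^sup>2) * fisher (\<rho> t)) \<partial>lborel)"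
  proof (rule nn_integral_mono_AE)
    show "AE t in lborel. ennreal (indicator {0..\<tau>} t * ell t)
      \<le> ((\<integral>\<^sup>+ x. ennreal ((norm (c t x))\<^sup>2) \<partial>\<rho> t) + ennreal ((\<alpha> / 2)\<^sup>2) * fisher (\<rho> t)) * indicator {0..\<tau>} t"
      using AE_u
    proof eventually_elim
      case (elim t)
      show ?case
      proof (cases "t \<in> {0..\<tau>}")
        case True
        have ut: "u t = ennreal (ur t)" using elim True by blast
        have ur0: "0 \<le> ur t" by (simp add: ur_def)
        \<comment> \<open>The bound \<open>L t\<close> may be negative, in which case
          \<open>ennreal\<close> truncates it; hence the maximum with 0.\<close>
        have "ell t \<le> ur t + \<alpha>\<^sup>2 / 4 * max 0 (L t)"
          unfolding ell_def using k_bound[OF ut, of "p t"] by (intro add_mono mult_left_mono) auto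
        then have "ennreal (ell t) \<le> ennreal (ur t + \<alpha>\<^sup>2 / 4 * max 0 (L t))" by (rule ennreal_leI)
        also have "\<dots> = ennreal (ur t) + ennreal ((\<alpha> / 2)\<^sup>2) * ennreal (L t)"
        proof -
          have "ennreal (\<alpha>\<^sup>2 / 4 * max 0 (L t)) = ennreal ((\<alpha> / 2)\<^sup>2) * ennreal (max 0 (L t))"
            by (subst ennreal_mult') (simp_all add: power_divide)
          then show ?thesis using ur0 by (subst ennreal_plus) (simp_all add: ennreal_max_0)
        qed
        also have "\<dots> \<le> u t + ennreal ((\<alpha> / 2)\<^sup>2) * fisher (clamped t)"
          unfolding ut by (intro add_mono mult_left_mono fish True) auto
        finally show ?thesis using True by (simp add: u_def clamped_eq)
      qed simp
    qed
  qed
  finally have "ennreal (1 / 2) * ennreal (\<integral>t. indicator {0..\<tau>} t * ell t \<partial>lborel) \<le> dynamic_action \<alpha> \<tau> (\<rho>, c)"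
    unfolding dynamic_action_def prod.case by (rule mult_left_mono) simp
  then have "ennreal (1 / 2 * (\<integral>t. indicator {0..\<tau>} t * ell t \<partial>lborel)) \<le> dynamic_action \<alpha> \<tau> (\<rho>, c)"
    by (simp only: half)
  then show ?thesis unfolding ell_val X_def .
qed

text \<open>An optimal curve leaves no room for the gain in \<open>action_lower_bound\<close>. For
  small \<delta> the gain dominates \<delta> B^2, so the integral of B^2 is 0, and by continuity B
  vanishes at every time.\<close>

lemma stein_eq_0:
  fixes S p :: "real \<Rightarrow> real"
  assumes S: "\<And>t. t \<in> {0..\<tau>} \<Longrightarrow> S t > 0" "\<And>t. t \<in> {0..\<tau>} \<Longrightarrow> isCont S t"
    and p: "\<And>t. t \<in> {0..\<tau>} \<Longrightarrow> (p has_real_derivative (- (p t)\<^sup>2 - \<alpha>\<^sup>2 / 4 / (S t)\<^sup>2)) (at t)"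
    and \<zeta>: "\<zeta> \<in> test_functions UNIV" and e: "e \<in> Basis" and \<alpha>: "\<alpha> \<noteq> 0"
    and V: "V = p \<tau> * m \<tau> - p 0 * m 0 + \<alpha>\<^sup>2 / 4 * (\<integral>t. indicator {0..\<tau>} t * (2 * real DIM('a) / S t) \<partial>lborel)" "0 \<le> V"
    and opt: "dynamic_action \<alpha> \<tau> (\<rho>, c) \<le> ennreal (1 / 2 * V)"
    and t: "t \<in> {0..\<tau>}"
  shows "stein S \<zeta> e t = 0"
proof -
  define B where "B = stein S \<zeta> e"
  define C where "C t = (\<integral>x. (\<zeta> x)\<^sup>2 * (norm e)\<^sup>2 \<partial>clamped t)" for t
  have Sc: "continuous_on {0..\<tau>} S" using S(2) by (intro continuous_at_imp_continuous_on) auto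
  have Bc: "continuous_on {0..\<tau>} B" unfolding B_def by (rule stein_continuous[OF S(1) Sc \<zeta> e])
  have test: "(\<lambda>x. \<zeta> x * (\<zeta> x * (norm e)\<^sup>2)) \<in> test_functions UNIV"
    by (intro test_functions_mult[OF \<zeta>] smooth_mult smooth_const test_functions_smooth[OF \<zeta>])
  have Cc: "continuous_on {0..\<tau>} C"
    using continuous_integral_test_function[OF test]
    by (rule continuous_on_eq) (simp add: C_def clamped_eq power2_eq_square mult.assoc)
  have "compact (C ` {0..\<tau>})" by (intro compact_continuous_image compact_Icc Cc)
  then obtain M where M: "M > 0" "\<And>y. y \<in> C ` {0..\<tau>} \<Longrightarrow> norm y \<le> M"
    using bounded_pos compact_imp_bounded by metis
  \<comment> \<open>Chosen so that \<delta> C \<le> 1, whence 2 \<delta> B^2 - \<delta>^2 B^2 C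
    \<ge> \<delta> B^2.\<close>
  define \<delta> where "\<delta> = 1 / M"
  have \<delta>: "\<delta> > 0" "\<delta> * C t \<le> 1" if "t \<in> {0..\<tau>}" for t
    using M(1) M(2)[of "C t"] that by (auto simp: \<delta>_def field_simps)
  have \<delta>0: "\<delta> > 0" using M(1) by (simp add: \<delta>_def)
  define X where "X t = 2 * \<delta> * (B t)\<^sup>2 - \<delta>\<^sup>2 * (B t)\<^sup>2 * C t" for t
  have Xi: "integrable lborel (\<lambda>t. indicator {0..\<tau>} t * X t)"
    unfolding X_def by (intro m_integrable continuous_intros Bc Cc)
  have B2i: "integrable lborel (\<lambda>t. indicator {0..\<tau>} t * (B t)\<^sup>2)"
    by (intro m_integrable continuous_intros Bc)
  have XB: "\<delta> * (indicator {0..\<tau>} t * (B t)\<^sup>2) \<le> indicator {0..\<tau>} t * X t" for t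
  proof (cases "t \<in> {0..\<tau>}")
    case True
    have "\<delta> * (B t)\<^sup>2 * (\<delta> * C t) \<le> \<delta> * (B t)\<^sup>2 * 1"
      using \<delta>[OF True] by (intro mult_left_mono) auto
    then show ?thesis using True by (simp add: X_def power2_eq_square algebra_simps)
  qed simp
  have "ennreal (1 / 2 * (V + \<alpha>\<^sup>2 / 4 * (\<integral>t. indicator {0..\<tau>} t * X t \<partial>lborel))) \<le> ennreal (1 / 2 * V)"
    using order_trans[OF action_lower_bound[OF S p \<zeta> e, of \<delta>] opt]
    unfolding V(1) X_def B_def C_def by simp
  moreover define y where "y = \<alpha>\<^sup>2 / 4 * (\<integral>t. indicator {0..\<tau>} t * X t \<partial>lborel)"
  \<comment> \<open>The comparison in \<open>ennreal\<close> gives one between reals because V is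
    nonnegative.\<close>
  ultimately have "1 / 2 * (V + y) \<le> 1 / 2 * V"
    using V(2) by (subst (asm) ennreal_le_iff) auto
  then have "\<alpha>\<^sup>2 / 4 * (\<integral>t. indicator {0..\<tau>} t * X t \<partial>lborel) \<le> 0" unfolding y_def[symmetric] by simp
  then have X0: "(\<integral>t. indicator {0..\<tau>} t * X t \<partial>lborel) \<le> 0"
    using \<alpha> by (simp add: mult_le_0_iff)
  have "\<delta> * (\<integral>t. indicator {0..\<tau>} t * (B t)\<^sup>2 \<partial>lborel) = (\<integral>t. \<delta> * (indicator {0..\<tau>} t * (B t)\<^sup>2) \<partial>lborel)" by simp
  also have "\<dots> \<le> (\<integral>t. indicator {0..\<tau>} t * X t \<partial>lborel)"
    by (intro integral_mono integrable_mult_right B2i Xi XB)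
  also note X0
  finally have "(\<integral>t. indicator {0..\<tau>} t * (B t)\<^sup>2 \<partial>lborel) \<le> 0"
    using \<delta>0 by (simp add: mult_le_0_iff)
  moreover have "(\<integral>t. indicator {0..\<tau>} t * (B t)\<^sup>2 \<partial>lborel) \<ge> 0" by simp
  ultimately have B0: "(\<integral>t. indicator {0..\<tau>} t * (B t)\<^sup>2 \<partial>lborel) = 0" by linarith
  have "set_integrable lborel {0..\<tau>} (\<lambda>t. (B t)\<^sup>2)"
    using B2i by (simp add: set_integrable_def)
  from set_borel_integral_eq_integral[OF this] B0
  have "((\<lambda>t. (B t)\<^sup>2) has_integral 0) (cbox 0 \<tau>)"
    by (simp add: set_lebesgue_integral_def has_integral_iff)
  then have "(B t)\<^sup>2 = 0"
    using Bc t tau by (intro has_integral_0_cbox_imp_0[of 0 \<tau> "\<lambda>t. (B t)\<^sup>2"]) (auto intro!: continuous_intros)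
  then show ?thesis by (simp add: B_def)
qed

end

text \<open>Multiplying by the inverse Gaussian weight turns Stein's equation into the vanishing of
  all distributional derivatives.\<close>

lemma gaussian_if_stein:
  fixes \<rho> :: "'a::euclidean_space measure"
  assumes \<rho>: "\<rho> \<in> P2" and s: "s > 0"
    and stein: "\<And>\<zeta> e. \<zeta> \<in> test_functions UNIV \<Longrightarrow> e \<in> Basis \<Longrightarrow>
      (\<integral>x. frechet_derivative \<zeta> (at x) e - \<zeta> x * (x \<bullet> e) / s \<partial>\<rho>) = 0"
  shows "\<rho> = gaussian s"
proof -
  interpret prob_space \<rho> using P2D(1)[OF \<rho>] .
  note [measurable_cong] = P2D(2)[OF \<rho>]
  define w :: "'a \<Rightarrow> real" where "w x = exp (1 / (2 * s) * (norm x)\<^sup>2)" for x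
  have w_smooth: "smooth w"
    unfolding w_def[abs_def] by (intro smooth_compose[OF smooth_real_exp] smooth_mult smooth_const smooth_norm_sq)
  have w_pos: "w x > 0" for x by (simp add: w_def)
  have w_deriv: "(w has_derivative (\<lambda>h. (x \<bullet> h) / s * w x)) (at x)" for x
  proof -
    have "((\<lambda>x::'a. x \<bullet> x) has_derivative (\<lambda>h. x \<bullet> h + h \<bullet> x)) (at x)"
      by (intro has_derivative_inner has_derivative_ident)
    from bounded_linear.has_derivative[OF bounded_linear_mult_right this, of "1 / (2 * s)"]
    have "((\<lambda>x::'a. 1 / (2 * s) * (norm x)\<^sup>2) has_derivative (\<lambda>h. (x \<bullet> h) / s)) (at x)"
      by (simp add: power2_norm_eq_inner inner_commute)
    from DERIV_compose_FDERIV[OF DERIV_exp this] show ?thesis unfolding w_def[abs_def] .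
  qed
  have [measurable]: "w \<in> borel_measurable borel" by (rule smooth_measurable[OF w_smooth])
  define \<nu> where "\<nu> = density \<rho> (\<lambda>x. ennreal (w x))"
  have \<nu>_sets: "sets \<nu> = sets borel" by (simp add: \<nu>_def P2D(2)[OF \<rho>])
  have \<nu>_sigma: "sigma_finite_measure \<nu>"
    unfolding \<nu>_def by (subst sigma_finite_iff_density_finite) auto
  have \<nu>_fin: "emeasure \<nu> (cball 0 R) < \<infinity>" for R
  proof -
    have "emeasure \<nu> (cball 0 R) = (\<integral>\<^sup>+x. ennreal (w x) * indicator (cball 0 R) x \<partial>\<rho>)"
      unfolding \<nu>_def by (rule emeasure_density) (auto simp: P2D(2)[OF \<rho>])
    also have "\<dots> \<le> (\<integral>\<^sup>+x. ennreal (exp (1 / (2 * s) * R\<^sup>2)) \<partial>\<rho>)"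
    proof (rule nn_integral_mono)
      fix x
      show "ennreal (w x) * indicator (cball 0 R) x \<le> ennreal (exp (1 / (2 * s) * R\<^sup>2))"
      proof (cases "norm x \<le> R")
        case True
        then have "w x \<le> exp (1 / (2 * s) * R\<^sup>2)"
          unfolding w_def using s by (auto intro!: divide_right_mono power_mono)
        then show ?thesis by (auto simp: indicator_def intro: ennreal_leI)
      qed simp
    qed
    also have "\<dots> < \<infinity>" by (simp add: emeasure_space_1 less_top[symmetric])
    finally show ?thesis .
  qed
  have basis0: "(\<integral>x. w x * frechet_derivative \<phi> (at x) e \<partial>\<rho>) = 0"
    if \<phi>: "\<phi> \<in> test_functions UNIV" and e: "e \<in> Basis" for \<phi> e
  proof -
    have "((\<lambda>x. \<phi> x * w x) has_derivative (\<lambda>h. \<phi> x * ((x \<bullet> h) / s * w x) + frechet_derivative \<phi> (at x) h * w x)) (at x)" for x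
      by (intro has_derivative_mult w_deriv smooth_has_derivative test_functions_smooth[OF \<phi>])
    from frechet_derivative_at[OF this, symmetric]
    have d: "frechet_derivative (\<lambda>x. \<phi> x * w x) (at x) e - \<phi> x * w x * (x \<bullet> e) / s = w x * frechet_derivative \<phi> (at x) e" for x
      by (simp add: algebra_simps)
    show ?thesis using stein[OF test_functions_mult[OF \<phi> w_smooth] e] unfolding d .
  qed
  have all0: "(\<integral>x. frechet_derivative \<phi> (at x) h \<partial>\<nu>) = 0" if \<phi>: "\<phi> \<in> test_functions UNIV" for \<phi> h
  proof -
    note sm = test_functions_smooth[OF \<phi>]
    have i: "integrable \<rho> (\<lambda>x. w x * frechet_derivative \<phi> (at x) e)" if e: "e \<in> Basis" for e
    proof -
      have t: "(\<lambda>x. frechet_derivative \<phi> (at x) e * w x) \<in> test_functions UNIV"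
        by (rule test_functions_mult[OF test_functions_derivative_Basis[OF \<phi> e] w_smooth])
      obtain C where "\<And>x. \<bar>frechet_derivative \<phi> (at x) e * w x\<bar> \<le> C" using test_functions_bound[OF t] by metis
      then show ?thesis
        using smooth_measurable[OF test_functions_smooth[OF t]]
        by (intro integrable_const_bound[of _ C]) (auto simp: mult.commute)
    qed
    have "(\<integral>x. frechet_derivative \<phi> (at x) h \<partial>\<nu>) = (\<integral>x. w x * frechet_derivative \<phi> (at x) h \<partial>\<rho>)"
      unfolding \<nu>_def using smooth_derivative_measurable[OF sm] w_pos
      by (subst integral_density) (auto simp: less_imp_le)
    also have "\<dots> = (\<integral>x. (\<Sum>i\<in>Basis. (h \<bullet> i) * (w x * frechet_derivative \<phi> (at x) i)) \<partial>\<rho>)"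
      by (subst frechet_derivative_sum_Basis[OF sm]) (simp add: sum_distrib_left mult_ac)
    also have "\<dots> = (\<Sum>i\<in>Basis. (h \<bullet> i) * (\<integral>x. w x * frechet_derivative \<phi> (at x) i \<partial>\<rho>))"
      using i by (subst Bochner_Integration.integral_sum) auto
    also have "\<dots> = 0" using basis0[OF \<phi>] by simp
    finally show ?thesis .
  qed
  \<comment> \<open>With g = 0 and h = 1 the shift formula says that K and its translate have the
    same \<nu>-mass.\<close>
  have inv: "(\<integral>x. (indicator K (x - h) :: real) \<partial>\<nu>) = (\<integral>x. indicator K x \<partial>\<nu>)" if K: "compact K" for K h
  proof -
    have "weak_translation \<nu> (\<lambda>_. 0) h"
      by (rule weak_translation.intro) (use \<nu>_sigma \<nu>_sets \<nu>_fin all0 in auto)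
    from weak_translation.shift_identity_compact[OF this K]
    show ?thesis
      unfolding weak_translation.shift_identity_def[OF \<open>weak_translation \<nu> (\<lambda>_. 0) h\<close>]
      by (auto dest: spec[of _ 1])
  qed
  obtain c where c: "c \<ge> 0" "\<nu> = density lborel (\<lambda>_. ennreal c)"
    using translation_invariant_measure[OF \<nu>_sigma \<nu>_sets \<nu>_fin inv] by metis
  have inv_w: "ennreal (w x) * ennreal (1 / w x) = 1" for x
    using w_pos[of x] by (simp add: ennreal_mult[symmetric])
  have "\<rho> = density \<nu> (\<lambda>x. ennreal (1 / w x))"
    unfolding \<nu>_def by (subst density_density_eq) (auto simp: inv_w density_1)
  also have "\<dots> = density lborel (\<lambda>x. ennreal (c / w x))"
    unfolding c(2) using c(1) w_pos by (subst density_density_eq) (auto simp: ennreal_mult[symmetric] less_imp_le)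
  also have "(\<lambda>x. ennreal (c / w x)) = (\<lambda>x. ennreal (c * (2 * pi * s) powr (real DIM('a) / 2)) * ennreal (gdens s x))"
  proof
    fix x :: 'a
    have "(2 * pi * s) powr (real DIM('a) / 2) * (2 * pi * s) powr (- real DIM('a) / 2) = 1"
      using s by (simp add: powr_add[symmetric])
    moreover have "c / w x = c * exp (- (norm x)\<^sup>2 / (2 * s))"
    proof -
      have "w x * exp (- (norm x)\<^sup>2 / (2 * s)) = 1"
        unfolding w_def mult_exp_exp by simp
      then have "c / w x = c * (w x * exp (- (norm x)\<^sup>2 / (2 * s))) / w x" by simp
      also have "\<dots> = c * exp (- (norm x)\<^sup>2 / (2 * s))" using w_pos[of x] by simp
      finally show ?thesis .
    qed
    moreover have "(c * (2 * pi * s) powr (real DIM('a) / 2)) * gdens s x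
        = c * ((2 * pi * s) powr (real DIM('a) / 2) * (2 * pi * s) powr (- real DIM('a) / 2)) * exp (- (norm x)\<^sup>2 / (2 * s))"
      unfolding gdens_def by (simp only: mult_ac)
    ultimately have "c / w x = (c * (2 * pi * s) powr (real DIM('a) / 2)) * gdens s x" by auto
    then show "ennreal (c / w x) = ennreal (c * (2 * pi * s) powr (real DIM('a) / 2)) * ennreal (gdens s x)"
      using c(1) by (subst ennreal_mult[symmetric]) simp_all
  qed
  finally have eq: "\<rho> = density lborel (\<lambda>x. ennreal (c * (2 * pi * s) powr (real DIM('a) / 2)) * ennreal (gdens s x))" .
  \<comment> \<open>The constant left free by translation invariance is fixed by the total mass
    1.\<close>
  define q where "q = ennreal (c * (2 * pi * s) powr (real DIM('a) / 2))"
  have "1 = emeasure \<rho> UNIV" using emeasure_space_1 P2D(3)[OF \<rho>] by simp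
  also have "\<dots> = q * (\<integral>\<^sup>+x. ennreal (gdens s (x::'a)) \<partial>lborel)"
    unfolding eq q_def[symmetric] by (subst emeasure_density) (auto simp: nn_integral_cmult)
  also have "\<dots> = q" using s by (simp add: nn_integral_gdens)
  finally have "q = 1" ..
  then show ?thesis unfolding eq q_def[symmetric] by (simp add: gaussian_density)
qed

section \<open>The optimal Gaussian curve\<close>

context schroedinger_step
begin

text \<open>\<open>svar\<close> solves \<open>2 S S'' - S'\<^sup>2 = - \<alpha>\<^sup>2\<close> with \<open>S 0 = s\<close> and \<open>S \<tau> = s'\<close>.\<close>

definition uu :: "real \<Rightarrow> real" where "uu t = 1 + l * (\<tau> - t)"
definition nn :: "real \<Rightarrow> real" where "nn t = s * uu t + \<alpha> * t * v"
definition svar :: "real \<Rightarrow> real" where "svar t = uu t * nn t / v\<^sup>2"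
definition svar' :: "real \<Rightarrow> real" where "svar' t = (uu t * (\<alpha> * v - l * s) - l * nn t) / v\<^sup>2"
text \<open>The field x to \<open>pv t\<close> x generates the dilations that carry the Gaussian of
  variance \<open>svar\<close> along, since the derivative of sqrt S is p sqrt S.\<close>

definition pv :: "real \<Rightarrow> real" where "pv t = svar' t / (2 * svar t)"

lemma uu_pos: "t \<in> {0..\<tau>} \<Longrightarrow> uu t > 0"
proof -
  assume t: "t \<in> {0..\<tau>}"
  \<comment> \<open>\<open>uu\<close> is affine with value v at 0 and 1 at \<tau>, so on the
    interval it is a convex combination of two positive numbers, whatever the sign of l.\<close>
  have "uu t = (t / \<tau>) * 1 + (1 - t / \<tau>) * v" using pos by (simp add: uu_def v field_simps)
  moreover have "0 \<le> t / \<tau>" "t / \<tau> \<le> 1" using t pos by auto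
  moreover have "0 < (t / \<tau>) * 1 + (1 - t / \<tau>) * v"
  proof (cases "t = 0")
    case False
    then have "0 < t / \<tau>" using t pos by auto
    then show ?thesis using calculation(3) pos by (intro add_pos_nonneg) auto
  qed (use pos in simp)
  ultimately show ?thesis by simp
qed

lemma nn_pos: "t \<in> {0..\<tau>} \<Longrightarrow> nn t > 0"
  unfolding nn_def using uu_pos[of t] pos by (intro add_pos_nonneg) auto

lemma svar_pos: "t \<in> {0..\<tau>} \<Longrightarrow> svar t > 0"
  unfolding svar_def using uu_pos nn_pos pos by simp

lemma svar_0: "svar 0 = s" and svar_tau: "svar \<tau> = s'"
proof -
  have u: "uu 0 = v" by (simp add: uu_def v)
  have "nn 0 = s * v" unfolding nn_def u by simp
  with u show "svar 0 = s" using pos by (simp add: svar_def power2_eq_square)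
  have u: "uu \<tau> = 1" by (simp add: uu_def)
  have "nn \<tau> = s + \<alpha> * \<tau> * v" unfolding nn_def u by simp
  with u show "svar \<tau> = s'" using pos by (simp add: svar_def s' r add_divide_distrib power2_eq_square)
qed

lemma uu_DERIV: "(uu has_real_derivative - l) (at t)"
  unfolding uu_def[abs_def] by (auto intro!: derivative_eq_intros)

lemma nn_DERIV: "(nn has_real_derivative (\<alpha> * v - l * s)) (at t)"
  unfolding nn_def[abs_def] by (auto intro!: derivative_eq_intros uu_DERIV simp: algebra_simps)

lemma svar_DERIV: "(svar has_real_derivative svar' t) (at t)"
  unfolding svar_def[abs_def] svar'_def
  by (rule DERIV_cong[OF DERIV_cdivide[OF DERIV_mult[OF uu_DERIV nn_DERIV]]]) (simp add: algebra_simps)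

lemma svar'_DERIV: "(svar' has_real_derivative (- 2 * l * (\<alpha> * v - l * s) / v\<^sup>2)) (at t)"
  unfolding svar'_def[abs_def]
  by (rule DERIV_cong[OF DERIV_cdivide[OF DERIV_diff[OF DERIV_cmult_right[OF uu_DERIV] DERIV_cmult[OF nn_DERIV]]]])
    (simp add: algebra_simps)

text \<open>For a product S of two affine functions, 2 S S'' - S'^2 is minus the square of their
  Wronskian, hence constant. The Wronskian of \<open>uu\<close> and \<open>nn\<close> is \<alpha>
  v^2, and the denominator of \<open>svar\<close> contributes v^4.\<close>

lemma svar_wronskian: "2 * svar t * (- 2 * l * (\<alpha> * v - l * s) / v\<^sup>2) - (svar' t)\<^sup>2 = - \<alpha>\<^sup>2"
proof -
  let ?N' = "\<alpha> * v - l * s"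
  have v0: "v \<noteq> 0" using pos by simp
  have "uu t * ?N' + l * nn t = \<alpha> * v * (uu t + l * t)" by (simp add: nn_def algebra_simps)
  also have "uu t + l * t = v" by (simp add: uu_def v algebra_simps)
  finally have N: "uu t * ?N' + l * nn t = \<alpha> * v * v" .
  have "2 * svar t * (- 2 * l * ?N' / v\<^sup>2) - (svar' t)\<^sup>2 = - (uu t * ?N' + l * nn t)\<^sup>2 / (v\<^sup>2 * v\<^sup>2)"
    unfolding svar_def svar'_def using v0 by (simp add: field_simps power2_eq_square)
  also have "\<dots> = - \<alpha>\<^sup>2" unfolding N using v0 by (simp add: power2_eq_square)
  finally show ?thesis .
qed

text \<open>The Riccati form of \<open>svar_wronskian\<close>, through p' = (2 S S'' - S'^2) / (4
  S^2) - p^2.\<close>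

lemma pv_DERIV:
  assumes "t \<in> {0..\<tau>}"
  shows "(pv has_real_derivative (- (pv t)\<^sup>2 - \<alpha>\<^sup>2 / 4 / (svar t)\<^sup>2)) (at t)"
proof -
  have S: "svar t \<noteq> 0" using svar_pos[OF assms] by simp
  let ?S'' = "- 2 * l * (\<alpha> * v - l * s) / v\<^sup>2"
  have "(pv has_real_derivative (?S'' * (2 * svar t) - svar' t * (2 * svar' t)) / ((2 * svar t) * (2 * svar t))) (at t)"
    unfolding pv_def[abs_def] by (intro DERIV_divide svar'_DERIV DERIV_cmult svar_DERIV) (use S in simp)
  moreover have "(?S'' * (2 * svar t) - svar' t * (2 * svar' t)) / ((2 * svar t) * (2 * svar t)) = - (pv t)\<^sup>2 - \<alpha>\<^sup>2 / 4 / (svar t)\<^sup>2"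
  proof -
    have "?S'' * (2 * svar t) - svar' t * (2 * svar' t) = - (svar' t)\<^sup>2 - \<alpha>\<^sup>2"
      using svar_wronskian[of t] by (simp add: power2_eq_square mult_ac)
    then have "(?S'' * (2 * svar t) - svar' t * (2 * svar' t)) / ((2 * svar t) * (2 * svar t)) = (- (svar' t)\<^sup>2 - \<alpha>\<^sup>2) / (4 * (svar t)\<^sup>2)"
      by (simp add: power2_eq_square)
    also have "\<dots> = - (pv t)\<^sup>2 - \<alpha>\<^sup>2 / 4 / (svar t)\<^sup>2"
      using S unfolding pv_def by (simp add: power_divide diff_divide_distrib power_mult_distrib)
    finally show ?thesis .
  qed
  ultimately show ?thesis by simp
qed

lemma isCont_svar: "isCont svar t" and isCont_svar': "isCont svar' t"
  by (rule DERIV_isCont, rule svar_DERIV, rule DERIV_isCont, rule svar'_DERIV)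

lemma isCont_pv: "t \<in> {0..\<tau>} \<Longrightarrow> isCont pv t"
  by (rule DERIV_isCont, rule pv_DERIV)

lemma svar_measurable [measurable]: "svar \<in> borel_measurable borel"
  and pv_measurable [measurable]: "pv \<in> borel_measurable borel"
  unfolding pv_def[abs_def] svar'_def svar_def[abs_def] nn_def uu_def by measurable

lemma continuous_on_svar: "continuous_on A svar"
  by (intro continuous_at_imp_continuous_on ballI isCont_svar)

lemma continuous_on_pv: "continuous_on {0..\<tau>} pv"
  by (intro continuous_at_imp_continuous_on ballI isCont_pv)

text \<open>Twice the minimal action, written in exactly the form in which
  \<open>action_lower_bound\<close> delivers it.\<close>

definition opt_value :: "'a::euclidean_space itself \<Rightarrow> real" where
  "opt_value TYPE('a) = pv \<tau> * (real DIM('a) * s') - pv 0 * (real DIM('a) * s)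
     + \<alpha>\<^sup>2 / 4 * (\<integral>t. indicator {0..\<tau>} t * (2 * real DIM('a) / svar t) \<partial>lborel)"

text \<open>The derivative of p S is p^2 S - \<alpha>^2 / (4 S), so the boundary terms of
  \<open>opt_value\<close> are d times the integral of this difference; the term with 2 d / S then
  reverses the sign of the second part.\<close>

lemma opt_value_eq:
  "has_bochner_integral lborel (\<lambda>t. indicator {0..\<tau>} t * ((pv t)\<^sup>2 * (real DIM('a) * svar t) + (\<alpha> / 2)\<^sup>2 * (real DIM('a) / svar t)))
    (opt_value TYPE('a::euclidean_space))"
proof -
  let ?d = "real DIM('a)"
  have S0: "svar t \<noteq> 0" if "t \<in> {0..\<tau>}" for t using svar_pos[OF that] by simp
  have d: "((\<lambda>t. pv t * svar t) has_real_derivative ((pv t)\<^sup>2 * svar t - \<alpha>\<^sup>2 / 4 / svar t)) (at t)"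
    if t: "0 \<le> t" "t \<le> \<tau>" for t
  proof -
    have t': "t \<in> {0..\<tau>}" using t by auto
    have "((\<lambda>t. pv t * svar t) has_real_derivative ((- (pv t)\<^sup>2 - \<alpha>\<^sup>2 / 4 / (svar t)\<^sup>2) * svar t + svar' t * pv t)) (at t)"
      by (intro DERIV_mult pv_DERIV t' svar_DERIV)
    moreover have "svar' t = 2 * pv t * svar t" using S0[OF t'] by (simp add: pv_def)
    then have "(- (pv t)\<^sup>2 - \<alpha>\<^sup>2 / 4 / (svar t)\<^sup>2) * svar t + svar' t * pv t = (pv t)\<^sup>2 * svar t - \<alpha>\<^sup>2 / 4 / svar t"
      using S0[OF t'] by (simp add: field_simps power2_eq_square)
    ultimately show ?thesis by simp
  qed
  have A: "has_bochner_integral lborel (\<lambda>t. ((pv t)\<^sup>2 * svar t - \<alpha>\<^sup>2 / 4 / svar t) * indicator {0..\<tau>} t) (pv \<tau> * svar \<tau> - pv 0 * svar 0)"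
  proof (rule has_bochner_integral_FTC_Icc_real)
    fix t assume t: "0 \<le> t" "t \<le> \<tau>"
    then have "t \<in> {0..\<tau>}" by auto
    then show "isCont (\<lambda>t. (pv t)\<^sup>2 * svar t - \<alpha>\<^sup>2 / 4 / svar t) t"
      using S0 by (intro continuous_intros isCont_pv isCont_svar) auto
  qed (use d pos in auto)
  have "continuous_on {0..\<tau>} (\<lambda>t. 2 * ?d / svar t)"
    using S0 by (intro continuous_intros continuous_on_svar) auto
  from borel_integrable_compact[OF compact_Icc this]
  have B: "has_bochner_integral lborel (\<lambda>t. indicator {0..\<tau>} t * (2 * ?d / svar t)) (\<integral>t. indicator {0..\<tau>} t * (2 * ?d / svar t) \<partial>lborel)"
    by (simp add: has_bochner_integral_iff)
  have "has_bochner_integral lborel (\<lambda>t. ?d * (((pv t)\<^sup>2 * svar t - \<alpha>\<^sup>2 / 4 / svar t) * indicator {0..\<tau>} t)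
      + \<alpha>\<^sup>2 / 4 * (indicator {0..\<tau>} t * (2 * ?d / svar t)))
    (?d * (pv \<tau> * svar \<tau> - pv 0 * svar 0) + \<alpha>\<^sup>2 / 4 * (\<integral>t. indicator {0..\<tau>} t * (2 * ?d / svar t) \<partial>lborel))"
    by (intro has_bochner_integral_add has_bochner_integral_mult_right A B)
  moreover have "?d * (pv \<tau> * svar \<tau> - pv 0 * svar 0) + \<alpha>\<^sup>2 / 4 * (\<integral>t. indicator {0..\<tau>} t * (2 * ?d / svar t) \<partial>lborel) = opt_value TYPE('a)"
    by (simp add: opt_value_def svar_0 svar_tau algebra_simps)
  moreover have "?d * (((pv t)\<^sup>2 * svar t - \<alpha>\<^sup>2 / 4 / svar t) * indicator {0..\<tau>} t) + \<alpha>\<^sup>2 / 4 * (indicator {0..\<tau>} t * (2 * ?d / svar t))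
     = indicator {0..\<tau>} t * ((pv t)\<^sup>2 * (?d * svar t) + (\<alpha> / 2)\<^sup>2 * (?d / svar t))" for t
    by (cases "t \<in> {0..\<tau>}") (auto simp: power_divide field_simps)
  ultimately show ?thesis by simp
qed

lemma opt_value_nonneg: "0 \<le> opt_value TYPE('a::euclidean_space)"
proof -
  have "opt_value TYPE('a) = (\<integral>t. indicator {0..\<tau>} t * ((pv t)\<^sup>2 * (real DIM('a) * svar t) + (\<alpha> / 2)\<^sup>2 * (real DIM('a) / svar t)) \<partial>lborel)"
    using opt_value_eq[where 'a='a] by (simp add: has_bochner_integral_iff)
  also have "\<dots> \<ge> 0"
  proof (rule integral_nonneg_AE, rule AE_I2)
    fix t
    show "0 \<le> indicator {0..\<tau>} t * ((pv t)\<^sup>2 * (real DIM('a) * svar t) + (\<alpha> / 2)\<^sup>2 * (real DIM('a) / svar t))"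
      using svar_pos[of t] by (cases "t \<in> {0..\<tau>}") auto
  qed
  finally show ?thesis .
qed

section \<open>Optimality of the Gaussian curve\<close>

lemma dynamic_action_gaussian:
  fixes \<rho> :: "real \<Rightarrow> 'a::euclidean_space measure"
  assumes \<rho>: "\<And>t. t \<in> {0..\<tau>} \<Longrightarrow> \<rho> t = gaussian (svar t)"
  shows "dynamic_action \<alpha> \<tau> (\<rho>, \<lambda>t x. pv t *\<^sub>R x) = ennreal (1 / 2 * opt_value TYPE('a))"
proof -
  let ?f = "\<lambda>t. (pv t)\<^sup>2 * (real DIM('a) * svar t) + (\<alpha> / 2)\<^sup>2 * (real DIM('a) / svar t)"
  have pt: "((\<integral>\<^sup>+ x. ennreal ((norm (pv t *\<^sub>R x))\<^sup>2) \<partial>\<rho> t) + ennreal ((\<alpha> / 2)\<^sup>2) * fisher (\<rho> t)) * indicator {0..\<tau>} t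
     = ennreal (indicator {0..\<tau>} t * ?f t)" for t
  proof (cases "t \<in> {0..\<tau>}")
    case True
    note S = svar_pos[OF True]
    have "(\<integral>\<^sup>+ x. ennreal ((norm (pv t *\<^sub>R x))\<^sup>2) \<partial>\<rho> t) = (\<integral>\<^sup>+ x. ennreal ((pv t)\<^sup>2) * ennreal ((norm (x::'a))\<^sup>2) \<partial>gaussian (svar t))"
      unfolding \<rho>[OF True] by (intro nn_integral_cong) (simp add: ennreal_mult power_mult_distrib)
    also have "\<dots> = ennreal ((pv t)\<^sup>2 * (real DIM('a) * svar t))"
      using S by (simp add: nn_integral_cmult nn_integral_gaussian_norm_sq ennreal_mult')
    finally have 1: "(\<integral>\<^sup>+ x. ennreal ((norm (pv t *\<^sub>R x))\<^sup>2) \<partial>\<rho> t) = ennreal ((pv t)\<^sup>2 * (real DIM('a) * svar t))" .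
    have 2: "ennreal ((\<alpha> / 2)\<^sup>2) * fisher (\<rho> t) = ennreal ((\<alpha> / 2)\<^sup>2 * (real DIM('a) / svar t))"
      unfolding \<rho>[OF True] fisher_gaussian[OF S] by (rule ennreal_mult'[symmetric]) simp
    show ?thesis unfolding 1 2 using True S by (subst ennreal_plus[symmetric]) auto
  qed simp
  have "(\<integral>\<^sup>+t. ennreal (indicator {0..\<tau>} t * ?f t) \<partial>lborel) = ennreal (opt_value TYPE('a))"
  proof (subst nn_integral_eq_integral)
    show "AE t in lborel. 0 \<le> indicator {0..\<tau>} t * ?f t"
    proof (rule AE_I2)
      fix t
      show "0 \<le> indicator {0..\<tau>} t * ?f t" using svar_pos[of t] by (cases "t \<in> {0..\<tau>}") auto
    qed
  qed (use opt_value_eq[where 'a='a] in \<open>auto simp: has_bochner_integral_iff\<close>)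
  then have "dynamic_action \<alpha> \<tau> (\<rho>, \<lambda>t x. pv t *\<^sub>R x) = ennreal (1 / 2) * ennreal (opt_value TYPE('a))"
    unfolding dynamic_action_def prod.case pt by simp
  also have "\<dots> = ennreal (1 / 2 * opt_value TYPE('a))" by (rule ennreal_mult'[symmetric]) simp
  finally show ?thesis .
qed

text \<open>All slices are images \<sigma>(t) z of one standard Gaussian vector z. For fixed z the
  integrand is the time derivative of \<phi>(t, \<sigma>(t) z), whose integral is 0 because \<phi>
  vanishes at the times 0 and \<tau>; Fubini exchanges the two integrals.\<close>

lemma weak_continuity_gaussian:
  fixes \<rho> :: "real \<Rightarrow> 'a::euclidean_space measure"
  assumes \<rho>: "\<And>t. t \<in> {0..\<tau>} \<Longrightarrow> \<rho> t = gaussian (svar t)"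
    and \<phi>: "\<phi> \<in> test_functions ({0<..<\<tau>} \<times> UNIV)"
  shows "(LBINT t:{0..\<tau>}. (\<integral>x. frechet_derivative \<phi> (at (t, x)) (1, pv t *\<^sub>R x) \<partial>\<rho> t)) = 0"
proof -
  let ?G = "gaussian 1 :: 'a measure"
  interpret G: prob_space ?G by (rule prob_space_gaussian) simp
  interpret P: pair_sigma_finite "lborel :: real measure" ?G by unfold_locales
  note sm = test_functions_smooth[OF \<phi>]
  define \<sigma> where "\<sigma> t = sqrt (svar t)" for t
  have \<sigma>_DERIV: "(\<sigma> has_real_derivative (pv t * \<sigma> t)) (at t)" if t: "t \<in> {0..\<tau>}" for t
  proof -
    have S: "svar t > 0" by (rule svar_pos[OF t])
    have "(\<sigma> has_real_derivative (inverse (sqrt (svar t)) / 2 * svar' t)) (at t)"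
      unfolding \<sigma>_def[abs_def] by (rule DERIV_chain2[OF DERIV_real_sqrt[OF S] svar_DERIV])
    moreover have "inverse (sqrt (svar t)) / 2 * svar' t = pv t * \<sigma> t"
      unfolding pv_def \<sigma>_def using S by (simp add: field_simps)
    ultimately show ?thesis by simp
  qed
  have [measurable]: "\<sigma> \<in> borel_measurable borel" unfolding \<sigma>_def[abs_def] by measurable
  define D where "D t z = frechet_derivative \<phi> (at (t, \<sigma> t *\<^sub>R z)) (1, (pv t * \<sigma> t) *\<^sub>R z)" for t and z :: 'a
  have D_sum: "D t z = (\<Sum>i\<in>Basis. ((1, (pv t * \<sigma> t) *\<^sub>R z) \<bullet> i) * frechet_derivative \<phi> (at (t, \<sigma> t *\<^sub>R z)) i)" for t z
    unfolding D_def by (rule frechet_derivative_sum_Basis[OF sm])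
  have Dm[measurable]: "(\<lambda>(t, z). D t z) \<in> borel_measurable (lborel \<Otimes>\<^sub>M ?G)"
  proof -
    have f: "fst \<in> borel_measurable (lborel \<Otimes>\<^sub>M ?G)"
      by (rule measurable_fst'[OF measurable_ident_sets]) simp
    have g: "snd \<in> borel_measurable (lborel \<Otimes>\<^sub>M ?G)"
      by (rule measurable_snd'[OF measurable_ident_sets]) simp
    have pm: "(\<lambda>(t, z). (t, \<sigma> t *\<^sub>R z)) \<in> borel_measurable (lborel \<Otimes>\<^sub>M ?G)"
      "(\<lambda>(t, z). (1::real, (pv t * \<sigma> t) *\<^sub>R z)) \<in> borel_measurable (lborel \<Otimes>\<^sub>M ?G)"
      unfolding case_prod_beta'
      by (intro borel_measurable_Pair borel_measurable_scaleR borel_measurable_times f g borel_measurable_const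
        measurable_compose[OF f] \<open>\<sigma> \<in> borel_measurable borel\<close> pv_measurable)+
    have "(\<lambda>p. frechet_derivative \<phi> (at (case p of (t, z) \<Rightarrow> (t, \<sigma> t *\<^sub>R z))) i) \<in> borel_measurable (lborel \<Otimes>\<^sub>M ?G)" for i
      by (rule measurable_compose[OF pm(1) smooth_derivative_measurable[OF sm]])
    moreover have "(\<lambda>p. (case p of (t, z) \<Rightarrow> (1::real, (pv t * \<sigma> t) *\<^sub>R z)) \<bullet> i) \<in> borel_measurable (lborel \<Otimes>\<^sub>M ?G)" for i
      by (intro borel_measurable_inner pm(2) borel_measurable_const)
    ultimately have "(\<lambda>p. (\<Sum>i\<in>Basis. ((case p of (t, z) \<Rightarrow> (1::real, (pv t * \<sigma> t) *\<^sub>R z)) \<bullet> i)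
        * frechet_derivative \<phi> (at (case p of (t, z) \<Rightarrow> (t, \<sigma> t *\<^sub>R z))) i)) \<in> borel_measurable (lborel \<Otimes>\<^sub>M ?G)"
      by (intro borel_measurable_sum borel_measurable_times)
    then show ?thesis by (simp add: D_sum case_prod_beta')
  qed
  obtain C where C: "C \<ge> 0" "\<And>x. \<bar>\<phi> x\<bar> \<le> C" "\<And>x w. \<bar>frechet_derivative \<phi> (at x) w\<bar> \<le> C * norm w"
    using test_functions_bound[OF \<phi>] by metis
  have "compact ((\<lambda>t. pv t * \<sigma> t) ` {0..\<tau>})"
    unfolding \<sigma>_def by (intro compact_continuous_image compact_Icc continuous_intros continuous_on_pv continuous_on_svar)
  then obtain Q where Q: "Q > 0" "\<And>y. y \<in> (\<lambda>t. pv t * \<sigma> t) ` {0..\<tau>} \<Longrightarrow> norm y \<le> Q"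
    using bounded_pos compact_imp_bounded by metis
  \<comment> \<open>The linear growth in z is relaxed to 1 + |z|^2, because the second moment is the
    one at hand.\<close>
  have D_bd: "\<bar>indicator {0..\<tau>} t * D t z\<bar> \<le> indicator {0..\<tau>} t * (C * (1 + Q * (1 + (norm z)\<^sup>2)))" for t z
  proof (cases "t \<in> {0..\<tau>}")
    case True
    have "norm (1::real, (pv t * \<sigma> t) *\<^sub>R z) \<le> norm (1::real) + norm ((pv t * \<sigma> t) *\<^sub>R z)" by (rule norm_Pair_le)
    also have "\<dots> \<le> 1 + Q * norm z"
      using Q(2)[of "pv t * \<sigma> t"] True by (auto intro!: mult_right_mono)
    also have "Q * norm z \<le> Q * (1 + (norm z)\<^sup>2)"
    proof (rule mult_left_mono)
      have "0 \<le> (norm z - 1)\<^sup>2" by simp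
      then have "2 * norm z \<le> 1 + (norm z)\<^sup>2" by (simp add: power2_diff)
      moreover have "norm z \<le> 2 * norm z" by simp
      ultimately show "norm z \<le> 1 + (norm z)\<^sup>2" by (rule order_trans[rotated])
    qed (use Q in simp)
    finally have "norm (1::real, (pv t * \<sigma> t) *\<^sub>R z) \<le> 1 + Q * (1 + (norm z)\<^sup>2)" by simp
    then have "\<bar>D t z\<bar> \<le> C * (1 + Q * (1 + (norm z)\<^sup>2))"
      unfolding D_def using C(1) by (intro order_trans[OF C(3)] mult_left_mono) auto
    then show ?thesis using True by simp
  qed simp
  have gi: "integrable ?G (\<lambda>z. C * (1 + Q * (1 + (norm z)\<^sup>2)))"
    using P2D(4)[OF gaussian_P2[of 1, where 'a='a]] by simp
  have Dm2[measurable]: "D t \<in> borel_measurable borel" for t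
  proof -
    have "D t \<in> borel_measurable ?G" using measurable_Pair2[OF Dm, of t] by simp
    then show ?thesis using measurable_cong_sets[OF sets_gaussian refl] by blast
  qed
  have Dzi: "integrable ?G (\<lambda>z. indicator {0..\<tau>} t * D t z)" for t
    by (rule Bochner_Integration.integrable_bound[OF integrable_mult_right[OF gi, of "indicator {0..\<tau>} t"]])
      (use D_bd[of t] in \<open>auto intro: order_trans[OF _ abs_ge_self]\<close>)
  have int: "integrable (lborel \<Otimes>\<^sub>M ?G) (\<lambda>(t, z). indicator {0..\<tau>} t * D t z)"
  proof (rule P.Fubini_integrable)
    show "(\<lambda>(t, z). indicator {0..\<tau>} t * D t z) \<in> borel_measurable (lborel \<Otimes>\<^sub>M ?G)" by measurable
    show "AE t in lborel. integrable ?G (\<lambda>z. case (t, z) of (t, z) \<Rightarrow> indicator {0..\<tau>} t * D t z)" using Dzi by simp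
    show "integrable lborel (\<lambda>t. \<integral>z. norm (case (t, z) of (t, z) \<Rightarrow> indicator {0..\<tau>} t * D t z) \<partial>?G)"
    proof (rule Bochner_Integration.integrable_bound)
      let ?J = "\<integral>z. C * (1 + Q * (1 + (norm z)\<^sup>2)) \<partial>?G"
      show "integrable lborel (\<lambda>t. ?J * indicator {0..\<tau>} t :: real)"
        using pos by (intro integrable_mult_right integrable_real_indicator) auto
      have "(\<integral>z. \<bar>indicator {0..\<tau>} t * D t z\<bar> \<partial>?G) \<le> ?J * indicator {0..\<tau>} t" for t
      proof -
        have "(\<integral>z. \<bar>indicator {0..\<tau>} t * D t z\<bar> \<partial>?G) \<le> (\<integral>z. indicator {0..\<tau>} t * (C * (1 + Q * (1 + (norm z)\<^sup>2))) \<partial>?G)"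
          by (intro integral_mono integrable_abs Dzi integrable_mult_right gi D_bd)
        also have "\<dots> = ?J * indicator {0..\<tau>} t" by (subst integral_mult_right_zero) (rule mult.commute)
        finally show ?thesis .
      qed
      then show "AE t in lborel. norm (\<integral>z. norm (case (t, z) of (t, z) \<Rightarrow> indicator {0..\<tau>} t * D t z) \<partial>?G) \<le> norm (?J * indicator {0..\<tau>} t)"
        by (auto intro: order_trans[OF _ abs_ge_self])
    qed measurable
  qed
  have push: "(\<integral>x. frechet_derivative \<phi> (at (t, x)) (1, pv t *\<^sub>R x) \<partial>\<rho> t) = (\<integral>z. D t z \<partial>?G)" if t: "t \<in> {0..\<tau>}" for t
  proof -
    have "\<rho> t = distr ?G borel (\<lambda>z. \<sigma> t *\<^sub>R z)"
      unfolding \<rho>[OF t] using gaussian_scale[of 1 "\<sigma> t", where 'a='a] svar_pos[OF t] by (simp add: \<sigma>_def)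
    moreover have "(\<lambda>x. frechet_derivative \<phi> (at (t, x)) (1, pv t *\<^sub>R x)) \<in> borel_measurable borel"
    proof -
      have pm: "(\<lambda>x::'a. (t, x)) \<in> borel_measurable borel" "(\<lambda>x::'a. (1::real, pv t *\<^sub>R x)) \<in> borel_measurable borel"
        by (intro borel_measurable_continuous_onI continuous_intros)+
      show ?thesis
        by (subst frechet_derivative_sum_Basis[OF sm])
          (intro borel_measurable_sum borel_measurable_times measurable_compose[OF pm(1) smooth_derivative_measurable[OF sm]]
            borel_measurable_inner pm(2) borel_measurable_const)
    qed
    ultimately show ?thesis by (simp add: integral_distr D_def mult.commute)
  qed
  have inner: "(\<integral>t. indicator {0..\<tau>} t * D t z \<partial>lborel) = 0" for z
  proof -
    have out: "\<phi> (t, x) = 0" if "t \<notin> {0<..<\<tau>}" for t x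
    proof -
      have "closure {x. \<phi> x \<noteq> 0} \<subseteq> {0<..<\<tau>} \<times> UNIV" using \<phi> by (simp add: test_functions_def)
      then show ?thesis using closure_subset[of "{x. \<phi> x \<noteq> 0}"] that by blast
    qed
    have "(\<integral>t. D t z * indicator {0..\<tau>} t \<partial>lborel) = \<phi> (\<tau>, \<sigma> \<tau> *\<^sub>R z) - \<phi> (0, \<sigma> 0 *\<^sub>R z)"
    proof (rule integral_FTC_Icc_real)
      fix t assume "0 \<le> t" "t \<le> \<tau>"
      then have t: "t \<in> {0..\<tau>}" by auto
      interpret L: bounded_linear "frechet_derivative \<phi> (at (t, \<sigma> t *\<^sub>R z))"
        using smooth_has_derivative[OF sm] by (rule has_derivative_bounded_linear)
      have "(\<sigma> has_derivative (\<lambda>h. h * (pv t * \<sigma> t))) (at t)"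
        by (rule has_derivative_eq_rhs[OF \<sigma>_DERIV[OF t, unfolded has_field_derivative_def]]) (simp add: fun_eq_iff mult.commute)
      then have "((\<lambda>t. (t, \<sigma> t *\<^sub>R z)) has_derivative (\<lambda>h. (h, (h * (pv t * \<sigma> t)) *\<^sub>R z))) (at t)"
        by (intro has_derivative_Pair has_derivative_ident has_derivative_scaleR_left)
      from has_derivative_compose[OF this smooth_has_derivative[OF sm]]
      have "((\<lambda>t. \<phi> (t, \<sigma> t *\<^sub>R z)) has_derivative (\<lambda>h. frechet_derivative \<phi> (at (t, \<sigma> t *\<^sub>R z)) (h, (h * (pv t * \<sigma> t)) *\<^sub>R z))) (at t)" .
      moreover have "frechet_derivative \<phi> (at (t, \<sigma> t *\<^sub>R z)) (h, (h * (pv t * \<sigma> t)) *\<^sub>R z) = D t z * h" for h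
        using L.scaleR[of h "(1, (pv t * \<sigma> t) *\<^sub>R z)"] by (simp add: D_def mult_ac)
      ultimately show "((\<lambda>t. \<phi> (t, \<sigma> t *\<^sub>R z)) has_real_derivative D t z) (at t)"
        by (simp add: has_field_derivative_def)
      have cs: "isCont \<sigma> t" using \<sigma>_DERIV[OF t] by (rule DERIV_isCont)
      have "isCont (\<lambda>t. frechet_derivative \<phi> (at (t, \<sigma> t *\<^sub>R z)) i) t" for i
      proof -
        have "isCont (\<lambda>y. frechet_derivative \<phi> (at y) i) (t, \<sigma> t *\<^sub>R z)"
          using smooth_continuous_derivative[OF sm, of i] by (simp add: continuous_on_eq_continuous_at)
        moreover have "isCont (\<lambda>t. (t, \<sigma> t *\<^sub>R z)) t" by (intro continuous_intros cs)
        ultimately show ?thesis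
          using isCont_o2[where f="\<lambda>t. (t, \<sigma> t *\<^sub>R z)" and g="\<lambda>y. frechet_derivative \<phi> (at y) i"] by blast
      qed
      then show "isCont (\<lambda>t. D t z) t"
        unfolding D_sum by (intro continuous_intros isCont_pv[OF t] cs)
    qed (use pos in auto)
    then show ?thesis using out[of 0] out[of \<tau>] by (simp add: mult.commute)
  qed
  have "(LBINT t:{0..\<tau>}. (\<integral>x. frechet_derivative \<phi> (at (t, x)) (1, pv t *\<^sub>R x) \<partial>\<rho> t))
      = (\<integral>t. (\<integral>z. indicator {0..\<tau>} t * D t z \<partial>?G) \<partial>lborel)"
    unfolding set_lebesgue_integral_def
    by (intro Bochner_Integration.integral_cong refl) (auto simp: push indicator_def)
  also have "\<dots> = (\<integral>z. (\<integral>t. indicator {0..\<tau>} t * D t z \<partial>lborel) \<partial>?G)"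
    by (rule P.Fubini_integral[OF int, symmetric])
  also have "\<dots> = 0" by (simp add: inner)
  finally show ?thesis .
qed

lemma admissible_gaussian:
  fixes \<rho> :: "real \<Rightarrow> 'a::euclidean_space measure"
  assumes \<rho>: "\<And>t. t \<in> {0..\<tau>} \<Longrightarrow> \<rho> t = gaussian (svar t)"
  shows "admissible \<tau> (gaussian s) (gaussian s') (\<rho>, \<lambda>t x. pv t *\<^sub>R x)"
  unfolding admissible_def prod.case
proof (intro conjI ballI)
  show "\<rho> t \<in> P2" if "t \<in> {0..\<tau>}" for t
    using gaussian_P2[OF svar_pos[OF that]] by (simp add: \<rho>[OF that])
  show "\<rho> 0 = gaussian s" "\<rho> \<tau> = gaussian s'" using pos \<rho> by (auto simp: svar_0 svar_tau)
  show "((\<lambda>t. W2 (\<rho> t) (\<rho> t')) \<longlongrightarrow> 0) (at t' within {0..\<tau>})" if t': "t' \<in> {0..\<tau>}" for t'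
  proof -
    have "((\<lambda>t. sqrt DIM('a) * \<bar>sqrt (svar t) - sqrt (svar t')\<bar>) \<longlongrightarrow> sqrt DIM('a) * \<bar>sqrt (svar t') - sqrt (svar t')\<bar>) (at t' within {0..\<tau>})"
      using continuous_on_svar[of "{0..\<tau>}"] t' by (intro tendsto_intros) (auto simp: continuous_on_def)
    moreover have "\<forall>\<^sub>F t in at t' within {0..\<tau>}. sqrt DIM('a) * \<bar>sqrt (svar t) - sqrt (svar t')\<bar> = W2 (\<rho> t) (\<rho> t')"
      using t' by (auto simp: eventually_at_filter \<rho> W2_gaussian svar_pos)
    ultimately show ?thesis by (simp add: Lim_transform_eventually)
  qed
  show "continuity_equation \<tau> \<rho> (\<lambda>t x. pv t *\<^sub>R x)"
    unfolding continuity_equation_def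
  proof (intro conjI allI impI ballI)
    show "(\<lambda>(t, x). pv t *\<^sub>R x) \<in> borel_measurable (borel :: (real \<times> 'a) measure)"
      unfolding borel_prod[symmetric] by measurable
    show "(LBINT t:{0..\<tau>}. (\<integral>x. frechet_derivative \<phi> (at (t, x)) (1, pv t *\<^sub>R x) \<partial>\<rho> t)) = 0"
      if "\<phi> \<in> test_functions ({0<..<\<tau>} \<times> UNIV)" for \<phi>
      by (rule weak_continuity_gaussian[OF \<rho> that])
    fix K :: "'a set" assume "compact K"
    then obtain R where R: "R > 0" "\<And>x. x \<in> K \<Longrightarrow> norm x \<le> R"
      using bounded_pos compact_imp_bounded by metis
    have "compact (pv ` {0..\<tau>})" by (intro compact_continuous_image compact_Icc continuous_on_pv)
    then obtain Q where Q: "Q > 0" "\<And>y. y \<in> pv ` {0..\<tau>} \<Longrightarrow> norm y \<le> Q"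
      using bounded_pos compact_imp_bounded by metis
    have "(\<integral>\<^sup>+ t\<in>{0..\<tau>}. (\<integral>\<^sup>+ x\<in>K. ennreal (norm (pv t *\<^sub>R x)) \<partial>\<rho> t) \<partial>lborel) \<le> (\<integral>\<^sup>+ t\<in>{0..\<tau>}. ennreal (Q * R) \<partial>lborel)"
    proof (rule nn_integral_mono)
      fix t
      show "(\<integral>\<^sup>+ x\<in>K. ennreal (norm (pv t *\<^sub>R x)) \<partial>\<rho> t) * indicator {0..\<tau>} t \<le> ennreal (Q * R) * indicator {0..\<tau>} t"
      proof (cases "t \<in> {0..\<tau>}")
        case True
        interpret prob_space "\<rho> t" using prob_space_gaussian[OF svar_pos[OF True]] \<rho>[OF True] by simp
        have "(\<integral>\<^sup>+ x\<in>K. ennreal (norm (pv t *\<^sub>R x)) \<partial>\<rho> t) \<le> (\<integral>\<^sup>+ x. ennreal (Q * R) \<partial>\<rho> t)"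
        proof (rule nn_integral_mono)
          fix x
          show "ennreal (norm (pv t *\<^sub>R x)) * indicator K x \<le> ennreal (Q * R)"
          proof (cases "x \<in> K")
            case True': True
            have "norm (pv t *\<^sub>R x) \<le> Q * R"
              using Q(2)[of "pv t"] R(2)[OF True'] True Q(1) by (auto intro!: mult_mono)
            then show ?thesis using True' by (simp add: ennreal_leI)
          qed simp
        qed
        also have "\<dots> = ennreal (Q * R)" by (simp add: emeasure_space_1)
        finally show ?thesis by (rule mult_right_mono) simp
      qed simp
    qed
    also have "\<dots> = ennreal (Q * R) * emeasure lborel {0..\<tau>}" by (subst nn_integral_cmult_indicator) auto
    also have "\<dots> < \<infinity>" using pos by (simp add: ennreal_mult_less_top)
    finally show "(\<integral>\<^sup>+ t\<in>{0..\<tau>}. (\<integral>\<^sup>+ x\<in>K. ennreal (norm (pv t *\<^sub>R x)) \<partial>\<rho> t) \<partial>lborel) < \<infinity>" .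
  qed
qed

lemma finite_action_curveI:
  fixes \<rho> :: "real \<Rightarrow> 'a::euclidean_space measure"
  assumes adm: "admissible \<tau> (gaussian s) (gaussian s') (\<rho>, c)" and fin: "dynamic_action \<alpha> \<tau> (\<rho>, c) < \<infinity>"
  shows "finite_action_curve \<rho> \<tau> c"
proof
  show "\<tau> > 0" by (rule pos)
  show "\<rho> t \<in> P2" if "t \<in> {0..\<tau>}" for t using adm that by (auto simp: admissible_def)
  show "((\<lambda>t. W2 (\<rho> t) (\<rho> s)) \<longlongrightarrow> 0) (at s within {0..\<tau>})" if "s \<in> {0..\<tau>}" for s
    using adm that by (auto simp: admissible_def)
  show "continuity_equation \<tau> \<rho> c" using adm by (auto simp: admissible_def)
  let ?a = "\<integral>\<^sup>+ t\<in>{0..\<tau>}. (\<integral>\<^sup>+ x. ennreal ((norm (c t x))\<^sup>2) \<partial>\<rho> t) \<partial>lborel"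
  have "ennreal (1 / 2) * ?a \<le> dynamic_action \<alpha> \<tau> (\<rho>, c)"
    unfolding dynamic_action_def prod.case by (intro mult_left_mono nn_integral_mono mult_right_mono) auto
  then have "ennreal (1 / 2) * ?a < \<infinity>" using fin by (rule le_less_trans)
  then show "?a < \<infinity>" by (auto simp: ennreal_mult_less_top ennreal_eq_0_iff)
qed

lemma endpoint_moments:
  fixes \<rho> :: "real \<Rightarrow> 'a::euclidean_space measure"
  assumes adm: "admissible \<tau> (gaussian s) (gaussian s') (\<rho>, c)" and F: "finite_action_curve \<rho> \<tau> c"
  shows "finite_action_curve.m \<rho> \<tau> 0 = real DIM('a) * s" "finite_action_curve.m \<rho> \<tau> \<tau> = real DIM('a) * s'"
proof -
  interpret finite_action_curve \<rho> \<tau> c by (rule F)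
  have "\<rho> 0 = gaussian s" "\<rho> \<tau> = gaussian s'" using adm by (auto simp: admissible_def)
  then show "m 0 = real DIM('a) * s" "m \<tau> = real DIM('a) * s'"
    using tau pos(1) s'_pos by (simp_all add: m_def clamped_eq integral_gaussian_norm_sq)
qed

lemma action_ge_opt_value:
  fixes \<rho> :: "real \<Rightarrow> 'a::euclidean_space measure"
  assumes adm: "admissible \<tau> (gaussian s) (gaussian s') (\<rho>, c)"
  shows "ennreal (1 / 2 * opt_value TYPE('a)) \<le> dynamic_action \<alpha> \<tau> (\<rho>, c)"
proof (cases "dynamic_action \<alpha> \<tau> (\<rho>, c) < \<infinity>")
  case True
  note F = finite_action_curveI[OF adm True]
  interpret finite_action_curve \<rho> \<tau> c by (rule F)
  \<comment> \<open>With \<zeta> = 0, \<delta> = 0 and an arbitrary basis vector, the lower bound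
    reduces to \<open>opt_value\<close>.\<close>
  have z: "(\<lambda>x::'a. 0) \<in> test_functions UNIV" by (rule test_functionsI[of _ 0]) (auto intro: smooth_const)
  show ?thesis
    using action_lower_bound[OF svar_pos isCont_svar pv_DERIV z SOME_Basis, of 0]
    unfolding endpoint_moments[OF adm F] by (simp add: opt_value_def)
qed (simp add: not_less top_unique)

theorem gaussian_is_minimizer:
  fixes \<rho> :: "real \<Rightarrow> 'a::euclidean_space measure"
  assumes \<rho>: "\<And>t. t \<in> {0..\<tau>} \<Longrightarrow> \<rho> t = gaussian (svar t)"
  shows "is_arg_min (dynamic_action \<alpha> \<tau>) (admissible \<tau> (gaussian s) (gaussian s')) (\<rho>, \<lambda>t x. pv t *\<^sub>R x)"
  unfolding is_arg_min_def
  using admissible_gaussian[OF \<rho>] dynamic_action_gaussian[OF \<rho>] action_ge_opt_value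
  by (metis not_less surj_pair)

text \<open>Only the curve is identified, not its velocity field: \<open>interpolating_curve\<close>
  quantifies the latter existentially.\<close>

theorem minimizer_is_gaussian:
  fixes \<rho> :: "real \<Rightarrow> 'a::euclidean_space measure"
  assumes min: "is_arg_min (dynamic_action \<alpha> \<tau>) (admissible \<tau> (gaussian s) (gaussian s')) (\<rho>, c)" and t: "t \<in> {0..\<tau>}"
  shows "\<rho> t = gaussian (svar t)"
proof -
  let ?\<rho>0 = "\<lambda>t. gaussian (svar t) :: 'a measure"
  have adm: "admissible \<tau> (gaussian s) (gaussian s') (\<rho>, c)" using min by (simp add: is_arg_min_def)
  have le: "dynamic_action \<alpha> \<tau> (\<rho>, c) \<le> ennreal (1 / 2 * opt_value TYPE('a))"
    using min admissible_gaussian[of ?\<rho>0] dynamic_action_gaussian[of ?\<rho>0]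
    unfolding is_arg_min_def by (metis not_less)
  then have "dynamic_action \<alpha> \<tau> (\<rho>, c) < \<infinity>" by (rule le_less_trans) simp
  note F = finite_action_curveI[OF adm this]
  interpret finite_action_curve \<rho> \<tau> c by (rule F)
  show ?thesis
  proof (rule gaussian_if_stein[OF P2[OF t] svar_pos[OF t]])
    fix \<zeta> :: "'a \<Rightarrow> real" and e :: 'a assume \<zeta>: "\<zeta> \<in> test_functions UNIV" and e: "e \<in> Basis"
    have "stein svar \<zeta> e t = 0"
    proof (rule stein_eq_0[OF svar_pos isCont_svar pv_DERIV \<zeta> e _ _ opt_value_nonneg le t])
      show "\<alpha> \<noteq> 0" using pos by simp
      show "opt_value TYPE('a) = pv \<tau> * m \<tau> - pv 0 * m 0 + \<alpha>\<^sup>2 / 4 * (\<integral>t. indicator {0..\<tau>} t * (2 * real DIM('a) / svar t) \<partial>lborel)"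
        unfolding endpoint_moments[OF adm F] opt_value_def ..
    qed
    then show "(\<integral>x. frechet_derivative \<zeta> (at x) e - \<zeta> x * (x \<bullet> e) / svar t \<partial>\<rho> t) = 0"
      by (simp add: stein_def clamped_eq[OF t])
  qed
qed

text \<open>The antiderivative of \<open>1 / svar\<close> comes from partial fractions in \<open>svar = uu nn / v\<^sup>2\<close>.\<close>

lemma integral_inverse_svar:
  "(\<integral>\<^sup>+t. ennreal (real DIM('a::euclidean_space) / svar t) * indicator {0..\<tau>} t \<partial>lborel)
    = ennreal (real DIM('a) / \<alpha> * (ln (s' / s) + 2 * ln v))"
proof -
  have d: "((\<lambda>t. (ln (nn t) - ln (uu t)) / \<alpha>) has_real_derivative 1 / svar t) (at t)" if t: "t \<in> {0..\<tau>}" for t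
  proof -
    note p = uu_pos[OF t] nn_pos[OF t]
    have "((\<lambda>t. (ln (nn t) - ln (uu t)) / \<alpha>) has_real_derivative ((1 / nn t * (\<alpha> * v - l * s) - 1 / uu t * (- l)) / \<alpha>)) (at t)"
      by (intro DERIV_cdivide DERIV_diff DERIV_chain2[OF DERIV_ln_divide] nn_DERIV uu_DERIV p)
    moreover have "(1 / nn t * (\<alpha> * v - l * s) - 1 / uu t * (- l)) / \<alpha> = 1 / svar t"
    proof -
      have "uu t * (\<alpha> * v - l * s) + l * nn t = \<alpha> * v * (uu t + l * t)" by (simp add: nn_def algebra_simps)
      also have "uu t + l * t = v" by (simp add: uu_def v algebra_simps)
      finally have N: "uu t * (\<alpha> * v - l * s) + l * nn t = \<alpha> * v\<^sup>2" by (simp add: power2_eq_square)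
      have "1 / nn t * (\<alpha> * v - l * s) - 1 / uu t * (- l) = (uu t * (\<alpha> * v - l * s) + l * nn t) / (uu t * nn t)"
        using p by (simp add: field_simps)
      then show ?thesis unfolding N svar_def using pos p by simp
    qed
    ultimately show ?thesis by simp
  qed
  have A: "has_bochner_integral lborel (\<lambda>t. 1 / svar t * indicator {0..\<tau>} t)
      ((ln (nn \<tau>) - ln (uu \<tau>)) / \<alpha> - (ln (nn 0) - ln (uu 0)) / \<alpha>)"
  proof (rule has_bochner_integral_FTC_Icc_real)
    fix t assume "0 \<le> t" "t \<le> \<tau>"
    then have t: "t \<in> {0..\<tau>}" by auto
    show "((\<lambda>t. (ln (nn t) - ln (uu t)) / \<alpha>) has_real_derivative 1 / svar t) (at t)" by (rule d[OF t])
    show "isCont (\<lambda>t. 1 / svar t) t" using svar_pos[OF t] by (intro continuous_intros isCont_svar) auto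
  qed (use pos in auto)
  have val: "(ln (nn \<tau>) - ln (uu \<tau>)) / \<alpha> - (ln (nn 0) - ln (uu 0)) / \<alpha> = (ln (s' / s) + 2 * ln v) / \<alpha>"
  proof -
    have u: "uu 0 = v" "uu \<tau> = 1" by (simp_all add: uu_def v)
    moreover have "nn 0 = s * v" unfolding nn_def u by simp
    moreover have "nn \<tau> = s' * v\<^sup>2" using svar_tau pos by (simp add: svar_def u field_simps)
    ultimately show ?thesis
      using pos s'_pos by (simp add: ln_mult ln_div ln_realpow diff_divide_distrib add_divide_distrib)
  qed
  have "(\<integral>\<^sup>+t. ennreal (real DIM('a) / svar t) * indicator {0..\<tau>} t \<partial>lborel)
      = (\<integral>\<^sup>+t. ennreal (real DIM('a) * (1 / svar t * indicator {0..\<tau>} t)) \<partial>lborel)"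
    by (intro nn_integral_cong) (auto simp: indicator_def)
  also have "\<dots> = ennreal (\<integral>t. real DIM('a) * (1 / svar t * indicator {0..\<tau>} t) \<partial>lborel)"
  proof (rule nn_integral_eq_integral)
    show "integrable lborel (\<lambda>t. real DIM('a) * (1 / svar t * indicator {0..\<tau>} t))"
      using A by (intro integrable_mult_right) (simp add: has_bochner_integral_iff)
    show "AE t in lborel. 0 \<le> real DIM('a) * (1 / svar t * indicator {0..\<tau>} t)"
    proof (rule AE_I2)
      fix t
      show "0 \<le> real DIM('a) * (1 / svar t * indicator {0..\<tau>} t)"
        using svar_pos[of t] by (cases "t \<in> {0..\<tau>}") auto
    qed
  qed
  also have "(\<integral>t. real DIM('a) * (1 / svar t * indicator {0..\<tau>} t) \<partial>lborel) = real DIM('a) * ((ln (s' / s) + 2 * ln v) / \<alpha>)"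
    using A unfolding val by (subst integral_mult_right_zero) (simp add: has_bochner_integral_iff)
  finally show ?thesis by simp
qed

end

section \<open>The residual and the error estimate\<close>

text \<open>Multiply |x - sqrt y| by the number x + sqrt y, which is at least as large. No lower
  bound for the sum enters, at the price of half a power of \<tau> in the one-step error.\<close>

lemma abs_sqrt_diff_le:
  assumes "0 \<le> x" "0 \<le> y"
  shows "\<bar>x - sqrt y\<bar> \<le> sqrt \<bar>x\<^sup>2 - y\<bar>"
proof (rule real_le_rsqrt)
  have y: "(sqrt y)\<^sup>2 = y" using assms by simp
  have "0 \<le> sqrt y" using assms by simp
  then have "\<bar>x - sqrt y\<bar> \<le> \<bar>x + sqrt y\<bar>" using assms by linarith
  then have "\<bar>x - sqrt y\<bar> * \<bar>x - sqrt y\<bar> \<le> \<bar>x + sqrt y\<bar> * \<bar>x - sqrt y\<bar>" by (rule mult_right_mono) simp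
  also have "\<dots> = \<bar>(x + sqrt y) * (x - sqrt y)\<bar>" by (rule abs_mult[symmetric])
  also have "(x + sqrt y) * (x - sqrt y) = x\<^sup>2 - y"
    using y by (simp add: algebra_simps power2_eq_square)
  finally show "\<bar>x - sqrt y\<bar>\<^sup>2 \<le> \<bar>x\<^sup>2 - y\<bar>" by (simp only: power2_eq_square)
qed

text \<open>The increment is h divided by the sum of the two roots, and the square of that sum lies
  between 4 s and 4 s + 2 h.\<close>

lemma sqrt_increment_sq:
  assumes "0 < s" "0 \<le> h"
  shows "\<bar>(sqrt (s + h) - sqrt s)\<^sup>2 - h\<^sup>2 / (4 * s)\<bar> \<le> h ^ 3 / (8 * s\<^sup>2)"
proof -
  define x w where "x = sqrt (s + h) - sqrt s" and "w = (sqrt (s + h) + sqrt s)\<^sup>2"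
  have p: "(sqrt (s + h))\<^sup>2 = s + h" "(sqrt s)\<^sup>2 = s" using assms by auto
  have "x * (sqrt (s + h) + sqrt s) = h" using p by (simp add: x_def algebra_simps power2_eq_square)
  then have xw: "x\<^sup>2 * w = h\<^sup>2" by (metis power_mult_distrib w_def)
  have "sqrt s \<le> sqrt (s + h)" using assms by simp
  then have "(2 * sqrt s)\<^sup>2 \<le> w" unfolding w_def using assms by (intro power_mono) auto
  then have w1: "4 * s \<le> w" using p by (simp add: power_mult_distrib)
  have "0 \<le> (sqrt (s + h) - sqrt s)\<^sup>2" by simp
  then have "2 * (sqrt (s + h) * sqrt s) \<le> (s + h) + s" using p by (simp add: power2_diff)
  then have w2: "w \<le> 4 * s + 2 * h" unfolding w_def using p by (simp add: power2_sum)
  have w0: "w > 0" using w1 assms by simp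
  have "x\<^sup>2 = h\<^sup>2 / w" using xw w0 by (simp add: field_simps)
  then have eq: "h\<^sup>2 / (4 * s) - x\<^sup>2 = h\<^sup>2 * (w - 4 * s) / (4 * s * w)" using w0 assms by (simp add: field_simps)
  have nn: "0 \<le> h\<^sup>2 * (w - 4 * s) / (4 * s * w)" using w0 w1 assms by simp
  have "h\<^sup>2 * (w - 4 * s) / (4 * s * w) \<le> h\<^sup>2 * (2 * h) / (4 * s * (4 * s))"
    using w1 w2 assms by (intro frac_le mult_left_mono) auto
  also have "\<dots> = h ^ 3 / (8 * s\<^sup>2)" by (simp add: power2_eq_square power3_eq_cube)
  finally show ?thesis using eq nn unfolding x_def by linarith
qed

text \<open>Both squares are \<alpha>^2 \<tau>^2 / (4 s) to leading order: l \<tau> - ln v is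
  quadratic in \<tau>, and ln (1 + q) differs from q by at most q^2. The smallness conditions put v
  into [1/2, 2] and q into [0, 1]. The 3 in the constant is 1 from \<open>t4\<close> plus 2 from
  \<open>t3\<close>.\<close>

lemma one_step_error:
  fixes s \<alpha> \<tau> l v m :: real
  assumes m: "0 < m" "m \<le> s" and pos: "0 < \<alpha>" "0 < \<tau>" and v: "v = 1 + l * \<tau>"
    and small: "\<bar>l\<bar> * \<tau> \<le> 1 / 2" "2 * \<alpha> * \<tau> \<le> m"
  shows "\<bar>(sqrt (s + \<alpha> * \<tau> * v) - sqrt s) - sqrt \<tau> * sqrt (\<alpha> * (l * \<tau> - ln v + ln (1 + \<alpha> * \<tau> * v / s) / 4) / v)\<bar>
    \<le> sqrt ((3 * \<alpha> ^ 3 / m\<^sup>2 + \<alpha>\<^sup>2 * \<bar>l\<bar> / m + 4 * \<alpha> * l\<^sup>2) * \<tau> ^ 3)"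
proof -
  define h q where "h = \<alpha> * \<tau> * v" and "q = h / s"
  have lt: "\<bar>l * \<tau>\<bar> \<le> 1 / 2" using small(1) pos by (simp add: abs_mult)
  then have vb: "1 / 2 \<le> v" "v \<le> 2" unfolding v by linarith+
  have s0: "s > 0" using m by simp
  have h: "0 \<le> h" "h \<le> 2 * \<alpha> * \<tau>"
    using pos vb mult_left_mono[OF vb(2), of "\<alpha> * \<tau>"] by (auto simp: h_def mult_ac)
  have q: "0 \<le> q" "q \<le> 2 * \<alpha> * \<tau> / m" unfolding q_def using h m s0 pos by (auto intro!: frac_le)
  have "2 * \<alpha> * \<tau> / m \<le> 1" using small(2) m by simp
  with q have q1: "q \<le> 1" by simp
  let ?X = "sqrt (s + h) - sqrt s"
  define A where "A = l * \<tau> - ln v"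
  define B where "B = q - ln (1 + q)"
  have A: "0 \<le> A" "A \<le> 2 * (l * \<tau>)\<^sup>2"
    using ln_add_one_self_le_self2[of "l * \<tau>"] abs_ln_one_plus_x_minus_x_bound[OF lt] lt by (auto simp: A_def v abs_le_iff)
  have B: "0 \<le> B" "B \<le> q\<^sup>2"
    using ln_add_one_self_le_self[OF q(1)] abs_ln_one_plus_x_minus_x_bound_nonneg[OF q(1) q1] by (auto simp: B_def)
  have ln0: "0 \<le> ln (1 + q)" using q by simp
  define Y where "Y = \<tau> * (\<alpha> * (A + ln (1 + q) / 4) / v)"
  have Y0: "0 \<le> Y" unfolding Y_def using pos vb A ln0 by simp
  \<comment> \<open>The part of ln (1 + q) / 4 that is linear in q. It reproduces the leading term
    of the squared increment up to the factor v^2, which accounts for the error term with v^2 -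
    1.\<close>
  have qv: "\<tau> * \<alpha> * q / (4 * v) = \<alpha>\<^sup>2 * \<tau>\<^sup>2 / (4 * s)"
    unfolding q_def h_def using vb s0 by (simp add: power2_eq_square mult_ac)
  have eq: "h\<^sup>2 / (4 * s) - Y = \<alpha>\<^sup>2 * \<tau>\<^sup>2 * (v\<^sup>2 - 1) / (4 * s) - \<tau> * \<alpha> / v * A + \<tau> * \<alpha> / (4 * v) * B"
  proof -
    have "Y = \<tau> * \<alpha> / v * A + \<tau> * \<alpha> * q / (4 * v) - \<tau> * \<alpha> / (4 * v) * B"
      unfolding Y_def B_def using vb by (simp add: field_simps)
    moreover have "h\<^sup>2 / (4 * s) = \<alpha>\<^sup>2 * \<tau>\<^sup>2 * (v\<^sup>2 - 1) / (4 * s) + \<alpha>\<^sup>2 * \<tau>\<^sup>2 / (4 * s)"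
      unfolding h_def using s0 by (simp add: field_simps power_mult_distrib)
    ultimately show ?thesis unfolding qv by simp
  qed
  have iv: "1 / v \<le> 2" using vb by (simp add: field_simps)
  have t1: "\<bar>\<alpha>\<^sup>2 * \<tau>\<^sup>2 * (v\<^sup>2 - 1) / (4 * s)\<bar> \<le> \<alpha>\<^sup>2 * \<bar>l\<bar> / m * \<tau> ^ 3"
  proof -
    have "v\<^sup>2 - 1 = (l * \<tau>) * (2 + l * \<tau>)" by (simp add: v power2_eq_square algebra_simps)
    then have "\<bar>v\<^sup>2 - 1\<bar> = \<bar>l\<bar> * \<tau> * \<bar>2 + l * \<tau>\<bar>" using pos by (simp add: abs_mult)
    also have "\<dots> \<le> \<bar>l\<bar> * \<tau> * 4" using lt pos by (intro mult_left_mono) auto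
    finally have "\<bar>v\<^sup>2 - 1\<bar> \<le> 4 * (\<bar>l\<bar> * \<tau>)" by simp
    then have "\<alpha>\<^sup>2 * \<tau>\<^sup>2 * \<bar>v\<^sup>2 - 1\<bar> / (4 * s) \<le> \<alpha>\<^sup>2 * \<tau>\<^sup>2 * (4 * (\<bar>l\<bar> * \<tau>)) / (4 * m)"
      using m s0 pos by (intro frac_le mult_left_mono) auto
    also have "\<dots> = \<alpha>\<^sup>2 * \<bar>l\<bar> / m * \<tau> ^ 3" by (simp add: power2_eq_square power3_eq_cube)
    finally show ?thesis using s0 by (simp add: abs_mult)
  qed
  have t2: "\<bar>\<tau> * \<alpha> / v * A\<bar> \<le> 4 * \<alpha> * l\<^sup>2 * \<tau> ^ 3"
  proof -
    have "\<tau> * \<alpha> * (1 / v) * A \<le> \<tau> * \<alpha> * 2 * (2 * (l * \<tau>)\<^sup>2)"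
      using A pos iv vb by (intro mult_mono) auto
    also have "\<dots> = 4 * \<alpha> * l\<^sup>2 * \<tau> ^ 3" by (simp add: power2_eq_square power3_eq_cube)
    finally show ?thesis using A(1) pos vb by simp
  qed
  have t3: "\<bar>\<tau> * \<alpha> / (4 * v) * B\<bar> \<le> 2 * \<alpha> ^ 3 / m\<^sup>2 * \<tau> ^ 3"
  proof -
    have "\<tau> * \<alpha> / 4 * (1 / v) * B \<le> \<tau> * \<alpha> / 4 * 2 * (2 * \<alpha> * \<tau> / m)\<^sup>2"
      using B pos iv vb order_trans[OF B(2) power_mono[OF q(2) q(1)]] by (intro mult_mono) auto
    also have "\<dots> = 2 * \<alpha> ^ 3 / m\<^sup>2 * \<tau> ^ 3" by (simp add: power2_eq_square power3_eq_cube)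
    finally show ?thesis using B(1) pos vb by (simp add: mult.commute)
  qed
  have t4: "\<bar>?X\<^sup>2 - h\<^sup>2 / (4 * s)\<bar> \<le> \<alpha> ^ 3 / m\<^sup>2 * \<tau> ^ 3"
  proof -
    have "h ^ 3 / (8 * s\<^sup>2) \<le> (2 * \<alpha> * \<tau>) ^ 3 / (8 * m\<^sup>2)"
      using h m s0 by (intro frac_le power_mono mult_left_mono zero_le_power) auto
    also have "\<dots> = \<alpha> ^ 3 / m\<^sup>2 * \<tau> ^ 3" by (simp add: power_mult_distrib)
    finally show ?thesis using sqrt_increment_sq[OF s0 h(1)] by linarith
  qed
  have sum4: "\<bar>x - y\<bar> \<le> e4 + (e1 + e2 + e3)"
    if "\<bar>d1\<bar> \<le> e1" "\<bar>d2\<bar> \<le> e2" "\<bar>d3\<bar> \<le> e3" "\<bar>x - z\<bar> \<le> e4" "z - y = d1 - d2 + d3"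
    for x y z d1 d2 d3 e1 e2 e3 e4 :: real using that by linarith
  have "\<bar>?X\<^sup>2 - Y\<bar> \<le> \<alpha> ^ 3 / m\<^sup>2 * \<tau> ^ 3 + (\<alpha>\<^sup>2 * \<bar>l\<bar> / m * \<tau> ^ 3 + 4 * \<alpha> * l\<^sup>2 * \<tau> ^ 3 + 2 * \<alpha> ^ 3 / m\<^sup>2 * \<tau> ^ 3)"
    by (rule sum4[OF t1 t2 t3 t4 eq])
  also have "\<dots> = (3 * \<alpha> ^ 3 / m\<^sup>2 + \<alpha>\<^sup>2 * \<bar>l\<bar> / m + 4 * \<alpha> * l\<^sup>2) * \<tau> ^ 3" by (simp add: algebra_simps)
  finally have "\<bar>?X\<^sup>2 - Y\<bar> \<le> (3 * \<alpha> ^ 3 / m\<^sup>2 + \<alpha>\<^sup>2 * \<bar>l\<bar> / m + 4 * \<alpha> * l\<^sup>2) * \<tau> ^ 3" .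
  moreover have "\<bar>?X - sqrt Y\<bar> \<le> sqrt \<bar>?X\<^sup>2 - Y\<bar>"
    using Y0 h by (intro abs_sqrt_diff_le) auto
  ultimately have "\<bar>?X - sqrt Y\<bar> \<le> sqrt ((3 * \<alpha> ^ 3 / m\<^sup>2 + \<alpha>\<^sup>2 * \<bar>l\<bar> / m + 4 * \<alpha> * l\<^sup>2) * \<tau> ^ 3)"
    using real_sqrt_le_mono order_trans by blast
  then show ?thesis unfolding Y_def A_def q_def h_def real_sqrt_mult[of \<tau>] .
qed

abbreviation (input) quadratic :: "real \<Rightarrow> 'a::euclidean_space measure \<Rightarrow> real" where
  "quadratic l \<equiv> (\<lambda>\<rho>. l / 2 * (\<integral>x. (norm x)\<^sup>2 \<partial>\<rho>))"

section \<open>Iterates, interpolating curve and residual in closed form\<close>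

locale gaussian_scheme =
  fixes a \<alpha> \<tau> l v :: real
  assumes pos: "a > 0" "\<alpha> > 0" "\<tau> > 0" "v > 0" and v: "v = 1 + l * \<tau>"
begin

primrec sq :: "nat \<Rightarrow> real" where
  "sq 0 = a"
| "sq (Suc k) = sq k / v\<^sup>2 + \<alpha> * \<tau> / v"

lemma sq_pos: "sq k > 0"
  using pos by (induction k) (auto intro: add_pos_pos)

text \<open>Without the noise terms the recursion is that of the unregularized scheme. This gives
  the sign of the difference of the standard deviations and, later, a lower bound for the variances
  that is uniform in k.\<close>

lemma sq_ge: "a / (v\<^sup>2) ^ k \<le> sq k"
proof (induction k)
  case (Suc k)
  have "a / (v\<^sup>2) ^ Suc k = a / (v\<^sup>2) ^ k / v\<^sup>2" by simp
  also have "\<dots> \<le> sq k / v\<^sup>2" using Suc by (rule divide_right_mono) simp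
  also have "\<dots> \<le> sq (Suc k)" using pos by simp
  finally show ?case .
qed simp

text \<open>The factor v turns one step of the recursion into an increment under the root, so that
  v^k times the k-th standard deviation telescopes.\<close>

lemma v_sqrt_sq_Suc: "v * sqrt (sq (Suc k)) = sqrt (sq k + \<alpha> * \<tau> * v)"
proof -
  have "v * sqrt (sq (Suc k)) = sqrt (v\<^sup>2 * sq (Suc k))" using pos by (simp add: real_sqrt_mult)
  also have "v\<^sup>2 * sq (Suc k) = sq k + \<alpha> * \<tau> * v" using pos by (simp add: distrib_left power2_eq_square)
  finally show ?thesis .
qed

lemma step: "schroedinger_step (sq k) \<alpha> \<tau> l v (\<alpha> * \<tau> / v) (sq (Suc k))"
  by unfold_locales (rule pos sq_pos v sq.simps(2) refl)+

lemma Jalpha_iter_gaussian: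
  "Jalpha_iter (quadratic l) \<alpha> k \<tau> (gaussian a :: 'a::euclidean_space measure) = gaussian (sq k)"
proof (induction k)
  case (Suc k)
  then show ?case using schroedinger_step.Jalpha_gaussian[OF step[of k], where 'a='a]
    by (simp add: Jalpha_iter_def)
qed (simp add: Jalpha_iter_def)

lemma J0_iter_gaussian:
  "J0_iter (quadratic l) k \<tau> (gaussian a :: 'a::euclidean_space measure) = gaussian (a / (v\<^sup>2) ^ k)"
proof (induction k)
  case (Suc k)
  have "0 < a / (v\<^sup>2) ^ k" using pos by simp
  from J0_gaussian[OF pos(3) v pos(4) this, where 'a='a] show ?case
    using Suc by (simp add: J0_iter_def mult.commute)
qed (simp add: J0_iter_def)

definition sv :: "nat \<Rightarrow> real \<Rightarrow> real" where
  "sv k = schroedinger_step.svar (sq k) \<alpha> \<tau> l v"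

lemma sv_pos: "t \<in> {0..\<tau>} \<Longrightarrow> sv k t > 0"
  unfolding sv_def by (rule schroedinger_step.svar_pos[OF step])

lemma sv_0: "sv k 0 = sq k"
  unfolding sv_def by (rule schroedinger_step.svar_0[OF step])

lemma sv_tau: "sv k \<tau> = sq (Suc k)"
  unfolding sv_def by (rule schroedinger_step.svar_tau[OF step])

lemma sv_measurable [measurable]: "sv k \<in> borel_measurable borel"
  unfolding sv_def by (rule schroedinger_step.svar_measurable[OF step])

text \<open>At negative times the value is \<open>undefined\<close>, as membership in
  \<open>extensional\<close> demands; at k \<tau> the floor selects the segment that starts
  there.\<close>

definition curve :: "real \<Rightarrow> 'a::euclidean_space measure" where
  "curve t = (if 0 \<le> t then gaussian (sv (nat \<lfloor>t / \<tau>\<rfloor>) (t - real (nat \<lfloor>t / \<tau>\<rfloor>) * \<tau>)) else undefined)"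

lemma curve_segment:
  assumes "t \<in> {0..\<tau>}"
  shows "curve (real k * \<tau> + t) = gaussian (sv k t)"
proof -
  have nonneg: "0 \<le> real k * \<tau> + t" using assms pos by simp
  have div: "(real k * \<tau> + t) / \<tau> = real k + t / \<tau>" using pos by (simp add: field_simps)
  show ?thesis
  proof (cases "t < \<tau>")
    case True
    then have "\<lfloor>(real k * \<tau> + t) / \<tau>\<rfloor> = int k"
      unfolding div using assms pos by (intro floor_unique) (auto simp: field_simps)
    then show ?thesis using nonneg by (simp add: curve_def)
  next
    \<comment> \<open>At t = \<tau> the floor has already jumped to k + 1, so the value is read off
      at the start of the next segment, where it matches the end of this one.\<close>
    case False
    then have t: "t = \<tau>" using assms by simp
    then have "\<lfloor>(real k * \<tau> + t) / \<tau>\<rfloor> = int (Suc k)"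
      unfolding div using pos by (intro floor_unique) auto
    then have "nat \<lfloor>(real k * \<tau> + t) / \<tau>\<rfloor> = Suc k" by simp
    then have "curve (real k * \<tau> + t) = gaussian (sv (Suc k) (real k * \<tau> + \<tau> - real (Suc k) * \<tau>))"
      using nonneg by (simp only: curve_def t if_True)
    also have "real k * \<tau> + \<tau> - real (Suc k) * \<tau> = 0" by (simp add: algebra_simps)
    finally show ?thesis by (simp only: sv_0 t sv_tau)
  qed
qed

lemma segment_exists:
  assumes "0 \<le> s"
  shows "\<exists>k t. t \<in> {0..\<tau>} \<and> s = real k * \<tau> + t"
proof -
  let ?k = "nat \<lfloor>s / \<tau>\<rfloor>"
  have "real ?k \<le> s / \<tau>" "s / \<tau> \<le> real ?k + 1" using assms pos by (auto intro: of_nat_floor)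
  then have "s - real ?k * \<tau> \<in> {0..\<tau>}" using pos by (simp add: field_simps)
  then have "s - real ?k * \<tau> \<in> {0..\<tau>} \<and> s = real ?k * \<tau> + (s - real ?k * \<tau>)" by simp
  then show ?thesis by blast
qed

lemma interpolating_curve_curve:
  "interpolating_curve (quadratic l) \<alpha> \<tau> (gaussian a) (curve :: real \<Rightarrow> 'a::euclidean_space measure)"
  unfolding interpolating_curve_def Jalpha_iter_gaussian
proof (intro conjI allI impI)
  show "curve \<in> extensional {0..}" by (auto simp: extensional_def curve_def)
  show "(curve s :: 'a measure) \<in> P2" if s: "0 \<le> s" for s
  proof -
    obtain k t where t: "t \<in> {0..\<tau>}" "s = real k * \<tau> + t" using segment_exists[OF s] by blast
    show ?thesis unfolding t(2) curve_segment[OF t(1)] by (rule gaussian_P2[OF sv_pos[OF t(1)]])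
  qed
  show "curve (real k * \<tau>) = gaussian (sq k)" for k
    using curve_segment[of 0 k] pos by (simp add: sv_0)
  show "\<exists>c. is_arg_min (dynamic_action \<alpha> \<tau>) (admissible \<tau> (gaussian (sq k)) (gaussian (sq (Suc k))))
      (\<lambda>s. curve (real k * \<tau> + s) :: 'a measure, c)" for k
  proof (rule exI, rule schroedinger_step.gaussian_is_minimizer[OF step])
    fix t assume "t \<in> {0..\<tau>}"
    then show "curve (real k * \<tau> + t) = gaussian (schroedinger_step.svar (sq k) \<alpha> \<tau> l v t)"
      by (simp only: curve_segment sv_def)
  qed
qed

text \<open>Every nonnegative time lies in a segment, on which minimality determines the curve; the
  negative times are fixed by extensionality.\<close>

lemma interpolating_curve_unique:
  fixes r :: "real \<Rightarrow> 'a::euclidean_space measure"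
  assumes r: "interpolating_curve (quadratic l) \<alpha> \<tau> (gaussian a) r"
  shows "r = curve"
proof
  fix s
  show "r s = curve s"
  proof (cases "0 \<le> s")
    case True
    then obtain k t where t: "t \<in> {0..\<tau>}" "s = real k * \<tau> + t" using segment_exists by blast
    obtain c where "is_arg_min (dynamic_action \<alpha> \<tau>) (admissible \<tau> (gaussian (sq k)) (gaussian (sq (Suc k)))) (\<lambda>s. r (real k * \<tau> + s), c)"
      using r unfolding interpolating_curve_def Jalpha_iter_gaussian by blast
    from schroedinger_step.minimizer_is_gaussian[OF step this t(1)] show ?thesis
      unfolding t(2) curve_segment[OF t(1)] sv_def .
  next
    case False
    then show ?thesis using r by (auto simp: interpolating_curve_def extensional_def curve_def)
  qed
qed

lemma rho_bar_eq_curve: "rho_bar (quadratic l) \<alpha> \<tau> (gaussian a) = (curve :: real \<Rightarrow> 'a::euclidean_space measure)"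
  unfolding rho_bar_def
  by (rule the_equality, rule interpolating_curve_curve, rule interpolating_curve_unique)

text \<open>The recursion multiplied by v^2. Through it the entropy difference and the integrated
  Fisher information lead to the same logarithm.\<close>

lemma ln_sq_ratio: "ln (sq (Suc k) / sq k) + 2 * ln v = ln (1 + \<alpha> * \<tau> * v / sq k)"
proof -
  have "sq (Suc k) / sq k * v\<^sup>2 = 1 + \<alpha> * \<tau> * v / sq k"
    using pos sq_pos[of k] by (simp add: field_simps power2_eq_square)
  moreover have "ln (sq (Suc k) / sq k * v\<^sup>2) = ln (sq (Suc k) / sq k) + ln (v\<^sup>2)"
    by (rule ln_mult_pos) (use pos sq_pos[of k] sq_pos[of "Suc k"] in \<open>auto simp del: sq.simps\<close>)
  ultimately show ?thesis using pos by (simp add: ln_realpow del: sq.simps)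
qed

lemma fisher_integral:
  "(\<integral>\<^sup>+ s\<in>{real k * \<tau>..real (Suc k) * \<tau>}. fisher (curve s :: 'a::euclidean_space measure) \<partial>lborel)
    = ennreal (real DIM('a) / \<alpha> * ln (1 + \<alpha> * \<tau> * v / sq k))"
proof -
  let ?I = "{real k * \<tau>..real (Suc k) * \<tau>}"
  let ?g = "\<lambda>s. ennreal (real DIM('a) / sv k (s - real k * \<tau>)) * indicator ?I s"
  have "(\<integral>\<^sup>+ s\<in>?I. fisher (curve s :: 'a measure) \<partial>lborel) = (\<integral>\<^sup>+ s. ?g s \<partial>lborel)"
  proof (rule nn_integral_cong)
    fix s
    show "fisher (curve s :: 'a measure) * indicator ?I s = ?g s"
    proof (cases "s \<in> ?I")
      case True
      then have t: "s - real k * \<tau> \<in> {0..\<tau>}" by (auto simp: algebra_simps)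
      have "curve s = (gaussian (sv k (s - real k * \<tau>)) :: 'a measure)"
        using curve_segment[OF t, of k, where 'a='a] by simp
      then show ?thesis using fisher_gaussian[OF sv_pos[OF t], where 'a='a] by simp
    qed simp
  qed
  also have "\<dots> = (\<integral>\<^sup>+ t. ?g (real k * \<tau> + 1 * t) \<partial>lborel)"
    by (subst nn_integral_real_affine[where c=1 and t="real k * \<tau>"]) auto
  also have "\<dots> = (\<integral>\<^sup>+ t. ennreal (real DIM('a) / sv k t) * indicator {0..\<tau>} t \<partial>lborel)"
    by (intro nn_integral_cong) (auto simp: indicator_def algebra_simps)
  also have "\<dots> = ennreal (real DIM('a) / \<alpha> * (ln (sq (Suc k) / sq k) + 2 * ln v))"
    unfolding sv_def by (rule schroedinger_step.integral_inverse_svar[OF step])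
  finally show ?thesis unfolding ln_sq_ratio .
qed

text \<open>Convolution adds the variance \<alpha> \<tau> per coordinate and contributes d l
  \<alpha> \<tau>. With L the logarithm on the right, the entropy difference gives d \<alpha> (L / 2
  - ln v), and the Fisher term subtracts d \<alpha> L / 4.\<close>

lemma residual_eq:
  "residual (quadratic l) (gaussian a :: 'a::ordered_euclidean_space measure) k \<alpha> \<tau>
    = real DIM('a) * (\<alpha> * (l * \<tau> - ln v + ln (1 + \<alpha> * \<tau> * v / sq k) / 4))"
proof -
  let ?d = "real DIM('a)" and ?L = "ln (1 + \<alpha> * \<tau> * v / sq k)"
  note s = sq_pos[of k] and s1 = sq_pos[of "Suc k"]
  have sv: "0 < sq k / v\<^sup>2" using s pos by simp
  have J0: "J0 (quadratic l) \<tau> (gaussian (sq k) :: 'a measure) = gaussian (sq k / v\<^sup>2)"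
    by (rule J0_gaussian[OF pos(3) v pos(4) s])
  have "0 < \<alpha> * \<tau>" using pos by simp
  note conv = convolution_gaussian_norm_sq[OF gaussian_P2[OF sv] this, where 'a='a]
  \<comment> \<open>Nonnegativity lets \<open>enn2real\<close> undo \<open>ennreal\<close> in the
    Fisher integral.\<close>
  have "0 \<le> ?L" using s pos by simp
  then have fi: "enn2real (\<integral>\<^sup>+ s\<in>{real k * \<tau>..real (Suc k) * \<tau>}. fisher (curve s :: 'a measure) \<partial>lborel) = ?d / \<alpha> * ?L"
    unfolding fisher_integral using pos by simp
  have ln: "ln (2 * pi * sq (Suc k)) - ln (2 * pi * sq k) = ?L - 2 * ln v"
    using s s1 ln_sq_ratio[of k] by (simp add: ln_mult ln_div del: sq.simps)
  have "residual (quadratic l) (gaussian a :: 'a measure) k \<alpha> \<tau>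
      = 2 * (l / 2 * (?d * (sq k / v\<^sup>2) + ?d * (\<alpha> * \<tau>))) - 2 * (l / 2 * (?d * (sq k / v\<^sup>2)))
        + \<alpha> * (?d / 2 * (ln (2 * pi * sq (Suc k)) - ln (2 * pi * sq k))) - \<alpha>\<^sup>2 / 4 * (?d / \<alpha> * ?L)"
    unfolding residual_def Jalpha_iter_gaussian J0 rho_bar_eq_curve fi conv
      integral_gaussian_norm_sq[OF sv] boltzmann_gaussian[OF s] boltzmann_gaussian[OF s1]
    by (simp add: right_diff_distrib del: sq.simps)
  also have "\<dots> = ?d * (\<alpha> * (l * \<tau> - ln v + ?L / 4))"
    unfolding ln using pos by (simp add: field_simps power2_eq_square)
  finally show ?thesis .
qed

text \<open>The difference of the standard deviations after n steps is a telescoping sum of v^k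
  times the k-th standard deviation, divided by v^n; \<open>sq_ge\<close> supplies its sign.\<close>

lemma W2_iterates:
  "W2 (J0_iter (quadratic l) n \<tau> (gaussian a :: 'a::euclidean_space measure)) (Jalpha_iter (quadratic l) \<alpha> n \<tau> (gaussian a))
    = sqrt (real DIM('a)) * (\<Sum>k<n. v ^ k / v ^ n * (sqrt (sq k + \<alpha> * \<tau> * v) - sqrt (sq k)))"
proof -
  have p: "0 < a / (v\<^sup>2) ^ n" using pos by simp
  have "(\<Sum>k<n. v ^ k / v ^ n * (sqrt (sq k + \<alpha> * \<tau> * v) - sqrt (sq k)))
      = (\<Sum>k<n. v ^ Suc k / v ^ n * sqrt (sq (Suc k)) - v ^ k / v ^ n * sqrt (sq k))"
    unfolding v_sqrt_sq_Suc[symmetric] by (simp add: right_diff_distrib mult_ac del: sq.simps)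
  also have "\<dots> = sqrt (sq n) - sqrt a / v ^ n"
    by (subst sum_lessThan_telescope) (use pos in simp)
  also have "sqrt a / v ^ n = sqrt (a / (v\<^sup>2) ^ n)"
    using pos by (simp add: real_sqrt_divide real_sqrt_power)
  finally have "(\<Sum>k<n. v ^ k / v ^ n * (sqrt (sq k + \<alpha> * \<tau> * v) - sqrt (sq k))) = sqrt (sq n) - sqrt (a / (v\<^sup>2) ^ n)" .
  moreover have "sqrt (a / (v\<^sup>2) ^ n) \<le> sqrt (sq n)" using sq_ge by simp
  ultimately show ?thesis
    unfolding J0_iter_gaussian Jalpha_iter_gaussian W2_gaussian[OF p sq_pos] by simp
qed

text \<open>The number \<open>m\<close> bounds the variances from below and exp (2 |l| t) bounds the
  weights v^(k - n) from above, both uniformly in k < n because n \<tau> = t. Each of the n terms is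
  of order \<tau>^(3/2), and n sqrt (K \<tau>^3) = sqrt (K t^3 / n).\<close>

lemma error_bound:
  assumes n: "0 < n" "\<tau> = t / real n" and m: "m = a * exp (- 2 * \<bar>l\<bar> * t)"
    and small: "\<bar>l\<bar> * \<tau> \<le> 1 / 2" "2 * \<alpha> * \<tau> \<le> m"
  shows "\<bar>W2 (J0_iter (quadratic l) n \<tau> (gaussian a :: 'a::ordered_euclidean_space measure)) (Jalpha_iter (quadratic l) \<alpha> n \<tau> (gaussian a))
      - (\<Sum>k<n. v powi (int k - int n) * sqrt \<tau>
          * sqrt (residual (quadratic l) (gaussian a :: 'a measure) k \<alpha> \<tau> / v))\<bar>
    \<le> exp (2 * \<bar>l\<bar> * t) * sqrt (real DIM('a))
        * sqrt ((3 * \<alpha> ^ 3 / m\<^sup>2 + \<alpha>\<^sup>2 * \<bar>l\<bar> / m + 4 * \<alpha> * l\<^sup>2) * t ^ 3 / real n)"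
proof -
  define K where "K = 3 * \<alpha> ^ 3 / m\<^sup>2 + \<alpha>\<^sup>2 * \<bar>l\<bar> / m + 4 * \<alpha> * l\<^sup>2"
  let ?d = "real DIM('a)"
  have m0: "m > 0" using m pos by simp
  have t: "real n * \<tau> = t" using n by simp
  have lt: "\<bar>l * \<tau>\<bar> \<le> 1 / 2" using small(1) pos by (simp add: abs_mult)
  have v_le: "v \<le> exp (\<bar>l\<bar> * \<tau>)"
  proof -
    have "l * \<tau> \<le> \<bar>l\<bar> * \<tau>" using pos by (intro mult_right_mono) auto
    then show ?thesis using exp_ge_add_one_self[of "\<bar>l\<bar> * \<tau>"] v by linarith
  qed
  \<comment> \<open>ln v differs from l \<tau> by at most 2 (l \<tau>)^2, which is at most |l
    \<tau>| under the smallness condition; hence the 2 in the exponent that bounds the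
    weights.\<close>
  have v_ge: "exp (- (2 * \<bar>l\<bar> * \<tau>)) \<le> v"
  proof -
    let ?y = "\<bar>l * \<tau>\<bar>"
    have "2 * (l * \<tau>)\<^sup>2 \<le> ?y"
    proof -
      have "?y * ?y \<le> ?y * (1 / 2)" using lt by (intro mult_left_mono) auto
      then show ?thesis by (simp add: power2_eq_square)
    qed
    moreover have "\<bar>ln v - l * \<tau>\<bar> \<le> 2 * (l * \<tau>)\<^sup>2" using abs_ln_one_plus_x_minus_x_bound[OF lt] unfolding v .
    ultimately have "- (2 * ?y) \<le> ln v" by linarith
    then have "exp (- (2 * ?y)) \<le> exp (ln v)" by simp
    then show ?thesis using pos by (simp add: abs_mult mult.assoc)
  qed
  have powle: "v ^ j \<le> exp (\<bar>l\<bar> * t)" if "j \<le> n" for j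
  proof -
    have "v ^ j \<le> exp (\<bar>l\<bar> * \<tau>) ^ j" using pos v_le by (intro power_mono) auto
    also have "\<dots> = exp (\<bar>l\<bar> * (real j * \<tau>))" by (simp add: exp_of_nat_mult[symmetric] mult_ac)
    also have "\<dots> \<le> exp (\<bar>l\<bar> * t)"
      using that pos unfolding t[symmetric] by (simp add: mult_left_mono mult_right_mono)
    finally show ?thesis .
  qed
  have powge: "exp (- (2 * \<bar>l\<bar> * t)) \<le> v ^ j" if "j \<le> n" for j
  proof -
    have "exp (- (2 * \<bar>l\<bar> * t)) \<le> exp (- (2 * \<bar>l\<bar> * (real j * \<tau>)))"
      using that pos unfolding t[symmetric] by (simp add: mult_left_mono mult_right_mono)
    also have "\<dots> = exp (- (2 * \<bar>l\<bar> * \<tau>)) ^ j" by (simp add: exp_of_nat_mult[symmetric] mult_ac)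
    also have "\<dots> \<le> v ^ j" using v_ge by (intro power_mono) auto
    finally show ?thesis .
  qed
  have coeff: "v ^ k / v ^ n \<le> exp (2 * \<bar>l\<bar> * t)" if "k < n" for k
  proof -
    have "v ^ n = v ^ k * v ^ (n - k)" using that by (simp add: power_add[symmetric])
    then have "v ^ k / v ^ n = 1 / v ^ (n - k)" using pos by simp
    also have "\<dots> \<le> 1 / exp (- (2 * \<bar>l\<bar> * t))" using powge[of "n - k"] by (intro divide_left_mono) (auto simp: pos)
    also have "\<dots> = exp (2 * \<bar>l\<bar> * t)" by (simp add: exp_minus field_simps)
    finally show ?thesis .
  qed
  have sq_m: "m \<le> sq k" if "k < n" for k
  proof -
    have "(v ^ k)\<^sup>2 \<le> (exp (\<bar>l\<bar> * t))\<^sup>2" using powle[of k] that pos by (intro power_mono) auto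
    also have "\<dots> = exp (2 * \<bar>l\<bar> * t)" by (simp add: power2_eq_square exp_add[symmetric])
    finally have "(v\<^sup>2) ^ k \<le> exp (2 * \<bar>l\<bar> * t)" by (simp add: power_mult[symmetric] mult.commute)
    then have "a / exp (2 * \<bar>l\<bar> * t) \<le> a / (v\<^sup>2) ^ k" using pos by (intro divide_left_mono) auto
    moreover have "m = a / exp (2 * \<bar>l\<bar> * t)" by (simp add: m exp_minus field_simps)
    ultimately show ?thesis using sq_ge[of k] by linarith
  qed
  let ?\<delta> = "\<lambda>k. (sqrt (sq k + \<alpha> * \<tau> * v) - sqrt (sq k))
    - sqrt \<tau> * sqrt (\<alpha> * (l * \<tau> - ln v + ln (1 + \<alpha> * \<tau> * v / sq k) / 4) / v)"
  have eq: "W2 (J0_iter (quadratic l) n \<tau> (gaussian a :: 'a measure)) (Jalpha_iter (quadratic l) \<alpha> n \<tau> (gaussian a))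
      - (\<Sum>k<n. v powi (int k - int n) * sqrt \<tau> * sqrt (residual (quadratic l) (gaussian a :: 'a measure) k \<alpha> \<tau> / v))
    = (\<Sum>k<n. v ^ k / v ^ n * sqrt ?d * ?\<delta> k)"
    unfolding W2_iterates sum_distrib_left sum_subtractf[symmetric]
  proof (rule sum.cong[OF refl])
    fix k
    have "v powi (int k - int n) = v ^ k / v ^ n" using pos by (simp add: power_int_diff)
    moreover have "sqrt (residual (quadratic l) (gaussian a :: 'a measure) k \<alpha> \<tau> / v)
        = sqrt ?d * sqrt (\<alpha> * (l * \<tau> - ln v + ln (1 + \<alpha> * \<tau> * v / sq k) / 4) / v)"
      unfolding residual_eq by (simp only: real_sqrt_mult[symmetric] times_divide_eq_right)
    ultimately show "sqrt ?d * (v ^ k / v ^ n * (sqrt (sq k + \<alpha> * \<tau> * v) - sqrt (sq k)))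
        - v powi (int k - int n) * sqrt \<tau> * sqrt (residual (quadratic l) (gaussian a :: 'a measure) k \<alpha> \<tau> / v)
      = v ^ k / v ^ n * sqrt ?d * ?\<delta> k"
      by (simp only: right_diff_distrib mult_ac)
  qed
  have le: "\<bar>\<Sum>k<n. v ^ k / v ^ n * sqrt ?d * ?\<delta> k\<bar> \<le> (\<Sum>k<n. exp (2 * \<bar>l\<bar> * t) * sqrt ?d * sqrt (K * \<tau> ^ 3))"
  proof (intro order_trans[OF sum_abs] sum_mono)
    fix k assume "k \<in> {..<n}"
    then have k: "k < n" by simp
    have "\<bar>?\<delta> k\<bar> \<le> sqrt (K * \<tau> ^ 3)"
      unfolding K_def by (rule one_step_error[OF m0 sq_m[OF k] pos(2,3) v small])
    then have "(v ^ k / v ^ n * sqrt ?d) * \<bar>?\<delta> k\<bar> \<le> (exp (2 * \<bar>l\<bar> * t) * sqrt ?d) * sqrt (K * \<tau> ^ 3)"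
      using coeff[OF k] pos by (intro mult_mono) auto
    then show "\<bar>v ^ k / v ^ n * sqrt ?d * ?\<delta> k\<bar> \<le> exp (2 * \<bar>l\<bar> * t) * sqrt ?d * sqrt (K * \<tau> ^ 3)"
      using pos by (simp add: abs_mult)
  qed
  have "(real n)\<^sup>2 * (K * \<tau> ^ 3) = K * t ^ 3 / real n"
    using n by (simp add: power_divide power2_eq_square power3_eq_cube)
  moreover have "real n * sqrt (K * \<tau> ^ 3) = sqrt ((real n)\<^sup>2 * (K * \<tau> ^ 3))" by (simp add: real_sqrt_mult)
  ultimately have n_sqrt: "real n * sqrt (K * \<tau> ^ 3) = sqrt (K * t ^ 3 / real n)" by simp
  have "(\<Sum>k<n. exp (2 * \<bar>l\<bar> * t) * sqrt ?d * sqrt (K * \<tau> ^ 3)) = exp (2 * \<bar>l\<bar> * t) * sqrt ?d * (real n * sqrt (K * \<tau> ^ 3))"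
    unfolding sum_constant card_lessThan by (rule mult.left_commute)
  from ord_le_eq_trans[OF le this, unfolded n_sqrt] show ?thesis unfolding eq unfolding K_def .
qed

end

theorem theorem5p7:
  fixes l \<alpha> a t :: real
    and F :: "(real ^ 'n) measure \<Rightarrow> real"
    and \<mu>\<^sub>0 :: "(real ^ 'n) measure"
  assumes "l \<noteq> 0" and "\<alpha> > 0" and "a > 0" and "t > 0"
    and "F = (\<lambda>\<rho>. l / 2 * (\<integral>x. (norm x)\<^sup>2 \<partial>\<rho>))"
    and "\<mu>\<^sub>0 = gaussian a"
  shows "(\<lambda>n. W2 (J0_iter F n (t / real n) \<mu>\<^sub>0) (Jalpha_iter F \<alpha> n (t / real n) \<mu>\<^sub>0)
            - (\<Sum>k<n. (1 + l * (t / real n)) powi (int k - int n) * sqrt (t / real n)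
                 * sqrt (residual F \<mu>\<^sub>0 k \<alpha> (t / real n) / (1 + l * (t / real n)))))
         \<in> o(\<lambda>_. 1)"
proof -
  define m where "m = a * exp (- 2 * \<bar>l\<bar> * t)"
  define K where "K = (3 * \<alpha> ^ 3 / m\<^sup>2 + \<alpha>\<^sup>2 * \<bar>l\<bar> / m + 4 * \<alpha> * l\<^sup>2) * t ^ 3"
  define C where "C = exp (2 * \<bar>l\<bar> * t) * sqrt (real DIM(real ^ 'n))"
  define E where "E n = W2 (J0_iter F n (t / real n) \<mu>\<^sub>0) (Jalpha_iter F \<alpha> n (t / real n) \<mu>\<^sub>0)
            - (\<Sum>k<n. (1 + l * (t / real n)) powi (int k - int n) * sqrt (t / real n)
                 * sqrt (residual F \<mu>\<^sub>0 k \<alpha> (t / real n) / (1 + l * (t / real n))))" for n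
  have m0: "0 < m" using \<open>a > 0\<close> by (simp add: m_def)
  have lim: "(\<lambda>n. c * (t / real n)) \<longlonglongrightarrow> c * 0" for c
    by (intro tendsto_mult_left lim_const_over_n)
  have "\<forall>\<^sub>F n in sequentially. \<bar>l\<bar> * (t / real n) < 1 / 2"
    using lim[of "\<bar>l\<bar>"] by (rule order_tendstoD) simp
  moreover have "\<forall>\<^sub>F n in sequentially. 2 * \<alpha> * (t / real n) < m"
    using lim[of "2 * \<alpha>"] by (rule order_tendstoD) (use m0 in simp)
  ultimately have bound: "\<forall>\<^sub>F n in sequentially. norm (E n) \<le> C * sqrt (K / real n)"
    using eventually_gt_at_top[of 0]
  proof eventually_elim
    case (elim n)
    have \<tau>: "0 < t / real n" using elim \<open>t > 0\<close> by simp
    have "\<bar>l * (t / real n)\<bar> = \<bar>l\<bar> * (t / real n)" using \<tau> by (simp only: abs_mult abs_of_pos)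
    \<comment> \<open>Smallness makes 1 + l t / n positive, the condition under which both schemes
      have the closed form of \<open>gaussian_scheme\<close>.\<close>
    with elim(1) have "\<bar>l * (t / real n)\<bar> < 1" by linarith
    then have "0 < 1 + l * (t / real n)" by linarith
    then have "gaussian_scheme a \<alpha> (t / real n) l (1 + l * (t / real n))"
      using assms(2,3) \<tau> by unfold_locales simp_all
    from gaussian_scheme.error_bound[OF this elim(3) refl m_def, where 'a="real ^ 'n"] elim show ?case
      unfolding E_def C_def K_def assms(5,6) by simp
  qed
  have "(\<lambda>n. C * sqrt (K / real n)) \<longlonglongrightarrow> C * sqrt 0"
    by (intro tendsto_mult_left tendsto_real_sqrt lim_const_over_n)
  then have "(\<lambda>n. C * sqrt (K / real n)) \<longlonglongrightarrow> 0" by simp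
  from Lim_null_comparison[OF bound this] have "E \<longlonglongrightarrow> 0" .
  then show ?thesis unfolding E_def[abs_def, symmetric] by (intro smalloI_tendsto) auto
qed

end
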